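(* Let $\mathcal K$ be the $C^*$-algebra of compact operators on a separable infinite-dimensional Hilbert space. Let $(A,\iota)$ be a $\mathcal K$-algebra, i.e. $A$ is a $C^*$-algebra and $\iota\colon\mathcal K\to M(A)$ is a nondegenerate homomorphism, and let $$C(A,\iota)=\{a\in M(A):\iota(k)a=a\iota(k)\in A\text{ for all }k\in\mathcal K\}.$$ Then $C(A,\iota)$ is a nondegenerate $C^*$-subalgebra of $M(A)$, and there is an isomorphism of $C^*$-algebras $$\theta\colon C(A,\iota)\otimes\mathcal K\to A$$ given on elementary tensors by $\theta(a\otimes k)=a\iota(k)$. Furthermore, if $B$ is a $C^*$-algebra, and if $B\otimes\mathcal K$ is regarded as a $\mathcal K$-algebra via the map $1\otimes\mathrm{id}\colon \mathcal K\to M(B\otimes\mathcal K)$, $k\mapsto 1_B\otimes k$, then the map $b\mapsto b\otimes 1$ (where $1$ is the identity of $M(\mathcal K)$) gives an isomorphism $$B\simeq C(B\otimes\mathcal K,1\otimes\mathrm{id}).$$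
   Context: Homomorphisms of $C^*$-algebras are $*$-homomorphisms. $M(A)$ denotes the multiplier algebra of $A$. A homomorphism $\iota\colon D\to M(A)$ is nondegenerate if $\overline{\operatorname{span}}\,\iota(D)A=A$; a $C^*$-subalgebra $D\subset M(A)$ is nondegenerate if $\overline{\operatorname{span}}\,DA=A$. $1_B$ denotes the identity of $M(B)$. Tensor products are $C^*$-tensor products ($\mathcal K$ is nuclear). *)

theory Defs
  imports "HOL-Analysis.Analysis" "HOL-Library.Poly_Mapping"
begin

section \<open>\<open>C\<^sup>*\<close>-algebras on carrier sets\<close>

record 'a cstar_alg =
  ccarrier :: "'a set"
  czero :: 'a (\<open>\<zero>\<index>\<close>)
  cadd :: "'a \<Rightarrow> 'a \<Rightarrow> 'a" (infixl \<open>\<oplus>\<index>\<close> 65)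
  csmult :: "complex \<Rightarrow> 'a \<Rightarrow> 'a" (infixr \<open>\<odot>\<index>\<close> 75)
  cmult :: "'a \<Rightarrow> 'a \<Rightarrow> 'a" (infixl \<open>\<cdot>\<index>\<close> 70)
  cstar :: "'a \<Rightarrow> 'a"
  cnorm :: "'a \<Rightarrow> real"

definition cdiff :: "'a cstar_alg \<Rightarrow> 'a \<Rightarrow> 'a \<Rightarrow> 'a" where
  "cdiff A x y = x \<oplus>\<^bsub>A\<^esub> (- 1) \<odot>\<^bsub>A\<^esub> y"

text \<open>The library locale \<^locale>\<open>Metric_space\<close> wants nonnegativity and symmetry of the distance
  on the whole type, so the norm distance is cut off outside the carrier.\<close>

definition cdist :: "'a cstar_alg \<Rightarrow> 'a \<Rightarrow> 'a \<Rightarrow> real" where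
  "cdist A x y = (if x \<in> ccarrier A \<and> y \<in> ccarrier A then cnorm A (cdiff A x y) else 0)"

abbreviation ctopology :: "'a cstar_alg \<Rightarrow> 'a topology" where
  "ctopology A \<equiv> Metric_space.mtopology (ccarrier A) (cdist A)"

locale cstar_algebra =
  fixes A :: "'a cstar_alg" (structure)
  assumes zero_closed: "\<zero> \<in> ccarrier A"
    and add_closed: "\<lbrakk>x \<in> ccarrier A; y \<in> ccarrier A\<rbrakk> \<Longrightarrow> x \<oplus> y \<in> ccarrier A"
    and smult_closed: "x \<in> ccarrier A \<Longrightarrow> c \<odot> x \<in> ccarrier A"
    and mult_closed: "\<lbrakk>x \<in> ccarrier A; y \<in> ccarrier A\<rbrakk> \<Longrightarrow> x \<cdot> y \<in> ccarrier A"
    and star_closed: "x \<in> ccarrier A \<Longrightarrow> cstar A x \<in> ccarrier A"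
    and add_assoc: "\<lbrakk>x \<in> ccarrier A; y \<in> ccarrier A; z \<in> ccarrier A\<rbrakk>
          \<Longrightarrow> (x \<oplus> y) \<oplus> z = x \<oplus> (y \<oplus> z)"
    and add_commute: "\<lbrakk>x \<in> ccarrier A; y \<in> ccarrier A\<rbrakk> \<Longrightarrow> x \<oplus> y = y \<oplus> x"
    and add_zero: "x \<in> ccarrier A \<Longrightarrow> \<zero> \<oplus> x = x"
    and add_inverse: "x \<in> ccarrier A \<Longrightarrow> x \<oplus> (- 1) \<odot> x = \<zero>"
    and smult_add_right: "\<lbrakk>x \<in> ccarrier A; y \<in> ccarrier A\<rbrakk>
          \<Longrightarrow> c \<odot> (x \<oplus> y) = (c \<odot> x) \<oplus> (c \<odot> y)"
    and smult_add_left: "x \<in> ccarrier A \<Longrightarrow> (c + d) \<odot> x = (c \<odot> x) \<oplus> (d \<odot> x)"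
    and smult_smult: "x \<in> ccarrier A \<Longrightarrow> c \<odot> (d \<odot> x) = (c * d) \<odot> x"
    and smult_one: "x \<in> ccarrier A \<Longrightarrow> 1 \<odot> x = x"
    and mult_assoc: "\<lbrakk>x \<in> ccarrier A; y \<in> ccarrier A; z \<in> ccarrier A\<rbrakk>
          \<Longrightarrow> (x \<cdot> y) \<cdot> z = x \<cdot> (y \<cdot> z)"
    and distrib_left: "\<lbrakk>x \<in> ccarrier A; y \<in> ccarrier A; z \<in> ccarrier A\<rbrakk>
          \<Longrightarrow> x \<cdot> (y \<oplus> z) = (x \<cdot> y) \<oplus> (x \<cdot> z)"
    and distrib_right: "\<lbrakk>x \<in> ccarrier A; y \<in> ccarrier A; z \<in> ccarrier A\<rbrakk>
          \<Longrightarrow> (x \<oplus> y) \<cdot> z = (x \<cdot> z) \<oplus> (y \<cdot> z)"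
    and mult_smult_left: "\<lbrakk>x \<in> ccarrier A; y \<in> ccarrier A\<rbrakk>
          \<Longrightarrow> (c \<odot> x) \<cdot> y = c \<odot> (x \<cdot> y)"
    and mult_smult_right: "\<lbrakk>x \<in> ccarrier A; y \<in> ccarrier A\<rbrakk>
          \<Longrightarrow> x \<cdot> (c \<odot> y) = c \<odot> (x \<cdot> y)"
    and star_star: "x \<in> ccarrier A \<Longrightarrow> cstar A (cstar A x) = x"
    and star_add: "\<lbrakk>x \<in> ccarrier A; y \<in> ccarrier A\<rbrakk>
          \<Longrightarrow> cstar A (x \<oplus> y) = cstar A x \<oplus> cstar A y"
    and star_smult: "x \<in> ccarrier A \<Longrightarrow> cstar A (c \<odot> x) = cnj c \<odot> cstar A x"
    and star_mult: "\<lbrakk>x \<in> ccarrier A; y \<in> ccarrier A\<rbrakk>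
          \<Longrightarrow> cstar A (x \<cdot> y) = cstar A y \<cdot> cstar A x"
    and norm_nonneg: "x \<in> ccarrier A \<Longrightarrow> 0 \<le> cnorm A x"
    and norm_eq_zero: "x \<in> ccarrier A \<Longrightarrow> cnorm A x = 0 \<longleftrightarrow> x = \<zero>"
    and norm_triangle: "\<lbrakk>x \<in> ccarrier A; y \<in> ccarrier A\<rbrakk>
          \<Longrightarrow> cnorm A (x \<oplus> y) \<le> cnorm A x + cnorm A y"
    and norm_smult: "x \<in> ccarrier A \<Longrightarrow> cnorm A (c \<odot> x) = cmod c * cnorm A x"
    and norm_mult: "\<lbrakk>x \<in> ccarrier A; y \<in> ccarrier A\<rbrakk>
          \<Longrightarrow> cnorm A (x \<cdot> y) \<le> cnorm A x * cnorm A y"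
    and cstar_identity: "x \<in> ccarrier A \<Longrightarrow> cnorm A (cstar A x \<cdot> x) = (cnorm A x)\<^sup>2"
    and complete: "Metric_space.mcomplete (ccarrier A) (cdist A)"

lemma (in cstar_algebra) Metric_space_cdist: "Metric_space (ccarrier A) (cdist A)"
proof -
  have neg: "(- 1) \<odot> x \<in> ccarrier A" if "x \<in> ccarrier A" for x
    using that by (rule smult_closed)
  have diff: "cdiff A x y \<in> ccarrier A" if "x \<in> ccarrier A" "y \<in> ccarrier A" for x y
    unfolding cdiff_def using that by (intro add_closed neg)
  have cancel: "(x \<oplus> (- 1) \<odot> y) \<oplus> (y \<oplus> z) = x \<oplus> z"
    if "x \<in> ccarrier A" "y \<in> ccarrier A" "z \<in> ccarrier A" for x y z
  proof -
    have "(x \<oplus> (- 1) \<odot> y) \<oplus> (y \<oplus> z) = x \<oplus> (((- 1) \<odot> y \<oplus> y) \<oplus> z)"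
      using that by (simp add: add_assoc add_closed neg)
    also have "(- 1) \<odot> y \<oplus> y = \<zero>"
      using that by (metis add_commute add_inverse neg)
    finally show ?thesis using that by (simp add: add_zero)
  qed
  have commute: "cnorm A (cdiff A x y) = cnorm A (cdiff A y x)"
    if "x \<in> ccarrier A" "y \<in> ccarrier A" for x y
  proof -
    have "cdiff A y x = (- 1) \<odot> cdiff A x y"
      unfolding cdiff_def
      using that by (simp add: smult_add_right neg smult_smult smult_one add_commute)
    then show ?thesis using diff[OF that] by (simp add: norm_smult)
  qed
  have zero: "cnorm A (cdiff A x y) = 0 \<longleftrightarrow> x = y"
    if "x \<in> ccarrier A" "y \<in> ccarrier A" for x y
  proof -
    have "x = y" if eq: "x \<oplus> (- 1) \<odot> y = \<zero>"
    proof -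
      have "x = x \<oplus> \<zero>"
        by (metis \<open>x \<in> ccarrier A\<close> add_commute add_zero zero_closed)
      also have "\<dots> = (x \<oplus> (- 1) \<odot> y) \<oplus> (y \<oplus> \<zero>)"
        using cancel \<open>x \<in> ccarrier A\<close> \<open>y \<in> ccarrier A\<close> zero_closed by metis
      also have "\<dots> = y"
        using eq \<open>y \<in> ccarrier A\<close> zero_closed
        by (metis add_closed add_commute add_zero)
      finally show ?thesis .
    qed
    moreover have "cnorm A (cdiff A x y) = 0 \<longleftrightarrow> cdiff A x y = \<zero>"
      using diff that norm_eq_zero by blast
    ultimately show ?thesis using that add_inverse by (auto simp: cdiff_def)
  qed
  have triangle: "cnorm A (cdiff A x z) \<le> cnorm A (cdiff A x y) + cnorm A (cdiff A y z)"
    if "x \<in> ccarrier A" "y \<in> ccarrier A" "z \<in> ccarrier A" for x y z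
  proof -
    have "cdiff A x z = cdiff A x y \<oplus> cdiff A y z"
      unfolding cdiff_def using that cancel neg by metis
    then show ?thesis using norm_triangle diff that by simp
  qed
  show ?thesis
    by unfold_locales
      (use norm_nonneg diff commute zero triangle in \<open>auto simp: cdist_def\<close>)
qed

definition cstar_hom :: "'a cstar_alg \<Rightarrow> 'b cstar_alg \<Rightarrow> ('a \<Rightarrow> 'b) \<Rightarrow> bool" where
  "cstar_hom A B f \<longleftrightarrow>
     f \<in> ccarrier A \<rightarrow> ccarrier B \<and>
     (\<forall>x\<in>ccarrier A. \<forall>y\<in>ccarrier A. f (x \<oplus>\<^bsub>A\<^esub> y) = f x \<oplus>\<^bsub>B\<^esub> f y) \<and>
     (\<forall>c. \<forall>x\<in>ccarrier A. f (c \<odot>\<^bsub>A\<^esub> x) = c \<odot>\<^bsub>B\<^esub> f x) \<and>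
     (\<forall>x\<in>ccarrier A. \<forall>y\<in>ccarrier A. f (x \<cdot>\<^bsub>A\<^esub> y) = f x \<cdot>\<^bsub>B\<^esub> f y) \<and>
     (\<forall>x\<in>ccarrier A. f (cstar A x) = cstar B (f x))"

definition cstar_iso :: "'a cstar_alg \<Rightarrow> 'b cstar_alg \<Rightarrow> ('a \<Rightarrow> 'b) \<Rightarrow> bool" where
  "cstar_iso A B f \<longleftrightarrow>
     cstar_algebra A \<and> cstar_algebra B \<and> cstar_hom A B f \<and>
     bij_betw f (ccarrier A) (ccarrier B)"

definition csubspace :: "'a cstar_alg \<Rightarrow> 'a set \<Rightarrow> bool" where
  "csubspace A V \<longleftrightarrow>
     V \<subseteq> ccarrier A \<and> \<zero>\<^bsub>A\<^esub> \<in> V \<and>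
     (\<forall>x\<in>V. \<forall>y\<in>V. x \<oplus>\<^bsub>A\<^esub> y \<in> V) \<and> (\<forall>c. \<forall>x\<in>V. c \<odot>\<^bsub>A\<^esub> x \<in> V)"

definition cspan :: "'a cstar_alg \<Rightarrow> 'a set \<Rightarrow> 'a set" where
  "cspan A S = \<Inter>{V. csubspace A V \<and> S \<subseteq> V}"

definition cstar_subalgebra :: "'a set \<Rightarrow> 'a cstar_alg \<Rightarrow> bool" where
  "cstar_subalgebra D A \<longleftrightarrow>
     csubspace A D \<and>
     (\<forall>x\<in>D. \<forall>y\<in>D. x \<cdot>\<^bsub>A\<^esub> y \<in> D) \<and> (\<forall>x\<in>D. cstar A x \<in> D) \<and>
     closedin (ctopology A) D"


section \<open>Multiplier algebras\<close>

text \<open>\<open>M(A)\<close> is the algebra of double centralizers \<open>(L, R)\<close>, where \<open>L\<close> is left and \<open>R\<close> is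
  right multiplication by the multiplier. Both maps are \<^const>\<open>undefined\<close> off the carrier
  (\<^const>\<open>PiE\<close>), so that equal multipliers are equal pairs.\<close>

type_synonym 'a multiplier = "('a \<Rightarrow> 'a) \<times> ('a \<Rightarrow> 'a)"

definition bounded_clinear_on :: "'a cstar_alg \<Rightarrow> ('a \<Rightarrow> 'a) \<Rightarrow> bool" where
  "bounded_clinear_on A f \<longleftrightarrow>
     f \<in> ccarrier A \<rightarrow>\<^sub>E ccarrier A \<and>
     (\<forall>x\<in>ccarrier A. \<forall>y\<in>ccarrier A. f (x \<oplus>\<^bsub>A\<^esub> y) = f x \<oplus>\<^bsub>A\<^esub> f y) \<and>
     (\<forall>c. \<forall>x\<in>ccarrier A. f (c \<odot>\<^bsub>A\<^esub> x) = c \<odot>\<^bsub>A\<^esub> f x) \<and>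
     (\<exists>C. \<forall>x\<in>ccarrier A. cnorm A (f x) \<le> C * cnorm A x)"

definition double_centralizer :: "'a cstar_alg \<Rightarrow> 'a multiplier \<Rightarrow> bool" where
  "double_centralizer A m \<longleftrightarrow>
     bounded_clinear_on A (fst m) \<and> bounded_clinear_on A (snd m) \<and>
     (\<forall>x\<in>ccarrier A. \<forall>y\<in>ccarrier A.
        fst m (x \<cdot>\<^bsub>A\<^esub> y) = fst m x \<cdot>\<^bsub>A\<^esub> y \<and>
        snd m (x \<cdot>\<^bsub>A\<^esub> y) = x \<cdot>\<^bsub>A\<^esub> snd m y \<and>
        snd m x \<cdot>\<^bsub>A\<^esub> y = x \<cdot>\<^bsub>A\<^esub> fst m y)"

definition multiplier_algebra :: "'a cstar_alg \<Rightarrow> 'a multiplier cstar_alg" where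
  "multiplier_algebra A =
     \<lparr>ccarrier = {m. double_centralizer A m},
      czero = (\<lambda>x\<in>ccarrier A. \<zero>\<^bsub>A\<^esub>, \<lambda>x\<in>ccarrier A. \<zero>\<^bsub>A\<^esub>),
      cadd = (\<lambda>m n. (\<lambda>x\<in>ccarrier A. fst m x \<oplus>\<^bsub>A\<^esub> fst n x,
                      \<lambda>x\<in>ccarrier A. snd m x \<oplus>\<^bsub>A\<^esub> snd n x)),
      csmult = (\<lambda>c m. (\<lambda>x\<in>ccarrier A. c \<odot>\<^bsub>A\<^esub> fst m x, \<lambda>x\<in>ccarrier A. c \<odot>\<^bsub>A\<^esub> snd m x)),
      cmult = (\<lambda>m n. (\<lambda>x\<in>ccarrier A. fst m (fst n x), \<lambda>x\<in>ccarrier A. snd n (snd m x))),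
      cstar = (\<lambda>m. (\<lambda>x\<in>ccarrier A. cstar A (snd m (cstar A x)),
                     \<lambda>x\<in>ccarrier A. cstar A (fst m (cstar A x)))),
      cnorm = (\<lambda>m. Sup {cnorm A (fst m x) | x. x \<in> ccarrier A \<and> cnorm A x \<le> 1})\<rparr>"

definition multiplier_one :: "'a cstar_alg \<Rightarrow> 'a multiplier" where
  "multiplier_one A = (\<lambda>x\<in>ccarrier A. x, \<lambda>x\<in>ccarrier A. x)"

definition multiplier_embed :: "'a cstar_alg \<Rightarrow> 'a \<Rightarrow> 'a multiplier" where
  "multiplier_embed A a = (\<lambda>x\<in>ccarrier A. a \<cdot>\<^bsub>A\<^esub> x, \<lambda>x\<in>ccarrier A. x \<cdot>\<^bsub>A\<^esub> a)"

text \<open>For \<open>D \<subseteq> M(A)\<close>, the set \<open>DA\<close> consists of the elements \<open>da = fst d a\<close> of \<open>A\<close>.\<close>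

definition nondegenerate :: "'a cstar_alg \<Rightarrow> 'a multiplier set \<Rightarrow> bool" where
  "nondegenerate A D \<longleftrightarrow>
     ctopology A closure_of cspan A {fst d a | d a. d \<in> D \<and> a \<in> ccarrier A} = ccarrier A"


section \<open>Compact operators\<close>

text \<open>Complex Hilbert spaces; the inner product is linear in the first variable.\<close>

class complex_hilbert_space = real_inner + complete_space +
  fixes scaleC :: "complex \<Rightarrow> 'a \<Rightarrow> 'a"
    and cinner :: "'a \<Rightarrow> 'a \<Rightarrow> complex"
  assumes scaleC_add_right: "scaleC c (x + y) = scaleC c x + scaleC c y"
    and scaleC_add_left: "scaleC (c + d) x = scaleC c x + scaleC d x"
    and scaleC_scaleC: "scaleC c (scaleC d x) = scaleC (c * d) x"
    and scaleC_one: "scaleC 1 x = x"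
    and scaleR_scaleC: "scaleR r x = scaleC (complex_of_real r) x"
    and cinner_commute: "cinner x y = cnj (cinner y x)"
    and cinner_add_left: "cinner (x + y) z = cinner x z + cinner y z"
    and cinner_scaleC_left: "cinner (scaleC c x) y = c * cinner x y"
    and inner_cinner: "inner x y = Re (cinner x y)"

definition compact_operators :: "('h::complex_hilbert_space \<Rightarrow>\<^sub>L 'h) cstar_alg" where
  "compact_operators =
     \<lparr>ccarrier = {T. (\<forall>c x. blinfun_apply T (scaleC c x) = scaleC c (blinfun_apply T x)) \<and>
                     compact (closure (blinfun_apply T ` cball 0 1))},
      czero = 0,
      cadd = (+),
      csmult = (\<lambda>c T. Blinfun (\<lambda>x. scaleC c (blinfun_apply T x))),
      cmult = (o\<^sub>L),
      cstar = (\<lambda>T. THE S. \<forall>x y. cinner (blinfun_apply T x) y = cinner x (blinfun_apply S y)),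
      cnorm = norm\<rparr>"

definition separable_infinite_dim :: "'h::complex_hilbert_space itself \<Rightarrow> bool" where
  "separable_infinite_dim TYPE('h) \<longleftrightarrow>
     (\<exists>S :: 'h set. countable S \<and> closure S = UNIV) \<and>
     \<not> (\<exists>S :: 'h set. finite S \<and> module.span scaleC S = UNIV)"


section \<open>Tensor products\<close>

text \<open>The algebraic tensor product of \<open>A\<close> and \<open>B\<close> is the quotient of the free complex vector space
  on \<open>A \<times> B\<close> (finitely supported functions, with the \<open>*\<close>-algebra structure coming from the
  factors) by the span of the bilinearity relations. A seminorm on the quotient is the same as a
  seminorm on the free space that vanishes on these relations.\<close>

definition free_tensor_carrier ::
    "'a cstar_alg \<Rightarrow> 'b cstar_alg \<Rightarrow> ('a \<times> 'b \<Rightarrow>\<^sub>0 complex) set" where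
  "free_tensor_carrier A B = {u. Poly_Mapping.keys u \<subseteq> ccarrier A \<times> ccarrier B}"

definition free_tensor_smult ::
    "complex \<Rightarrow> ('a \<times> 'b \<Rightarrow>\<^sub>0 complex) \<Rightarrow> ('a \<times> 'b \<Rightarrow>\<^sub>0 complex)" where
  "free_tensor_smult c u = Poly_Mapping.map (\<lambda>z. c * z) u"

definition free_tensor_mult ::
    "'a cstar_alg \<Rightarrow> 'b cstar_alg \<Rightarrow> ('a \<times> 'b \<Rightarrow>\<^sub>0 complex) \<Rightarrow> ('a \<times> 'b \<Rightarrow>\<^sub>0 complex)
      \<Rightarrow> ('a \<times> 'b \<Rightarrow>\<^sub>0 complex)" where
  "free_tensor_mult A B u v =
     (\<Sum>(a, b)\<in>Poly_Mapping.keys u. \<Sum>(a', b')\<in>Poly_Mapping.keys v.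
        Poly_Mapping.single (a \<cdot>\<^bsub>A\<^esub> a', b \<cdot>\<^bsub>B\<^esub> b')
          (Poly_Mapping.lookup u (a, b) * Poly_Mapping.lookup v (a', b')))"

definition free_tensor_star ::
    "'a cstar_alg \<Rightarrow> 'b cstar_alg \<Rightarrow> ('a \<times> 'b \<Rightarrow>\<^sub>0 complex) \<Rightarrow> ('a \<times> 'b \<Rightarrow>\<^sub>0 complex)" where
  "free_tensor_star A B u =
     (\<Sum>(a, b)\<in>Poly_Mapping.keys u.
        Poly_Mapping.single (cstar A a, cstar B b) (cnj (Poly_Mapping.lookup u (a, b))))"

definition bilinearity_relations ::
    "'a cstar_alg \<Rightarrow> 'b cstar_alg \<Rightarrow> ('a \<times> 'b \<Rightarrow>\<^sub>0 complex) set" where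
  "bilinearity_relations A B =
     {Poly_Mapping.single (a \<oplus>\<^bsub>A\<^esub> a', b) 1 - Poly_Mapping.single (a, b) 1
        - Poly_Mapping.single (a', b) 1
        | a a' b. a \<in> ccarrier A \<and> a' \<in> ccarrier A \<and> b \<in> ccarrier B} \<union>
     {Poly_Mapping.single (a, b \<oplus>\<^bsub>B\<^esub> b') 1 - Poly_Mapping.single (a, b) 1
        - Poly_Mapping.single (a, b') 1
        | a b b'. a \<in> ccarrier A \<and> b \<in> ccarrier B \<and> b' \<in> ccarrier B} \<union>
     {Poly_Mapping.single (c \<odot>\<^bsub>A\<^esub> a, b) 1 - Poly_Mapping.single (a, b) c
        | c a b. a \<in> ccarrier A \<and> b \<in> ccarrier B} \<union>
     {Poly_Mapping.single (a, c \<odot>\<^bsub>B\<^esub> b) 1 - Poly_Mapping.single (a, b) c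
        | c a b. a \<in> ccarrier A \<and> b \<in> ccarrier B}"

definition tensor_cstar_seminorm ::
    "'a cstar_alg \<Rightarrow> 'b cstar_alg \<Rightarrow> (('a \<times> 'b \<Rightarrow>\<^sub>0 complex) \<Rightarrow> real) \<Rightarrow> bool" where
  "tensor_cstar_seminorm A B p \<longleftrightarrow>
     (\<forall>u\<in>free_tensor_carrier A B. 0 \<le> p u) \<and>
     (\<forall>u\<in>free_tensor_carrier A B. \<forall>v\<in>free_tensor_carrier A B. p (u + v) \<le> p u + p v) \<and>
     (\<forall>c. \<forall>u\<in>free_tensor_carrier A B. p (free_tensor_smult c u) = cmod c * p u) \<and>
     (\<forall>u\<in>free_tensor_carrier A B. \<forall>v\<in>free_tensor_carrier A B.
        p (free_tensor_mult A B u v) \<le> p u * p v) \<and>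
     (\<forall>u\<in>free_tensor_carrier A B. p (free_tensor_star A B u) = p u) \<and>
     (\<forall>u\<in>free_tensor_carrier A B. p (free_tensor_mult A B (free_tensor_star A B u) u) = (p u)\<^sup>2) \<and>
     (\<forall>u\<in>bilinearity_relations A B. p u = 0)"

text \<open>The greatest \<open>C\<^sup>*\<close>-seminorm on the algebraic tensor product. When one of the factors is
  nuclear, as in the case of the compact operators, it is the only \<open>C\<^sup>*\<close>-norm there.\<close>

definition free_tensor :: "'a cstar_alg \<Rightarrow> 'b cstar_alg \<Rightarrow> ('a \<times> 'b \<Rightarrow>\<^sub>0 complex) cstar_alg" where
  "free_tensor A B =
     \<lparr>ccarrier = free_tensor_carrier A B,
      czero = 0,
      cadd = (+),
      csmult = free_tensor_smult,
      cmult = free_tensor_mult A B,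
      cstar = free_tensor_star A B,
      cnorm = (\<lambda>u. Sup {p u | p. tensor_cstar_seminorm A B p})\<rparr>"

text \<open>Hausdorff completion of a \<open>*\<close>-algebra \<open>P\<close> with a \<open>C\<^sup>*\<close>-seminorm: Cauchy sequences modulo
  sequences whose seminorm tends to \<open>0\<close>. In particular, elements of seminorm \<open>0\<close> are divided out.\<close>

definition cauchy_seqs :: "'a cstar_alg \<Rightarrow> (nat \<Rightarrow> 'a) set" where
  "cauchy_seqs P =
     {s. range s \<subseteq> ccarrier P \<and>
         (\<forall>e>0. \<exists>N. \<forall>m\<ge>N. \<forall>n\<ge>N. cnorm P (cdiff P (s m) (s n)) < e)}"

definition cauchy_rel :: "'a cstar_alg \<Rightarrow> ((nat \<Rightarrow> 'a) \<times> (nat \<Rightarrow> 'a)) set" where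
  "cauchy_rel P =
     {(s, t). s \<in> cauchy_seqs P \<and> t \<in> cauchy_seqs P \<and>
              (\<lambda>n. cnorm P (cdiff P (s n) (t n))) \<longlonglongrightarrow> 0}"

definition cauchy_class :: "'a cstar_alg \<Rightarrow> (nat \<Rightarrow> 'a) \<Rightarrow> (nat \<Rightarrow> 'a) set" where
  "cauchy_class P s = cauchy_rel P `` {s}"

definition cauchy_rep :: "(nat \<Rightarrow> 'a) set \<Rightarrow> nat \<Rightarrow> 'a" where
  "cauchy_rep X = (SOME s. s \<in> X)"

definition completion :: "'a cstar_alg \<Rightarrow> (nat \<Rightarrow> 'a) set cstar_alg" where
  "completion P =
     \<lparr>ccarrier = cauchy_seqs P // cauchy_rel P,
      czero = cauchy_class P (\<lambda>n. \<zero>\<^bsub>P\<^esub>),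
      cadd = (\<lambda>X Y. cauchy_class P (\<lambda>n. cauchy_rep X n \<oplus>\<^bsub>P\<^esub> cauchy_rep Y n)),
      csmult = (\<lambda>c X. cauchy_class P (\<lambda>n. c \<odot>\<^bsub>P\<^esub> cauchy_rep X n)),
      cmult = (\<lambda>X Y. cauchy_class P (\<lambda>n. cauchy_rep X n \<cdot>\<^bsub>P\<^esub> cauchy_rep Y n)),
      cstar = (\<lambda>X. cauchy_class P (\<lambda>n. cstar P (cauchy_rep X n))),
      cnorm = (\<lambda>X. lim (\<lambda>n. cnorm P (cauchy_rep X n)))\<rparr>"

type_synonym ('a, 'b) tensor = "(nat \<Rightarrow> ('a \<times> 'b \<Rightarrow>\<^sub>0 complex)) set"

definition tensor_product ::
    "'a cstar_alg \<Rightarrow> 'b cstar_alg \<Rightarrow> ('a, 'b) tensor cstar_alg" (infixr \<open>\<otimes>\<^sub>C\<close> 70) where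
  "A \<otimes>\<^sub>C B = completion (free_tensor A B)"

definition elementary_tensor ::
    "'a cstar_alg \<Rightarrow> 'b cstar_alg \<Rightarrow> 'a \<Rightarrow> 'b \<Rightarrow> ('a, 'b) tensor" where
  "elementary_tensor A B a b =
     cauchy_class (free_tensor A B) (\<lambda>n. Poly_Mapping.single (a, b) 1)"

text \<open>For multipliers \<open>m\<close> of \<open>A\<close> and \<open>n\<close> of \<open>B\<close>, the multiplier \<open>m \<otimes> n\<close> of the tensor product is
  determined by \<open>(m \<otimes> n)(a \<otimes> b) = ma \<otimes> nb\<close> and \<open>(a \<otimes> b)(m \<otimes> n) = am \<otimes> bn\<close>.\<close>

definition multiplier_tensor ::
    "'a cstar_alg \<Rightarrow> 'b cstar_alg \<Rightarrow> 'a multiplier \<Rightarrow> 'b multiplier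
      \<Rightarrow> ('a, 'b) tensor multiplier" where
  "multiplier_tensor A B m n =
     (THE x. x \<in> ccarrier (multiplier_algebra (A \<otimes>\<^sub>C B)) \<and>
        (\<forall>a\<in>ccarrier A. \<forall>b\<in>ccarrier B.
           fst x (elementary_tensor A B a b) = elementary_tensor A B (fst m a) (fst n b) \<and>
           snd x (elementary_tensor A B a b) = elementary_tensor A B (snd m a) (snd n b)))"


section \<open>\<open>\<K>\<close>-algebras\<close>

definition K_algebra ::
    "'a cstar_alg \<Rightarrow> (('h::complex_hilbert_space \<Rightarrow>\<^sub>L 'h) \<Rightarrow> 'a multiplier) \<Rightarrow> bool" where
  "K_algebra A \<iota> \<longleftrightarrow>
     cstar_algebra A \<and>
     cstar_hom compact_operators (multiplier_algebra A) \<iota> \<and>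
     nondegenerate A (\<iota> ` ccarrier compact_operators)"

definition K_commutant ::
    "'a cstar_alg \<Rightarrow> (('h::complex_hilbert_space \<Rightarrow>\<^sub>L 'h) \<Rightarrow> 'a multiplier) \<Rightarrow> 'a multiplier set" where
  "K_commutant A \<iota> =
     {a \<in> ccarrier (multiplier_algebra A).
        \<forall>k\<in>ccarrier compact_operators.
          \<iota> k \<cdot>\<^bsub>multiplier_algebra A\<^esub> a = a \<cdot>\<^bsub>multiplier_algebra A\<^esub> \<iota> k \<and>
          a \<cdot>\<^bsub>multiplier_algebra A\<^esub> \<iota> k \<in> multiplier_embed A ` ccarrier A}"

definition K_commutant_algebra ::
    "'a cstar_alg \<Rightarrow> (('h::complex_hilbert_space \<Rightarrow>\<^sub>L 'h) \<Rightarrow> 'a multiplier)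
      \<Rightarrow> 'a multiplier cstar_alg" where
  "K_commutant_algebra A \<iota> = (multiplier_algebra A)\<lparr>ccarrier := K_commutant A \<iota>\<rparr>"

definition one_tensor_id ::
    "'b cstar_alg \<Rightarrow> ('h::complex_hilbert_space \<Rightarrow>\<^sub>L 'h)
      \<Rightarrow> ('b, 'h \<Rightarrow>\<^sub>L 'h) tensor multiplier" where
  "one_tensor_id B k =
     multiplier_tensor B compact_operators (multiplier_one B) (multiplier_embed compact_operators k)"

definition tensor_one ::
    "'b cstar_alg \<Rightarrow> 'b \<Rightarrow> ('b, 'h::complex_hilbert_space \<Rightarrow>\<^sub>L 'h) tensor multiplier" where
  "tensor_one B b =
     multiplier_tensor B compact_operators (multiplier_embed B b) (multiplier_one compact_operators)"

end

(* The positive part of C*-theory needed here is obtained from the norm alone: a self-adjoint contraction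
   is the real part of a unitary, so unitaries control every C*-seminorm and *-homomorphisms are contractive.

   Write e_ij for the matrix units of K and fix a unit vector w. For x in the corner i(e_ww) A i(e_ww) the sums
   of i(e_kw) x i(e_wk) over k < n are bounded by contractivity and converge strictly to an element c of M(A)
   that commutes with i(K) and satisfies c i(e_ww) = x; such a c is unique. Hence an element a of A is determined
   by the coefficients in C(A, i) belonging to i(e_wi) a i(e_jw). For the compression of A by the n-th projection
   the passage to these coefficients is a *-homomorphism into the tensor product, so it is contractive, and for
   n tending to infinity it shows that the canonical map from the algebraic tensor product is isometric.

   For B (x) K the same compression, together with the norm identity for b (x) e_ww that comes from the
   representation of the tensor product on the Hilbert module with inner product <u, v> = phi (u* v),
   identifies C(B (x) K) with B. *)

theory Submission
  imports Defs
begin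

text \<open>The tensor norm is the greatest C*-seminorm, so two separate facts are wanted: a bound
  common to all C*-seminorms, without which the supremum means nothing, and lower bounds, which only
  concrete seminorms can give. The common bound rests on one contractivity principle for seminorms
  \<open>f\<close> on a unital algebra that see \<open>a\<close> only through
  \<open>a\<^sup>* a\<close>; with \<open>f m = q (m v)\<close> it covers nonunital algebras and
  Hilbert modules alike, the unitaries being taken in the multiplier algebra. The lower bounds come
  from the matrix coefficients in one half, where they take the place of nuclearity of K, and from
  the Hilbert module in the other. Cauchy-Schwarz in that module requires positivity of
  \<open>a\<^sup>* a\<close>, obtained here from the growth of the powers of a square root of
  \<open>1 - a\<^sup>* a\<close>. The same powers provide approximate right factors, and these give
  the nondegeneracy of C(A, i). Compactness is used in the form that the projections
  \<open>P n\<close> satisfy \<open>P n o\<^sub>L T\<close> tends to \<open>T\<close> in norm, which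
  makes their images an approximate unit wherever K acts nondegenerately.\<close>

type_synonym 'h op = "'h \<Rightarrow>\<^sub>L 'h"

abbreviation car :: "'a cstar_alg => 'a set" where "car == ccarrier"
abbreviation dcent :: "'a cstar_alg => 'a multiplier => bool" where "dcent == double_centralizer"
abbreviation ap :: "('x::real_normed_vector) \<Rightarrow>\<^sub>L ('y::real_normed_vector) => 'x => 'y" where "ap == blinfun_apply"
abbreviation LIM_seq (infix "---->" 60) where "X ----> l == X \<longlonglongrightarrow> l"
abbreviation rc :: "real => complex" where "rc == complex_of_real"
abbreviation single :: "'x => 'c => ('x \<Rightarrow>\<^sub>0 'c::zero)" where "single == Poly_Mapping.single"
abbreviation lookup :: "('x \<Rightarrow>\<^sub>0 'c::zero) => 'x => 'c" where "lookup == Poly_Mapping.lookup"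
abbreviation keys :: "('x \<Rightarrow>\<^sub>0 'c::zero) => 'x set" where "keys == Poly_Mapping.keys"

section \<open>Complex vector spaces on carrier sets\<close>

text \<open>Scalar multiplication for an arbitrary index type, whereas
  \<open>free_tensor_smult\<close> is tied to pairs: the Hamel basis below requires formal
  combinations of single vectors.\<close>

definition pm_scale :: "complex => ('x \<Rightarrow>\<^sub>0 complex) => ('x \<Rightarrow>\<^sub>0 complex)" where
  "pm_scale c u = Poly_Mapping.map (%z. c * z) u"

lemma free_tensor_smult_eq: "free_tensor_smult = pm_scale"
  by (simp add: fun_eq_iff free_tensor_smult_def pm_scale_def)

lemma lookup_pm_scale [simp]:
  "lookup (pm_scale c u) k = c * lookup u k"
  by (simp add: pm_scale_def Poly_Mapping.map.rep_eq when_def)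

lemma vector_space_pm_scale: "vector_space pm_scale"
  by unfold_locales (auto intro!: poly_mapping_eqI simp: lookup_add algebra_simps)

lemma keys_pm_scale: "keys (pm_scale c u) \<subseteq> keys u"
  by (auto simp: in_keys_iff)

lemma pm_scale_single [simp]:
  "pm_scale c (single x d) = single x (c * d)"
  by (rule poly_mapping_eqI) (simp add: lookup_single when_def)

text \<open>For summands in the carrier, the test \<open>y \<in> car A\<close> makes the folded
  steps commute for every accumulator, because addition is known to be commutative only inside the
  carrier. Sums over infinite sets are zero by the convention of
  \<open>Finite_Set.fold\<close>.\<close>

definition csum :: "'a cstar_alg => ('x => 'a) => 'x set => 'a" where
  "csum A f S = Finite_Set.fold (%x y. if y \<in> car A then cadd A y (f x) else y) (czero A) S"

locale carrier_vector_space =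
  fixes A :: "'a cstar_alg" (structure)
  assumes zero_mem [simp, intro]: "\<zero> \<in> car A"
    and add_mem [simp, intro]: "[|x \<in> car A; y \<in> car A|] ==> x \<oplus> y \<in> car A"
    and smult_mem [simp, intro]: "x \<in> car A ==> c \<odot> x \<in> car A"
    and plus_assoc: "[|x \<in> car A; y \<in> car A; z \<in> car A|]
          ==> (x \<oplus> y) \<oplus> z = x \<oplus> (y \<oplus> z)"
    and plus_commute: "[|x \<in> car A; y \<in> car A|] ==> x \<oplus> y = y \<oplus> x"
    and zero_plus: "x \<in> car A ==> \<zero> \<oplus> x = x"
    and plus_inverse: "x \<in> car A ==> x \<oplus> (- 1) \<odot> x = \<zero>"
    and smult_plus: "[|x \<in> car A; y \<in> car A|]
          ==> c \<odot> (x \<oplus> y) = (c \<odot> x) \<oplus> (c \<odot> y)"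
    and plus_smult: "x \<in> car A ==> (c + d) \<odot> x = (c \<odot> x) \<oplus> (d \<odot> x)"
    and smult_assoc: "x \<in> car A ==> c \<odot> (d \<odot> x) = (c * d) \<odot> x"
    and one_smult: "x \<in> car A ==> 1 \<odot> x = x"
begin

lemma plus_left_commute:
  "[|x \<in> car A; y \<in> car A; z \<in> car A|] ==> x \<oplus> (y \<oplus> z) = y \<oplus> (x \<oplus> z)"
  by (metis plus_assoc plus_commute)

lemma plus_zero: "x \<in> car A ==> x \<oplus> \<zero> = x"
  using plus_commute zero_plus by auto

lemma zero_smult: "x \<in> car A ==> 0 \<odot> x = \<zero>"
  using plus_smult[of x 1 "-1"] plus_inverse one_smult by simp

lemma smult_zero: "c \<odot> \<zero> = \<zero>"
  using smult_assoc[of "\<zero>" c 0] zero_smult[of "\<zero>"] by simp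

lemma csum_empty [simp]: "csum A f {} = \<zero>"
  by (simp add: csum_def)

lemma csum_fold_commute:
  assumes "!!x. x \<in> S ==> f x \<in> car A"
  shows "comp_fun_commute_on S (%x y. if y \<in> car A then y \<oplus> f x else y)"
  by unfold_locales
    (use assms in \<open>auto simp: fun_eq_iff plus_assoc intro!: arg_cong2[where f="cadd A"] plus_commute\<close>)

lemma csum_insert:
  assumes "finite S" "x \<notin> S" "!!y. y \<in> insert x S ==> f y \<in> car A"
    and "csum A f S \<in> car A"
  shows "csum A f (insert x S) = csum A f S \<oplus> f x"
proof -
  interpret comp_fun_commute_on "insert x S" "%x y. if y \<in> car A then y \<oplus> f x else y"
    by (rule csum_fold_commute) (rule assms(3))
  show ?thesis
    using assms fold_insert[of x S "\<zero>"] by (auto simp: csum_def)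
qed

lemma csum_mem [simp, intro]:
  assumes "!!y. y \<in> S ==> f y \<in> car A"
  shows "csum A f S \<in> car A"
proof (cases "finite S")
  case True
  then show ?thesis using assms
  proof (induction S rule: finite_induct)
    case (insert x S)
    then show ?case by (subst csum_insert) auto
  qed simp
qed (simp add: csum_def)

lemma csum_insert':
  assumes "finite S" "x \<notin> S" "!!y. y \<in> insert x S ==> f y \<in> car A"
  shows "csum A f (insert x S) = csum A f S \<oplus> f x"
  using assms by (intro csum_insert) auto

lemma csum_insert_simp [simp]:
  assumes "finite S" "x \<notin> S" "f x \<in> car A" "!!y. y \<in> S ==> f y \<in> car A"
  shows "csum A f (insert x S) = csum A f S \<oplus> f x"
  using assms by (intro csum_insert') auto

lemma csum_singleton: "f x \<in> car A ==> csum A f {x} = f x"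
  by (subst csum_insert') (auto simp: zero_plus)

lemma csum_cong:
  assumes "S = T" "!!y. y \<in> T ==> f y = g y" "!!y. y \<in> T ==> g y \<in> car A"
  shows "csum A f S = csum A g T"
proof (cases "finite T")
  case True
  then show ?thesis unfolding \<open>S = T\<close> using assms(2,3)
  proof (induction T rule: finite_induct)
    case (insert x S)
    then show ?case by (subst (1 2) csum_insert') auto
  qed simp
qed (simp add: csum_def assms)

lemma csum_mono_neutral:
  assumes "finite T" "S \<subseteq> T" "!!y. y \<in> S ==> f y \<in> car A" "!!y. y \<in> T - S ==> f y = \<zero>"
  shows "csum A f T = csum A f S"
proof -
  have "csum A f (S \<union> R) = csum A f S" if "finite R" "R \<subseteq> T - S" for R
    using that
  proof (induction R rule: finite_induct)
    case (insert x R)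
    have "finite (S \<union> R)" using assms(1,2) insert finite_subset by auto
    moreover have "x \<notin> S \<union> R" using insert(2,4) by auto
    moreover have "f y \<in> car A" if "y \<in> insert x (S \<union> R)" for y
      using that insert(4) assms(3,4) by (metis DiffI Un_iff insertE insert_subset subsetD zero_mem)
    ultimately have "csum A f (insert x (S \<union> R)) = csum A f (S \<union> R) \<oplus> f x"
      by (rule csum_insert') auto
    then show ?case using insert assms(3,4) by (auto simp: plus_zero)
  qed simp
  from this[of "T - S"] show ?thesis using assms(1,2) by (simp add: Un_absorb1)
qed

lemma csum_add:
  assumes "!!y. y \<in> S ==> f y \<in> car A" "!!y. y \<in> S ==> g y \<in> car A"
  shows "csum A (%x. f x \<oplus> g x) S = csum A f S \<oplus> csum A g S"
proof (cases "finite S")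
  case True
  then show ?thesis using assms
  proof (induction S rule: finite_induct)
    case (insert x S)
    then show ?case
      by (subst (1 2 3) csum_insert') (auto simp: plus_assoc plus_commute plus_left_commute)
  qed (simp add: zero_plus)
qed (simp add: csum_def zero_plus)

lemma csum_smult:
  assumes "!!y. y \<in> S ==> f y \<in> car A"
  shows "csum A (%x. c \<odot> f x) S = c \<odot> csum A f S"
proof (cases "finite S")
  case True
  then show ?thesis using assms
  proof (induction S rule: finite_induct)
    case (insert x S)
    then show ?case by (subst (1 2) csum_insert') (auto simp: smult_plus)
  qed (simp add: smult_zero)
qed (simp add: csum_def smult_zero)

text \<open>Evaluates a formal linear combination of vectors. The carrier is the free vector space
  on its own elements modulo the kernel of this map.\<close>

definition lin_eval :: "('a \<Rightarrow>\<^sub>0 complex) => 'a" where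
  "lin_eval u = csum A (%x. lookup u x \<odot> x) (keys u)"

lemma lin_eval_superset:
  assumes "keys u \<subseteq> S" "S \<subseteq> car A" "finite S"
  shows "lin_eval u = csum A (%x. lookup u x \<odot> x) S"
  unfolding lin_eval_def
  by (rule sym, rule csum_mono_neutral) (use assms in "auto simp: zero_smult in_keys_iff subset_iff")

lemma lin_eval_add:
  assumes "keys u \<subseteq> car A" "keys v \<subseteq> car A"
  shows "lin_eval (u + v) = lin_eval u \<oplus> lin_eval v"
proof -
  let ?S = "keys u \<union> keys v"
  have S: "?S \<subseteq> car A" "finite ?S" using assms by auto
  have "lin_eval (u + v) = csum A (%x. lookup (u + v) x \<odot> x) ?S"
    by (rule lin_eval_superset[OF keys_add S])
  also have "... = csum A (%x. lookup u x \<odot> x \<oplus> lookup v x \<odot> x) ?S"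
    using S by (intro csum_cong) (auto simp: lookup_add plus_smult)
  also have "... = csum A (%x. lookup u x \<odot> x) ?S \<oplus> csum A (%x. lookup v x \<odot> x) ?S"
    using S by (intro csum_add) auto
  finally show ?thesis
    using lin_eval_superset[OF _ S, of u] lin_eval_superset[OF _ S, of v] by simp
qed

lemma lin_eval_smult:
  assumes "keys u \<subseteq> car A"
  shows "lin_eval (pm_scale c u) = c \<odot> lin_eval u"
proof -
  let ?S = "keys u"
  have "lin_eval (pm_scale c u) = csum A (%x. lookup (pm_scale c u) x \<odot> x) ?S"
    using assms by (intro lin_eval_superset keys_pm_scale) auto
  also have "... = csum A (%x. c \<odot> (lookup u x \<odot> x)) ?S"
    using assms by (intro csum_cong) (auto simp: smult_assoc)
  finally show ?thesis
    using csum_smult[of ?S "%x. lookup u x \<odot> x"] assms by (simp add: lin_eval_def subset_iff)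
qed

lemma lin_eval_single: "x \<in> car A ==> lin_eval (single x c) = c \<odot> x"
  by (cases "c = 0") (simp_all add: lin_eval_def zero_smult csum_singleton)

end

text \<open>A linear injection of the carrier into a function space, obtained from a Hamel basis. It
  transports vector identities on the carrier to identities between complex numbers.\<close>

definition is_coord :: "'a cstar_alg => ('a => ('a \<Rightarrow>\<^sub>0 complex) => complex) => bool" where
  "is_coord A J \<longleftrightarrow>
     (\<forall>x\<in>car A. \<forall>y\<in>car A. \<forall>i. J (cadd A x y) i = J x i + J y i) \<and>
     (\<forall>c. \<forall>x\<in>car A. \<forall>i. J (csmult A c x) i = c * J x i) \<and>
     (\<forall>x\<in>car A. \<forall>y\<in>car A. J x = J y --> x = y)"

definition coord :: "'a cstar_alg => 'a => ('a \<Rightarrow>\<^sub>0 complex) => complex" where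
  "coord A = (SOME J. is_coord A J)"

context carrier_vector_space
begin

text \<open>A carrier set is no type, so a basis is taken in the free space on it: a basis
  \<open>D\<close> of the kernel of \<open>lin_eval\<close> is extended to a basis \<open>E\<close>
  of the whole space, and the coordinates along \<open>E - D\<close> are linear and injective on the
  quotient, which is the carrier.\<close>

lemma is_coord_coord: "is_coord A (coord A)"
proof -
  interpret F: vector_space "pm_scale :: complex => ('a \<Rightarrow>\<^sub>0 complex) => _"
    by (rule vector_space_pm_scale)
  define N where "N = {u. keys u \<subseteq> car A \<and> lin_eval u = \<zero>}"
  have sub: "F.subspace N"
    unfolding F.subspace_def N_def
    using keys_add[where 'a='a and 'b=complex] keys_pm_scale[of _ "u :: 'a \<Rightarrow>\<^sub>0 complex" for u] lin_eval_add lin_eval_smult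
    by (auto simp: zero_plus smult_zero lin_eval_def[of 0]) (metis subsetD Un_iff)+
  obtain D where D: "D \<subseteq> N" "F.independent D" "N \<subseteq> F.span D"
    using F.basis_exists[of N] by metis
  have N: "N = F.span D"
    using D sub F.span_minimal by blast
  define E where "E = F.extend_basis D"
  have E: "D \<subseteq> E" "F.independent E" "F.span E = UNIV"
    unfolding E_def using D(2) F.extend_basis_superset F.independent_extend_basis F.span_extend_basis
    by auto
  \<comment> \<open>Dropping the coordinates along \<open>D\<close> annihilates the kernel
    \<open>N\<close> and nothing more.\<close>
  define J where "J x b = (if b \<in> D then 0 else F.representation E (single x 1) b)"
    for x b
  let ?s = "%x. single x (1::complex)"
  have ker: "F.representation E u b = 0" if "u \<in> N" "b \<notin> D" for u b
  proof -
    have "F.representation E u = F.representation D u"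
      using F.representation_extend[of E u D] E D that N by auto
    then show ?thesis using F.representation_ne_zero[of D u b] that by auto
  qed
  have diff: "F.representation E (u - v) b = F.representation E u b - F.representation E v b" for u v b
    using F.representation_diff[OF E(2), of v u] E(3) by auto
  have add: "F.representation E (u + v) b = F.representation E u b + F.representation E v b" for u v b
    using F.representation_add[OF E(2), of v u] E(3) by auto
  have scale: "F.representation E (pm_scale c u) b = c * F.representation E u b" for c u b
    using F.representation_scale[OF E(2), where v=u and r=c] E(3) by auto
  have neg: "u - v = u + pm_scale (-1) v" for u v :: "'a \<Rightarrow>\<^sub>0 complex"
    by (rule poly_mapping_eqI) (simp add: lookup_add lookup_minus)
  have Nadd: "?s (x \<oplus> y) - (?s x + ?s y) \<in> N" if "x \<in> car A" "y \<in> car A" for x y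
  proof -
    have k: "keys (?s x + ?s y) \<subseteq> car A"
      using keys_add[of "?s x" "?s y"] that by auto
    then have "keys (pm_scale (-1) (?s x + ?s y)) \<subseteq> car A"
      using keys_pm_scale by fast
    note k2 = this
    have "lin_eval (?s (x \<oplus> y) + pm_scale (-1) (?s x + ?s y)) = (x \<oplus> y) \<oplus> (- 1) \<odot> (x \<oplus> y)"
    proof -
      have 1: "keys (?s (x \<oplus> y)) \<subseteq> car A" "keys (?s x) \<subseteq> car A"
        "keys (?s y) \<subseteq> car A" using that by auto
      show ?thesis
        using that by (simp only: lin_eval_add[OF 1(1) k2] lin_eval_smult[OF k] lin_eval_add[OF 1(2,3)]
            lin_eval_single add_mem one_smult)
    qed
    also have "... = \<zero>" using that by (intro plus_inverse) auto
    finally show ?thesis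
      unfolding N_def neg
      using keys_add[of "?s (x \<oplus> y)" "pm_scale (-1) (?s x + ?s y)"] k2 that by (auto split: if_splits)
  qed
  have Nsm: "?s (c \<odot> x) - pm_scale c (?s x) \<in> N" if "x \<in> car A" for x c
    unfolding N_def neg pm_scale_single
    using keys_add[of "?s (c \<odot> x)" "single x (-1 * (c * 1))"] that
    by (auto simp: lin_eval_add lin_eval_single one_smult smult_assoc[symmetric] plus_inverse subset_iff split: if_splits)
      (use plus_inverse[of "c \<odot> x"] in \<open>simp_all add: smult_assoc\<close>)
  have inj: "x = y" if xy: "x \<in> car A" "y \<in> car A" "J x = J y" for x y
  proof -
    have 0: "F.representation E (?s x - ?s y) b = 0" if "b \<notin> D" for b
      using fun_cong[OF xy(3), of b] that by (simp add: J_def diff)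
    have "?s x - ?s y = (\<Sum>b | F.representation E (?s x - ?s y) b ~= 0.
        pm_scale (F.representation E (?s x - ?s y) b) b)"
      using F.sum_nonzero_representation_eq[OF E(2), of "?s x - ?s y"] E(3) by auto
    \<comment> \<open>All coordinates off \<open>D\<close> agree, so the difference is a combination
      of \<open>D\<close> and evaluates to zero.\<close>
    also have "... \<in> F.span D"
      using 0 by (intro F.span_sum F.span_scale F.span_base) auto
    finally have "lin_eval (?s x - ?s y) = \<zero>" using N by (auto simp: N_def)
    moreover have "lin_eval (?s x - ?s y) = x \<oplus> (- 1) \<odot> y"
      unfolding neg using xy by (subst lin_eval_add) (auto simp: lin_eval_smult lin_eval_single one_smult
          pm_scale_single)
    ultimately have "x \<oplus> (- 1) \<odot> y = \<zero>" by simp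
    then have "(x \<oplus> (- 1) \<odot> y) \<oplus> y = y" using xy by (simp add: zero_plus)
    then show ?thesis using xy plus_inverse[of y]
      by (simp add: plus_assoc plus_commute[of "(- 1) \<odot> y" y] plus_zero)
  qed
  have "is_coord A J"
    unfolding is_coord_def
  proof (intro conjI ballI allI impI)
    fix x y i assume "x \<in> car A" "y \<in> car A"
    then show "J (x \<oplus> y) i = J x i + J y i"
      using ker[OF Nadd[of x y], of i] by (auto simp: J_def diff add)
  next
    fix c x i assume "x \<in> car A"
    then show "J (c \<odot> x) i = c * J x i"
      using ker[OF Nsm[of x c], of i] scale[of c "?s x" i] by (auto simp: J_def diff)
  qed (rule inj)
  then show ?thesis unfolding coord_def by (rule someI[of "is_coord A"])
qed

lemma coord_add [simp]:
  "[|x \<in> car A; y \<in> car A|] ==> coord A (x \<oplus> y) i = coord A x i + coord A y i"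
  and coord_smult [simp]: "x \<in> car A ==> coord A (c \<odot> x) i = c * coord A x i"
  using is_coord_coord unfolding is_coord_def by auto

text \<open>Turns a linear identity in the carrier into a family of identities between complex
  numbers, where ordinary ring simplification applies; products and adjoints enter as opaque
  vectors.\<close>

lemma vec_eqI:
  assumes "x \<in> car A" "y \<in> car A" "!!i. coord A x i = coord A y i"
  shows "x = y"
  using is_coord_coord assms unfolding is_coord_def by (metis ext)

lemma coord_zero [simp]: "coord A \<zero> i = 0"
  using coord_smult[of "\<zero>" 0 i] by (simp add: zero_smult)

lemma diff_mem [simp, intro]: "[|x \<in> car A; y \<in> car A|] ==> cdiff A x y \<in> car A"
  by (simp add: cdiff_def)

lemma coord_diff [simp]:
  "[|x \<in> car A; y \<in> car A|] ==> coord A (cdiff A x y) i = coord A x i - coord A y i"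
  by (simp add: cdiff_def)

lemma coord_csum [simp]:
  assumes "!!y. y \<in> S ==> f y \<in> car A"
  shows "coord A (csum A f S) i = (\<Sum>x\<in>S. coord A (f x) i)"
proof (cases "finite S")
  case True
  then show ?thesis using assms
  proof (induction S rule: finite_induct)
    case (insert x S)
    then show ?case by (subst csum_insert') auto
  qed simp
qed (simp add: csum_def)

lemma diff_self: "x \<in> car A ==> cdiff A x x = \<zero>"
  by (rule vec_eqI) auto

lemma diff_eq_zero_iff: "[|x \<in> car A; y \<in> car A|] ==> cdiff A x y = \<zero> \<longleftrightarrow> x = y"
  by (metis coord_diff coord_zero diff_self eq_iff_diff_eq_0 vec_eqI)

lemma csum_lessThan_Suc:
  assumes "!!i. i <= n ==> f i \<in> car A"
  shows "csum A f {..<Suc n} = csum A f {..<n} \<oplus> f n"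
  using assms unfolding lessThan_Suc by (intro csum_insert_simp) auto

end

section \<open>Algebras with a \<open>C\<^sup>*\<close>-seminorm\<close>

text \<open>Neither definiteness nor completeness is assumed, so that the free tensor product with
  its greatest seminorm is an instance and can be fed to the completion.\<close>

locale pre_cstar_algebra = carrier_vector_space +
  assumes times_mem [simp, intro]: "[|x \<in> car A; y \<in> car A|] ==> x \<cdot> y \<in> car A"
    and adj_mem [simp, intro]: "x \<in> car A ==> cstar A x \<in> car A"
    and times_assoc: "[|x \<in> car A; y \<in> car A; z \<in> car A|]
          ==> (x \<cdot> y) \<cdot> z = x \<cdot> (y \<cdot> z)"
    and times_plus: "[|x \<in> car A; y \<in> car A; z \<in> car A|]
          ==> x \<cdot> (y \<oplus> z) = (x \<cdot> y) \<oplus> (x \<cdot> z)"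
    and plus_times: "[|x \<in> car A; y \<in> car A; z \<in> car A|]
          ==> (x \<oplus> y) \<cdot> z = (x \<cdot> z) \<oplus> (y \<cdot> z)"
    and smult_times: "[|x \<in> car A; y \<in> car A|] ==> (c \<odot> x) \<cdot> y = c \<odot> (x \<cdot> y)"
    and times_smult: "[|x \<in> car A; y \<in> car A|] ==> x \<cdot> (c \<odot> y) = c \<odot> (x \<cdot> y)"
    and adj_adj: "x \<in> car A ==> cstar A (cstar A x) = x"
    and adj_plus: "[|x \<in> car A; y \<in> car A|]
          ==> cstar A (x \<oplus> y) = cstar A x \<oplus> cstar A y"
    and adj_smult: "x \<in> car A ==> cstar A (c \<odot> x) = cnj c \<odot> cstar A x"
    and adj_times: "[|x \<in> car A; y \<in> car A|]
          ==> cstar A (x \<cdot> y) = cstar A y \<cdot> cstar A x"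
    and norm_ge_zero: "x \<in> car A ==> 0 <= cnorm A x"
    and norm_plus: "[|x \<in> car A; y \<in> car A|]
          ==> cnorm A (x \<oplus> y) <= cnorm A x + cnorm A y"
    and norm_scale: "x \<in> car A ==> cnorm A (c \<odot> x) = cmod c * cnorm A x"
    and norm_times: "[|x \<in> car A; y \<in> car A|]
          ==> cnorm A (x \<cdot> y) <= cnorm A x * cnorm A y"
    and norm_adj_times: "x \<in> car A ==> cnorm A (cstar A x \<cdot> x) = (cnorm A x)\<^sup>2"
begin

lemma times_diff: "[|x \<in> car A; y \<in> car A; z \<in> car A|]
    ==> x \<cdot> cdiff A y z = cdiff A (x \<cdot> y) (x \<cdot> z)"
  by (simp add: cdiff_def times_plus times_smult)

lemma diff_times: "[|x \<in> car A; y \<in> car A; z \<in> car A|]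
    ==> cdiff A x y \<cdot> z = cdiff A (x \<cdot> z) (y \<cdot> z)"
  by (simp add: cdiff_def plus_times smult_times)

lemma adj_diff: "[|x \<in> car A; y \<in> car A|]
    ==> cstar A (cdiff A x y) = cdiff A (cstar A x) (cstar A y)"
  by (simp add: cdiff_def adj_plus adj_smult)

lemma times_zero: "x \<in> car A ==> x \<cdot> \<zero> = \<zero>"
  using times_smult[of x "\<zero>" 0] by (simp add: zero_smult)

lemma zero_times: "x \<in> car A ==> \<zero> \<cdot> x = \<zero>"
  using smult_times[of "\<zero>" x 0] by (simp add: zero_smult)

lemma adj_zero: "cstar A \<zero> = \<zero>"
  using adj_smult[of "\<zero>" 0] by (simp add: zero_smult)

lemmas expand_simps = times_diff diff_times times_plus plus_times smult_times times_smult
  times_assoc adj_diff adj_plus adj_smult adj_times adj_adj adj_zero times_zero zero_times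

lemma norm_zero: "cnorm A \<zero> = 0"
  using norm_scale[of "\<zero>" 0] by (simp add: zero_smult)

text \<open>The C*-identity and submultiplicativity give one inequality after cancelling a factor;
  applied to the adjoint, they give the other.\<close>

lemma norm_adj: "x \<in> car A ==> cnorm A (cstar A x) = cnorm A x"
proof -
  have le: "cnorm A x <= cnorm A (cstar A x)" if "x \<in> car A" for x
  proof (cases "cnorm A x = 0")
    case False
    have "cnorm A x * cnorm A x <= cnorm A (cstar A x) * cnorm A x"
      using norm_adj_times[OF that] norm_times[of "cstar A x" x] that by (simp add: power2_eq_square)
    then show ?thesis using False norm_ge_zero[OF that] by (simp add: mult_le_cancel_right)
  qed (use norm_ge_zero that in auto)
  assume "x \<in> car A"
  then show ?thesis using le[of x] le[of "cstar A x"] by (simp add: adj_adj)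
qed

lemma norm_times_adj: "x \<in> car A ==> cnorm A (x \<cdot> cstar A x) = (cnorm A x)\<^sup>2"
  using norm_adj_times[of "cstar A x"] by (simp add: adj_adj norm_adj)

lemma norm_diff_commute: "[|x \<in> car A; y \<in> car A|] ==> cnorm A (cdiff A x y) = cnorm A (cdiff A y x)"
proof -
  assume xy: "x \<in> car A" "y \<in> car A"
  have "cdiff A x y = (- 1) \<odot> cdiff A y x" by (rule vec_eqI) (use xy in auto)
  then show ?thesis using xy by (simp add: norm_scale)
qed

lemma norm_diff_triangle: "[|x \<in> car A; y \<in> car A; z \<in> car A|]
    ==> cnorm A (cdiff A x z) <= cnorm A (cdiff A x y) + cnorm A (cdiff A y z)"
proof -
  assume xy: "x \<in> car A" "y \<in> car A" "z \<in> car A"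
  have "cdiff A x z = cdiff A x y \<oplus> cdiff A y z" by (rule vec_eqI) (use xy in auto)
  then show ?thesis using xy by (simp add: norm_plus)
qed

lemma norm_diff_le: "[|x \<in> car A; y \<in> car A|] ==> cnorm A (cdiff A x y) <= cnorm A x + cnorm A y"
  using norm_plus[of x "(- 1) \<odot> y"] by (simp add: cdiff_def norm_scale)

lemma norm_le_diff: "[|x \<in> car A; y \<in> car A|] ==> cnorm A x <= cnorm A (cdiff A x y) + cnorm A y"
proof -
  assume xy: "x \<in> car A" "y \<in> car A"
  have "x = cdiff A x y \<oplus> y" by (rule vec_eqI) (use xy in auto)
  then show ?thesis using xy norm_plus[of "cdiff A x y" y] by simp
qed

lemma abs_norm_diff: "[|x \<in> car A; y \<in> car A|] ==> \<bar>cnorm A x - cnorm A y\<bar> <= cnorm A (cdiff A x y)"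
  using norm_le_diff[of x y] norm_le_diff[of y x] norm_diff_commute[of x y] by auto

lemma times_csum:
  assumes "x \<in> car A" "!!y. y \<in> S ==> f y \<in> car A"
  shows "x \<cdot> csum A f S = csum A (%y. x \<cdot> f y) S"
proof (cases "finite S")
  case True
  then show ?thesis using assms
    by (induction S rule: finite_induct) (auto simp: times_zero times_plus)
qed (simp add: csum_def times_zero assms)

lemma csum_times:
  assumes "x \<in> car A" "!!y. y \<in> S ==> f y \<in> car A"
  shows "csum A f S \<cdot> x = csum A (%y. f y \<cdot> x) S"
proof (cases "finite S")
  case True
  then show ?thesis using assms
    by (induction S rule: finite_induct) (auto simp: zero_times plus_times)
qed (simp add: csum_def zero_times assms)

lemma adj_csum:
  assumes "!!y. y \<in> S ==> f y \<in> car A"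
  shows "cstar A (csum A f S) = csum A (%y. cstar A (f y)) S"
proof (cases "finite S")
  case True
  then show ?thesis using assms
    by (induction S rule: finite_induct) (auto simp: adj_zero adj_plus)
qed (simp add: csum_def adj_zero)

end

subsection \<open>Convergence\<close>

text \<open>Convergence for a seminorm: limits are unique only up to seminorm zero until
  \<open>cstar_algebra\<close> supplies definiteness.\<close>

definition ctends :: "'a cstar_alg => (nat => 'a) => 'a => bool" where
  "ctends A s l \<longleftrightarrow> (\<forall>n. s n \<in> car A) \<and> l \<in> car A \<and>
     (%n. cnorm A (cdiff A (s n) l)) ----> 0"

lemma ctends_mem: "ctends A s l ==> s n \<in> car A" "ctends A s l ==> l \<in> car A"
  by (auto simp: ctends_def)

lemma cauchy_seqs_mem: "s \<in> cauchy_seqs P ==> s n \<in> car P"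
  by (auto simp: cauchy_seqs_def)

context pre_cstar_algebra
begin

lemma ctendsI:
  assumes "!!n. s n \<in> car A" "l \<in> car A" "!!n. cnorm A (cdiff A (s n) l) <= f n" "f ----> 0"
  shows "ctends A s l"
  unfolding ctends_def using assms norm_ge_zero
  by (auto intro!: tendsto_sandwich[OF _ _ tendsto_const[of 0] assms(4)] always_eventually)

lemma ctends_const: "l \<in> car A ==> ctends A (%_. l) l"
  by (simp add: ctends_def diff_self norm_zero)

lemma ctends_add:
  assumes "ctends A s l" "ctends A t m"
  shows "ctends A (%n. s n \<oplus> t n) (l \<oplus> m)"
proof (rule ctendsI)
  note [simp] = ctends_mem[OF assms(1)] ctends_mem[OF assms(2)]
  show "cnorm A (cdiff A (s n \<oplus> t n) (l \<oplus> m)) <= cnorm A (cdiff A (s n) l) + cnorm A (cdiff A (t n) m)" for n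
  proof -
    have "cdiff A (s n \<oplus> t n) (l \<oplus> m) = cdiff A (s n) l \<oplus> cdiff A (t n) m"
      by (rule vec_eqI) auto
    then show ?thesis by (simp add: norm_plus)
  qed
  show "(%n. cnorm A (cdiff A (s n) l) + cnorm A (cdiff A (t n) m)) ----> 0"
    using assms by (auto simp: ctends_def intro: tendsto_add_zero)
qed (use assms in "auto simp: ctends_def")

lemma ctends_smult:
  assumes "ctends A s l"
  shows "ctends A (%n. c \<odot> s n) (c \<odot> l)"
proof (rule ctendsI)
  note [simp] = ctends_mem[OF assms(1)]
  show "cnorm A (cdiff A (c \<odot> s n) (c \<odot> l)) <= cmod c * cnorm A (cdiff A (s n) l)" for n
  proof -
    have "cdiff A (c \<odot> s n) (c \<odot> l) = c \<odot> cdiff A (s n) l"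
      by (rule vec_eqI) (auto simp: algebra_simps)
    then show ?thesis by (simp add: norm_scale)
  qed
  show "(%n. cmod c * cnorm A (cdiff A (s n) l)) ----> 0"
    using assms by (auto simp: ctends_def intro: tendsto_mult_right_zero)
qed (use assms in "auto simp: ctends_def")

lemma ctends_diff: "ctends A s l ==> ctends A t m ==> ctends A (%n. cdiff A (s n) (t n)) (cdiff A l m)"
  unfolding cdiff_def by (intro ctends_add ctends_smult)

lemma ctends_norm:
  assumes "ctends A s l"
  shows "(%n. cnorm A (s n)) ----> cnorm A l"
proof -
  have "norm (cnorm A (s n) - cnorm A l) <= cnorm A (cdiff A (s n) l)" for n
    using abs_norm_diff[of "s n" l] ctends_mem[OF assms] by simp
  then have ev: "\<forall>\<^sub>F n in sequentially. norm (cnorm A (s n) - cnorm A l) <= cnorm A (cdiff A (s n) l)"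
    by simp
  have "(%n. cnorm A (cdiff A (s n) l)) ----> 0" using assms by (simp add: ctends_def)
  from Lim_null_comparison[OF ev this] have "(%n. cnorm A (s n) - cnorm A l) ----> 0" .
  then show ?thesis by (simp add: LIM_zero_iff)
qed

lemma ctends_adj: "ctends A s l ==> ctends A (%n. cstar A (s n)) (cstar A l)"
  using norm_adj[of "cdiff A (s n) l" for n] by (auto simp: ctends_def adj_diff)

lemma ctends_times:
  assumes "ctends A s l" "ctends A t m"
  shows "ctends A (%n. s n \<cdot> t n) (l \<cdot> m)"
proof (rule ctendsI)
  note [simp] = ctends_mem[OF assms(1)] ctends_mem[OF assms(2)]
  show "cnorm A (cdiff A (s n \<cdot> t n) (l \<cdot> m))
      <= cnorm A (cdiff A (s n) l) * cnorm A (t n) + cnorm A l * cnorm A (cdiff A (t n) m)" for n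
  proof -
    have "cdiff A (s n \<cdot> t n) (l \<cdot> m) = cdiff A (s n) l \<cdot> t n \<oplus> l \<cdot> cdiff A (t n) m"
      by (rule vec_eqI) (auto simp: expand_simps)
    then show ?thesis
      using norm_plus[of "cdiff A (s n) l \<cdot> t n" "l \<cdot> cdiff A (t n) m"]
        norm_times[of "cdiff A (s n) l" "t n"] norm_times[of l "cdiff A (t n) m"] by simp
  qed
  have "(%n. cnorm A (cdiff A (s n) l) * cnorm A (t n) + cnorm A l * cnorm A (cdiff A (t n) m))
     ----> 0 * cnorm A m + cnorm A l * 0"
    using assms ctends_norm[OF assms(2)] by (intro tendsto_intros) (auto simp: ctends_def)
  then show "(%n. cnorm A (cdiff A (s n) l) * cnorm A (t n) + cnorm A l * cnorm A (cdiff A (t n) m)) ----> 0"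
    by simp
qed (use assms in "auto simp: ctends_def")

lemma ctends_norm_diff_unique:
  assumes "ctends A s l" "ctends A s m"
  shows "cnorm A (cdiff A l m) = 0"
proof -
  note [simp] = ctends_mem[OF assms(1)] ctends_mem[OF assms(2)]
  have "(%n. cnorm A (cdiff A (s n) (s n))) ----> cnorm A (cdiff A l m)"
    by (intro ctends_norm ctends_diff assms)
  then show ?thesis by (simp add: diff_self norm_zero LIMSEQ_const_iff)
qed

lemma ctends_cauchy: "ctends A s l ==> s \<in> cauchy_seqs A"
proof -
  assume s: "ctends A s l"
  note [simp] = ctends_mem[OF s]
  have "\<exists>N. \<forall>m\<ge>N. \<forall>n\<ge>N. cnorm A (cdiff A (s m) (s n)) < e" if "e > 0" for e
  proof -
    have "eventually (%n. cnorm A (cdiff A (s n) l) < e/2) sequentially"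
      using s that unfolding ctends_def by (intro order_tendstoD(2)) auto
    then obtain N where N: "!!n. n \<ge> N ==> cnorm A (cdiff A (s n) l) < e/2"
      by (auto simp: eventually_sequentially)
    have "cnorm A (cdiff A (s m) (s n)) < e" if "m \<ge> N" "n \<ge> N" for m n
      using norm_diff_triangle[of "s m" l "s n"] norm_diff_commute[of "s n" l] N[OF that(1)] N[OF that(2)]
      by simp
    then show ?thesis by blast
  qed
  then show ?thesis by (auto simp: cauchy_seqs_def)
qed

lemma cauchy_seqsI:
  assumes "!!n. s n \<in> car A" "!!m n. m <= n ==> cnorm A (cdiff A (s n) (s m)) <= f m" "f ----> 0"
  shows "s \<in> cauchy_seqs A"
proof -
  have "\<exists>N. \<forall>m\<ge>N. \<forall>n\<ge>N. cnorm A (cdiff A (s m) (s n)) < e" if "e > 0" for e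
  proof -
    have "eventually (%n. f n < e) sequentially"
      using assms(3) that by (auto simp: order_tendsto_iff)
    then obtain N where N: "!!n. n \<ge> N ==> f n < e" by (auto simp: eventually_sequentially)
    have "cnorm A (cdiff A (s m) (s n)) < e" if "m \<ge> N" "n \<ge> N" for m n
      using assms(2)[of m n] assms(2)[of n m] norm_diff_commute[OF assms(1) assms(1), of m n] N[OF that(1)] N[OF that(2)]
      by (cases "m <= n") auto
    then show ?thesis by blast
  qed
  then show ?thesis using assms(1) by (auto simp: cauchy_seqs_def)
qed

lemma norm_geometric_sum:
  assumes s: "!!n. s n \<in> car A" "!!n. cnorm A (cdiff A (s (Suc n)) (s n)) <= r ^ n" and r: "0 <= r" "r < 1"
  shows "s \<in> cauchy_seqs A"
proof (rule cauchy_seqsI)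
  have "cnorm A (cdiff A (s (m + k)) (s m)) <= r ^ m * ((1 - r ^ k) / (1 - r))" for m k
  proof (induction k)
    case (Suc k)
    have "cnorm A (cdiff A (s (m + Suc k)) (s m)) <= r ^ (m + k) + r ^ m * ((1 - r ^ k) / (1 - r))"
      using norm_diff_triangle[of "s (m + Suc k)" "s (m + k)" "s m"] s(1) s(2)[of "m + k"] Suc by simp
    also have "... = r ^ m * ((1 - r ^ Suc k) / (1 - r))"
      using r by (simp add: field_simps power_add)
    finally show ?case .
  qed (use s(1) in "simp add: diff_self norm_zero")
  moreover have "r ^ m * ((1 - r ^ k) / (1 - r)) <= r ^ m * (1 / (1 - r))" for m k
    using r by (intro mult_left_mono divide_right_mono) auto
  ultimately have "cnorm A (cdiff A (s (m + k)) (s m)) <= r ^ m * (1 / (1 - r))" for m k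
    using order_trans by blast
  then show "cnorm A (cdiff A (s n) (s m)) <= r ^ m * (1 / (1 - r))" if "m <= n" for m n
    using that le_Suc_ex by metis
  show "(%m. r ^ m * (1 / (1 - r))) ----> 0"
    using r by (intro tendsto_mult_left_zero LIMSEQ_realpow_zero) auto
qed (rule s)

end

section \<open>\<open>C\<^sup>*\<close>-algebras\<close>

sublocale cstar_algebra \<subseteq> pre_cstar_algebra
  by unfold_locales
    (assumption | rule zero_closed add_closed smult_closed mult_closed star_closed add_assoc
      add_commute add_zero add_inverse smult_add_right smult_add_left smult_smult smult_one mult_assoc
      distrib_left distrib_right mult_smult_left mult_smult_right star_star star_add star_smult
      star_mult norm_nonneg norm_triangle norm_smult norm_mult cstar_identity)+

context cstar_algebra
begin

lemma ctends_unique: "ctends A s l ==> ctends A s m ==> l = m"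
  using ctends_norm_diff_unique[of s l m] norm_eq_zero diff_eq_zero_iff ctends_mem diff_mem by metis

lemma cdist_eq: "[|x \<in> car A; y \<in> car A|] ==> cdist A x y = cnorm A (cdiff A x y)"
  by (simp add: cdist_def)

lemma limitin_iff_ctends:
  assumes "range s \<subseteq> car A"
  shows "limitin (ctopology A) s l sequentially \<longleftrightarrow> ctends A s l"
proof -
  interpret M: Metric_space "car A" "cdist A" by (rule Metric_space_cdist)
  have "(%n. cdist A (s n) l) ----> 0 \<longleftrightarrow> (%n. cnorm A (cdiff A (s n) l)) ----> 0" if "l \<in> car A"
    using assms that by (intro filterlim_cong) (auto simp: cdist_eq subset_iff)
  then show ?thesis
    using assms unfolding M.limitin_metric_dist_null ctends_def by (auto intro: always_eventually)
qed

lemma cauchy_convergent: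
  assumes "s \<in> cauchy_seqs A"
  obtains l where "ctends A s l"
proof -
  interpret M: Metric_space "car A" "cdist A" by (rule Metric_space_cdist)
  have mem: "s n \<in> car A" for n using assms by (rule cauchy_seqs_mem)
  have "M.MCauchy s"
    using assms by (auto simp: M.MCauchy_def cauchy_seqs_def cdist_eq mem)
  then show ?thesis
    using complete that limitin_iff_ctends[of s] mem unfolding M.mcomplete_def by (metis image_subsetI)
qed

lemma closedin_iff:
  "closedin (ctopology A) S \<longleftrightarrow> S \<subseteq> car A \<and> (\<forall>s l. (\<forall>n. s n \<in> S) --> ctends A s l --> l \<in> S)"
proof -
  interpret M: Metric_space "car A" "cdist A" by (rule Metric_space_cdist)
  have *: "limitin M.mtopology s l sequentially \<longleftrightarrow> ctends A s l" if "range s \<subseteq> S" "S \<subseteq> car A" for s l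
    using that by (intro limitin_iff_ctends) auto
  have rs: "(\<forall>n. s n \<in> S) \<longleftrightarrow> range s \<subseteq> S" for s :: "nat => 'a" by auto
  show ?thesis
    unfolding M.metric_closedin_iff_sequentially_closed rs using * by metis
qed

lemma closure_of_iff:
  assumes "S \<subseteq> car A"
  shows "x \<in> ctopology A closure_of S \<longleftrightarrow> (\<exists>s. (\<forall>n. s n \<in> S) \<and> ctends A s x)"
proof -
  interpret M: Metric_space "car A" "cdist A" by (rule Metric_space_cdist)
  have *: "limitin M.mtopology s l sequentially \<longleftrightarrow> ctends A s l" if "range s \<subseteq> S" for s l
    using that assms by (intro limitin_iff_ctends) auto
  show ?thesis
  proof
    assume "x \<in> ctopology A closure_of S"
    then show "\<exists>s. (\<forall>n. s n \<in> S) \<and> ctends A s x"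
      unfolding M.closure_of_sequentially using * by (auto simp: image_subset_iff)
  next
    assume "\<exists>s. (\<forall>n. s n \<in> S) \<and> ctends A s x"
    then obtain s where s: "\<forall>n. s n \<in> S" "ctends A s x" by blast
    then have "range s \<subseteq> S \<inter> car A" "x \<in> car A" "limitin M.mtopology s x sequentially"
      using assms *[of s x] ctends_mem[of A s x] by auto
    then show "x \<in> ctopology A closure_of S"
      unfolding M.closure_of_sequentially by blast
  qed
qed

lemma ctends_approx:
  assumes "ctends A s x" "e > 0"
  obtains n where "cnorm A (cdiff A (s n) x) < e"
proof -
  have "eventually (%n. cnorm A (cdiff A (s n) x) < e) sequentially"
    using assms unfolding ctends_def by (intro order_tendstoD(2)) auto
  then obtain n where "cnorm A (cdiff A (s n) x) < e"
    unfolding eventually_sequentially by blast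
  then show ?thesis by (rule that)
qed

end

text \<open>Entry point for every new C*-algebra: completeness is checked on norm-Cauchy sequences
  and translated here to the metric on the carrier.\<close>

lemma cstar_algebraI:
  assumes "pre_cstar_algebra A"
    and def: "!!x. x \<in> car A ==> cnorm A x = 0 ==> x = czero A"
    and comp: "!!s. s \<in> cauchy_seqs A ==> \<exists>l. ctends A s l"
  shows "cstar_algebra A"
proof -
  interpret pre_cstar_algebra A by fact
  have ms: "Metric_space (car A) (cdist A)"
  proof
    fix x y
    show "0 <= cdist A x y" using norm_ge_zero by (simp add: cdist_def)
    show "cdist A x y = cdist A y x" using norm_diff_commute by (simp add: cdist_def)
    show "cdist A x y = 0 \<longleftrightarrow> x = y" if "x \<in> car A" "y \<in> car A"
      using that def[of "cdiff A x y"] diff_eq_zero_iff[of x y] norm_zero by (auto simp: cdist_def)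
    show "cdist A x z <= cdist A x y + cdist A y z"
      if "x \<in> car A" "y \<in> car A" "z \<in> car A" for z
      using that norm_diff_triangle by (simp add: cdist_def)
  qed
  interpret M: Metric_space "car A" "cdist A" by fact
  have "M.mcomplete"
    unfolding M.mcomplete_def
  proof (intro allI impI)
    fix s assume s: "M.MCauchy s"
    then have mem: "s n \<in> car A" for n by (auto simp: M.MCauchy_def)
    then have "s \<in> cauchy_seqs A"
      using s by (auto simp: M.MCauchy_def cauchy_seqs_def cdist_def)
    then obtain l where l: "ctends A s l" using comp by blast
    have "(%n. cdist A (s n) l) ----> 0"
      using l mem by (simp add: ctends_def cdist_def)
    then show "\<exists>x. limitin M.mtopology s x sequentially"
      using l mem unfolding M.limitin_metric_dist_null by (auto simp: ctends_def intro: always_eventually)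
  qed
  then have complete: "Metric_space.mcomplete (car A) (cdist A)" .
  have definite: "cnorm A x = 0 \<longleftrightarrow> x = czero A" if "x \<in> car A" for x
    using that def norm_zero by blast
  show ?thesis
    by unfold_locales
      (assumption | rule zero_mem add_mem smult_mem times_mem adj_mem plus_assoc plus_commute zero_plus
        plus_inverse smult_plus plus_smult smult_assoc one_smult times_assoc times_plus plus_times
        smult_times times_smult adj_adj adj_plus adj_smult adj_times norm_ge_zero norm_plus
        norm_scale norm_times norm_adj_times complete definite)+
qed

section \<open>Unital \<open>C\<^sup>*\<close>-algebras\<close>

text \<open>If \<open>L < a\<close>, division by \<open>a ^ (2 ^ k)\<close> leaves a geometric term
  times a factor linear in the exponent, which tends to zero. A linear factor in the growth of
  powers is therefore harmless; the exponents \<open>2 ^ k\<close> are those at which the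
  C*-identity computes the norm of a power of a self-adjoint element.\<close>

lemma le_of_pow_two_pow_le:
  fixes a L C :: real
  assumes "0 <= a" "0 < L" "!!k. a ^ (2 ^ k) <= L ^ (2 ^ k) * (1 + 2 ^ k * C)"
  shows "a <= L"
proof (rule ccontr)
  assume "\<not> a <= L"
  then have a: "L < a" "0 < a" using assms by auto
  define x where "x = L / a"
  have x: "0 < x" "x < 1" using a assms by (auto simp: x_def)
  have "1 <= x ^ (2 ^ k) + C * (real (2 ^ k) * x ^ (2 ^ k))" for k
  proof -
    have "a ^ (2 ^ k) * 1 <= a ^ (2 ^ k) * (x ^ (2 ^ k) + C * (real (2 ^ k) * x ^ (2 ^ k)))"
      using assms(3)[of k] a by (simp add: x_def power_divide algebra_simps)
    then show ?thesis by (rule mult_left_le_imp_le) (use a in simp)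
  qed
  moreover have "(%k. x ^ (2 ^ k) + C * (real (2 ^ k) * x ^ (2 ^ k))) ----> 0 + C * 0"
  proof (intro tendsto_intros)
    have sub: "strict_mono (%k. 2 ^ k :: nat)" by (simp add: strict_mono_def)
    have "(%n. x ^ n) ----> 0" using x by (intro LIMSEQ_realpow_zero) auto
    from LIMSEQ_subseq_LIMSEQ[OF this sub] show "(%k. x ^ (2 ^ k)) ----> 0"
      by (simp add: o_def)
    have "(%n. real n * x ^ n) ----> 0" using powser_times_n_limit_0[of x] x by simp
    from LIMSEQ_subseq_LIMSEQ[OF this sub] show "(%k. real (2 ^ k) * x ^ (2 ^ k)) ----> 0"
      by (simp add: o_def)
  qed
  ultimately have "1 <= 0 + C * 0" by (intro LIMSEQ_le_const) auto
  then show False by simp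
qed

lemma real_le_of_eps:
  fixes x y K :: real
  assumes "!!e. 0 < e ==> e < 1 ==> x <= y + K * e"
  shows "x <= y"
proof -
  have "((%e. y + K * e) \<longlongrightarrow> y + K * 0) (at_right 0)"
    by (intro tendsto_intros)
  moreover have "eventually (%e::real. x <= y + K * e) (at_right 0)"
    using assms eventually_at_right_real[of 0 1] by (auto elim!: eventually_mono)
  ultimately have "x <= y + K * 0"
    by (intro tendsto_lowerbound[of _ _ "at_right 0"]) auto
  then show ?thesis by simp
qed

section \<open>Square roots near the unit, unitaries and contractive seminorms\<close>

locale unital_cstar_algebra = cstar_algebra +
  fixes e :: 'a
  assumes unit_mem [simp, intro]: "e \<in> car A"
    and unit_times: "x \<in> car A ==> e \<cdot> x = x"
    and times_unit: "x \<in> car A ==> x \<cdot> e = x"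
begin

lemma adj_unit: "cstar A e = e"
  by (metis adj_adj adj_mem adj_times times_unit unit_mem)

lemmas unital_simps = expand_simps unit_times times_unit adj_unit

lemma norm_unit_le: "cnorm A e <= 1"
proof -
  have "cnorm A e * cnorm A e = cnorm A e * 1"
    using norm_adj_times[of e] by (simp add: adj_unit unit_times power2_eq_square)
  then show ?thesis by (cases "cnorm A e = 0") auto
qed

lemma norm_smult_unit_le: "cnorm A (c \<odot> e) <= cmod c"
  using norm_unit_le mult_left_mono[of "cnorm A e" 1 "cmod c"] by (simp add: norm_scale)

lemma norm_square: "x \<in> car A ==> cstar A x = x ==> cnorm A (x \<cdot> x) = (cnorm A x)\<^sup>2"
  using norm_adj_times[of x] by simp

lemma ctends_Suc: "ctends A s l ==> ctends A (%n. s (Suc n)) l"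
  unfolding ctends_def using LIMSEQ_Suc[of "%n. cnorm A (cdiff A (s n) l)" 0] by auto

text \<open>With \<open>z = e - x\<close> of norm \<open>r < 1\<close>, the root is
  \<open>e - l\<close> for a fixed point \<open>l\<close> of
  \<open>y \<mapsto> (z + y\<^sup>2) / 2\<close>; on the ball of radius \<open>r\<close> this map
  contracts with factor \<open>r\<close>. The iterates are polynomials in \<open>z\<close>, hence
  commute with whatever commutes with \<open>x\<close>, and so does the limit.\<close>

lemma sqrt_near_unit:
  assumes x: "x \<in> car A" "cstar A x = x" "cnorm A (cdiff A e x) < 1"
  shows "\<exists>s\<in>car A. cstar A s = s \<and> s \<cdot> s = x \<and> (\<forall>y\<in>car A. y \<cdot> x = x \<cdot> y --> y \<cdot> s = s \<cdot> y)"
proof -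
  define z r where "z = cdiff A e x" and "r = cnorm A z"
  define F where "F y = (1/2) \<odot> (z \<oplus> y \<cdot> y)" for y
  define y where "y n = (F ^^ n) \<zero>" for n
  have z [simp]: "z \<in> car A" and z_adj: "cstar A z = z"
    using x by (auto simp: z_def unital_simps)
  have r: "0 <= r" "r < 1" using x by (auto simp: r_def z_def norm_ge_zero)
  have y0: "y 0 = \<zero>" and ySuc: "y (Suc n) = F (y n)" for n by (auto simp: y_def)
  have ymem [simp]: "y n \<in> car A" for n
    by (induction n) (auto simp: y0 ySuc F_def)
  have ynorm: "cnorm A (y n) <= r" for n
  proof (induction n)
    case (Suc n)
    have "cnorm A (z \<oplus> y n \<cdot> y n) <= r + cnorm A (y n) * cnorm A (y n)"
      using norm_plus[of z "y n \<cdot> y n"] norm_times[of "y n" "y n"] by (simp add: r_def)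
    also have "... <= r + r * 1"
      using Suc r by (intro add_mono mult_mono) (auto simp: norm_ge_zero)
    finally show ?case by (simp add: ySuc F_def norm_scale)
  qed (use r in "simp add: y0 norm_zero")
  have "cnorm A (cdiff A (y (Suc n)) (y n)) <= r ^ n" for n
  proof (induction n)
    case 0
    have "cdiff A (y (Suc 0)) (y 0) = (1/2) \<odot> z"
      by (rule vec_eqI) (auto simp: ySuc y0 F_def unital_simps)
    then show ?case using r by (simp add: norm_scale r_def)
  next
    case (Suc n)
    let ?d = "cdiff A (y (Suc n)) (y n)"
    \<comment> \<open>The difference of two squares is split as \<open>y' d + d y\<close>, which is
      valid without commutativity.\<close>
    have "cdiff A (y (Suc (Suc n))) (y (Suc n)) = (1/2) \<odot> (y (Suc n) \<cdot> ?d \<oplus> ?d \<cdot> y n)"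
      unfolding ySuc[of "Suc n"] by (subst (2) ySuc) (rule vec_eqI; auto simp: F_def unital_simps algebra_simps)
    then have "cnorm A (cdiff A (y (Suc (Suc n))) (y (Suc n)))
        = cnorm A (y (Suc n) \<cdot> ?d \<oplus> ?d \<cdot> y n) / 2"
      by (simp add: norm_scale)
    also have "... <= (cnorm A (y (Suc n)) * cnorm A ?d + cnorm A ?d * cnorm A (y n)) / 2"
      using norm_plus[of "y (Suc n) \<cdot> ?d" "?d \<cdot> y n"] norm_times[of "y (Suc n)" ?d] norm_times[of ?d "y n"]
      by simp
    also have "... <= (r * r ^ n + r ^ n * r) / 2"
      using Suc ynorm r by (intro divide_right_mono add_mono mult_mono) (auto simp: norm_ge_zero)
    finally show ?case by simp
  qed
  then have "y \<in> cauchy_seqs A" using r by (intro norm_geometric_sum) auto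
  then obtain l where l: "ctends A y l" by (rule cauchy_convergent)
  note [simp] = ctends_mem(2)[OF l]
  have "ctends A (%n. F (y n)) (F l)"
    unfolding F_def using l by (intro ctends_smult ctends_add ctends_times ctends_const) auto
  moreover have "ctends A (%n. F (y n)) l" using ctends_Suc[OF l] by (simp add: ySuc)
  ultimately have Fl: "F l = l" by (rule ctends_unique)
  have yadj: "cstar A (y n) = y n" for n
    by (induction n) (auto simp: y0 ySuc F_def unital_simps z_adj)
  then have ladj: "cstar A l = l"
    using ctends_unique[OF ctends_adj[OF l]] l by simp
  have comm: "w \<cdot> l = l \<cdot> w" if w [simp]: "w \<in> car A" and wx: "w \<cdot> x = x \<cdot> w" for w
  proof -
    have wz: "w \<cdot> z = z \<cdot> w" using x(1) wx by (simp add: z_def unital_simps)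
    have wy: "w \<cdot> y n = y n \<cdot> w" for n
    proof (induction n)
      case (Suc n)
      have "w \<cdot> (y n \<cdot> y n) = y n \<cdot> (y n \<cdot> w)"
        using Suc times_assoc[of w "y n" "y n"] times_assoc[of "y n" w "y n"] by simp
      then show ?case by (simp add: ySuc F_def unital_simps wz)
    qed (simp add: y0 unital_simps)
    have "ctends A (%n. w \<cdot> y n) (w \<cdot> l)" "ctends A (%n. y n \<cdot> w) (l \<cdot> w)"
      using l by (intro ctends_times ctends_const; simp)+
    then show ?thesis using ctends_unique by (simp add: wy)
  qed
  define s where "s = cdiff A e l"
  have "s \<cdot> s = x"
  proof (rule vec_eqI)
    fix i
    have "coord A l i = (coord A e i - coord A x i + coord A (l \<cdot> l) i) / 2"
      using x(1) by (subst Fl[symmetric]) (simp add: F_def z_def)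
    then show "coord A (s \<cdot> s) i = coord A x i"
      using x(1) by (simp add: s_def unital_simps field_simps)
  qed (use x in "auto simp: s_def")
  moreover have "cstar A s = s" by (simp add: s_def unital_simps ladj)
  moreover have "w \<cdot> s = s \<cdot> w" if "w \<in> car A" "w \<cdot> x = x \<cdot> w" for w
    using comm[OF that] that by (simp add: s_def unital_simps)
  ultimately show ?thesis by (intro bexI[of _ s]) (auto simp: s_def)
qed

lemma sqrt_unit_minus_square:
  assumes h: "h \<in> car A" "cstar A h = h" "cnorm A h < 1"
  shows "\<exists>s\<in>car A. cstar A s = s \<and> s \<cdot> s = cdiff A e (h \<cdot> h) \<and> h \<cdot> s = s \<cdot> h"
proof -
  let ?x = "cdiff A e (h \<cdot> h)"
  have "cdiff A e ?x = h \<cdot> h" by (rule vec_eqI) (use h in auto)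
  moreover have "(cnorm A h)\<^sup>2 < 1"
    using h norm_ge_zero[of h] by (simp add: abs_square_less_1)
  ultimately have "cnorm A (cdiff A e ?x) < 1" using h by (simp add: norm_square)
  from sqrt_near_unit[OF _ _ this] h show ?thesis by (auto simp: unital_simps)
qed

text \<open>Every self-adjoint \<open>h\<close> of norm less than one is the real part of the unitary
  \<open>h + \<i> (1 - h\<^sup>2)\<^sup>1\<^sup>/\<^sup>2\<close>.\<close>

lemma unitary_of_selfadjoint:
  assumes h: "h \<in> car A" "cstar A h = h" "cnorm A h < 1"
  obtains u s where "u \<in> car A" "cstar A u \<cdot> u = e" "u \<cdot> cstar A u = e"
    "h = (1/2) \<odot> (u \<oplus> cstar A u)" "s \<in> car A" "cstar A s = s"
    "s \<cdot> s = cdiff A e (h \<cdot> h)" "s = (- \<i>/2) \<odot> cdiff A u (cstar A u)"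
proof -
  obtain s where s: "s \<in> car A" "cstar A s = s" "s \<cdot> s = cdiff A e (h \<cdot> h)" "h \<cdot> s = s \<cdot> h"
    using sqrt_unit_minus_square[OF h] by blast
  let ?u = "h \<oplus> \<i> \<odot> s"
  have "cstar A ?u \<cdot> ?u = e" "?u \<cdot> cstar A ?u = e"
    by (rule vec_eqI; use h s in "auto simp: unital_simps algebra_simps")+
  moreover have "h = (1/2) \<odot> (?u \<oplus> cstar A ?u)" "s = (- \<i>/2) \<odot> cdiff A ?u (cstar A ?u)"
    by (rule vec_eqI; use h s in "auto simp: unital_simps algebra_simps")+
  ultimately show ?thesis using that[of ?u s] h s by auto
qed

lemma norm_unitary_le:
  assumes "u \<in> car A" "cstar A u \<cdot> u = e"
  shows "cnorm A u <= 1"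
proof -
  have "(cnorm A u)\<^sup>2 <= 1" using norm_adj_times[of u] norm_unit_le assms by simp
  then show ?thesis using norm_ge_zero[of u] assms by (simp add: abs_square_le_1)
qed

text \<open>\<open>e - h\<^sup>2\<close> is the square of the imaginary part of a unitary, and that
  part is a contraction. This bound makes squares positive in the norm sense below.\<close>

lemma norm_unit_minus_square_le:
  assumes h: "h \<in> car A" "cstar A h = h" "cnorm A h < 1"
  shows "cnorm A (cdiff A e (h \<cdot> h)) <= 1"
proof -
  obtain u s where u: "u \<in> car A" "cstar A u \<cdot> u = e" and s: "s \<in> car A" "cstar A s = s"
    "s \<cdot> s = cdiff A e (h \<cdot> h)" "s = (- \<i>/2) \<odot> cdiff A u (cstar A u)"
    using unitary_of_selfadjoint[OF h] by metis
  have "cnorm A s <= (cnorm A u + cnorm A u) / 2"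
    unfolding s(4) using u norm_diff_le[of u "cstar A u"] by (simp add: norm_scale norm_adj norm_divide)
  then have "cnorm A s <= 1" using norm_unitary_le[OF u] by simp
  then have "(cnorm A s)\<^sup>2 <= 1" using norm_ge_zero[OF s(1)] by (simp add: abs_square_le_1)
  then show ?thesis using norm_square[OF s(1,2)] s(3) by simp
qed

text \<open>For \<open>f a = p (a v)\<close> with a \<open>C\<^sup>*\<close>-seminorm \<open>p\<close>, this is automatic contractivity: unitaries
  preserve \<open>p\<close>, and they span the algebra.\<close>

lemma seminorm_le_norm:
  fixes f :: "'a => real"
  assumes nonneg: "!!a. a \<in> car A ==> 0 <= f a"
    and plus: "!!a b. a \<in> car A ==> b \<in> car A ==> f (a \<oplus> b) <= f a + f b"
    and scale: "!!c a. a \<in> car A ==> f (c \<odot> a) = cmod c * f a"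
    and isom: "!!a b. a \<in> car A ==> b \<in> car A ==> cstar A a \<cdot> a = cstar A b \<cdot> b ==> f a = f b"
    and cs: "!!a. a \<in> car A ==> (f a)\<^sup>2 <= f e * f (cstar A a \<cdot> a)"
    and a: "a \<in> car A"
  shows "f a <= cnorm A a * f e"
proof -
  have unit_ball: "f h <= f e" if h: "h \<in> car A" "cstar A h = h" "cnorm A h < 1" for h
  proof -
    obtain u where u: "u \<in> car A" "cstar A u \<cdot> u = e" "u \<cdot> cstar A u = e"
      "h = (1/2) \<odot> (u \<oplus> cstar A u)"
      using unitary_of_selfadjoint[OF h] by metis
    have "f u = f e" "f (cstar A u) = f e"
      using u isom[of u e] isom[of "cstar A u" e] by (auto simp: adj_unit adj_adj unit_times)
    then show ?thesis using u plus[of u "cstar A u"] by (simp add: scale)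
  qed
  have sa: "f h <= cnorm A h * f e" if h: "h \<in> car A" "cstar A h = h" for h
  proof (rule real_le_of_eps)
    fix d :: real assume d: "0 < d" "d < 1"
    let ?t = "cnorm A h + d"
    have t: "0 < ?t" using norm_ge_zero[OF h(1)] d by simp
    have "f (rc (1/?t) \<odot> h) <= f e"
      using t h d by (intro unit_ball) (auto simp: norm_scale adj_smult norm_divide field_simps simp flip: of_real_add)
    then have "f h / ?t <= f e" using t h by (simp add: scale norm_divide flip: of_real_add)
    then show "f h <= cnorm A h * f e + f e * d"
      using t by (simp add: field_simps)
  qed
  \<comment> \<open>By \<open>cs\<close> a general element is reduced to the self-adjoint
    \<open>a\<^sup>* a\<close>, whose norm is the square of that of \<open>a\<close>; the root is
    taken at the end.\<close>
  have "(f a)\<^sup>2 <= f e * (cnorm A (cstar A a \<cdot> a) * f e)"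
  proof -
    have "f (cstar A a \<cdot> a) <= cnorm A (cstar A a \<cdot> a) * f e"
      using a by (intro sa) (auto simp: adj_times adj_adj)
    then show ?thesis using cs[OF a] nonneg[OF unit_mem] by (meson mult_left_mono order_trans)
  qed
  also have "... = (cnorm A a * f e)\<^sup>2" using a by (simp add: norm_adj_times power2_eq_square)
  finally show ?thesis
    using nonneg[of e] norm_ge_zero[OF a] by (meson mult_nonneg_nonneg power2_le_imp_le unit_mem)
qed

section \<open>Positive elements\<close>

text \<open>Positivity is expressed through the norm, so that no spectral theory is needed.\<close>

definition pos :: "'a => bool" where
  "pos x \<longleftrightarrow> x \<in> car A \<and> cstar A x = x \<and>
     (\<exists>t::real. 0 <= t \<and> cnorm A (cdiff A (rc t \<odot> e) x) <= t)"

lemma pos_mem [simp]: "pos x ==> x \<in> car A" and pos_adj: "pos x ==> cstar A x = x"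
  by (auto simp: pos_def)

lemma pos_bound_mono:
  assumes "x \<in> car A" "cnorm A (cdiff A (rc t \<odot> e) x) <= t" "t <= t'"
  shows "cnorm A (cdiff A (rc t' \<odot> e) x) <= t'"
proof -
  have "cdiff A (rc t' \<odot> e) x = rc (t' - t) \<odot> e \<oplus> cdiff A (rc t \<odot> e) x"
    by (rule vec_eqI) (use assms in "auto simp: algebra_simps")
  then have "cnorm A (cdiff A (rc t' \<odot> e) x)
      <= cmod (rc (t' - t)) + cnorm A (cdiff A (rc t \<odot> e) x)"
    using norm_plus[of "rc (t' - t) \<odot> e" "cdiff A (rc t \<odot> e) x"]
      norm_smult_unit_le[of "rc (t' - t)"] assms(1) by simp
  then show ?thesis using assms by (simp del: of_real_diff)
qed

lemma pos_plus:
  assumes "pos x" "pos y" shows "pos (x \<oplus> y)"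
proof -
  obtain s t where st: "0 <= s" "0 <= t" "cnorm A (cdiff A (rc s \<odot> e) x) <= s"
    "cnorm A (cdiff A (rc t \<odot> e) y) <= t"
    using assms unfolding pos_def by blast
  have "cdiff A (rc (s + t) \<odot> e) (x \<oplus> y)
      = cdiff A (rc s \<odot> e) x \<oplus> cdiff A (rc t \<odot> e) y"
    by (rule vec_eqI) (use assms in "auto simp: algebra_simps")
  then have "cnorm A (cdiff A (rc (s + t) \<odot> e) (x \<oplus> y)) <= s + t"
    using st assms norm_plus[of "cdiff A (rc s \<odot> e) x" "cdiff A (rc t \<odot> e) y"] by simp
  then show ?thesis using assms st unfolding pos_def by (intro conjI exI[of _ "s + t"]) (auto simp: adj_plus)
qed

lemma pos_scale:
  assumes "pos x" "0 <= c" shows "pos (rc c \<odot> x)"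
proof -
  obtain t where t: "0 <= t" "cnorm A (cdiff A (rc t \<odot> e) x) <= t"
    using assms unfolding pos_def by blast
  have "cdiff A (rc (c * t) \<odot> e) (rc c \<odot> x)
      = rc c \<odot> cdiff A (rc t \<odot> e) x"
    by (rule vec_eqI) (use assms in "auto simp: algebra_simps")
  then have "cnorm A (cdiff A (rc (c * t) \<odot> e) (rc c \<odot> x)) <= c * t"
    using t assms by (simp add: norm_scale mult_left_mono)
  then show ?thesis using assms t unfolding pos_def
    by (intro conjI exI[of _ "c * t"]) (auto simp: adj_smult)
qed

lemma pos_square:
  assumes h: "h \<in> car A" "cstar A h = h" shows "pos (h \<cdot> h)"
proof -
  define c where "c = cnorm A h + 1"
  have c: "0 < c" "cnorm A h < c" using norm_ge_zero[OF h(1)] by (auto simp: c_def)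
  let ?h = "rc (1/c) \<odot> h"
  have "cnorm A (cdiff A e (?h \<cdot> ?h)) <= 1"
    using h c by (intro norm_unit_minus_square_le) (auto simp: adj_smult norm_scale norm_divide field_simps)
  moreover have "cdiff A (rc (c\<^sup>2) \<odot> e) (h \<cdot> h) = rc (c\<^sup>2) \<odot> cdiff A e (?h \<cdot> ?h)"
    by (rule vec_eqI) (use h c in "auto simp: unital_simps algebra_simps power2_eq_square")
  ultimately have "cnorm A (cdiff A (rc (c\<^sup>2) \<odot> e) (h \<cdot> h)) <= c\<^sup>2"
    using h c by (simp add: norm_scale norm_power mult_left_le)
  then show ?thesis using h unfolding pos_def by (intro conjI exI[of _ "c\<^sup>2"]) (auto simp: adj_times)
qed

lemma pos_zero: "pos \<zero>"
  using pos_square[of "\<zero>"] by (simp add: adj_zero times_zero)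

text \<open>The iteration for square roots requires distance less than 1 from the unit, so the root
  is taken of \<open>x + d\<close>: divided by \<open>t + d\<close>, this element is at distance at
  most \<open>t / (t + d) < 1\<close> from \<open>e\<close>. The commutation clause survives the
  rescaling.\<close>

lemma pos_sqrt:
  assumes x: "pos x" and d: "0 < d"
  shows "\<exists>h\<in>car A. cstar A h = h \<and> h \<cdot> h = x \<oplus> rc d \<odot> e \<and>
    (\<forall>y\<in>car A. y \<cdot> x = x \<cdot> y --> y \<cdot> h = h \<cdot> y)"
proof -
  obtain t where t: "0 <= t" "cnorm A (cdiff A (rc t \<odot> e) x) <= t"
    using x unfolding pos_def by blast
  define T where "T = t + d"
  have T: "0 < T" using t d by (simp add: T_def)
  have cT: "rc t + rc d ~= 0"
    using T by (metis T_def less_irrefl of_real_add of_real_eq_0_iff)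
  define y where "y = rc (1/T) \<odot> (x \<oplus> rc d \<odot> e)"
  have [simp]: "x \<in> car A" "y \<in> car A" using x by (auto simp: y_def)
  have "cdiff A e y = rc (1/T) \<odot> cdiff A (rc t \<odot> e) x"
    by (rule vec_eqI) (use cT in "auto simp: y_def T_def field_simps")
  then have "cnorm A (cdiff A e y) <= t / T"
    using t T by (simp add: norm_scale norm_divide divide_right_mono)
  also have "t / T < 1" using d T by (simp add: T_def)
  finally have lt: "cnorm A (cdiff A e y) < 1" .
  have "cstar A y = y" using pos_adj[OF x] by (simp add: y_def unital_simps)
  from sqrt_near_unit[OF \<open>y \<in> car A\<close> this lt] obtain s where s: "s \<in> car A" "cstar A s = s" "s \<cdot> s = y"
      "!!z. z \<in> car A ==> z \<cdot> y = y \<cdot> z ==> z \<cdot> s = s \<cdot> z"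
    by blast
  let ?h = "rc (sqrt T) \<odot> s"
  have r: "sqrt T * sqrt T = T" using T by simp
  have "?h \<cdot> ?h = (rc (sqrt T) * rc (sqrt T)) \<odot> y"
    using s(1,3) by (simp add: smult_times times_smult smult_assoc)
  also have "rc (sqrt T) * rc (sqrt T) = rc T"
    unfolding of_real_mult[symmetric] r ..
  also have "rc T \<odot> y = x \<oplus> rc d \<odot> e"
    using T by (simp add: y_def smult_assoc one_smult)
  finally have "?h \<cdot> ?h = x \<oplus> rc d \<odot> e" .
  moreover have "z \<cdot> ?h = ?h \<cdot> z" if "z \<in> car A" "z \<cdot> x = x \<cdot> z" for z
  proof -
    have "z \<cdot> y = y \<cdot> z" using that by (simp add: y_def unital_simps)
    then show ?thesis using s(1) s(4)[OF that(1)] that by (simp add: times_smult smult_times)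
  qed
  moreover have "cstar A ?h = ?h" "?h \<in> car A" using s(1,2) by (auto simp: adj_smult)
  ultimately show ?thesis by blast
qed

text \<open>The witness in \<open>pos\<close> may be any bound of the norm: \<open>x + d\<close> is
  a square \<open>h\<^sup>2\<close> with \<open>cnorm A h < sqrt T\<close>, and
  \<open>norm_unit_minus_square_le\<close> applies to \<open>h / sqrt T\<close>. A witness depending
  only on the norm is what allows passing to limits.\<close>

lemma pos_norm_bound:
  assumes x: "pos x" and t: "cnorm A x <= t"
  shows "cnorm A (cdiff A (rc t \<odot> e) x) <= t"
proof (rule real_le_of_eps)
  fix d :: real assume d: "0 < d" "d < 1"
  have [simp]: "x \<in> car A" using x by simp
  have t0: "0 <= t" using t norm_ge_zero[of x] by simp
  obtain h where h: "h \<in> car A" "cstar A h = h" "h \<cdot> h = x \<oplus> rc d \<odot> e"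
    using pos_sqrt[OF x d(1)] by blast
  \<comment> \<open>The second \<open>d\<close> makes the bound on \<open>h\<close> strict, as
    \<open>norm_unit_minus_square_le\<close> demands.\<close>
  define T where "T = t + 2 * d"
  have T: "0 < T" using t0 d by (simp add: T_def)
  have "(cnorm A h)\<^sup>2 <= t + d"
    using norm_square[OF h(1,2)] h(3) norm_plus[of x "rc d \<odot> e"] norm_smult_unit_le[of "rc d"] t d
    by simp
  also have "... < (sqrt T)\<^sup>2" using T d by (simp add: T_def)
  finally have hT: "cnorm A h < sqrt T" by (rule power2_less_imp_less) (use T in auto)
  let ?h = "rc (1 / sqrt T) \<odot> h"
  have cT: "rc t + rc d * 2 ~= 0"
    using T by (metis T_def less_irrefl mult.commute of_real_add of_real_eq_0_iff of_real_mult of_real_numeral)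
  have r: "1 / sqrt T * (1 / sqrt T) = 1 / T" using T by simp
  have "?h \<cdot> ?h = (rc (1 / sqrt T) * rc (1 / sqrt T)) \<odot> (h \<cdot> h)"
    using h(1) by (simp add: smult_times times_smult smult_assoc)
  also have "rc (1 / sqrt T) * rc (1 / sqrt T) = rc (1 / T)"
    unfolding of_real_mult[symmetric] r ..
  finally have hh: "?h \<cdot> ?h = rc (1 / T) \<odot> (x \<oplus> rc d \<odot> e)"
    using h(3) by simp
  have "cnorm A (cdiff A e (?h \<cdot> ?h)) <= 1"
    using h hT T by (intro norm_unit_minus_square_le) (auto simp: adj_smult norm_scale norm_divide)
  moreover have "cdiff A (rc (t + d) \<odot> e) x = rc T \<odot> cdiff A e (?h \<cdot> ?h)"
    unfolding hh by (rule vec_eqI) (use cT in "auto simp: T_def field_simps")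
  ultimately have 1: "cnorm A (cdiff A (rc (t + d) \<odot> e) x) <= T"
    using h T by (simp add: norm_scale mult_left_le)
  have "cdiff A (rc t \<odot> e) x
      = cdiff A (cdiff A (rc (t + d) \<odot> e) x) (rc d \<odot> e)"
    by (rule vec_eqI) (auto simp: algebra_simps)
  then have "cnorm A (cdiff A (rc t \<odot> e) x) <= T + d"
    using 1 norm_diff_le[of "cdiff A (rc (t + d) \<odot> e) x" "rc d \<odot> e"]
      norm_smult_unit_le[of "rc d"] d by simp
  then show "cnorm A (cdiff A (rc t \<odot> e) x) <= t + 3 * d" by (simp add: T_def)
qed

text \<open>A convergent sequence is bounded in norm, and by \<open>pos_norm_bound\<close> one bound
  \<open>K\<close> witnesses the positivity of all its terms.\<close>

lemma pos_limit:
  assumes s: "!!n. pos (s n)" and l: "ctends A s l"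
  shows "pos l"
proof -
  note [simp] = ctends_mem(2)[OF l]
  have adj: "cstar A l = l"
    using ctends_unique[OF ctends_adj[OF l]] l pos_adj[OF s] by simp
  have "Bseq (%n. cnorm A (s n))" using ctends_norm[OF l] by (auto intro: convergent_imp_Bseq convergentI)
  then obtain K where K: "0 < K" "!!n. cnorm A (s n) <= K"
    unfolding Bseq_def by (auto simp: abs_le_iff)
  have "cnorm A (cdiff A (rc K \<odot> e) (s n)) <= K" for n
    by (rule pos_norm_bound[OF s K(2)])
  moreover have "(%n. cnorm A (cdiff A (rc K \<odot> e) (s n))) ----> cnorm A (cdiff A (rc K \<odot> e) l)"
    using l by (intro ctends_norm ctends_diff ctends_const) auto
  ultimately have "cnorm A (cdiff A (rc K \<odot> e) l) <= K" by (intro LIMSEQ_le_const2) auto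
  then show ?thesis using adj K(1) unfolding pos_def by (intro conjI exI[of _ K]) auto
qed

text \<open>Up to a small \<open>d\<close>, \<open>x\<close> and \<open>t - x\<close> have commuting
  square roots \<open>h\<close> and \<open>k\<close>. For \<open>w = h + \<i> k\<close> the cross
  terms cancel, so \<open>w\<^sup>* w = t + 2 d\<close>, and \<open>h\<close> is the real part of
  \<open>w\<close>, hence no larger in norm.\<close>

lemma pos_norm_le:
  assumes x: "pos x" and tx: "pos (cdiff A (rc t \<odot> e) x)" and t: "0 <= t"
  shows "cnorm A x <= t"
proof (rule real_le_of_eps)
  fix d :: real assume d: "0 < d" "d < 1"
  let ?y = "cdiff A (rc t \<odot> e) x"
  have [simp]: "x \<in> car A" using x by simp
  obtain h where h: "h \<in> car A" "cstar A h = h" "h \<cdot> h = x \<oplus> rc d \<odot> e"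
      "!!y. y \<in> car A ==> y \<cdot> x = x \<cdot> y ==> y \<cdot> h = h \<cdot> y"
    using pos_sqrt[OF x d(1)] by blast
  obtain k where k: "k \<in> car A" "cstar A k = k" "k \<cdot> k = ?y \<oplus> rc d \<odot> e"
      "!!z. z \<in> car A ==> z \<cdot> ?y = ?y \<cdot> z ==> z \<cdot> k = k \<cdot> z"
    using pos_sqrt[OF tx d(1)] by blast
  have "x \<cdot> h = h \<cdot> x" using h(4)[of x] by simp
  then have hk: "h \<cdot> k = k \<cdot> h"
    using h(1) by (intro k(4)) (auto simp: unital_simps)
  let ?w = "h \<oplus> \<i> \<odot> k"
  have "cstar A ?w \<cdot> ?w = rc (t + 2 * d) \<odot> e"
    by (rule vec_eqI) (use h(1-3) k(1-3) hk in "auto simp: unital_simps algebra_simps")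
  then have w: "(cnorm A ?w)\<^sup>2 <= t + 2 * d"
    using norm_adj_times[of ?w] norm_smult_unit_le[of "rc (t + 2 * d)"] h(1) k(1) t d
    by (simp del: of_real_add)
  have "h = (1/2) \<odot> (?w \<oplus> cstar A ?w)"
    by (rule vec_eqI) (use h(1-3) k(1-3) in "auto simp: unital_simps algebra_simps")
  then have "cnorm A h = cnorm A (?w \<oplus> cstar A ?w) / 2"
    using h(1) k(1) norm_scale[of "?w \<oplus> cstar A ?w" "1/2"] by simp
  also have "... <= cnorm A ?w" using norm_plus[of ?w "cstar A ?w"] h(1) k(1) by (simp add: norm_adj)
  finally have "(cnorm A h)\<^sup>2 <= (cnorm A ?w)\<^sup>2" using norm_ge_zero[OF h(1)] by (intro power_mono)
  then have 1: "cnorm A (x \<oplus> rc d \<odot> e) <= t + 2 * d" using w norm_square[OF h(1,2)] h(3) by simp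
  have "x = cdiff A (x \<oplus> rc d \<odot> e) (rc d \<odot> e)" by (rule vec_eqI) auto
  then have "cnorm A x <= cnorm A (x \<oplus> rc d \<odot> e) + cnorm A (rc d \<odot> e)"
    using norm_diff_le[of "x \<oplus> rc d \<odot> e" "rc d \<odot> e"] by simp
  then show "cnorm A x <= t + 3 * d" using 1 norm_smult_unit_le[of "rc d"] d by simp
qed

lemma pos_norm_minus:
  assumes "y \<in> car A" "cstar A y = y"
  shows "pos (cdiff A (rc (cnorm A y) \<odot> e) y)"
proof -
  have "cdiff A (rc (cnorm A y) \<odot> e) (cdiff A (rc (cnorm A y) \<odot> e) y) = y"
    by (rule vec_eqI) (use assms in auto)
  then show ?thesis using assms norm_ge_zero[of y] unfolding pos_def
    by (intro conjI exI[of _ "cnorm A y"]) (auto simp: unital_simps)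
qed

text \<open>For \<open>t = cnorm A y\<close>, the element \<open>t - x\<close> is the sum of the
  positive elements \<open>t - y\<close> and \<open>y - x\<close>, so \<open>pos_norm_le\<close>
  applies.\<close>

lemma norm_mono:
  assumes "pos x" "pos (cdiff A y x)" "y \<in> car A"
  shows "cnorm A x <= cnorm A y"
proof -
  have "y = cdiff A y x \<oplus> x" by (rule vec_eqI) (use assms in auto)
  then have "cstar A y = y" using assms pos_adj adj_plus by (metis diff_mem pos_mem)
  then have "pos (cdiff A (rc (cnorm A y) \<odot> e) y \<oplus> cdiff A y x)"
    using assms by (intro pos_plus pos_norm_minus) auto
  moreover have "cdiff A (rc (cnorm A y) \<odot> e) y \<oplus> cdiff A y x
      = cdiff A (rc (cnorm A y) \<odot> e) x"
    by (rule vec_eqI) (use assms in auto)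
  ultimately show ?thesis using assms norm_ge_zero by (intro pos_norm_le) auto
qed

end

section \<open>Powers of a square root and the positivity of \<open>a\<^sup>* a\<close>\<close>

fun cpow :: "'a cstar_alg => 'a => 'a => nat => 'a" where
  "cpow A e x 0 = e"
| "cpow A e x (Suc n) = cmult A (cpow A e x n) x"

context unital_cstar_algebra
begin

lemma cpow_mem [simp, intro]: "x \<in> car A ==> cpow A e x n \<in> car A"
  by (induction n) auto

lemma cpow_add: "x \<in> car A ==> cpow A e x (m + n) = cpow A e x m \<cdot> cpow A e x n"
  by (induction n) (auto simp: times_unit times_assoc)

lemma cpow_commute:
  assumes "x \<in> car A" "y \<in> car A" "y \<cdot> x = x \<cdot> y"
  shows "y \<cdot> cpow A e x n = cpow A e x n \<cdot> y"
proof (induction n)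
  case (Suc n)
  have "y \<cdot> (cpow A e x n \<cdot> x) = cpow A e x n \<cdot> (y \<cdot> x)"
    using Suc assms times_assoc[of y "cpow A e x n" x] times_assoc[of "cpow A e x n" y x] by simp
  then show ?case using assms by (simp add: times_assoc)
qed (use assms in "simp add: unital_simps")

lemma cpow_adj:
  assumes "x \<in> car A" "cstar A x = x" shows "cstar A (cpow A e x n) = cpow A e x n"
proof (induction n)
  case (Suc n)
  then show ?case using assms cpow_commute[of x x n] by (simp add: adj_times)
qed (simp add: adj_unit)

lemma norm_cpow_two_pow:
  assumes "x \<in> car A" "cstar A x = x"
  shows "cnorm A (cpow A e x (2 ^ k)) = cnorm A x ^ (2 ^ k)"
proof (induction k)
  case (Suc k)
  have "cnorm A (cpow A e x (2 ^ Suc k)) = (cnorm A (cpow A e x (2 ^ k)))\<^sup>2"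
    using norm_square[of "cpow A e x (2 ^ k)"] cpow_adj[OF assms] assms cpow_add[of x "2 ^ k" "2 ^ k"]
    by (simp add: mult_2)
  then show ?case using Suc by (simp add: power_mult[symmetric] mult.commute)
qed (use assms in "simp add: unit_times")

text \<open>The powers of \<open>t + c c\<^sup>*\<close> are \<open>t\<^sup>n + c S\<^sub>n c\<^sup>*\<close> with \<open>S\<^sub>n\<close> a polynomial in
  \<open>t + c\<^sup>* c\<close>; this replaces the usual comparison of the spectra of \<open>c\<^sup>* c\<close> and \<open>c c\<^sup>*\<close>.\<close>

lemma pos_swap:
  assumes c [simp]: "c \<in> car A" and p: "pos (cdiff A (rc d \<odot> e) (cstar A c \<cdot> c))" and d: "0 <= d"
  shows "pos (cdiff A (rc d \<odot> e) (c \<cdot> cstar A c))"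
proof -
  let ?x = "cdiff A (rc d \<odot> e) (cstar A c \<cdot> c)"
  let ?x' = "cdiff A (rc d \<odot> e) (c \<cdot> cstar A c)"
  obtain s0 where s0: "0 <= s0" "cnorm A (cdiff A (rc s0 \<odot> e) ?x) <= s0"
    using p unfolding pos_def by blast
  \<comment> \<open>The constants are tied by \<open>L = t + d\<close>: then \<open>L\<close> minus
    \<open>d - c\<^sup>* c\<close> is \<open>y\<close>, and \<open>L\<close> minus
    \<open>d - c c\<^sup>*\<close> is \<open>z\<close>, so hypothesis and conclusion become the norm
    bound \<open>L\<close> for \<open>y\<close> and for \<open>z\<close>. Adding 1 ensures
    \<open>1 \<le> t\<close>, so that the powers of \<open>L\<close> increase.\<close>
  define L t where "L = s0 + d + 1" and "t = s0 + 1"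
  have t: "1 <= t" "t <= L" "1 <= L" "L = t + d" using s0 d by (auto simp: L_def t_def)
  define y z where "y = rc t \<odot> e \<oplus> cstar A c \<cdot> c" and "z = rc t \<odot> e \<oplus> c \<cdot> cstar A c"
  have [simp]: "y \<in> car A" "z \<in> car A" by (auto simp: y_def z_def)
  have "cnorm A (cdiff A (rc L \<odot> e) ?x) <= L"
    by (rule pos_bound_mono[of _ s0]) (use s0 d in "auto simp: L_def")
  moreover have "cdiff A (rc L \<odot> e) ?x = y"
    by (rule vec_eqI) (auto simp: y_def L_def t_def algebra_simps)
  ultimately have y: "cnorm A y <= L" by simp
  \<comment> \<open>The recursion encodes \<open>S n = (\<Sum>i<n. t ^ (n - 1 - i) y ^ i)\<close>,
    so the norm grows at most like \<open>n L ^ n\<close>.\<close>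
  define S where "S = rec_nat \<zero> (%n r. rc (t ^ n) \<odot> e \<oplus> r \<cdot> y)"
  have S0: "S 0 = \<zero>" and SSuc: "S (Suc n) = rc (t ^ n) \<odot> e \<oplus> S n \<cdot> y" for n
    by (auto simp: S_def)
  have Smem [simp]: "S n \<in> car A" for n by (induction n) (auto simp: S0 SSuc)
  have Snorm: "cnorm A (S n) <= n * L ^ n" for n
  proof (induction n)
    case (Suc n)
    have "cnorm A (S (Suc n)) <= t ^ n + cnorm A (S n) * cnorm A y"
      using norm_plus[of "rc (t ^ n) \<odot> e" "S n \<cdot> y"] norm_times[of "S n" y]
        norm_smult_unit_le[of "rc (t ^ n)"] t by (simp add: SSuc norm_power)
    also have "... <= L ^ Suc n + (n * L ^ n) * L"
      using Suc y t power_mono[of t L n] power_increasing[of n "Suc n" L]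
      by (intro add_mono mult_mono) (auto simp: norm_ge_zero simp del: power_Suc)
    finally show ?case by (simp add: algebra_simps)
  qed (simp add: S0 norm_zero)
  have zpow: "cpow A e z n = rc (t ^ n) \<odot> e \<oplus> c \<cdot> (S n \<cdot> cstar A c)" for n
  proof (induction n)
    case (Suc n)
    have "cpow A e z (Suc n) = (rc (t ^ n) \<odot> e \<oplus> c \<cdot> (S n \<cdot> cstar A c)) \<cdot> z"
      by (simp add: Suc)
    also have "... = rc (t ^ Suc n) \<odot> e \<oplus> c \<cdot> (S (Suc n) \<cdot> cstar A c)"
      by (rule vec_eqI) (auto simp: SSuc z_def y_def unital_simps algebra_simps)
    finally show ?case .
  qed (rule vec_eqI; auto simp: S0 unital_simps)
  have zadj: "cstar A z = z" by (simp add: z_def unital_simps)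
  have "cnorm A z <= L"
  proof (rule le_of_pow_two_pow_le)
    fix k
    let ?n = "2 ^ k :: nat"
    have "cnorm A z ^ ?n = cnorm A (cpow A e z ?n)" using norm_cpow_two_pow[OF _ zadj] by simp
    also have "... <= t ^ ?n + cnorm A c * (cnorm A (S ?n) * cnorm A c)"
    proof -
      have "cnorm A (c \<cdot> (S ?n \<cdot> cstar A c)) <= cnorm A c * cnorm A (S ?n \<cdot> cstar A c)"
        by (intro norm_times) auto
      also have "... <= cnorm A c * (cnorm A (S ?n) * cnorm A c)"
        using norm_times[of "S ?n" "cstar A c"] norm_adj[of c] by (intro mult_left_mono) (auto simp: norm_ge_zero)
      finally show ?thesis
        using norm_plus[of "rc (t ^ ?n) \<odot> e" "c \<cdot> (S ?n \<cdot> cstar A c)"]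
          norm_smult_unit_le[of "rc (t ^ ?n)"] t by (simp add: zpow norm_power)
    qed
    also have "... <= L ^ ?n + cnorm A c * ((?n * L ^ ?n) * cnorm A c)"
      using t Snorm[of ?n] by (intro add_mono power_mono mult_left_mono mult_right_mono) (auto simp: norm_ge_zero)
    finally show "cnorm A z ^ ?n <= L ^ ?n * (1 + 2 ^ k * (cnorm A c)\<^sup>2)"
      by (simp add: algebra_simps power2_eq_square)
  qed (use t in "auto simp: norm_ge_zero")
  moreover have "cdiff A (rc L \<odot> e) ?x' = z"
    by (rule vec_eqI) (auto simp: z_def L_def t_def algebra_simps)
  ultimately show ?thesis
    using t unfolding pos_def by (intro conjI exI[of _ L]) (auto simp: unital_simps)
qed

text \<open>Half the sum of the squares of \<open>p\<close> and \<open>q\<close>, which are twice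
  the real part and, up to sign, twice the imaginary part of \<open>c\<close>. Unlike the positivity
  of \<open>c\<^sup>* c\<close> alone, this is elementary.\<close>

lemma pos_adj_times_plus_times_adj:
  assumes [simp]: "c \<in> car A" shows "pos (cstar A c \<cdot> c \<oplus> c \<cdot> cstar A c)"
proof -
  let ?p = "c \<oplus> cstar A c" and ?q = "\<i> \<odot> cdiff A c (cstar A c)"
  have "pos (rc (1/2) \<odot> (?p \<cdot> ?p \<oplus> ?q \<cdot> ?q))"
  proof (intro pos_scale pos_plus pos_square)
    show "cstar A ?q = ?q" by (rule vec_eqI) (auto simp: unital_simps algebra_simps)
    show "cstar A ?p = ?p" by (rule vec_eqI) (auto simp: unital_simps algebra_simps)
  qed auto
  moreover have "rc (1/2) \<odot> (?p \<cdot> ?p \<oplus> ?q \<cdot> ?q) = cstar A c \<cdot> c \<oplus> c \<cdot> cstar A c"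
    by (rule vec_eqI) (auto simp: unital_simps algebra_simps)
  ultimately show ?thesis by simp
qed

lemma small_sqrt:
  assumes a [simp]: "a \<in> car A" and small: "(cnorm A a)\<^sup>2 <= 1/2"
  obtains k where "k \<in> car A" "cstar A k = k" "k \<cdot> k = cdiff A e (cstar A a \<cdot> a)"
    "(cstar A a \<cdot> a) \<cdot> k = k \<cdot> (cstar A a \<cdot> a)"
proof -
  let ?w = "cdiff A e (cstar A a \<cdot> a)"
  have "cdiff A e ?w = cstar A a \<cdot> a" by (rule vec_eqI) auto
  then have lt: "cnorm A (cdiff A e ?w) < 1" using small by (simp add: norm_adj_times)
  have w: "?w \<in> car A" "cstar A ?w = ?w" by (auto simp: unital_simps)
  from sqrt_near_unit[OF w lt] obtain k where k: "k \<in> car A" "cstar A k = k" "k \<cdot> k = ?w"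
    "\<forall>y\<in>car A. y \<cdot> ?w = ?w \<cdot> y --> y \<cdot> k = k \<cdot> y"
    by blast
  have "(cstar A a \<cdot> a) \<cdot> ?w = ?w \<cdot> (cstar A a \<cdot> a)"
    by (simp add: times_diff diff_times times_unit unit_times)
  with k(4) have "(cstar A a \<cdot> a) \<cdot> k = k \<cdot> (cstar A a \<cdot> a)" by simp
  then show ?thesis using that k(1-3) by blast
qed

context
  fixes a k
  assumes a [simp]: "a \<in> car A" and k [simp]: "k \<in> car A" and k_adj: "cstar A k = k"
    and kk: "k \<cdot> k = cdiff A e (cstar A a \<cdot> a)"
    and ka: "(cstar A a \<cdot> a) \<cdot> k = k \<cdot> (cstar A a \<cdot> a)"
begin

private abbreviation "K n \<equiv> cpow A e k n"

text \<open>Since \<open>k\<close> commutes with \<open>a\<^sup>* a = e - k\<^sup>2\<close>, the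
  element \<open>c = a k ^ m\<close> has for \<open>c\<^sup>* c\<close> a difference of consecutive
  even powers of \<open>k\<close>. These differences telescope, and they connect the powers of
  \<open>k\<close> with \<open>pos_swap\<close>.\<close>

lemma adj_times_cpow:
  "cstar A (a \<cdot> K m) \<cdot> (a \<cdot> K m) = cdiff A (K (2 * m)) (K (2 * Suc m))"
proof -
  have b: "cstar A a \<cdot> a = cdiff A e (k \<cdot> k)" unfolding kk by (rule vec_eqI) auto
  have "cstar A (a \<cdot> K m) \<cdot> (a \<cdot> K m) = K m \<cdot> ((cstar A a \<cdot> a) \<cdot> K m)"
    by (simp add: adj_times cpow_adj k_adj times_assoc)
  also have "... = K m \<cdot> (K m \<cdot> (cstar A a \<cdot> a))"
    using cpow_commute[of k "cstar A a \<cdot> a" m] ka by simp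
  also have "... = K (m + m) \<cdot> (cstar A a \<cdot> a)" by (simp add: cpow_add times_assoc)
  also have "... = cdiff A (K (m + m)) (K (m + m) \<cdot> (k \<cdot> k))"
    unfolding b by (simp add: times_diff times_unit)
  finally show ?thesis by (simp add: mult_2 times_assoc)
qed

text \<open>For \<open>m = 2 j\<close> it is the square of the self-adjoint
  \<open>K j - K (j + 2)\<close>: the even powers of \<open>k\<close> form a convex
  sequence.\<close>

lemma pos_second_difference:
  "pos (K m \<oplus> cdiff A (K (m + 4)) (rc 2 \<odot> K (m + 2)))" if "even m" for m
proof -
  from that obtain j where "m = 2 * j" by (rule evenE)
  then have j: "m = j + j" by simp
  let ?d = "cdiff A (K j) (K (j + 2))"
  have gen: "cdiff A x y \<cdot> cdiff A x y = x \<cdot> x \<oplus> cdiff A (y \<cdot> y) (rc 2 \<odot> (x \<cdot> y))"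
    if "x \<in> car A" "y \<in> car A" "y \<cdot> x = x \<cdot> y" for x y
    by (rule vec_eqI) (use that in "auto simp: times_diff diff_times")
  have e: "j + j = m" "(j + 2) + (j + 2) = m + 4" "j + (j + 2) = m + 2" "(j + 2) + j = m + 2"
    using j by linarith+
  have "K j \<cdot> K j = K m" "K (j + 2) \<cdot> K (j + 2) = K (m + 4)" "K j \<cdot> K (j + 2) = K (m + 2)"
    "K (j + 2) \<cdot> K j = K (m + 2)"
    unfolding cpow_add[OF k, symmetric] e by (rule refl)+
  then have "?d \<cdot> ?d = K m \<oplus> cdiff A (K (m + 4)) (rc 2 \<odot> K (m + 2))"
    using gen[of "K j" "K (j + 2)"] k by (simp only: cpow_mem)
  moreover have "pos (?d \<cdot> ?d)"
    by (intro pos_square) (auto simp: adj_diff cpow_adj k_adj simp del: cpow.simps)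
  ultimately show ?thesis by simp
qed

lemma pos_cpow_even: "pos (K (2 * m))"
  using pos_square[of "K m"] cpow_add[of k m m] by (simp only: mult_2 cpow_adj k k_adj cpow_mem)

text \<open>By convexity the first differences of the even powers decrease, so the case
  \<open>m = 0\<close> is decisive; there the element is \<open>k\<^sup>2\<close>.\<close>

lemma pos_unit_minus_difference:
  "pos (cdiff A e (cdiff A (K (2 * m)) (K (2 * Suc m))))"
proof (induction m)
  case 0
  have "cdiff A e (cdiff A (K (2 * 0)) (K (2 * Suc 0))) = k \<cdot> k"
    by (rule vec_eqI) (auto simp: numeral_2_eq_2 unit_times)
  then show ?case using pos_square[of k] k_adj by simp
next
  case (Suc m)
  have i: "2 * Suc m = 2 * m + 2" "2 * Suc (Suc m) = 2 * m + 4" by auto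
  have "pos (cdiff A e (cdiff A (K (2 * m)) (K (2 * Suc m))) \<oplus>
     (K (2 * m) \<oplus> cdiff A (K (2 * m + 4)) (rc 2 \<odot> K (2 * m + 2))))"
    by (intro pos_plus Suc pos_second_difference) auto
  moreover have "cdiff A e (cdiff A (K (2 * m)) (K (2 * Suc m))) \<oplus>
     (K (2 * m) \<oplus> cdiff A (K (2 * m + 4)) (rc 2 \<odot> K (2 * m + 2)))
      = cdiff A e (cdiff A (K (2 * Suc m)) (K (2 * Suc (Suc m))))"
    unfolding i by (rule vec_eqI) (auto simp del: cpow.simps)
  ultimately show ?case by simp
qed

text \<open>By convexity, \<open>m\<close> times the \<open>m\<close>-th difference is at most the
  sum of the differences before it, which is \<open>e - K (2 * m)\<close>. The induction carries the
  term \<open>K (2 * m)\<close> along, each step adding \<open>m + 1\<close> times a second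
  difference. The resulting decay like \<open>1 / m\<close> later yields approximate right
  factors.\<close>

lemma pos_unit_minus_scaled_difference:
  "pos (cdiff A e (rc (real m) \<odot> cdiff A (K (2 * m)) (K (2 * Suc m))))"
proof -
  have "pos (cdiff A e (K (2 * m) \<oplus> rc (real m) \<odot> cdiff A (K (2 * m)) (K (2 * Suc m))))"
  proof (induction m)
    case 0
    have "cdiff A e (K (2 * 0) \<oplus> rc (real 0) \<odot> cdiff A (K (2 * 0)) (K (2 * Suc 0))) = \<zero>"
      by (rule vec_eqI) (auto simp: numeral_2_eq_2)
    then show ?case using pos_zero by simp
  next
    case (Suc m)
    have i: "2 * Suc m = 2 * m + 2" "2 * Suc (Suc m) = 2 * m + 4" by auto
    have "pos (cdiff A e (K (2 * m) \<oplus> rc (real m) \<odot> cdiff A (K (2 * m)) (K (2 * Suc m))) \<oplus>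
        rc (real (Suc m)) \<odot> (K (2 * m) \<oplus> cdiff A (K (2 * m + 4)) (rc 2 \<odot> K (2 * m + 2))))"
      by (intro pos_plus Suc pos_scale pos_second_difference) auto
    moreover have "cdiff A e (K (2 * m) \<oplus> rc (real m) \<odot> cdiff A (K (2 * m)) (K (2 * Suc m))) \<oplus>
        rc (real (Suc m)) \<odot> (K (2 * m) \<oplus> cdiff A (K (2 * m + 4)) (rc 2 \<odot> K (2 * m + 2)))
       = cdiff A e (K (2 * Suc m) \<oplus> rc (real (Suc m)) \<odot> cdiff A (K (2 * Suc m)) (K (2 * Suc (Suc m))))"
      unfolding i by (rule vec_eqI) (auto simp: algebra_simps simp del: cpow.simps)
    ultimately show ?case by simp
  qed
  then have "pos (cdiff A e (K (2 * m) \<oplus> rc (real m) \<odot> cdiff A (K (2 * m)) (K (2 * Suc m))) \<oplus> K (2 * m))"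
    by (intro pos_plus pos_cpow_even)
  moreover have "cdiff A e (K (2 * m) \<oplus> rc (real m) \<odot> cdiff A (K (2 * m)) (K (2 * Suc m))) \<oplus> K (2 * m)
    = cdiff A e (rc (real m) \<odot> cdiff A (K (2 * m)) (K (2 * Suc m)))"
    by (rule vec_eqI) (auto simp del: cpow.simps)
  ultimately show ?thesis by simp
qed

text \<open>The crucial step, which must not presuppose that \<open>c\<^sup>* c\<close> is positive
  for \<open>c = a k ^ m\<close>: from \<open>e - c\<^sup>* c \<ge> 0\<close> the swap gives
  \<open>e - c c\<^sup>* \<ge> 0\<close>, and adding the elementary positive element
  \<open>c\<^sup>* c + c c\<^sup>*\<close> leaves \<open>e + c\<^sup>* c\<close>.\<close>

lemma pos_unit_plus_difference:
  "pos (e \<oplus> cdiff A (K (2 * m)) (K (2 * Suc m)))"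
proof -
  let ?c = "a \<cdot> K m"
  have 1: "rc 1 \<odot> e = e" by (simp add: one_smult)
  have "pos (cdiff A (rc 1 \<odot> e) (cstar A ?c \<cdot> ?c))"
    using pos_unit_minus_difference[of m] unfolding adj_times_cpow 1 .
  then have "pos (cdiff A e (?c \<cdot> cstar A ?c))"
    using pos_swap[of ?c 1] unfolding 1 by simp
  then have "pos (cdiff A e (?c \<cdot> cstar A ?c) \<oplus> (cstar A ?c \<cdot> ?c \<oplus> ?c \<cdot> cstar A ?c))"
    by (intro pos_plus pos_adj_times_plus_times_adj) auto
  moreover have "cdiff A e (?c \<cdot> cstar A ?c) \<oplus> (cstar A ?c \<cdot> ?c \<oplus> ?c \<cdot> cstar A ?c) = e \<oplus> cstar A ?c \<cdot> ?c"
    by (rule vec_eqI) auto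
  ultimately show ?thesis by (simp add: adj_times_cpow del: cpow.simps)
qed

text \<open>The positive elements of \<open>pos_unit_plus_difference\<close> telescope to
  \<open>m + 1 - K (2 * m)\<close>, so the norms of the even powers grow at most linearly, and
  \<open>le_of_pow_two_pow_le\<close> forces the norm below 1.\<close>

lemma norm_sqrt_le_one: "cnorm A k <= 1"
proof (rule le_of_pow_two_pow_le)
  have pos: "pos (cdiff A (rc (real m + 1) \<odot> e) (K (2 * m)))" for m
  proof (induction m)
    case 0
    have "cdiff A (rc (real 0 + 1) \<odot> e) (K (2 * 0)) = \<zero>" by (rule vec_eqI) auto
    then show ?case using pos_zero by simp
  next
    case (Suc m)
    have "pos (cdiff A (rc (real m + 1) \<odot> e) (K (2 * m)) \<oplus> (e \<oplus> cdiff A (K (2 * m)) (K (2 * Suc m))))"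
      by (intro pos_plus Suc pos_unit_plus_difference)
    moreover have "cdiff A (rc (real m + 1) \<odot> e) (K (2 * m)) \<oplus> (e \<oplus> cdiff A (K (2 * m)) (K (2 * Suc m)))
       = cdiff A (rc (real (Suc m) + 1) \<odot> e) (K (2 * Suc m))"
      by (rule vec_eqI) (auto simp: algebra_simps simp del: cpow.simps)
    ultimately show ?case by simp
  qed
  have bound: "cnorm A (K (2 * m)) <= real m + 1" for m
    by (rule pos_norm_le[OF pos_cpow_even pos]) simp
  fix j
  show "cnorm A k ^ (2 ^ j) <= 1 ^ (2 ^ j) * (1 + 2 ^ j * 1)"
  \<comment> \<open>The exponent \<open>2 ^ 0 = 1\<close> is odd and is treated through the
    square.\<close>
  proof (cases j)
    case 0
    have "(cnorm A k)\<^sup>2 <= 2\<^sup>2" using bound[of 1] norm_square[OF k k_adj]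
      by (simp add: numeral_2_eq_2 unit_times)
    then have "cnorm A k <= 2" by (rule power2_le_imp_le) simp
    then show ?thesis using 0 by simp
  next
    case (Suc i)
    have "cnorm A k ^ (2 ^ j) = cnorm A (K (2 * 2 ^ i))"
      using norm_cpow_two_pow[OF k k_adj, of j] Suc by simp
    also have "... <= 2 ^ i + 1" using bound[of "2 ^ i"] by simp
    also have "... <= 1 + 2 * (2::real) ^ i" by simp
    finally show ?thesis using Suc by simp
  qed
qed (auto simp: norm_ge_zero)

end

text \<open>The theorem of Kelley and Vaught.\<close>

lemma pos_adj_times:
  assumes a: "a \<in> car A" shows "pos (cstar A a \<cdot> a)"
proof -
  have small: "pos (cstar A a \<cdot> a)" if a: "a \<in> car A" and small: "(cnorm A a)\<^sup>2 <= 1/2" for a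
  proof -
    obtain k where k: "k \<in> car A" "cstar A k = k" "k \<cdot> k = cdiff A e (cstar A a \<cdot> a)"
      "(cstar A a \<cdot> a) \<cdot> k = k \<cdot> (cstar A a \<cdot> a)"
      by (rule small_sqrt[OF a small])
    have "cnorm A k <= 1" by (rule norm_sqrt_le_one[OF a k])
    then have "cnorm A (cdiff A e (cstar A a \<cdot> a)) <= 1"
      using norm_square[OF k(1,2)] k(3) norm_ge_zero[OF k(1)] by (simp add: abs_square_le_1)
    then show ?thesis using a unfolding pos_def
      by (intro conjI exI[of _ 1]) (auto simp: unital_simps one_smult)
  qed
  \<comment> \<open>The factor 2 brings the rescaled element to norm at most 1/2; adding 1 keeps
    \<open>c\<close> positive for \<open>a = 0\<close>.\<close>
  define c where "c = 2 * (cnorm A a + 1)"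
  have c: "0 < c" "cnorm A a <= c / 2" using norm_ge_zero[OF a] by (auto simp: c_def)
  let ?a = "rc (1/c) \<odot> a"
  have "cnorm A ?a <= 1/2" using a c by (simp add: norm_scale norm_divide field_simps)
  then have "(cnorm A ?a)\<^sup>2 <= (1/2)\<^sup>2" using a by (intro power_mono) (auto simp: norm_ge_zero)
  then have "(cnorm A ?a)\<^sup>2 <= 1/2" by (simp add: power2_eq_square)
  then have "pos (cstar A ?a \<cdot> ?a)" using a by (intro small) auto
  then have "pos (rc (c * c) \<odot> (cstar A ?a \<cdot> ?a))" using c by (intro pos_scale) auto
  moreover have "rc (c * c) \<odot> (cstar A ?a \<cdot> ?a) = cstar A a \<cdot> a"
    by (rule vec_eqI) (use a c in "auto simp: unital_simps")
  ultimately show ?thesis by simp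
qed

text \<open>The perturbed element \<open>x + 1 / Suc n\<close> is a square \<open>h\<^sup>2\<close>,
  so its conjugate by \<open>c\<close> is \<open>(h c)\<^sup>* (h c)\<close>, positive by the
  preceding theorem; positivity then passes to the limit.\<close>

lemma pos_conj:
  assumes x: "pos x" and c [simp]: "c \<in> car A"
  shows "pos (cstar A c \<cdot> (x \<cdot> c))"
proof (rule pos_limit)
  have [simp]: "x \<in> car A" using x by simp
  let ?s = "%n. cstar A c \<cdot> (x \<cdot> c) \<oplus> rc (1 / Suc n) \<odot> (cstar A c \<cdot> c)"
  show "pos (?s n)" for n
  proof -
    obtain h where h: "h \<in> car A" "cstar A h = h" "h \<cdot> h = x \<oplus> rc (1 / Suc n) \<odot> e"
    proof -
      have "0 < 1 / real (Suc n)" by simp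
      from pos_sqrt[OF x this] show thesis using that by blast
    qed
    have "cstar A (h \<cdot> c) \<cdot> (h \<cdot> c) = cstar A c \<cdot> ((h \<cdot> h) \<cdot> c)"
      using h(1,2) by (simp add: unital_simps)
    also have "... = ?s n" unfolding h(3)
      by (simp add: unital_simps del: of_real_divide)
    finally show ?thesis using pos_adj_times[of "h \<cdot> c"] h(1) by simp
  qed
  show "ctends A ?s (cstar A c \<cdot> (x \<cdot> c))"
  proof (rule ctendsI)
    fix n
    have "cdiff A (?s n) (cstar A c \<cdot> (x \<cdot> c)) = rc (1 / Suc n) \<odot> (cstar A c \<cdot> c)"
      by (rule vec_eqI) auto
    then show "cnorm A (cdiff A (?s n) (cstar A c \<cdot> (x \<cdot> c))) <= 1 / real (Suc n) * (cnorm A c)\<^sup>2"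
      by (simp add: norm_scale norm_adj_times norm_divide del: of_nat_Suc)
  next
    have "(%n. 1 / real (Suc n) * (cnorm A c)\<^sup>2) ----> 0 * (cnorm A c)\<^sup>2"
      using LIMSEQ_inverse_real_of_nat by (intro tendsto_intros) (simp add: inverse_eq_divide)
    then show "(%n. 1 / real (Suc n) * (cnorm A c)\<^sup>2) ----> 0" by simp
  qed auto
qed

text \<open>The approximants are \<open>e - K (2 * n)\<close> with
  \<open>k\<^sup>2 = e - a\<^sup>* a\<close>: polynomials in \<open>a\<^sup>* a\<close> without
  constant term, hence in \<open>D\<close>, although neither \<open>e\<close> nor \<open>k\<close>
  has to lie there. The error \<open>a K (2 * n)\<close> has squared norm at most
  \<open>1 / (2 n)\<close> by the scaled difference bound.\<close>

lemma right_factor_approx: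
  assumes D: "csubspace A D" "!!x y. x \<in> D ==> y \<in> D ==> x \<cdot> y \<in> D" "!!x. x \<in> D ==> cstar A x \<in> D"
    and a: "a \<in> D"
  obtains g where "!!n. g n \<in> D" "ctends A (%n. a \<cdot> g n) a"
proof -
  have sub: "x \<in> car A" if "x \<in> D" for x using D(1) that by (auto simp: csubspace_def)
  have Dadd: "x \<oplus> y \<in> D" if "x \<in> D" "y \<in> D" for x y using D(1) that by (auto simp: csubspace_def)
  have Dsm: "c \<odot> x \<in> D" if "x \<in> D" for c x using D(1) that by (auto simp: csubspace_def)
  have small: "\<exists>g. (\<forall>n. g n \<in> D) \<and> ctends A (%n. a \<cdot> g n) a"
    if a: "a \<in> D" and small: "(cnorm A a)\<^sup>2 <= 1/2" for a
  proof -
    have [simp]: "a \<in> car A" using sub a .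
    obtain k where k: "k \<in> car A" "cstar A k = k" "k \<cdot> k = cdiff A e (cstar A a \<cdot> a)"
      "(cstar A a \<cdot> a) \<cdot> k = k \<cdot> (cstar A a \<cdot> a)"
      by (rule small_sqrt[OF \<open>a \<in> car A\<close> small])
    note [simp] = k(1)
    let ?K = "cpow A e k"
    have gD: "cdiff A e (?K (2 * n)) \<in> D" for n
    proof (induction n)
      case 0
      have "cdiff A e (?K (2 * 0)) = \<zero>" by (rule vec_eqI) auto
      then show ?case using D(1) by (simp add: csubspace_def)
    next
      case (Suc n)
      let ?g = "cdiff A e (?K (2 * n))" and ?b = "cstar A a \<cdot> a"
      have "?K (2 * Suc n) = ?K (2 * n) \<cdot> cdiff A e ?b" by (simp add: times_assoc k(3))
      then have "cdiff A e (?K (2 * Suc n)) = ?g \<oplus> (?b \<oplus> (- 1) \<odot> (?g \<cdot> ?b))"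
        by (intro vec_eqI) (auto simp: unital_simps simp del: cpow.simps)
      moreover have "?b \<in> D" using a D by auto
      ultimately show ?case using Suc D(2) Dadd Dsm by simp
    qed
    have "ctends A (%n. a \<cdot> cdiff A e (?K (2 * n))) a"
    proof (rule ctendsI)
      fix n
      let ?c = "a \<cdot> ?K n"
      have d: "cdiff A (a \<cdot> cdiff A e (?K (2 * n))) a = (- 1) \<odot> (?c \<cdot> ?K n)"
        by (rule vec_eqI) (auto simp: unital_simps mult_2 cpow_add)
      have e: "cstar A (a \<cdot> ?K (2 * n)) \<cdot> (a \<cdot> ?K (2 * n)) = cdiff A (?K (2 * (2 * n))) (?K (2 * Suc (2 * n)))"
        by (rule adj_times_cpow[OF _ k]) simp
      have "cnorm A (rc (real (2 * n)) \<odot> cdiff A (?K (2 * (2 * n))) (?K (2 * Suc (2 * n)))) <= cnorm A e"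
        using pos_adj_times[of "a \<cdot> ?K (2 * n)"] pos_unit_minus_scaled_difference[OF _ k, of "2 * n"]
        by (intro norm_mono pos_scale) (auto simp: e simp del: cpow.simps)
      then have 1: "real (2 * n) * (cnorm A (a \<cdot> ?K (2 * n)))\<^sup>2 <= 1"
        using norm_unit_le norm_adj_times[of "a \<cdot> ?K (2 * n)"] by (simp add: norm_scale e del: cpow.simps)
      \<comment> \<open>For \<open>n = 0\<close> the bound above is void, so a constant larger than
        the norm of \<open>a\<close> is put in to cover this case.\<close>
      have "(cnorm A (a \<cdot> ?K (2 * n)))\<^sup>2 <= (1 + cnorm A a)\<^sup>2 / Suc n"
      proof (cases "n = 0")
        case True
        then show ?thesis using power_mono[of "cnorm A a" "1 + cnorm A a" 2] by (simp add: times_unit norm_ge_zero)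
      next
        case False
        have "real (Suc n) * (cnorm A (a \<cdot> ?K (2 * n)))\<^sup>2 <= real (2 * n) * (cnorm A (a \<cdot> ?K (2 * n)))\<^sup>2"
          using False by (intro mult_right_mono) auto
        also have "... <= 1\<^sup>2" using 1 by simp
        also have "... <= (1 + cnorm A a)\<^sup>2" by (intro power_mono) (auto simp: norm_ge_zero)
        finally show ?thesis by (simp add: field_simps del: of_nat_Suc)
      qed
      then have "cnorm A (a \<cdot> ?K (2 * n)) <= sqrt ((1 + cnorm A a)\<^sup>2 / Suc n)"
        by (rule real_le_rsqrt)
      then show "cnorm A (cdiff A (a \<cdot> cdiff A e (?K (2 * n))) a) <= sqrt ((1 + cnorm A a)\<^sup>2 / Suc n)"
        unfolding d by (simp add: norm_scale mult_2 cpow_add times_assoc)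
    next
      have "(%n. (1 + cnorm A a)\<^sup>2 * (1 / Suc n)) ----> (1 + cnorm A a)\<^sup>2 * 0"
        using LIMSEQ_inverse_real_of_nat by (intro tendsto_intros) (simp add: inverse_eq_divide)
      then have "(%n. (1 + cnorm A a)\<^sup>2 / Suc n) ----> 0" by simp
      from tendsto_real_sqrt[OF this] show "(%n. sqrt ((1 + cnorm A a)\<^sup>2 / Suc n)) ----> 0" by simp
    qed auto
    with gD show ?thesis by (intro exI[of _ "%n. cdiff A e (?K (2 * n))"]) auto
  qed
  have [simp]: "a \<in> car A" using sub a .
  define c where "c = 2 * (cnorm A a + 1)"
  have c: "0 < c" "cnorm A a <= c / 2" using norm_ge_zero[of a] by (auto simp: c_def)
  let ?a = "rc (1/c) \<odot> a"
  have "cnorm A ?a <= 1/2" using c by (simp add: norm_scale norm_divide field_simps)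
  then have "(cnorm A ?a)\<^sup>2 <= (1/2)\<^sup>2" by (intro power_mono) (auto simp: norm_ge_zero)
  then have "(cnorm A ?a)\<^sup>2 <= 1/2" by (simp add: power2_eq_square)
  from small[OF Dsm[OF a] this] obtain g where g: "!!n. g n \<in> D" "ctends A (%n. ?a \<cdot> g n) ?a"
    by blast
  have "ctends A (%n. rc c \<odot> (?a \<cdot> g n)) (rc c \<odot> ?a)"
    by (rule ctends_smult[OF g(2)])
  moreover have "rc c \<odot> (?a \<cdot> g n) = a \<cdot> g n" "rc c \<odot> ?a = a" for n
    by (rule vec_eqI; use c sub[OF g(1)] in "auto simp: smult_times")+
  ultimately have "ctends A (%n. a \<cdot> g n) a" by simp
  then show ?thesis by (rule that[OF g(1)])
qed

end

section \<open>Complex Hilbert spaces\<close>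

instance complex_hilbert_space \<subseteq> banach ..

section \<open>Complex scalars, the complex inner product and rank-one operators\<close>

lemma scaleC_minus_one: "scaleC (- 1) x = - (x::'h::complex_hilbert_space)"
  using scaleR_scaleC[of "-1" x] by simp

lemma scaleC_zero_left [simp]: "scaleC 0 (x::'h::complex_hilbert_space) = 0"
  using scaleR_scaleC[of 0 x] by simp

lemma scaleC_zero_right [simp]: "scaleC c (0::'h::complex_hilbert_space) = 0"
  using scaleC_add_right[of c 0 "0::'h"] by simp

lemma scaleC_minus_right: "scaleC c (- x) = - scaleC c (x::'h::complex_hilbert_space)"
  using scaleC_add_right[of c x "-x"] by (simp add: eq_neg_iff_add_eq_0 add.commute)

lemma scaleC_diff_right: "scaleC c (x - y) = scaleC c x - scaleC c (y::'h::complex_hilbert_space)"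
  using scaleC_add_right[of c x "-y"] by (simp add: scaleC_minus_right)

lemma cinner_add_right: "cinner x (y + z) = cinner x y + cinner (x::'h::complex_hilbert_space) z"
  by (subst (1 2 3) cinner_commute) (simp add: cinner_add_left)

lemma cinner_scaleC_right: "cinner x (scaleC c y) = cnj c * cinner (x::'h::complex_hilbert_space) y"
  by (subst (1 2) cinner_commute) (simp add: cinner_scaleC_left)

lemma cinner_zero_left [simp]: "cinner 0 (x::'h::complex_hilbert_space) = 0"
  using cinner_scaleC_left[of 0 x x] by simp

lemma cinner_zero_right [simp]: "cinner (x::'h::complex_hilbert_space) 0 = 0"
  using cinner_scaleC_right[of x 0 x] by simp

lemma cinner_minus_left: "cinner (- x) y = - cinner (x::'h::complex_hilbert_space) y"
  using cinner_scaleC_left[of "-1" x y] by (simp add: scaleC_minus_one)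

lemma cinner_diff_left: "cinner (x - y) z = cinner x z - cinner (y::'h::complex_hilbert_space) z"
  using cinner_add_left[of x "-y" z] by (simp add: cinner_minus_left)

lemma cinner_minus_right: "cinner x (- y) = - cinner (x::'h::complex_hilbert_space) y"
  using cinner_scaleC_right[of x "-1" y] by (simp add: scaleC_minus_one)

lemma cinner_diff_right: "cinner z (x - y) = cinner z x - cinner (z::'h::complex_hilbert_space) y"
  using cinner_add_right[of z x "-y"] by (simp add: cinner_minus_right)

lemma cinner_sum_left: "cinner (sum f S) y = (\<Sum>i\<in>S. cinner (f i :: 'h::complex_hilbert_space) y)"
  by (induction S rule: infinite_finite_induct) (auto simp: cinner_add_left)

lemma cinner_sum_right: "cinner y (sum f S) = (\<Sum>i\<in>S. cinner y (f i :: 'h::complex_hilbert_space))"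
  by (induction S rule: infinite_finite_induct) (auto simp: cinner_add_right)

lemma scaleC_sum_right: "scaleC c (sum f S) = (\<Sum>i\<in>S. scaleC c (f i :: 'h::complex_hilbert_space))"
  by (induction S rule: infinite_finite_induct) (auto simp: scaleC_add_right)

lemma cinner_scaleR_left: "cinner (r *\<^sub>R x) y = rc r * cinner (x::'h::complex_hilbert_space) y"
  by (simp add: scaleR_scaleC cinner_scaleC_left)

lemma cinner_self: "cinner x x = rc ((norm (x::'h::complex_hilbert_space))\<^sup>2)"
proof (rule complex_eqI)
  have "Im (cinner x x) = - Im (cinner x x)" by (subst cinner_commute) simp
  then show "Im (cinner x x) = Im (rc ((norm x)\<^sup>2))" by simp
qed (simp add: power2_norm_eq_inner inner_cinner)

lemma norm_scaleC: "norm (scaleC c x) = cmod c * norm (x::'h::complex_hilbert_space)"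
proof -
  have "rc ((norm (scaleC c x))\<^sup>2) = (c * cnj c) * rc ((norm x)\<^sup>2)"
    unfolding cinner_self[symmetric] by (simp add: cinner_scaleC_left cinner_scaleC_right algebra_simps)
  also have "... = rc ((cmod c * norm x)\<^sup>2)"
    unfolding complex_norm_square[symmetric] by (simp add: power_mult_distrib)
  finally have "(norm (scaleC c x))\<^sup>2 = (cmod c * norm x)\<^sup>2" by (simp only: of_real_eq_iff)
  then show ?thesis by (rule power2_eq_imp_eq) auto
qed

lemma cmod_cinner_le: "cmod (cinner x y) <= norm x * norm (y::'h::complex_hilbert_space)"
proof (cases "cinner x y = 0")
  case False
  define c where "c = cnj (cinner x y) / rc (cmod (cinner x y))"
  have c: "cmod c = 1" using False by (simp add: c_def norm_divide)
  have "c * cinner x y = rc (cmod (cinner x y))"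
    using False complex_norm_square[of "cinner x y"] by (simp add: c_def power2_eq_square field_simps)
  then have "cmod (cinner x y) = inner (scaleC c x) y"
    by (simp add: inner_cinner cinner_scaleC_left)
  also have "... <= norm (scaleC c x) * norm y" by (rule norm_cauchy_schwarz)
  finally show ?thesis using c by (simp add: norm_scaleC)
qed auto

lemma cinner_ext:
  assumes "!!z. cinner x z = cinner y (z::'h::complex_hilbert_space)" shows "x = y"
proof -
  have "cinner (x - y) (x - y) = 0" using assms by (simp add: cinner_diff_left)
  then show ?thesis by (simp add: cinner_self)
qed

lemma cinner_ext':
  assumes "!!z. cinner z x = cinner z (y::'h::complex_hilbert_space)" shows "x = y"
  by (rule cinner_ext) (metis assms cinner_commute)

lemma bounded_linear_scaleC: "bounded_linear (%x::'h::complex_hilbert_space. scaleC c x)"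
  by (rule bounded_linear_intro[where K="cmod c"])
    (auto simp: scaleC_add_right scaleR_scaleC scaleC_scaleC norm_scaleC mult.commute)

lemma bounded_linear_cinner_left: "bounded_linear (%x::'h::complex_hilbert_space. cinner x y)"
  by (rule bounded_linear_intro[where K="norm y"])
    (auto simp: cinner_add_left cinner_scaleR_left scaleR_conv_of_real cmod_cinner_le)

lemma bounded_linear_cinner_right: "bounded_linear (%x::'h::complex_hilbert_space. cinner y x)"
  by (rule bounded_linear_intro[where K="norm y"])
    (auto simp: cinner_add_right scaleR_scaleC cinner_scaleC_right scaleR_conv_of_real cmod_cinner_le mult.commute,
     metis cmod_cinner_le mult.commute)

lemma bounded_linear_scaleC_left: "bounded_linear (%c. scaleC c (x::'h::complex_hilbert_space))"
  by (rule bounded_linear_intro[where K="norm x"])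
    (auto simp: scaleC_add_left scaleR_scaleC scaleC_scaleC norm_scaleC scaleR_conv_of_real)

text \<open>Elements of \<open>'h \<Rightarrow>\<^sub>L 'h\<close> are only real linear, so complex
  linearity has to be asked for.\<close>

definition clin :: "('h::complex_hilbert_space \<Rightarrow>\<^sub>L 'h) => bool" where
  "clin T \<longleftrightarrow> (\<forall>c x. ap T (scaleC c x) = scaleC c (ap T x))"

text \<open>The operators \<open>rone (e i) (e j)\<close> are the matrix units.\<close>

definition rone :: "'h::complex_hilbert_space => 'h => ('h op)" where
  "rone a b = Blinfun (%x. scaleC (cinner x b) a)"

lemma rone_apply [simp]: "ap (rone a b) x = scaleC (cinner x b) a"
  unfolding rone_def
  by (subst bounded_linear_Blinfun_apply)
    (auto intro!: bounded_linear_compose[OF bounded_linear_scaleC_left bounded_linear_cinner_left])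

lemma clin_rone: "clin (rone a b)"
  by (simp add: clin_def cinner_scaleC_left scaleC_scaleC)

definition cscale_op :: "complex => ('h::complex_hilbert_space \<Rightarrow>\<^sub>L 'h) => ('h op)" where
  "cscale_op c T = Blinfun (%x. scaleC c (ap T x))"

lemma cscale_op_apply [simp]: "ap (cscale_op c T) x = scaleC c (ap T x)"
  unfolding cscale_op_def
  by (subst bounded_linear_Blinfun_apply)
    (auto intro!: bounded_linear_compose[OF bounded_linear_scaleC blinfun.bounded_linear_right])

lemma norm_op_le:
  fixes T :: "'h::complex_hilbert_space \<Rightarrow>\<^sub>L 'h"
  assumes "0 <= b" "!!x. norm x <= 1 ==> norm (ap T x) <= b" shows "norm T <= b"
proof (rule norm_blinfun_bound[OF assms(1)])
  fix x :: 'h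
  show "norm (ap T x) <= b * norm x"
  proof (cases "x = 0")
    case False
    have "norm (ap T (sgn x)) <= b" by (rule assms(2)) (simp add: norm_sgn)
    then show ?thesis using False by (simp add: sgn_div_norm blinfun.scaleR_right field_simps)
  qed simp
qed

lemma norm_cscale_op: "norm (cscale_op c T) = cmod c * norm T"
proof (cases "c = 0")
  case False
  have le: "norm (cscale_op c T) <= cmod c * norm T" for c and T :: "'h::complex_hilbert_space \<Rightarrow>\<^sub>L 'h"
    by (rule norm_blinfun_bound) (auto simp: norm_scaleC mult.assoc intro!: mult_left_mono norm_blinfun)
  have "T = cscale_op (1/c) (cscale_op c T)" using False
    by (intro blinfun_eqI) (simp add: scaleC_scaleC scaleC_one)
  then have "norm T <= cmod (1/c) * norm (cscale_op c T)" using le by metis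
  then have "cmod c * norm T <= norm (cscale_op c T)" using False by (simp add: norm_divide field_simps)
  then show ?thesis using le[of c T] by simp
next
  case True
  have "cscale_op 0 T = 0" by (rule blinfun_eqI) (simp add: blinfun.zero_left)
  then show ?thesis using True by simp
qed

subsection \<open>Orthogonal sequences\<close>

text \<open>The vectors \<open>e n\<close> that remain after normalisation form an orthonormal basis; allowing some
  of them to vanish spares the reindexing in the Gram-Schmidt process.\<close>

locale hilbert_basis =
  fixes e :: "nat => 'h::complex_hilbert_space"
  assumes orth: "i ~= j ==> cinner (e i) (e j) = 0"
    and unit: "e i = 0 \<or> norm (e i) = 1"
    and total: "(%n. \<Sum>i<n. scaleC (cinner x (e i)) (e i)) ----> x"

definition hproj :: "(nat => 'h::complex_hilbert_space) => nat => 'h => 'h" where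
  "hproj e n x = (\<Sum>i<n. scaleC (cinner x (e i)) (e i))"

lemma cinner_self_unit:
  assumes "e i = 0 \<or> norm (e i) = 1" shows "cinner x (e i) * cinner (e i) (e i) = cinner x (e i)"
  using assms by (auto simp: cinner_self)

lemma cinner_hproj:
  assumes orth: "!!i. i < n ==> i ~= j ==> cinner (e i) (e j) = 0" and u: "e j = 0 \<or> norm (e j) = 1" and j: "j < n"
  shows "cinner (hproj e n x) (e j) = cinner x (e j)"
proof -
  have "cinner (hproj e n x) (e j) = (\<Sum>i<n. cinner x (e i) * cinner (e i) (e j))"
    by (simp add: hproj_def cinner_sum_left cinner_scaleC_left)
  also have "... = (\<Sum>i<n. if i = j then cinner x (e j) else 0)"
    using orth cinner_self_unit[of e j, OF u] by (intro sum.cong) auto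
  finally show ?thesis using j by simp
qed

text \<open>The projection \<open>hproj e n\<close> reads only the vectors before \<open>n\<close>,
  so the recursion is well founded. Since \<open>sgn 0 = 0\<close>, a vector dependent on its
  predecessors contributes zero.\<close>

lemma gram_schmidt:
  fixes s :: "nat => 'h::complex_hilbert_space"
  obtains e where "!!n. e n = sgn (s n - hproj e n (s n))"
proof -
  define F where "F f n = sgn (s n - hproj f n (s n))" for f :: "nat => 'h" and n
  define e where "e = wfrec less_than F"
  have "adm_wf less_than F"
    unfolding adm_wf_def F_def hproj_def by (auto intro!: arg_cong[where f=sgn] sum.cong)
  then have "e = F e" unfolding e_def by (intro wfrec_fixpoint) auto
  then show ?thesis using that[of e] unfolding F_def by metis
qed

text \<open>Orthonormalising a dense sequence \<open>s\<close> makes \<open>hproj e n\<close> fix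
  \<open>s m\<close> for \<open>m < n\<close>; since all \<open>hproj e n\<close> are contractions,
  convergence passes from the dense set to every vector.\<close>

lemma hilbert_basis_exists:
  assumes "separable_infinite_dim TYPE('h::complex_hilbert_space)"
  shows "\<exists>e::nat => 'h. hilbert_basis e"
proof -
  obtain S :: "'h set" where S: "countable S" "closure S = UNIV"
    using assms unfolding separable_infinite_dim_def by blast
  then have "S ~= {}" by auto
  define s where "s = from_nat_into S"
  have rs: "range s = S" using S \<open>S ~= {}\<close> by (simp add: s_def range_from_nat_into)
  obtain e where e: "!!n. e n = sgn (s n - hproj e n (s n))" using gram_schmidt by blast
  have unit: "e i = 0 \<or> norm (e i) = 1" for i by (subst (1 2) e) (simp add: norm_sgn sgn_zero_iff)
  have orth1: "\<forall>j<n. cinner (e n) (e j) = 0" for n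
  proof (induction n rule: less_induct)
    case (less n)
    show ?case
    proof (intro allI impI)
      fix j assume j: "j < n"
      have "cinner (e i) (e j) = 0" if "i < n" "i ~= j" for i
      proof (cases "j < i")
        case False
        then have "cinner (e j) (e i) = 0" using less j that by auto
        then show ?thesis by (subst cinner_commute) simp
      qed (use less that in auto)
      then have "cinner (s n - hproj e n (s n)) (e j) = 0"
        using cinner_hproj[of n j e "s n"] unit j by (simp add: cinner_diff_left)
      then show "cinner (e n) (e j) = 0"
        by (subst e) (simp add: sgn_div_norm cinner_scaleR_left)
    qed
  qed
  have orth: "cinner (e i) (e j) = 0" if "i ~= j" for i j
    using that orth1[of i] orth1[of j] cinner_commute[of "e i" "e j"] by (cases "i < j") auto
  have cip: "cinner (hproj e n x) (e j) = cinner x (e j)" if "j < n" for n j x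
    using that orth unit by (intro cinner_hproj) auto
  have lin: "hproj e n (x + y) = hproj e n x + hproj e n y" "hproj e n (scaleC c x) = scaleC c (hproj e n x)" for n x y c
    by (simp_all add: hproj_def cinner_add_left scaleC_add_left sum.distrib cinner_scaleC_left scaleC_scaleC scaleC_sum_right)
  have pyth: "(norm x)\<^sup>2 = (norm (x - hproj e n x))\<^sup>2 + (norm (hproj e n x))\<^sup>2" for n x
  proof -
    have "cinner (x - hproj e n x) (hproj e n x) = (\<Sum>i<n. cnj (cinner x (e i)) * cinner (x - hproj e n x) (e i))"
      by (subst (2) hproj_def) (simp add: cinner_sum_right cinner_scaleC_right)
    also have "... = 0" by (intro sum.neutral) (simp add: cinner_diff_left cip)
    finally have "inner (x - hproj e n x) (hproj e n x) = 0" by (simp add: inner_cinner)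
    then show ?thesis using norm_add_Pythagorean[of "x - hproj e n x" "hproj e n x"]
      by (simp add: orthogonal_def)
  qed
  have bessel: "norm (hproj e n x) <= norm x" for n x
    by (rule power2_le_imp_le) (use pyth[of x n] in auto)
  have pe: "hproj e n (e j) = e j" if "j < n" for n j
  proof -
    have "hproj e n (e j) = (\<Sum>i<n. if i = j then scaleC (cinner (e j) (e j)) (e j) else 0)"
      unfolding hproj_def using orth by (intro sum.cong) auto
    also have "... = scaleC (cinner (e j) (e j)) (e j)" using that by simp
    also have "... = e j" using unit[of j] by (auto simp: cinner_self scaleC_one)
    finally show ?thesis .
  qed
  have ps: "hproj e n (s m) = s m" if "m < n" for n m
  proof -
    have nz: "norm y *\<^sub>R sgn y = y" for y :: 'h by (cases "y = 0") (simp_all add: sgn_div_norm)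
    have "s m = hproj e m (s m) + norm (s m - hproj e m (s m)) *\<^sub>R e m"
      by (subst e) (simp add: nz)
    then have sm: "s m = (\<Sum>i<m. scaleC (cinner (s m) (e i)) (e i)) + scaleC (norm (s m - hproj e m (s m))) (e m)"
      by (simp add: hproj_def scaleR_scaleC)
    have sumlin: "hproj e n (\<Sum>i<m. f i) = (\<Sum>i<m. hproj e n (f i))" for f
    proof -
      have "hproj e n 0 = 0" by (simp add: hproj_def)
      then show ?thesis by (induction m) (auto simp: lin)
    qed
    show ?thesis
      apply (subst (1 2) sm) using that by (simp add: lin sumlin pe)
  qed
  have total: "(%n. hproj e n x) ----> x" for x
  proof (rule metric_LIMSEQ_I)
    fix r :: real assume "0 < r"
    have "x \<in> closure (range s)" using S rs by simp
    then obtain m where m: "dist (s m) x < r / 2"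
      using closure_approachable[of x "range s"] \<open>0 < r\<close> by (metis half_gt_zero rangeE)
    have "dist (hproj e n x) x < r" if "n \<ge> Suc m" for n
    proof -
      have "hproj e n x = hproj e n (x - s m) + s m"
        using lin(1)[of n "x - s m" "s m"] ps[of m n] that by simp
      then have "norm (hproj e n x - x) <= norm (hproj e n (x - s m)) + norm (s m - x)"
        using norm_triangle_ineq[of "hproj e n (x - s m)" "s m - x"] by (simp add: algebra_simps)
      also have "... <= norm (x - s m) + norm (s m - x)" using bessel by simp
      also have "... < r" using m by (simp add: dist_norm norm_minus_commute)
      finally show ?thesis by (simp add: dist_norm)
    qed
    then show "\<exists>N. \<forall>n\<ge>N. dist (hproj e n x) x < r" by blast
  qed
  then have "hilbert_basis e"
    using orth unit unfolding hproj_def by unfold_locales auto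
  then show ?thesis by blast
qed

context hilbert_basis
begin

lemma hproj_tendsto: "(%n. hproj e n x) ----> x"
  using total by (simp add: hproj_def)

lemma cinner_hproj_basis: "j < n ==> cinner (hproj e n x) (e j) = cinner x (e j)"
  using orth unit by (intro cinner_hproj) auto

lemma norm_hproj_pythagoras:
  "(norm x)\<^sup>2 = (norm (x - hproj e n x))\<^sup>2 + (norm (hproj e n x))\<^sup>2"
proof -
  have "cinner (x - hproj e n x) (hproj e n x) = (\<Sum>i<n. cnj (cinner x (e i)) * cinner (x - hproj e n x) (e i))"
    by (subst (2) hproj_def) (simp add: cinner_sum_right cinner_scaleC_right)
  also have "... = 0" by (intro sum.neutral) (simp add: cinner_diff_left cinner_hproj_basis)
  finally have "inner (x - hproj e n x) (hproj e n x) = 0" by (simp add: inner_cinner)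
  then show ?thesis using norm_add_Pythagorean[of "x - hproj e n x" "hproj e n x"]
    by (simp add: orthogonal_def)
qed

lemma norm_hproj_le: "norm (hproj e n x) <= norm x"
  by (rule power2_le_imp_le) (use norm_hproj_pythagoras[of x n] in auto)

lemma scaleC_cinner_basis: "scaleC (cinner (e j) (e j)) (e j) = e j"
  using unit[of j] by (auto simp: cinner_self scaleC_one)

definition P :: "nat => ('h op)" where
  "P n = (\<Sum>i<n. rone (e i) (e i))"

lemma P_apply: "ap (P n) x = hproj e n x"
  by (simp add: P_def hproj_def blinfun.sum_left)

lemma norm_P: "norm (P n) <= 1"
  by (rule norm_op_le) (auto simp: P_apply intro: order_trans[OF norm_hproj_le])

text \<open>The representing vector is the limit of its truncations \<open>v n\<close>, which are
  forced by the values on the basis. Their squared norms increase and stay below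
  \<open>C\<^sup>2\<close>, and \<open>(norm (v m - v n))\<^sup>2\<close> is a difference of two of
  them, so \<open>v\<close> is Cauchy.\<close>

lemma riesz:
  fixes f :: "'h => complex"
  assumes add: "!!x y. f (x + y) = f x + f y" and sc: "!!c x. f (scaleC c x) = c * f x"
    and C0: "0 <= C" and bd: "!!x. cmod (f x) <= C * norm x"
  shows "\<exists>v. (\<forall>x. f x = cinner x v) \<and> norm v <= C"
proof -
  have bl: "bounded_linear f"
    by (rule bounded_linear_intro[where K=C])
      (auto simp: add scaleR_scaleC sc scaleR_conv_of_real mult.commute bd)
  have f0: "f 0 = 0" using sc[of 0 0] by simp
  have fsum: "f (\<Sum>i<n. g i) = (\<Sum>i<n. f (g i))" for g and n :: nat
    by (induction n) (auto simp: add f0)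
  define v where "v n = (\<Sum>i<n. scaleC (cnj (f (e i))) (e i))" for n
  have v: "cinner x (v n) = f (hproj e n x)" for x n
    by (simp add: v_def hproj_def cinner_sum_right cinner_scaleC_right fsum sc mult.commute)
  have vproj: "hproj e n (v m) = v n" if "n <= m" for n m
  proof -
    have "cinner (v m) (e i) = cnj (f (e i))" if "i < m" for i
    proof -
      have "cinner (v m) (e i) = (\<Sum>j<m. if j = i then cnj (f (scaleC (cinner (e i) (e i)) (e i))) else 0)"
        unfolding v_def cinner_sum_left cinner_scaleC_left using orth
        by (intro sum.cong) (auto simp: sc cinner_self)
      then show ?thesis using that by (simp add: scaleC_cinner_basis)
    qed
    then show ?thesis using that by (auto simp: hproj_def v_def intro!: sum.cong)
  qed
  define a where "a n = (norm (v n))\<^sup>2" for n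
  have vd: "(norm (v m - v n))\<^sup>2 = a m - a n" if "n <= m" for n m
    using norm_hproj_pythagoras[of "v m" n] vproj[OF that] by (simp add: a_def)
  have C: "norm (v n) <= C" for n
  proof -
    have "rc ((norm (v n))\<^sup>2) = f (v n)"
      unfolding cinner_self[symmetric] v using vproj[of n n] by simp
    then have "(norm (v n))\<^sup>2 <= C * norm (v n)" using bd[of "v n"] by (metis norm_of_real abs_of_nonneg zero_le_power2)
    then have "norm (v n) * norm (v n) <= C * norm (v n)" by (simp add: power2_eq_square)
    then show ?thesis using C0 by (cases "norm (v n) = 0") (auto simp: mult_le_cancel_right)
  qed
  have "incseq a" unfolding incseq_def using vd zero_le_power2 by (metis diff_ge_0_iff_ge)
  moreover have "Bseq a"
    by (rule BseqI'[of _ "C\<^sup>2"]) (auto simp: a_def C intro!: power_mono)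
  ultimately have "convergent a" using Bseq_monoseq_convergent incseq_imp_monoseq by blast
  then have ca: "Cauchy a" by (rule convergent_Cauchy)
  have "Cauchy v"
  proof (rule metric_CauchyI)
    fix r :: real assume "0 < r"
    then obtain M where M: "!!m n. m \<ge> M ==> n \<ge> M ==> dist (a m) (a n) < r\<^sup>2"
      using metric_CauchyD[OF ca, of "r\<^sup>2"] by auto
    have "dist (v m) (v n) < r" if "m \<ge> M" "n \<ge> M" for m n
    proof -
      have "(dist (v m) (v n))\<^sup>2 = dist (a m) (a n)"
        using vd[of m n] vd[of n m] zero_le_power2[of "norm (v m - v n)"]
        unfolding dist_norm real_norm_def norm_minus_commute[of "v n" "v m"] by (cases "m <= n") auto
      then have "(dist (v m) (v n))\<^sup>2 < r\<^sup>2" using M[OF that] by simp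
      then show ?thesis by (rule power2_less_imp_less) (use \<open>0 < r\<close> in simp)
    qed
    then show "\<exists>M. \<forall>m\<ge>M. \<forall>n\<ge>M. dist (v m) (v n) < r" by blast
  qed
  then obtain w where w: "v ----> w" using Cauchy_convergent convergent_def by blast
  have "f x = cinner x w" for x
  proof (rule LIMSEQ_unique)
    show "(%n. f (hproj e n x)) ----> f x"
      by (rule bounded_linear.tendsto[OF bl hproj_tendsto])
    show "(%n. f (hproj e n x)) ----> cinner x w"
      unfolding v[symmetric] by (rule bounded_linear.tendsto[OF bounded_linear_cinner_right w])
  qed
  moreover have "norm w <= C" using tendsto_norm[OF w] C by (intro LIMSEQ_le_const2) auto
  ultimately show ?thesis by blast
qed

subsection \<open>Adjoints and compact operators\<close>

text \<open>The same description as the involution of \<open>compact_operators\<close>, so that the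
  two agree by unfolding.\<close>

definition hadj :: "('h op) => ('h op)" where
  "hadj T = (THE S. \<forall>x y. cinner (ap T x) y = cinner x (ap S y))"

lemma hadj_unique:
  assumes "!!x y. cinner (ap T x) y = cinner x (ap S y)" shows "hadj T = S"
  unfolding hadj_def
proof (rule the_equality)
  fix S' assume "\<forall>x y. cinner (ap T x) y = cinner x (ap S' y)"
  then have "ap S' y = ap S y" for y
    using assms by (intro cinner_ext') metis
  then show "S' = S" by (rule blinfun_eqI)
qed (use assms in blast)

lemma hadj_exists:
  fixes T :: "'h op"
  assumes T: "clin T"
  shows "\<exists>S. (\<forall>x y. cinner (ap T x) y = cinner x (ap S y)) \<and> clin S \<and> norm S <= norm T"
proof -
  have "\<exists>v. (\<forall>x. cinner (ap T x) y = cinner x v) \<and> norm v <= norm T * norm y" for y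
  proof (rule riesz[where f="%x. cinner (ap T x) y"])
    show "cmod (cinner (ap T x) y) <= norm T * norm y * norm x" for x
      using cmod_cinner_le[of "ap T x" y] mult_right_mono[OF norm_blinfun[of T x], of "norm y"]
      by (simp add: mult_ac)
  qed (use T in "auto simp: clin_def blinfun.add_right cinner_add_left cinner_scaleC_left")
  then obtain g where g: "!!x y. cinner (ap T x) y = cinner x (g y)" "!!y. norm (g y) <= norm T * norm y"
    by metis
  have gadd: "g (x + y) = g x + g y" for x y
    by (rule cinner_ext') (simp add: g(1)[symmetric] cinner_add_right)
  have gsc: "g (scaleC c x) = scaleC c (g x)" for x c
    by (rule cinner_ext') (simp add: g(1)[symmetric] cinner_scaleC_right)
  have bl: "bounded_linear g"
    by (rule bounded_linear_intro[where K="norm T"])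
      (use g(2) in "auto simp: gadd gsc scaleR_scaleC mult.commute")
  have ap: "ap (Blinfun g) = g" by (rule bounded_linear_Blinfun_apply[OF bl])
  have "norm (Blinfun g) <= norm T" by (rule norm_blinfun_bound) (use g(2) in "auto simp: ap")
  then show ?thesis using g(1) by (intro exI[of _ "Blinfun g"]) (auto simp: ap clin_def gsc)
qed

lemma hadj:
  assumes "clin T"
  shows "cinner (ap T x) y = cinner x (ap (hadj T) y)" "clin (hadj T)" "norm (hadj T) <= norm T"
proof -
  obtain S where S: "!!x y. cinner (ap T x) y = cinner x (ap S y)" "clin S" "norm S <= norm T"
    using hadj_exists[OF assms] by blast
  have "hadj T = S" by (rule hadj_unique) (rule S(1))
  then show "cinner (ap T x) y = cinner x (ap (hadj T) y)" "clin (hadj T)" "norm (hadj T) <= norm T"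
    using S by auto
qed

lemma clin_add: "clin S ==> clin T ==> clin (S + T)"
  and clin_diff: "clin S ==> clin T ==> clin (S - T)"
  and clin_cscale: "clin T ==> clin (cscale_op c T)"
  and clin_compose: "clin S ==> clin T ==> clin (S o\<^sub>L T)"
  and clin_zero: "clin 0"
  for S T :: "'h op"
  by (simp_all add: clin_def blinfun.add_left blinfun.diff_left scaleC_add_right scaleC_diff_right scaleC_scaleC mult.commute blinfun.zero_left)

lemma clin_sum: "(!!i. i \<in> I ==> clin (T i)) ==> clin (sum T I)" for T :: "'x => 'h op"
  by (induction I rule: infinite_finite_induct) (auto simp: clin_zero clin_add)

lemma clin_P: "clin (P n)"
  unfolding P_def by (intro clin_sum clin_rone)

lemma hadj_add: "clin S ==> clin T ==> hadj (S + T) = hadj S + hadj T"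
  by (rule hadj_unique) (simp add: blinfun.add_left cinner_add_left cinner_add_right hadj(1))

lemma hadj_diff: "clin S ==> clin T ==> hadj (S - T) = hadj S - hadj T"
  by (rule hadj_unique) (simp add: blinfun.diff_left cinner_diff_left cinner_diff_right hadj(1))

lemma hadj_cscale: "clin T ==> hadj (cscale_op c T) = cscale_op (cnj c) (hadj T)"
  by (rule hadj_unique) (simp add: cinner_scaleC_left cinner_scaleC_right hadj(1))

lemma hadj_compose: "clin S ==> clin T ==> hadj (S o\<^sub>L T) = hadj T o\<^sub>L hadj S"
  by (rule hadj_unique) (simp add: hadj(1))

lemma hadj_hadj: "clin T ==> hadj (hadj T) = T"
  by (rule hadj_unique) (metis cinner_commute hadj(1))

lemma hadj_rone: "hadj (rone a b) = rone b a"
proof (rule hadj_unique)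
  fix x y
  have "cinner a y = cnj (cinner y a)" by (rule cinner_commute)
  then show "cinner (ap (rone a b) x) y = cinner x (ap (rone b a) y)"
    by (simp add: cinner_scaleC_left cinner_scaleC_right)
qed

lemma hadj_P: "hadj (P n) = P n"
proof (rule hadj_unique)
  fix x y
  have "cinner (e i) y = cnj (cinner y (e i))" for i by (rule cinner_commute)
  then show "cinner (ap (P n) x) y = cinner x (ap (P n) y)"
    by (simp add: P_apply hproj_def cinner_sum_left cinner_sum_right cinner_scaleC_left cinner_scaleC_right mult.commute)
qed

lemma norm_hadj: "clin T ==> norm (hadj T) = norm T"
  using hadj(3)[of T] hadj(3)[of "hadj T"] hadj(2)[of T] hadj_hadj[of T] by simp

text \<open>Working form of compactness: closure under sums, products and limits becomes continuity
  of the operations. Equivalence with the defining condition is \<open>Kop_iff\<close>.\<close>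

definition Kop :: "('h op) => bool" where
  "Kop T \<longleftrightarrow> clin T \<and> (%n. P n o\<^sub>L T) ----> T"

lemma Kop_clin: "Kop T ==> clin T" by (simp add: Kop_def)

lemma compact_image_P:
  "\<exists>C. compact C \<and> hproj e n ` cball 0 R \<subseteq> C"
proof -
  have "\<exists>C. compact C \<and> (\<forall>x. norm x <= R --> hproj e n x \<in> C)"
  proof (induction n)
    case 0
    show ?case by (intro exI[of _ "{0}"]) (auto simp: hproj_def)
  next
    case (Suc n)
    then obtain C where C: "compact C" "!!x. norm x <= R ==> hproj e n x \<in> C" by blast
    let ?D = "(%c. scaleC c (e n)) ` cball 0 R"
    have "compact ?D"
      by (intro compact_continuous_image linear_continuous_on bounded_linear_scaleC_left compact_cball)
    then have "compact {x + y |x y. x \<in> C \<and> y \<in> ?D}" using compact_sums[OF C(1)] by blast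
    moreover have "hproj e (Suc n) x \<in> {x + y |x y. x \<in> C \<and> y \<in> ?D}" if "norm x <= R" for x
    proof -
      have "cmod (cinner x (e n)) <= norm x * 1"
        using cmod_cinner_le[of x "e n"] unit[of n] by auto
      then have "scaleC (cinner x (e n)) (e n) \<in> ?D" using that by auto
      moreover have "hproj e (Suc n) x = hproj e n x + scaleC (cinner x (e n)) (e n)" by (simp add: hproj_def)
      ultimately show ?thesis using C(2)[OF that] by blast
    qed
    ultimately show ?case by blast
  qed
  then show ?thesis by (auto simp: image_subset_iff)
qed

text \<open>Forwards, the contractions \<open>P n\<close> converge pointwise, hence uniformly on the
  totally bounded image of the ball. Backwards, that image is uniformly close to its projection
  under some \<open>P n\<close>, which lies in a compact set.\<close>

lemma Kop_iff: "T \<in> car compact_operators \<longleftrightarrow> Kop T"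
proof
  assume "T \<in> car compact_operators"
  then have T: "clin T" and comp: "compact (closure (ap T ` cball 0 1))"
    by (auto simp: compact_operators_def clin_def)
  have "(%n. P n o\<^sub>L T) ----> T"
  proof (rule metric_LIMSEQ_I)
    fix r :: real assume r: "0 < r"
    obtain k where k: "finite k" "closure (ap T ` cball 0 1) \<subseteq> (\<Union>x\<in>k. ball x (r/4))"
      using comp r unfolding compact_eq_totally_bounded by (meson divide_pos_pos zero_less_numeral)
    have "\<forall>\<^sub>F n in sequentially. \<forall>y\<in>k. dist (hproj e n y) y < r/4"
      using k(1) r hproj_tendsto by (intro eventually_ball_finite ballI tendstoD) auto
    then obtain N where N: "!!n y. n \<ge> N ==> y \<in> k ==> dist (hproj e n y) y < r/4"
      by (auto simp: eventually_sequentially)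
    have "dist (P n o\<^sub>L T) T < r" if n: "n \<ge> N" for n
    proof -
      have "norm ((P n o\<^sub>L T) - T) <= 3 * r / 4"
      proof (rule norm_op_le)
        fix x :: 'h assume "norm x <= 1"
        then have "ap T x \<in> closure (ap T ` cball 0 1)"
          by (intro subsetD[OF closure_subset]) auto
        then obtain y where y: "y \<in> k" "dist y (ap T x) < r/4" using k(2) by auto
        let ?z = "ap T x"
        have "hproj e n ?z - ?z = ap (P n) (?z - y) + (hproj e n y - y) + (y - ?z)"
          by (simp add: P_apply[symmetric] blinfun.diff_right)
        then have "norm (hproj e n ?z - ?z) <= norm (ap (P n) (?z - y)) + norm (hproj e n y - y) + norm (y - ?z)"
          using norm_triangle_ineq[of "ap (P n) (?z - y) + (hproj e n y - y)" "y - ?z"]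
            norm_triangle_ineq[of "ap (P n) (?z - y)" "hproj e n y - y"] by simp
        also have "... <= r/4 + r/4 + r/4"
          using y N[OF n y(1)] norm_hproj_le[of n "?z - y"]
          by (intro add_mono) (auto simp: dist_norm P_apply norm_minus_commute)
        finally show "norm (ap ((P n o\<^sub>L T) - T) x) <= 3 * r / 4"
          by (simp add: blinfun.diff_left P_apply)
      qed (use r in simp)
      then show ?thesis using r by (simp add: dist_norm)
    qed
    then show "\<exists>N. \<forall>n\<ge>N. dist (P n o\<^sub>L T) T < r" by blast
  qed
  with T show "Kop T" by (simp add: Kop_def)
next
  assume T: "Kop T"
  let ?S = "ap T ` cball 0 1"
  have "\<exists>k. finite k \<and> closure ?S \<subseteq> (\<Union>x\<in>k. ball x r)" if r: "0 < r" for r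
  proof -
    obtain n where n: "dist (P n o\<^sub>L T) T < r/4"
      using T r unfolding Kop_def lim_sequentially by (metis order_refl divide_pos_pos zero_less_numeral)
    obtain C where C: "compact C" "hproj e n ` cball 0 (norm T) \<subseteq> C" using compact_image_P by blast
    then obtain k where k: "finite k" "C \<subseteq> (\<Union>x\<in>k. ball x (r/4))"
      using r unfolding compact_eq_totally_bounded by (meson divide_pos_pos zero_less_numeral)
    have "?S \<subseteq> (\<Union>x\<in>k. cball x (r/2))"
    proof
      fix z assume "z \<in> ?S"
      then obtain x where x: "norm x <= 1" and z: "z = ap T x" by auto
      have "norm (ap T x) <= norm T * 1"
        using norm_blinfun[of T x] mult_left_mono[OF x, of "norm T"] by simp
      then have "hproj e n (ap T x) \<in> C" using C(2) by auto
      then obtain y where y: "y \<in> k" "dist y (hproj e n (ap T x)) < r/4" using k(2) by auto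
      have "dist (hproj e n (ap T x)) (ap T x) = norm (ap ((P n o\<^sub>L T) - T) x)"
        by (simp add: dist_norm blinfun.diff_left P_apply)
      also have "... <= dist (P n o\<^sub>L T) T * 1"
        using norm_blinfun[of "(P n o\<^sub>L T) - T" x] mult_left_mono[OF x, of "norm ((P n o\<^sub>L T) - T)"]
        by (simp add: dist_norm)
      finally have "dist y (ap T x) <= r / 2"
        using y n dist_triangle[of y "ap T x" "hproj e n (ap T x)"] by simp
      with y z show "z \<in> (\<Union>x\<in>k. cball x (r/2))" by auto
    qed
    then have "closure ?S \<subseteq> (\<Union>x\<in>k. cball x (r/2))"
      using k(1) by (intro closure_minimal closed_UN) auto
    also have "... \<subseteq> (\<Union>x\<in>k. ball x r)" using r by (auto intro: UN_mono)
    finally show ?thesis using k(1) by blast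
  qed
  moreover have "complete (closure ?S)" by (simp add: complete_eq_closed)
  ultimately have "compact (closure ?S)" unfolding compact_eq_totally_bounded by blast
  with T show "T \<in> car compact_operators" by (auto simp: compact_operators_def Kop_def clin_def)
qed

lemma Kop_add: "Kop S ==> Kop T ==> Kop (S + T)"
  unfolding Kop_def by (auto intro!: clin_add tendsto_add simp: bounded_bilinear.add_right[OF bounded_bilinear_blinfun_compose])

lemma Kop_compose: "Kop S ==> clin T ==> Kop (S o\<^sub>L T)"
proof -
  assume S: "Kop S" and T: "clin T"
  have "(%n. (P n o\<^sub>L S) o\<^sub>L T) ----> (S o\<^sub>L T)"
    using S unfolding Kop_def by (intro bounded_linear.tendsto[OF bounded_bilinear.bounded_linear_left[OF bounded_bilinear_blinfun_compose]]) auto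
  moreover have "(P n o\<^sub>L S) o\<^sub>L T = P n o\<^sub>L (S o\<^sub>L T)" for n by (rule blinfun_eqI) simp
  ultimately show ?thesis using S T by (simp add: Kop_def clin_compose)
qed

lemma cscale_compose: "clin S ==> S o\<^sub>L cscale_op c T = cscale_op c (S o\<^sub>L T)"
  by (rule blinfun_eqI) (simp add: clin_def)

lemma bounded_linear_cscale_op: "bounded_linear (cscale_op c :: ('h op) => _)"
  by (rule bounded_linear_intro[where K="cmod c"])
    (auto simp: norm_cscale_op mult.commute scaleC_add_right blinfun.add_left blinfun.scaleR_left scaleR_scaleC scaleC_scaleC intro!: blinfun_eqI)

lemma Kop_cscale: "Kop T ==> Kop (cscale_op c T)"
  unfolding Kop_def by (auto simp: cscale_compose clin_P clin_cscale intro!: bounded_linear.tendsto[OF bounded_linear_cscale_op])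

lemma Kop_limit:
  assumes T: "!!m. Kop (T m)" and lim: "T ----> S"
  shows "Kop S"
proof -
  have "clin S"
    unfolding clin_def
  proof (intro allI)
    fix c x
    have ap: "(%m. ap (T m) y) ----> ap S y" for y
      by (rule bounded_linear.tendsto[OF blinfun.bounded_linear_left lim])
    have "(%m. scaleC c (ap (T m) x)) ----> scaleC c (ap S x)"
      by (rule bounded_linear.tendsto[OF bounded_linear_scaleC ap])
    moreover have "ap (T m) (scaleC c x) = scaleC c (ap (T m) x)" for m
      using T[of m] by (simp add: Kop_def clin_def)
    ultimately show "ap S (scaleC c x) = scaleC c (ap S x)"
      using ap[of "scaleC c x"] LIMSEQ_unique by fastforce
  qed
  moreover have "(%n. P n o\<^sub>L S) ----> S"
  proof (rule metric_LIMSEQ_I)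
    fix r :: real assume r: "0 < r"
    obtain m where m: "dist (T m) S < r/3"
      using lim r unfolding lim_sequentially by (metis order_refl divide_pos_pos zero_less_numeral)
    obtain N where N: "!!n. n \<ge> N ==> dist (P n o\<^sub>L T m) (T m) < r/3"
      using T[of m] r unfolding Kop_def lim_sequentially by (metis divide_pos_pos zero_less_numeral)
    have "dist (P n o\<^sub>L S) S < r" if "n \<ge> N" for n
    proof -
      have "dist (P n o\<^sub>L S) (P n o\<^sub>L T m) = norm (P n o\<^sub>L (S - T m))"
        by (simp add: dist_norm bounded_bilinear.diff_right[OF bounded_bilinear_blinfun_compose])
      also have "... <= norm (P n) * norm (S - T m)" by (rule norm_blinfun_compose)
      also have "... <= 1 * norm (S - T m)" by (intro mult_right_mono norm_P) auto
      finally have "dist (P n o\<^sub>L S) (P n o\<^sub>L T m) < r/3" using m by (simp add: dist_norm norm_minus_commute)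
      then show ?thesis using m N[OF that] dist_triangle[of "P n o\<^sub>L S" S "P n o\<^sub>L T m"]
          dist_triangle[of "P n o\<^sub>L T m" S "T m"] by simp
    qed
    then show "\<exists>N. \<forall>n\<ge>N. dist (P n o\<^sub>L S) S < r" by blast
  qed
  ultimately show ?thesis by (simp add: Kop_def)
qed

lemma norm_rone_le: "norm (rone a b :: 'h op) <= norm a * norm b"
proof (rule norm_op_le)
  fix x :: 'h assume "norm x <= 1"
  then have "cmod (cinner x b) <= norm b"
    using cmod_cinner_le[of x b] mult_right_mono[of "norm x" 1 "norm b"] by simp
  then show "norm (ap (rone a b) x) <= norm a * norm b"
    by (simp add: norm_scaleC mult.commute mult_left_mono)
qed auto

lemma rone_diff_left: "rone (a - a') b = rone a b - (rone a' b :: 'h op)"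
  by (rule blinfun_eqI) (simp add: scaleC_diff_right blinfun.diff_left)

lemma op_rone: "clin T ==> T o\<^sub>L rone a b = rone (ap T a) b"
  by (rule blinfun_eqI) (simp add: clin_def)

lemma rone_op: "clin T ==> rone a b o\<^sub>L T = rone a (ap (hadj T) b)"
  by (rule blinfun_eqI) (simp add: hadj(1))

lemma Kop_rone: "Kop (rone a b)"
  unfolding Kop_def
proof
  have "(%n. rone (hproj e n a) b - rone a b) ----> 0"
  proof (rule Lim_null_comparison)
    show "\<forall>\<^sub>F n in sequentially. norm (rone (hproj e n a) b - rone a b) <= norm (hproj e n a - a) * norm b"
      unfolding rone_diff_left[symmetric] by (simp add: norm_rone_le)
    show "(%n. norm (hproj e n a - a) * norm b) ----> 0"
      using hproj_tendsto[of a] by (intro tendsto_mult_left_zero) (simp add: LIM_zero_iff tendsto_norm_zero)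
  qed
  then show "(%n. P n o\<^sub>L rone a b) ----> rone a b"
    by (simp add: op_rone clin_P P_apply LIM_zero_iff)
qed (rule clin_rone)

lemma Kop_zero: "Kop 0" by (simp add: Kop_def clin_zero)

lemma Kop_sum: "(!!i. i \<in> I ==> Kop (T i)) ==> Kop (sum T I)"
  by (induction I rule: infinite_finite_induct) (auto simp: Kop_zero Kop_add)

lemma Kop_P: "Kop (P n)"
  unfolding P_def by (intro Kop_sum Kop_rone)

lemma Kop_adj_P_tendsto:
  assumes "Kop T" shows "(%n. hadj T o\<^sub>L P n) ----> hadj T"
proof -
  have T: "clin T" using assms by (rule Kop_clin)
  have "(%n. (hadj T o\<^sub>L P n) - hadj T) ----> 0"
  proof (rule Lim_null_comparison)
    have "(hadj T o\<^sub>L P n) - hadj T = hadj ((P n o\<^sub>L T) - T)" for n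
      using T by (simp add: hadj_diff hadj_compose clin_compose clin_P hadj_P)
    then show "\<forall>\<^sub>F n in sequentially. norm ((hadj T o\<^sub>L P n) - hadj T) <= norm ((P n o\<^sub>L T) - T)"
      using T by (simp add: hadj(3) clin_compose clin_P clin_diff)
    show "(%n. norm ((P n o\<^sub>L T) - T)) ----> 0"
      using assms by (simp add: Kop_def LIM_zero_iff tendsto_norm_zero)
  qed
  then show ?thesis by (simp add: LIM_zero_iff)
qed

text \<open>\<open>hadj T o\<^sub>L P m\<close> is a finite sum of rank-one operators, and it tends
  to \<open>hadj T\<close>, being at most as far from it as \<open>P m o\<^sub>L T\<close> is from
  \<open>T\<close>.\<close>

lemma Kop_hadj:
  assumes "Kop T" shows "Kop (hadj T)"
proof (rule Kop_limit[OF _ Kop_adj_P_tendsto[OF assms]])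
  fix m
  have "hadj T o\<^sub>L P m = (\<Sum>i<m. rone (ap (hadj T) (e i)) (e i))"
    by (rule blinfun_eqI) (simp add: P_apply hproj_def blinfun.sum_left blinfun.sum_right
        hadj(2)[OF Kop_clin[OF assms], unfolded clin_def])
  then show "Kop (hadj T o\<^sub>L P m)" by (simp add: Kop_sum Kop_rone)
qed

lemma Kop_P_right: "Kop T ==> (%n. T o\<^sub>L P n) ----> T"
  using Kop_adj_P_tendsto[OF Kop_hadj, of T] by (simp add: hadj_hadj Kop_clin)

lemma compact_operators_simps [simp]:
  "czero compact_operators = 0" "cadd compact_operators = (+)" "csmult compact_operators = cscale_op"
  "cmult compact_operators = (o\<^sub>L)" "cnorm compact_operators = norm" "cstar compact_operators = hadj"
  "cdiff compact_operators S T = S - T"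
proof -
  show "cdiff compact_operators S T = S - T"
    unfolding cdiff_def by (intro blinfun_eqI)
      (auto simp: compact_operators_def cscale_op_def[symmetric] fun_eq_iff blinfun.add_left blinfun.diff_left scaleC_minus_one)
qed (auto simp: compact_operators_def cscale_op_def hadj_def fun_eq_iff)

lemma cstar_algebra_compact_operators: "cstar_algebra (compact_operators :: ('h op) cstar_alg)"
proof (rule cstar_algebraI)
  show "pre_cstar_algebra (compact_operators :: ('h op) cstar_alg)"
  proof (unfold_locales, unfold Kop_iff compact_operators_simps)
    fix x y z :: "'h op" and c d :: complex
    show "Kop 0" by (rule Kop_zero)
    show "0 <= norm x" by simp
    show "norm (cscale_op c x) = cmod c * norm x" by (rule norm_cscale_op)
    show "norm (x o\<^sub>L y) <= norm x * norm y" by (rule norm_blinfun_compose)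
    show "norm (x + y) <= norm x + norm y" by (rule norm_triangle_ineq)
    show "0 + x = x" "x + y + z = x + (y + z)" "x + y = y + x" by (auto simp: add_ac)
    show "cscale_op (c + d) x = cscale_op c x + cscale_op d x" "cscale_op c (x + y) = cscale_op c x + cscale_op c y"
      "cscale_op c (cscale_op d x) = cscale_op (c * d) x" "cscale_op 1 x = x" "x + cscale_op (- 1) x = 0"
      by (rule blinfun_eqI; simp add: blinfun.add_left scaleC_add_left scaleC_add_right scaleC_scaleC scaleC_one scaleC_minus_one blinfun.zero_left)+
    show "x o\<^sub>L y o\<^sub>L z = x o\<^sub>L (y o\<^sub>L z)" "x o\<^sub>L (y + z) = (x o\<^sub>L y) + (x o\<^sub>L z)"
      "(x + y) o\<^sub>L z = (x o\<^sub>L z) + (y o\<^sub>L z)" "cscale_op c x o\<^sub>L y = cscale_op c (x o\<^sub>L y)"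
      by (rule blinfun_eqI; simp add: blinfun.add_left blinfun.add_right)+
    assume x: "Kop x"
    then show "Kop (cscale_op c x)" "Kop (hadj x)" "hadj (hadj x) = x" "hadj (cscale_op c x) = cscale_op (cnj c) (hadj x)"
      by (auto simp: Kop_cscale Kop_hadj hadj_hadj Kop_clin hadj_cscale)
    show "norm (hadj x o\<^sub>L x) = (norm x)\<^sup>2"
    proof (rule antisym)
      have "norm (hadj x o\<^sub>L x) <= norm (hadj x) * norm x" by (rule norm_blinfun_compose)
      then show "norm (hadj x o\<^sub>L x) <= (norm x)\<^sup>2" using x by (simp add: norm_hadj Kop_clin power2_eq_square)
      have "norm x <= sqrt (norm (hadj x o\<^sub>L x))"
      proof (rule norm_op_le)
        fix v :: 'h assume v: "norm v <= 1"
        have "rc ((norm (ap x v))\<^sup>2) = cinner v (ap (hadj x o\<^sub>L x) v)"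
          using hadj(1)[OF Kop_clin[OF x], of v "ap x v"] by (simp add: cinner_self)
        then have "(norm (ap x v))\<^sup>2 = cmod (cinner v (ap (hadj x o\<^sub>L x) v))"
          by (metis norm_of_real abs_of_nonneg zero_le_power2)
        also have "... <= norm v * norm (ap (hadj x o\<^sub>L x) v)" by (rule cmod_cinner_le)
        also have "... <= 1 * (norm (hadj x o\<^sub>L x) * 1)"
          using v norm_blinfun[of "hadj x o\<^sub>L x" v] mult_left_mono[OF v, of "norm (hadj x o\<^sub>L x)"]
          by (intro mult_mono) auto
        finally show "norm (ap x v) <= sqrt (norm (hadj x o\<^sub>L x))" by (intro real_le_rsqrt) simp
      qed simp
      then have "(norm x)\<^sup>2 <= (sqrt (norm (hadj x o\<^sub>L x)))\<^sup>2" by (rule power_mono) simp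
      then show "(norm x)\<^sup>2 <= norm (hadj x o\<^sub>L x)" by simp
    qed
    assume y: "Kop y"
    with x show "Kop (x + y)" "Kop (x o\<^sub>L y)" "hadj (x + y) = hadj x + hadj y" "hadj (x o\<^sub>L y) = hadj y o\<^sub>L hadj x"
      "x o\<^sub>L cscale_op c y = cscale_op c (x o\<^sub>L y)"
      by (auto simp: Kop_add Kop_compose hadj_add hadj_compose Kop_clin cscale_compose)
  qed
next
  fix s assume s: "s \<in> cauchy_seqs (compact_operators :: ('h op) cstar_alg)"
  then have "Cauchy s" by (auto simp: cauchy_seqs_def Cauchy_def dist_norm)
  then obtain l where l: "s ----> l" using Cauchy_convergent convergent_def by blast
  have mem: "Kop (s n)" for n using cauchy_seqs_mem[OF s] Kop_iff by blast
  then have "ctends compact_operators s l"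
    using Kop_limit[OF mem l] l by (simp add: ctends_def Kop_iff LIM_zero_iff tendsto_norm_zero)
  then show "\<exists>l. ctends compact_operators s l" by blast
qed simp

end

section \<open>Multiplier algebras\<close>

lemma cauchy_seqsD:
  assumes "s \<in> cauchy_seqs P" "0 < r"
  obtains N where "\<forall>m\<ge>N. \<forall>n\<ge>N. cnorm P (cdiff P (s m) (s n)) < r"
proof -
  have "\<exists>N. \<forall>m\<ge>N. \<forall>n\<ge>N. cnorm P (cdiff P (s m) (s n)) < r" using assms by (simp add: cauchy_seqs_def)
  then show ?thesis by (elim exE) (rule that)
qed

lemma cauchy_seqsI':
  assumes "!!n. s n \<in> car P"
    and "!!r. 0 < r ==> \<exists>N. \<forall>m\<ge>N. \<forall>n\<ge>N. cnorm P (cdiff P (s m) (s n)) < r"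
  shows "s \<in> cauchy_seqs P"
  using assms by (simp add: cauchy_seqs_def image_subset_iff)

lemma cauchy_seqs_shift: "t \<in> cauchy_seqs P ==> (%n. t (n + k)) \<in> cauchy_seqs P"
proof (rule cauchy_seqsI')
  fix r :: real assume t: "t \<in> cauchy_seqs P" and "0 < r"
  then obtain N where "\<forall>m\<ge>N. \<forall>n\<ge>N. cnorm P (cdiff P (t m) (t n)) < r"
    by (rule cauchy_seqsD)
    note N = this[rule_format]
  then show "\<exists>N. \<forall>m\<ge>N. \<forall>n\<ge>N. cnorm P (cdiff P (t (m + k)) (t (n + k))) < r"
    by (intro exI[of _ N] allI impI N trans_le_add1)
qed (rule cauchy_seqs_mem)

lemma M_simps [simp]:
  "m \<in> car (multiplier_algebra A) \<longleftrightarrow> dcent A m"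
  "czero (multiplier_algebra A) = (\<lambda>x\<in>car A. czero A, \<lambda>x\<in>car A. czero A)"
  "cadd (multiplier_algebra A) m n = (\<lambda>x\<in>car A. cadd A (fst m x) (fst n x), \<lambda>x\<in>car A. cadd A (snd m x) (snd n x))"
  "csmult (multiplier_algebra A) c m = (\<lambda>x\<in>car A. csmult A c (fst m x), \<lambda>x\<in>car A. csmult A c (snd m x))"
  "cmult (multiplier_algebra A) m n = (\<lambda>x\<in>car A. fst m (fst n x), \<lambda>x\<in>car A. snd n (snd m x))"
  "cstar (multiplier_algebra A) m = (\<lambda>x\<in>car A. cstar A (snd m (cstar A x)), \<lambda>x\<in>car A. cstar A (fst m (cstar A x)))"
  by (auto simp: multiplier_algebra_def)

context cstar_algebra
begin

abbreviation "M \<equiv> multiplier_algebra A"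

text \<open>Multiplying by the adjoint of \<open>a - b\<close> and using the C*-identity
  suffices.\<close>

lemma times_eqI:
  assumes "a \<in> car A" "b \<in> car A" "!!y. y \<in> car A ==> a \<cdot> y = b \<cdot> y"
  shows "a = b"
proof -
  let ?d = "cdiff A a b"
  have "?d \<cdot> cstar A ?d = \<zero>"
    using assms by (simp add: diff_times diff_self)
  then have "(cnorm A ?d)\<^sup>2 = 0" using assms norm_times_adj[of ?d] by (simp add: norm_zero)
  then show ?thesis using assms norm_eq_zero[of ?d] diff_eq_zero_iff by auto
qed

lemma times_eqI':
  assumes "a \<in> car A" "b \<in> car A" "!!y. y \<in> car A ==> y \<cdot> a = y \<cdot> b"
  shows "a = b"
proof -
  have "cstar A a = cstar A b"
  proof (rule times_eqI)
    fix y assume y: "y \<in> car A"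
    show "cstar A a \<cdot> y = cstar A b \<cdot> y"
      using arg_cong[OF assms(3)[of "cstar A y"], of "cstar A"] assms(1,2) y by (simp add: adj_times adj_adj)
  qed (use assms in auto)
  then show ?thesis using assms adj_adj by metis
qed

text \<open>Linearity, the module property and the bound for \<open>g\<close> come for free.\<close>

lemma double_centralizerI:
  assumes f: "!!x. x \<in> car A ==> f x \<in> car A" and g: "!!x. x \<in> car A ==> g x \<in> car A"
    and mid: "!!x y. x \<in> car A ==> y \<in> car A ==> g x \<cdot> y = x \<cdot> f y"
    and bd: "!!x. x \<in> car A ==> cnorm A (f x) <= C * cnorm A x"
  shows "dcent A (\<lambda>x\<in>car A. f x, \<lambda>x\<in>car A. g x)"
proof -
  have mid': "x \<cdot> f y = g x \<cdot> y" if "x \<in> car A" "y \<in> car A" for x y using mid that by simp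
  have fadd: "f (x \<oplus> y) = f x \<oplus> f y" if "x \<in> car A" "y \<in> car A" for x y
    by (rule times_eqI') (use that f g in "auto simp: times_plus mid'")
  have fsm: "f (c \<odot> x) = c \<odot> f x" if "x \<in> car A" for x c
    by (rule times_eqI') (use that f g in "auto simp: times_smult mid'")
  have gadd: "g (x \<oplus> y) = g x \<oplus> g y" if "x \<in> car A" "y \<in> car A" for x y
    by (rule times_eqI) (use that f g in "auto simp: plus_times mid")
  have gsm: "g (c \<odot> x) = c \<odot> g x" if "x \<in> car A" for x c
    by (rule times_eqI) (use that f g in "auto simp: smult_times mid")
  have ft: "f (x \<cdot> y) = f x \<cdot> y" if "x \<in> car A" "y \<in> car A" for x y
    by (rule times_eqI') (use that f g in "auto simp: mid' times_assoc[symmetric]")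
  have gt: "g (x \<cdot> y) = x \<cdot> g y" if "x \<in> car A" "y \<in> car A" for x y
    by (rule times_eqI) (use that f g in "auto simp: mid times_assoc")
  have gbd: "cnorm A (g x) <= C * cnorm A x" if x: "x \<in> car A" for x
  proof (cases "cnorm A (g x) = 0")
    case True
    then show ?thesis using bd[OF x] norm_ge_zero[OF f[OF x]] by linarith
  next
    case False
    \<comment> \<open>The middle identity is used with \<open>y\<close> the adjoint of
      \<open>g x\<close>, which turns the squared norm of \<open>g x\<close> into the norm of a
      product with a value of \<open>f\<close>.\<close>
    have "cnorm A (g x) * cnorm A (g x) = cnorm A (x \<cdot> f (cstar A (g x)))"
      using norm_times_adj[OF g[OF x]] mid[OF x, of "cstar A (g x)"] g[OF x] by (simp add: power2_eq_square)
    also have "... <= cnorm A x * cnorm A (f (cstar A (g x)))" using x f g by (intro norm_times) auto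
    also have "... <= cnorm A x * (C * cnorm A (g x))"
      using bd[of "cstar A (g x)"] g[OF x] x by (intro mult_left_mono) (auto simp: norm_adj norm_ge_zero)
    finally show ?thesis
      using False norm_ge_zero[OF g[OF x]] by (simp add: mult_le_cancel_right mult.assoc[symmetric] mult.commute[of "cnorm A x"])
  qed
  show ?thesis
    unfolding double_centralizer_def bounded_clinear_on_def using f g fadd fsm gadd gsm ft gt mid bd gbd
    by (auto simp: restrict_PiE_iff intro!: exI[of _ C])
qed

lemma
  assumes "dcent A m"
  shows fst_mem [simp, intro]: "x \<in> car A ==> fst m x \<in> car A"
    and snd_mem [simp, intro]: "x \<in> car A ==> snd m x \<in> car A"
    and fst_plus: "[|x \<in> car A; y \<in> car A|] ==> fst m (x \<oplus> y) = fst m x \<oplus> fst m y"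
    and snd_plus: "[|x \<in> car A; y \<in> car A|] ==> snd m (x \<oplus> y) = snd m x \<oplus> snd m y"
    and fst_smult: "x \<in> car A ==> fst m (c \<odot> x) = c \<odot> fst m x"
    and snd_smult: "x \<in> car A ==> snd m (c \<odot> x) = c \<odot> snd m x"
    and fst_times: "[|x \<in> car A; y \<in> car A|] ==> fst m (x \<cdot> y) = fst m x \<cdot> y"
    and snd_times: "[|x \<in> car A; y \<in> car A|] ==> snd m (x \<cdot> y) = x \<cdot> snd m y"
    and snd_times_fst: "[|x \<in> car A; y \<in> car A|] ==> snd m x \<cdot> y = x \<cdot> fst m y"
    and fst_bound: "\<exists>C. \<forall>x\<in>car A. cnorm A (fst m x) <= C * cnorm A x"
    and fst_off: "x \<notin> car A ==> fst m x = undefined"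
    and snd_off: "x \<notin> car A ==> snd m x = undefined"
  using assms unfolding double_centralizer_def bounded_clinear_on_def PiE_iff extensional_def by auto

lemma fst_diff: "[|dcent A m; x \<in> car A; y \<in> car A|] ==> fst m (cdiff A x y) = cdiff A (fst m x) (fst m y)"
  by (simp add: cdiff_def fst_plus fst_smult)

lemma snd_diff: "[|dcent A m; x \<in> car A; y \<in> car A|] ==> snd m (cdiff A x y) = cdiff A (snd m x) (snd m y)"
  by (simp add: cdiff_def snd_plus snd_smult)

text \<open>The left map determines the right one through
  \<open>snd m x \<cdot> y = x \<cdot> fst m y\<close> and faithfulness of multiplication.\<close>

lemma multiplier_eqI:
  assumes m: "dcent A m" and n: "dcent A n"
    and eq: "!!x. x \<in> car A ==> fst m x = fst n x"
  shows "m = n"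
proof (rule prod_eqI)
  show "fst m = fst n" using eq fst_off[OF m] fst_off[OF n] by (metis ext)
  show "snd m = snd n"
  proof
    fix x show "snd m x = snd n x"
    proof (cases "x \<in> car A")
      case True
      show ?thesis
        by (rule times_eqI) (use True m n eq in "auto simp: snd_times_fst")
    qed (use snd_off m n in auto)
  qed
qed

lemma
  assumes m: "dcent A m"
  shows multiplier_norm_bound: "x \<in> car A ==> cnorm A (fst m x) <= cnorm M m * cnorm A x"
    and multiplier_norm_nonneg: "0 <= cnorm M m"
    and multiplier_norm_le: "0 <= K ==> (!!x. x \<in> car A ==> cnorm A (fst m x) <= K * cnorm A x) ==> cnorm M m <= K"
proof -
  let ?S = "{cnorm A (fst m x) |x. x \<in> car A \<and> cnorm A x <= 1}"
  have nm: "cnorm M m = Sup ?S" by (simp add: multiplier_algebra_def)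
  obtain C where C: "!!x. x \<in> car A ==> cnorm A (fst m x) <= C * cnorm A x" using fst_bound[OF m] by blast
  have bdd: "bdd_above ?S"
  proof (rule bdd_aboveI[of _ "\<bar>C\<bar>"], elim CollectE exE conjE)
    fix y x assume x: "y = cnorm A (fst m x)" "x \<in> car A" "cnorm A x <= 1"
    have "y <= C * cnorm A x" unfolding x(1) by (rule C[OF x(2)])
    also have "... <= \<bar>C\<bar> * 1" using x(3) norm_ge_zero[OF x(2)] by (intro mult_mono) auto
    finally show "y <= \<bar>C\<bar>" by simp
  qed
  have in0: "cnorm A (fst m \<zero>) \<in> ?S" by (intro CollectI exI[of _ "\<zero>"]) (simp add: norm_zero)
  show nn: "0 <= cnorm M m"
    unfolding nm using cSup_upper[OF in0 bdd] norm_ge_zero[of "fst m \<zero>"] m by (simp add: order_trans)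
  show "cnorm A (fst m x) <= cnorm M m * cnorm A x" if x: "x \<in> car A" for x
  proof (cases "cnorm A x = 0")
    case True
    then show ?thesis using C[OF x] by simp
  next
    case False
    then have p: "0 < cnorm A x" using norm_ge_zero[OF x] by simp
    let ?y = "rc (1 / cnorm A x) \<odot> x"
    have "?y \<in> car A \<and> cnorm A ?y <= 1" using x p by (simp add: norm_scale norm_divide)
    then have "cnorm A (fst m ?y) \<in> ?S" by (intro CollectI exI conjI refl) auto
    from cSup_upper[OF this bdd] have "cnorm A (fst m ?y) <= cnorm M m" by (simp add: nm)
    then show ?thesis using x p m by (simp add: fst_smult norm_scale norm_divide field_simps)
  qed
  show "cnorm M m <= K" if K: "0 <= K" "!!x. x \<in> car A ==> cnorm A (fst m x) <= K * cnorm A x" for K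
    unfolding nm
  proof (rule cSup_least, use in0 in fast, elim CollectE exE conjE)
    fix y x assume x: "y = cnorm A (fst m x)" "x \<in> car A" "cnorm A x <= 1"
    then show "y <= K" using K(2)[OF x(2)] mult_left_mono[OF x(3) K(1)] by simp
  qed
qed

lemma dcent_adj:
  assumes m: "dcent A m"
  shows "dcent A (\<lambda>x\<in>car A. cstar A (snd m (cstar A x)), \<lambda>x\<in>car A. cstar A (fst m (cstar A x)))"
proof -
  obtain C where C: "!!x. x \<in> car A ==> cnorm A (snd m x) <= C * cnorm A x"
    using m unfolding double_centralizer_def bounded_clinear_on_def by blast
  show ?thesis
  proof (rule double_centralizerI)
    fix x y assume xy: "x \<in> car A" "y \<in> car A"
    have "cstar A (snd m (cstar A y) \<cdot> cstar A x) = cstar A (cstar A y \<cdot> fst m (cstar A x))"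
      using xy m by (simp add: snd_times_fst)
    then show "cstar A (fst m (cstar A x)) \<cdot> y = x \<cdot> cstar A (snd m (cstar A y))"
      using xy m by (simp add: adj_times adj_adj)
  next
    fix x assume x: "x \<in> car A"
    show "cnorm A (cstar A (snd m (cstar A x))) <= C * cnorm A x"
      using C[of "cstar A x"] x m by (simp add: norm_adj)
  qed (use m in auto)
qed

lemma
  assumes m: "dcent A m"
  shows adj_fst: "x \<in> car A ==> cstar A (fst m x) = snd (cstar M m) (cstar A x)"
    and multiplier_adj_mem: "dcent A (cstar M m)"
  using m dcent_adj[OF m] by (simp_all add: adj_adj)

text \<open>The squared norm of \<open>m x\<close> is the norm of
  \<open>x\<^sup>* (m\<^sup>* m x)\<close>; this is the nontrivial half of the C*-identity for
  multipliers.\<close>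

lemma multiplier_norm_sq:
  assumes m: "dcent A m" and mm: "dcent A (cmult M (cstar M m) m)"
  shows "(cnorm M m)\<^sup>2 <= cnorm M (cmult M (cstar M m) m)"
proof -
  let ?n = "cmult M (cstar M m) m"
  have "cnorm M m <= sqrt (cnorm M ?n)"
  proof (rule multiplier_norm_le[OF m])
    fix x assume x: "x \<in> car A"
    have "(cnorm A (fst m x))\<^sup>2 = cnorm A (cstar A (fst m x) \<cdot> fst m x)" using m x norm_adj_times by simp
    also have "cstar A (fst m x) \<cdot> fst m x = cstar A x \<cdot> fst ?n x"
      unfolding adj_fst[OF m x] using m x multiplier_adj_mem[OF m]
      by (simp add: snd_times_fst del: M_simps(6))
    also have "cnorm A ... <= cnorm A (cstar A x) * cnorm A (fst ?n x)"
      by (rule norm_times[OF adj_mem[OF x] fst_mem[OF mm x]])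
    also have "... <= cnorm A x * (cnorm M ?n * cnorm A x)"
      unfolding norm_adj[OF x] by (rule mult_left_mono[OF multiplier_norm_bound[OF mm x] norm_ge_zero[OF x]])
    also have "... = (sqrt (cnorm M ?n) * cnorm A x)\<^sup>2"
      using multiplier_norm_nonneg[OF mm] by (simp add: power_mult_distrib power2_eq_square)
    finally show "cnorm A (fst m x) <= sqrt (cnorm M ?n) * cnorm A x"
      by (rule power2_le_imp_le) (use x multiplier_norm_nonneg[OF mm] in "simp add: norm_ge_zero")
  qed (use multiplier_norm_nonneg[OF mm] in simp)
  then have "(cnorm M m)\<^sup>2 <= (sqrt (cnorm M ?n))\<^sup>2" using multiplier_norm_nonneg[OF m] by (rule power_mono)
  then show ?thesis using multiplier_norm_nonneg[OF mm] by simp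
qed

lemma dcent_mult:
  assumes m: "dcent A m" and n: "dcent A n"
  shows "dcent A (cmult M m n)"
  unfolding M_simps
proof (rule double_centralizerI)
  fix x assume x: "x \<in> car A"
  have "cnorm A (fst m (fst n x)) <= cnorm M m * cnorm A (fst n x)" using n x by (intro multiplier_norm_bound m) auto
  also have "... <= cnorm M m * (cnorm M n * cnorm A x)"
    by (intro mult_left_mono multiplier_norm_bound n x multiplier_norm_nonneg m)
  finally show "cnorm A (fst m (fst n x)) <= (cnorm M m * cnorm M n) * cnorm A x" by simp
qed (use m n in "auto simp: snd_times_fst")

lemma dcent_add:
  assumes m: "dcent A m" and n: "dcent A n"
  shows "dcent A (cadd M m n)"
  unfolding M_simps
proof (rule double_centralizerI)
  fix x assume x: "x \<in> car A"
  show "cnorm A (fst m x \<oplus> fst n x) <= (cnorm M m + cnorm M n) * cnorm A x"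
    using norm_plus[OF fst_mem[OF m x] fst_mem[OF n x]] multiplier_norm_bound[OF m x] multiplier_norm_bound[OF n x]
    unfolding semiring_class.distrib_right by linarith
qed (use m n in "auto simp: snd_times_fst plus_times times_plus")

lemma dcent_smult:
  assumes m: "dcent A m"
  shows "dcent A (csmult M c m)"
  unfolding M_simps
proof (rule double_centralizerI)
  fix x assume x: "x \<in> car A"
  show "cnorm A (c \<odot> fst m x) <= (cmod c * cnorm M m) * cnorm A x"
    using multiplier_norm_bound[OF m x] m x by (simp add: norm_scale mult_left_mono mult.assoc)
qed (use m in "auto simp: snd_times_fst smult_times times_smult")

lemma dcent_zero: "dcent A (czero M)"
  unfolding M_simps
  by (rule double_centralizerI[where C=0]) (auto simp: zero_times times_zero norm_zero)

lemma dcent_one: "dcent A (multiplier_one A)"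
  unfolding multiplier_one_def by (rule double_centralizerI[where C=1]) auto

text \<open>The means of producing multipliers outside \<open>A\<close>: the identity linking left
  and right maps survives strict limits, the uniform bound \<open>K\<close> gives boundedness, and
  \<open>double_centralizerI\<close> supplies the rest.\<close>

lemma strict_limit:
  assumes m: "!!n. dcent A (m n)" and bd: "!!n. cnorm M (m n) <= K"
    and L: "!!x. x \<in> car A ==> (%n. fst (m n) x) \<in> cauchy_seqs A"
    and R: "!!x. x \<in> car A ==> (%n. snd (m n) x) \<in> cauchy_seqs A"
  shows "\<exists>k. dcent A k \<and> (\<forall>x\<in>car A. ctends A (%n. fst (m n) x) (fst k x)) \<and>
    (\<forall>x\<in>car A. ctends A (%n. snd (m n) x) (snd k x)) \<and> cnorm M k <= K"
proof -
  have "\<forall>x. \<exists>l. x \<in> car A --> ctends A (%n. fst (m n) x) l" using L cauchy_convergent by metis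
  then obtain f where f: "!!x. x \<in> car A ==> ctends A (%n. fst (m n) x) (f x)" by metis
  have "\<forall>x. \<exists>l. x \<in> car A --> ctends A (%n. snd (m n) x) l" using R cauchy_convergent by metis
  then obtain g where g: "!!x. x \<in> car A ==> ctends A (%n. snd (m n) x) (g x)" by metis
  let ?k = "(\<lambda>x\<in>car A. f x, \<lambda>x\<in>car A. g x)"
  have fm: "f x \<in> car A" and gm: "g x \<in> car A" if "x \<in> car A" for x
    using ctends_mem(2)[OF f[OF that]] ctends_mem(2)[OF g[OF that]] by auto
  have K0: "0 <= K" using multiplier_norm_nonneg[OF m] bd order_trans by blast
  have fb: "cnorm A (f x) <= K * cnorm A x" if x: "x \<in> car A" for x
  proof (rule LIMSEQ_le_const2[OF ctends_norm[OF f[OF x]]])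
    have "cnorm A (fst (m n) x) <= K * cnorm A x" for n
      using multiplier_norm_bound[OF m x] mult_right_mono[OF bd norm_ge_zero[OF x]] order_trans by blast
    then show "\<exists>N. \<forall>n\<ge>N. cnorm A (fst (m n) x) <= K * cnorm A x" by blast
  qed
  have mid: "g x \<cdot> y = x \<cdot> f y" if x: "x \<in> car A" and y: "y \<in> car A" for x y
  proof (rule ctends_unique)
    show "ctends A (%n. snd (m n) x \<cdot> y) (g x \<cdot> y)" by (intro ctends_times g ctends_const x y)
    have "ctends A (%n. x \<cdot> fst (m n) y) (x \<cdot> f y)" by (intro ctends_times f ctends_const x y)
    then show "ctends A (%n. snd (m n) x \<cdot> y) (x \<cdot> f y)" using snd_times_fst[OF m x y] by simp
  qed
  have k: "dcent A ?k" by (rule double_centralizerI[OF fm gm mid fb])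
  have "cnorm M ?k <= K" by (rule multiplier_norm_le[OF k K0]) (simp add: fb)
  then show ?thesis using k f g by (intro exI[of _ ?k]) simp
qed

text \<open>The algebraic axioms are checked on the left maps alone. For completeness, a norm-Cauchy
  sequence has a strict limit, and the Cauchy estimate, applied at each \<open>x\<close>, shows that
  it is a norm limit.\<close>

lemma unital_cstar_algebra_multiplier: "unital_cstar_algebra M (multiplier_one A)"
proof -
  note mem = dcent_zero dcent_add dcent_smult dcent_mult
    multiplier_adj_mem dcent_one
  note fs = fst_mem snd_mem fst_plus snd_plus fst_smult snd_smult
  have pre: "pre_cstar_algebra M"
  proof (unfold_locales, unfold M_simps(1))
    fix m n k :: "'a multiplier" and c d :: complex
    show "dcent A (czero M)" by (rule mem)
    assume m: "dcent A m"
    show 1: "dcent A (csmult M c m)" "dcent A (cstar M m)" by (intro mem m)+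
    show "cadd M (czero M) m = m" "cadd M m (csmult M (- 1) m) = czero M"
      "csmult M (c + d) m = cadd M (csmult M c m) (csmult M d m)" "csmult M c (csmult M d m) = csmult M (c * d) m"
      "csmult M 1 m = m"
      by (rule multiplier_eqI; (intro mem m)?; use m in "simp add: zero_plus plus_inverse plus_smult smult_assoc one_smult")+
    show "cstar M (cstar M m) = m"
      by (rule multiplier_eqI; (intro mem m)?; use m in "simp add: adj_adj")
    show "cstar M (csmult M c m) = csmult M (cnj c) (cstar M m)"
      by (rule multiplier_eqI; (intro mem m)?; use m in "simp add: adj_smult")
    show "0 <= cnorm M m" by (rule multiplier_norm_nonneg[OF m])
    have sle: "cnorm M (csmult M c m) <= cmod c * cnorm M m" if m: "dcent A m" for c m
    proof (rule multiplier_norm_le)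
      fix x assume x: "x \<in> car A"
      show "cnorm A (fst (csmult M c m) x) <= cmod c * cnorm M m * cnorm A x"
        using multiplier_norm_bound[OF m x] m x by (simp add: norm_scale mult_left_mono mult.assoc)
    qed (simp_all add: mem m multiplier_norm_nonneg del: M_simps)
    show "cnorm M (csmult M c m) = cmod c * cnorm M m"
    proof (cases "c = 0")
      case True
      then show ?thesis using sle[OF m, of c] multiplier_norm_nonneg[OF 1(1)] by simp
    next
      case False
      have "csmult M (1 / c) (csmult M c m) = m"
        by (rule multiplier_eqI; (intro mem m)?; use m False in "simp add: smult_assoc one_smult")
      then have "cnorm M m <= cmod (1 / c) * cnorm M (csmult M c m)" using sle[OF 1(1), of "1 / c"] by simp
      then have "cmod c * cnorm M m <= cnorm M (csmult M c m)" using False by (simp add: norm_divide field_simps)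
      then show ?thesis using sle[OF m, of c] by simp
    qed
    have mmle: "cnorm M (cmult M m n) <= cnorm M m * cnorm M n" if m: "dcent A m" and n: "dcent A n" for m n
    proof (rule multiplier_norm_le)
      fix x assume x: "x \<in> car A"
      have "cnorm A (fst m (fst n x)) <= cnorm M m * cnorm A (fst n x)" using n x by (intro multiplier_norm_bound m) auto
      also have "... <= cnorm M m * (cnorm M n * cnorm A x)"
        by (intro mult_left_mono multiplier_norm_bound n x multiplier_norm_nonneg m)
      finally show "cnorm A (fst (cmult M m n) x) <= cnorm M m * cnorm M n * cnorm A x" using x by simp
    qed (simp_all add: mem m n multiplier_norm_nonneg del: M_simps)
    show "cnorm M (cmult M (cstar M m) m) = (cnorm M m)\<^sup>2"
    proof (rule antisym)
      have le: "cnorm M m <= cnorm M (cstar M m)" if m: "dcent A m" for m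
      proof (cases "cnorm M m = 0")
        case False
        have ms: "dcent A (cstar M m)" using m by (rule mem)
        have "(cnorm M m)\<^sup>2 <= cnorm M (cstar M m) * cnorm M m"
          using multiplier_norm_sq[OF m mem(4)[OF ms m]] mmle[OF ms m] by linarith
        then show ?thesis using False multiplier_norm_nonneg[OF m]
          by (simp add: power2_eq_square mult_le_cancel_right)
      qed (use multiplier_norm_nonneg[OF mem(5)[OF m]] in simp)
      have "cnorm M (cstar M m) <= cnorm M m" using le[OF 1(2)] \<open>cstar M (cstar M m) = m\<close> by simp
      then show "cnorm M (cmult M (cstar M m) m) <= (cnorm M m)\<^sup>2"
        using mmle[OF 1(2) m] mult_right_mono[OF _ multiplier_norm_nonneg[OF m]] by (fastforce simp: power2_eq_square)
      show "(cnorm M m)\<^sup>2 <= cnorm M (cmult M (cstar M m) m)"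
        by (rule multiplier_norm_sq[OF m mem(4)[OF 1(2) m]])
    qed
    assume n: "dcent A n"
    show "dcent A (cadd M m n)" "dcent A (cmult M m n)" by (intro mem m n)+
    show "cadd M m n = cadd M n m"
      by (rule multiplier_eqI; (intro mem m n)?; use m n in "simp add: plus_commute")
    show "csmult M c (cadd M m n) = cadd M (csmult M c m) (csmult M c n)"
      by (rule multiplier_eqI; (intro mem m n)?; use m n in "simp add: smult_plus")
    show "cmult M (csmult M c m) n = csmult M c (cmult M m n)"
      "cmult M m (csmult M c n) = csmult M c (cmult M m n)"
      by (rule multiplier_eqI; (intro mem m n)?; use m n in "simp add: fst_smult")+
    show "cstar M (cadd M m n) = cadd M (cstar M m) (cstar M n)"
      by (rule multiplier_eqI; (intro mem m n)?; use m n in "simp add: adj_plus")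
    show "cstar M (cmult M m n) = cmult M (cstar M n) (cstar M m)"
      by (rule multiplier_eqI; (intro mem m n)?; use m n in "simp add: adj_adj")
    show "cnorm M (cadd M m n) <= cnorm M m + cnorm M n"
    proof (rule multiplier_norm_le)
      fix x assume x: "x \<in> car A"
      show "cnorm A (fst (cadd M m n) x) <= (cnorm M m + cnorm M n) * cnorm A x"
        using norm_plus[OF fst_mem[OF m x] fst_mem[OF n x]] multiplier_norm_bound[OF m x] multiplier_norm_bound[OF n x] x
        unfolding semiring_class.distrib_right by simp
    qed (simp_all add: mem m n multiplier_norm_nonneg del: M_simps)
    show "cnorm M (cmult M m n) <= cnorm M m * cnorm M n" by (rule mmle[OF m n])
    assume k: "dcent A k"
    show "cadd M (cadd M m n) k = cadd M m (cadd M n k)"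
      by (rule multiplier_eqI; (intro mem m n k)?; use m n k in "simp add: plus_assoc")
    show "cmult M (cmult M m n) k = cmult M m (cmult M n k)"
      by (rule multiplier_eqI; (intro mem m n k)?; use m n k in simp)
    show "cmult M m (cadd M n k) = cadd M (cmult M m n) (cmult M m k)"
      by (rule multiplier_eqI; (intro mem m n k)?; use m n k in "simp add: fst_plus")
    show "cmult M (cadd M m n) k = cadd M (cmult M m k) (cmult M n k)"
      by (rule multiplier_eqI; (intro mem m n k)?; use m n k in simp)
  qed
  interpret M: pre_cstar_algebra M by (rule pre)
  have "cstar_algebra M"
  proof (rule cstar_algebraI[OF pre])
    fix m assume m: "m \<in> car M" "cnorm M m = 0"
    then have mm: "dcent A m" by simp
    show "m = czero M"
    proof (rule multiplier_eqI[OF mm dcent_zero])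
      fix x assume x: "x \<in> car A"
      then have "cnorm A (fst m x) = 0"
        using multiplier_norm_bound[OF mm x] m(2) norm_ge_zero[OF fst_mem[OF mm x]] by simp
      then show "fst m x = fst (czero M) x" using x mm norm_eq_zero by simp
    qed
  next
    fix s assume s: "s \<in> cauchy_seqs M"
    have mem': "dcent A (s n)" for n using cauchy_seqs_mem[OF s] by simp
    have ap: "fst (cdiff M (s n) (s k)) x = cdiff A (fst (s n) x) (fst (s k) x)"
      "snd (cdiff M (s n) (s k)) x = cdiff A (snd (s n) x) (snd (s k) x)" if "x \<in> car A" for n k x
      using that by (simp_all add: cdiff_def)
    have dm: "dcent A (cdiff M (s n) (s k))" for n k
      using M.diff_mem[of "s n" "s k"] mem' by simp
    have sb: "cnorm A (snd m x) <= cnorm M m * cnorm A x" if m: "dcent A m" and x: "x \<in> car A" for m x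
    proof -
      have "snd m x = cstar A (fst (cstar M m) (cstar A x))"
        using x m by (simp add: adj_adj)
      then have "cnorm A (snd m x) = cnorm A (fst (cstar M m) (cstar A x))"
        using fst_mem[OF mem(5)[OF m], of "cstar A x"] x by (simp only: norm_adj adj_mem)
      also have "... <= cnorm M (cstar M m) * cnorm A (cstar A x)" using x by (intro multiplier_norm_bound mem m) auto
      finally show ?thesis using m x M.norm_adj[of m] norm_adj[of x] by simp
    qed
    have cau: "(%n. g (s n)) \<in> cauchy_seqs A"
      if g: "!!n. g (s n) \<in> car A"
        "!!i j. cnorm A (cdiff A (g (s i)) (g (s j))) <= cnorm M (cdiff M (s i) (s j)) * t" and t: "0 <= t" for g t
    proof (rule cauchy_seqsI')
      fix r :: real assume "0 < r"
      then have "0 < r / (t + 1)" using t by simp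
      then obtain N where "\<forall>i\<ge>N. \<forall>j\<ge>N. cnorm M (cdiff M (s i) (s j)) < r / (t + 1)"
        by (rule cauchy_seqsD[OF s])
        note N = this[rule_format]
      have "cnorm A (cdiff A (g (s i)) (g (s j))) < r" if "i \<ge> N" "j \<ge> N" for i j
      proof -
        have "cnorm M (cdiff M (s i) (s j)) * (t + 1) < r" using N[OF that] t by (simp add: field_simps)
        moreover have "cnorm M (cdiff M (s i) (s j)) * t <= cnorm M (cdiff M (s i) (s j)) * (t + 1)"
          using multiplier_norm_nonneg[OF dm] by (intro mult_left_mono) auto
        ultimately show ?thesis using g(2)[of i j] by linarith
      qed
      then show "\<exists>N. \<forall>i\<ge>N. \<forall>j\<ge>N. cnorm A (cdiff A (g (s i)) (g (s j))) < r" by blast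
    qed (rule g(1))
    have LR: "(%n. fst (s n) x) \<in> cauchy_seqs A" "(%n. snd (s n) x) \<in> cauchy_seqs A" if x: "x \<in> car A" for x
      using cau[of "%m. fst m x" "cnorm A x"] cau[of "%m. snd m x" "cnorm A x"]
        multiplier_norm_bound[OF dm x] sb[OF dm x] norm_ge_zero[OF x] mem' x
      unfolding ap[OF x] by (simp_all del: M_simps)
    \<comment> \<open>\<open>strict_limit\<close> asks for one bound on all terms, so the sequence
      is cut off at an index beyond which it varies by less than 1.\<close>
    have "(0::real) < 1" by simp
    then obtain N0 where "\<forall>i\<ge>N0. \<forall>j\<ge>N0. cnorm M (cdiff M (s i) (s j)) < 1"
      by (rule cauchy_seqsD[OF s])
      note N0 = this[rule_format]
    have bd: "cnorm M (s (n + N0)) <= 1 + cnorm M (s N0)" for n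
      using M.norm_le_diff[of "s (n + N0)" "s N0"] N0[of "n + N0" N0] mem' by simp
    note shift = cauchy_seqs_shift[where k=N0]
    have "\<exists>k. dcent A k \<and> (\<forall>x\<in>car A. ctends A (%n. fst (s (n + N0)) x) (fst k x)) \<and>
      (\<forall>x\<in>car A. ctends A (%n. snd (s (n + N0)) x) (snd k x)) \<and> cnorm M k <= 1 + cnorm M (s N0)"
      by (rule strict_limit[OF mem' bd shift[OF LR(1)] shift[OF LR(2)]])
    then obtain k where k: "dcent A k" "\<forall>x\<in>car A. ctends A (%n. fst (s (n + N0)) x) (fst k x)"
      by (elim exE conjE)
    have "ctends M s k"
      unfolding ctends_def
    proof (intro conjI allI metric_LIMSEQ_I)
      fix r :: real assume r: "0 < r"
      then have "0 < r / 2" by simp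
      then obtain N where "\<forall>i\<ge>N. \<forall>j\<ge>N. cnorm M (cdiff M (s i) (s j)) < r / 2"
        by (rule cauchy_seqsD[OF s])
        note N = this[rule_format]
      have "cnorm M (cdiff M (s i) k) <= r / 2" if i: "i \<ge> N" for i
      proof (rule multiplier_norm_le)
        show "dcent A (cdiff M (s i) k)" using M.diff_mem[of "s i" k] mem' k by simp
        fix x assume x: "x \<in> car A"
        have lim: "(%n. cnorm A (cdiff A (fst (s i) x) (fst (s (n + N0)) x))) ----> cnorm A (cdiff A (fst (s i) x) (fst k x))"
          using mem' x by (intro ctends_norm ctends_diff ctends_const bspec[OF k(2)]) auto
        have "cnorm A (cdiff A (fst (s i) x) (fst (s (n + N0)) x)) <= r / 2 * cnorm A x" if "n \<ge> N" for n
          using multiplier_norm_bound[OF dm x, of i "n + N0"] mult_right_mono[OF less_imp_le[OF N[OF i, of "n + N0"]] norm_ge_zero[OF x]] that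
          unfolding ap[OF x] by simp
        then have "cnorm A (cdiff A (fst (s i) x) (fst k x)) <= r / 2 * cnorm A x"
          by (intro LIMSEQ_le_const2[OF lim]) blast
        then show "cnorm A (fst (cdiff M (s i) k) x) <= r / 2 * cnorm A x" using x by (simp add: cdiff_def)
      qed (use r in simp)
      then have "dist (cnorm M (cdiff M (s n) k)) 0 < r" if "n \<ge> N" for n
        using that r M.norm_ge_zero[of "cdiff M (s n) k"] M.diff_mem[of "s n" k] mem' k by fastforce
      then show "\<exists>N. \<forall>n\<ge>N. dist (cnorm M (cdiff M (s n) k)) 0 < r" by blast
    qed (use mem' k in auto)
    then show "\<exists>l. ctends M s l" by blast
  qed
  then interpret MC: cstar_algebra M .
  show ?thesis
  proof
    show "multiplier_one A \<in> car M" using dcent_one by simp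
    fix m assume "m \<in> car M"
    then have m: "dcent A m" by simp
    show "cmult M (multiplier_one A) m = m" "cmult M m (multiplier_one A) = m"
      by (rule multiplier_eqI; (intro mem m)?; use m in "simp add: multiplier_one_def")+
  qed
qed

lemma dcent_embed:
  assumes "a \<in> car A" shows "dcent A (multiplier_embed A a)"
  unfolding multiplier_embed_def
  by (rule double_centralizerI[where C="cnorm A a"]) (use assms norm_times in "auto simp: times_assoc")

lemma fst_embed [simp]: "x \<in> car A ==> fst (multiplier_embed A a) x = a \<cdot> x"
  and snd_embed [simp]: "x \<in> car A ==> snd (multiplier_embed A a) x = x \<cdot> a"
  by (simp_all add: multiplier_embed_def)

lemma norm_embed:
  assumes a: "a \<in> car A" shows "cnorm M (multiplier_embed A a) = cnorm A a"
proof (rule antisym)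
  note m = dcent_embed[OF a]
  show "cnorm M (multiplier_embed A a) <= cnorm A a"
    by (rule multiplier_norm_le[OF m]) (use a norm_times norm_ge_zero in auto)
  show "cnorm A a <= cnorm M (multiplier_embed A a)"
  proof (cases "cnorm A a = 0")
    case False
    have "cnorm A a * cnorm A a <= cnorm M (multiplier_embed A a) * cnorm A a"
      using multiplier_norm_bound[OF m, of "cstar A a"] a norm_times_adj[OF a]
      by (simp add: norm_adj power2_eq_square)
    then show ?thesis using False norm_ge_zero[OF a] by (simp add: mult_le_cancel_right)
  qed (use multiplier_norm_nonneg[OF m] in simp)
qed

lemma embed_inj: "a \<in> car A ==> b \<in> car A ==> multiplier_embed A a = multiplier_embed A b ==> a = b"
  by (rule times_eqI) (auto dest: fst_embed[THEN sym] simp flip: fst_embed)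

lemma
  assumes m: "dcent A m" and a: "a \<in> car A"
  shows mult_embed: "cmult M m (multiplier_embed A a) = multiplier_embed A (fst m a)"
    and embed_mult: "cmult M (multiplier_embed A a) m = multiplier_embed A (snd m a)"
  by (rule multiplier_eqI; (intro dcent_mult dcent_embed fst_mem snd_mem m a)?;
      use m a in "simp add: fst_times snd_times_fst")+

lemma
  assumes a: "a \<in> car A" and b: "b \<in> car A"
  shows embed_add: "multiplier_embed A (a \<oplus> b) = cadd M (multiplier_embed A a) (multiplier_embed A b)"
    and embed_times: "multiplier_embed A (a \<cdot> b) = cmult M (multiplier_embed A a) (multiplier_embed A b)"
    and embed_smult: "multiplier_embed A (c \<odot> a) = csmult M c (multiplier_embed A a)"
    and embed_adj: "multiplier_embed A (cstar A a) = cstar M (multiplier_embed A a)"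
    and embed_diff: "multiplier_embed A (cdiff A a b) = cdiff M (multiplier_embed A a) (multiplier_embed A b)"
  by (rule multiplier_eqI;
      (unfold cdiff_def)?, (intro dcent_mult dcent_add dcent_smult
         multiplier_adj_mem dcent_embed times_mem add_mem smult_mem adj_mem a b)?;
      use a b in "simp add: plus_times smult_times times_assoc adj_times adj_adj")+

text \<open>The algebra may lack a unit, so unitaries are taken in the multiplier algebra and act on
  a fixed \<open>v\<close>: the square of \<open>q (m v)\<close> is
  \<open>q (v\<^sup>* (m\<^sup>* m v))\<close>, so \<open>q (m v)\<close> depends on
  \<open>m\<close> only through \<open>m\<^sup>* m\<close>. Choosing for \<open>v\<close> the
  adjoint of \<open>a\<close> yields the claim.\<close>

lemma cstar_seminorm_le_norm:
  fixes q :: "'a => real"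
  assumes nonneg: "!!a. a \<in> car A ==> 0 <= q a"
    and plus: "!!a b. a \<in> car A ==> b \<in> car A ==> q (a \<oplus> b) <= q a + q b"
    and scale: "!!c a. a \<in> car A ==> q (c \<odot> a) = cmod c * q a"
    and mult: "!!a b. a \<in> car A ==> b \<in> car A ==> q (a \<cdot> b) <= q a * q b"
    and cstar: "!!a. a \<in> car A ==> q (cstar A a \<cdot> a) = (q a)\<^sup>2"
    and a: "a \<in> car A"
  shows "q a <= cnorm A a"
proof -
  interpret M: unital_cstar_algebra M "multiplier_one A" by (rule unital_cstar_algebra_multiplier)
  have qle: "q x <= q (cstar A x)" if x: "x \<in> car A" for x
  proof (cases "q x = 0")
    case False
    have "q x * q x <= q (cstar A x) * q x" using cstar[OF x] mult[of "cstar A x" x] x by (simp add: power2_eq_square)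
    then show ?thesis using False nonneg[OF x] by (simp add: mult_le_cancel_right)
  qed (use nonneg x in auto)
  have qadj: "q (cstar A x) = q x" if "x \<in> car A" for x
    using qle[OF that] qle[of "cstar A x"] that by (simp add: adj_adj)
  have act: "q (fst m v) <= cnorm M m * q v" if m: "dcent A m" and v: "v \<in> car A" for m v
  proof -
    have sq: "(q (fst m v))\<^sup>2 = q (cstar A v \<cdot> fst (cmult M (cstar M m) m) v)" if m: "dcent A m" for m
    proof -
      have "cstar A (fst m v) \<cdot> fst m v = snd (cstar M m) (cstar A v) \<cdot> fst m v"
        using adj_fst[OF m v] by simp
      also have "... = cstar A v \<cdot> fst (cstar M m) (fst m v)"
        using m v by (intro snd_times_fst multiplier_adj_mem) auto
      finally show ?thesis using cstar[OF fst_mem[OF m v]] v by (simp add: M_simps(5))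
    qed
    have "q (fst m v) <= cnorm M m * q (fst (multiplier_one A) v)"
    proof (rule M.seminorm_le_norm[where f="%m. q (fst m v)"])
      fix m n assume "m \<in> car M" "n \<in> car M"
      then have mn: "dcent A m" "dcent A n" by auto
      show "q (fst (cadd M m n) v) <= q (fst m v) + q (fst n v)" using mn v plus by simp
      assume "cmult M (cstar M m) m = cmult M (cstar M n) n"
      then have "(q (fst m v))\<^sup>2 = (q (fst n v))\<^sup>2" unfolding sq[OF mn(1)] sq[OF mn(2)] by (rule arg_cong)
      then show "q (fst m v) = q (fst n v)" by (rule power2_eq_imp_eq) (use nonneg mn v in auto)
    next
      fix m c assume "m \<in> car M"
      then have m: "dcent A m" by simp
      show "0 <= q (fst m v)" "q (fst (csmult M c m) v) = cmod c * q (fst m v)" using m v nonneg scale by auto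
      have mm: "dcent A (cmult M (cstar M m) m)"
        using m by (intro dcent_mult multiplier_adj_mem)
      show "(q (fst m v))\<^sup>2 <= q (fst (multiplier_one A) v) * q (fst (cmult M (cstar M m) m) v)"
        unfolding sq[OF m] using mult[of "cstar A v" "fst (cmult M (cstar M m) m) v"] fst_mem[OF mm v] qadj[OF v] v
        by (simp add: multiplier_one_def del: M_simps)
    qed (use m in simp)
    then show ?thesis using v by (simp add: multiplier_one_def)
  qed
  have "(q (cstar A a))\<^sup>2 = q (a \<cdot> cstar A a)" using cstar[of "cstar A a"] a by (simp add: adj_adj)
  also have "... <= cnorm A a * q (cstar A a)"
    using act[OF dcent_embed[OF a], of "cstar A a"] a by (simp add: norm_embed)
  finally have "q a * q a <= cnorm A a * q a" using a by (simp add: qadj power2_eq_square)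
  then show ?thesis using nonneg[OF a] norm_ge_zero[OF a] by (cases "q a = 0") (auto simp: mult_le_cancel_right)
qed

lemma cstar_subalgebra_algebra:
  assumes D: "cstar_subalgebra D A"
  shows "cstar_algebra (A\<lparr>ccarrier := D\<rparr>)"
proof -
  let ?D = "A\<lparr>ccarrier := D\<rparr>"
  have sub: "D \<subseteq> car A" using D by (auto simp: cstar_subalgebra_def csubspace_def)
  then have s: "x \<in> D ==> x \<in> car A" for x by auto
  have cl: "\<zero> \<in> D" "!!x y. x \<in> D ==> y \<in> D ==> x \<oplus> y \<in> D" "!!c x. x \<in> D ==> c \<odot> x \<in> D"
    "!!x y. x \<in> D ==> y \<in> D ==> x \<cdot> y \<in> D" "!!x. x \<in> D ==> cstar A x \<in> D"
    using D by (auto simp: cstar_subalgebra_def csubspace_def)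
  have diff: "cdiff ?D x y = cdiff A x y" for x y by (simp add: cdiff_def)
  show ?thesis
  proof (rule cstar_algebraI)
    show "pre_cstar_algebra ?D"
      by (unfold_locales; (simp add: cl)?; (drule s)+;
          rule plus_assoc plus_commute zero_plus plus_inverse smult_plus plus_smult smult_assoc one_smult
            times_assoc times_plus plus_times smult_times times_smult adj_adj adj_plus adj_smult adj_times
            norm_ge_zero norm_plus norm_scale norm_times norm_adj_times; assumption)
  next
    fix t assume t: "t \<in> cauchy_seqs ?D"
    have mem: "t n \<in> D" for n using cauchy_seqs_mem[OF t] by simp
    have "t \<in> cauchy_seqs A" using t sub by (auto simp: cauchy_seqs_def diff)
    then obtain l where l: "ctends A t l" by (rule cauchy_convergent)
    then have "l \<in> D" using D mem unfolding cstar_subalgebra_def closedin_iff by blast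
    then have "ctends ?D t l" using l mem by (simp add: ctends_def diff)
    then show "\<exists>l. ctends ?D t l" by blast
  next
    fix x assume "x \<in> ccarrier ?D" "cnorm ?D x = 0"
    then show "x = czero ?D" using norm_eq_zero[of x] s by simp
  qed
qed

end

lemma cstar_hom_norm_le:
  assumes A: "cstar_algebra A" and B: "cstar_algebra B" and f: "cstar_hom A B f" and a: "a \<in> car A"
  shows "cnorm B (f a) <= cnorm A a"
proof -
  interpret A: cstar_algebra A by fact
  interpret B: cstar_algebra B by fact
  have f': "!!x. x \<in> car A ==> f x \<in> car B"
    "!!x y. x \<in> car A ==> y \<in> car A ==> f (cadd A x y) = cadd B (f x) (f y)"
    "!!c x. x \<in> car A ==> f (csmult A c x) = csmult B c (f x)"
    "!!x y. x \<in> car A ==> y \<in> car A ==> f (cmult A x y) = cmult B (f x) (f y)"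
    "!!x. x \<in> car A ==> f (cstar A x) = cstar B (f x)"
    using f unfolding cstar_hom_def by auto
  show ?thesis
    by (rule A.cstar_seminorm_le_norm[where q="%x. cnorm B (f x)"])
      (simp_all add: f' a B.norm_ge_zero B.norm_plus B.norm_scale B.norm_times B.norm_adj_times)
qed

section \<open>Completion\<close>

context pre_cstar_algebra
begin

lemma cauchy_seqs_const: "x \<in> car A ==> (%_. x) \<in> cauchy_seqs A"
  using ctends_cauchy ctends_const by blast

lemma cauchy_seqs_bounded:
  assumes "s \<in> cauchy_seqs A"
  shows "\<exists>K>0. \<forall>n. cnorm A (s n) <= K"
proof -
  have mem: "s n \<in> car A" for n using assms by (rule cauchy_seqs_mem)
  have "(0::real) < 1" by simp
  then obtain N where "\<forall>m\<ge>N. \<forall>n\<ge>N. cnorm A (cdiff A (s m) (s n)) < 1"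
    by (rule cauchy_seqsD[OF assms])
  note N = this[rule_format]
  define K where "K = 1 + cnorm A (s N) + (\<Sum>i<N. cnorm A (s i))"
  have sum: "0 <= (\<Sum>i<N. cnorm A (s i))" by (intro sum_nonneg norm_ge_zero mem)
  have "cnorm A (s n) <= K" for n
  proof (cases "n < N")
    case True
    then have "cnorm A (s n) <= (\<Sum>i<N. cnorm A (s i))"
      by (intro member_le_sum) (auto simp: norm_ge_zero mem)
    then show ?thesis using norm_ge_zero[OF mem, of N] by (simp add: K_def)
  next
    case False
    then show ?thesis using N[of n N] norm_le_diff[OF mem mem, of n N] sum by (simp add: K_def)
  qed
  moreover have "0 < K" using sum norm_ge_zero[OF mem, of N] by (simp add: K_def)
  ultimately show ?thesis by blast
qed

lemma cauchy_norm_convergent: "s \<in> cauchy_seqs A ==> convergent (%n. cnorm A (s n))"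
proof -
  assume s: "s \<in> cauchy_seqs A"
  have "Cauchy (%n. cnorm A (s n))"
  proof (rule metric_CauchyI)
    fix r :: real assume "0 < r"
    then obtain N where "\<forall>m\<ge>N. \<forall>n\<ge>N. cnorm A (cdiff A (s m) (s n)) < r"
      by (rule cauchy_seqsD[OF s])
    then show "\<exists>M. \<forall>m\<ge>M. \<forall>n\<ge>M. dist (cnorm A (s m)) (cnorm A (s n)) < r"
      using abs_norm_diff[OF cauchy_seqs_mem[OF s] cauchy_seqs_mem[OF s]]
      unfolding dist_real_def by (meson le_less_trans)
  qed
  then show ?thesis by (rule Cauchy_convergent)
qed

lemma cauchy_seqs_dominated:
  assumes "!!n. t n \<in> car A" "s \<in> cauchy_seqs B" "0 <= K"
    and "!!m n. cnorm A (cdiff A (t m) (t n)) <= K * cnorm B (cdiff B (s m) (s n))"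
  shows "t \<in> cauchy_seqs A"
proof (rule cauchy_seqsI')
  fix r :: real assume "0 < r"
  then have "0 < r / (K + 1)" using assms(3) by simp
  then obtain N where "\<forall>m\<ge>N. \<forall>n\<ge>N. cnorm B (cdiff B (s m) (s n)) < r / (K + 1)"
    by (rule cauchy_seqsD[OF assms(2)])
  note N = this[rule_format]
  have "cnorm A (cdiff A (t m) (t n)) < r" if mn: "m \<ge> N" "n \<ge> N" for m n
  proof (cases "K = 0")
    case True
    then show ?thesis using assms(4)[of m n] \<open>0 < r\<close> by simp
  next
    case False
    then have K: "0 < K" using assms(3) by simp
    have "K * cnorm B (cdiff B (s m) (s n)) < K * (r / (K + 1))"
      by (rule mult_strict_left_mono[OF N[OF mn] K])
    also have "... <= r" using K \<open>0 < r\<close> by (simp add: field_simps)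
    finally show ?thesis using assms(4)[of m n] by simp
  qed
  then show "\<exists>N. \<forall>m\<ge>N. \<forall>n\<ge>N. cnorm A (cdiff A (t m) (t n)) < r" by blast
qed (rule assms(1))

lemma cauchy_seqs_add:
  assumes s: "s \<in> cauchy_seqs A" and t: "t \<in> cauchy_seqs A"
  shows "(%n. s n \<oplus> t n) \<in> cauchy_seqs A"
proof (rule cauchy_seqsI')
  note [simp] = cauchy_seqs_mem[OF s] cauchy_seqs_mem[OF t]
  fix r :: real assume "0 < r"
  then have r: "0 < r / 2" by simp
  obtain N1 where N1: "\<forall>m\<ge>N1. \<forall>n\<ge>N1. cnorm A (cdiff A (s m) (s n)) < r / 2" by (rule cauchy_seqsD[OF s r])
  obtain N2 where N2: "\<forall>m\<ge>N2. \<forall>n\<ge>N2. cnorm A (cdiff A (t m) (t n)) < r / 2" by (rule cauchy_seqsD[OF t r])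
  have "cnorm A (cdiff A (s m \<oplus> t m) (s n \<oplus> t n)) < r" if "m \<ge> max N1 N2" "n \<ge> max N1 N2" for m n
  proof -
    have "cdiff A (s m \<oplus> t m) (s n \<oplus> t n) = cdiff A (s m) (s n) \<oplus> cdiff A (t m) (t n)"
      by (rule vec_eqI) auto
    moreover have "cnorm A (cdiff A (s m) (s n)) < r / 2" "cnorm A (cdiff A (t m) (t n)) < r / 2"
      using N1 N2 that by auto
    ultimately show ?thesis using norm_plus[of "cdiff A (s m) (s n)" "cdiff A (t m) (t n)"] by simp
  qed
  then show "\<exists>N. \<forall>m\<ge>N. \<forall>n\<ge>N. cnorm A (cdiff A (s m \<oplus> t m) (s n \<oplus> t n)) < r" by blast
qed (use s t in "auto intro: cauchy_seqs_mem")

lemma cauchy_seqs_smult: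
  assumes s: "s \<in> cauchy_seqs A" shows "(%n. c \<odot> s n) \<in> cauchy_seqs A"
proof (rule cauchy_seqs_dominated[OF _ s, of _ "cmod c"])
  note [simp] = cauchy_seqs_mem[OF s]
  fix m n
  have "cdiff A (c \<odot> s m) (c \<odot> s n) = c \<odot> cdiff A (s m) (s n)"
    by (rule vec_eqI) (auto simp: algebra_simps)
  then show "cnorm A (cdiff A (c \<odot> s m) (c \<odot> s n)) <= cmod c * cnorm A (cdiff A (s m) (s n))"
    by (simp add: norm_scale)
  show "c \<odot> s n \<in> car A" by simp
qed simp

lemma cauchy_seqs_adj:
  assumes s: "s \<in> cauchy_seqs A" shows "(%n. cstar A (s n)) \<in> cauchy_seqs A"
proof (rule cauchy_seqs_dominated[OF _ s, of _ 1])
  note [simp] = cauchy_seqs_mem[OF s]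
  fix m n
  show "cnorm A (cdiff A (cstar A (s m)) (cstar A (s n))) <= 1 * cnorm A (cdiff A (s m) (s n))"
    by (simp add: adj_diff[symmetric] norm_adj)
  show "cstar A (s n) \<in> car A" by simp
qed simp

lemma cauchy_seqs_times:
  assumes s: "s \<in> cauchy_seqs A" and t: "t \<in> cauchy_seqs A"
  shows "(%n. s n \<cdot> t n) \<in> cauchy_seqs A"
proof (rule cauchy_seqsI')
  note [simp] = cauchy_seqs_mem[OF s] cauchy_seqs_mem[OF t]
  obtain K1 where K1: "0 < K1" "!!n. cnorm A (s n) <= K1" using cauchy_seqs_bounded[OF s] by auto
  obtain K2 where K2: "0 < K2" "!!n. cnorm A (t n) <= K2" using cauchy_seqs_bounded[OF t] by auto
  fix r :: real assume r: "0 < r"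
  have r1: "0 < r / (2 * K2)" and r2: "0 < r / (2 * K1)" using r K1 K2 by auto
  obtain N1 where N1: "\<forall>m\<ge>N1. \<forall>n\<ge>N1. cnorm A (cdiff A (s m) (s n)) < r / (2 * K2)" by (rule cauchy_seqsD[OF s r1])
  obtain N2 where N2: "\<forall>m\<ge>N2. \<forall>n\<ge>N2. cnorm A (cdiff A (t m) (t n)) < r / (2 * K1)" by (rule cauchy_seqsD[OF t r2])
  have "cnorm A (cdiff A (s m \<cdot> t m) (s n \<cdot> t n)) < r" if "m \<ge> max N1 N2" "n \<ge> max N1 N2" for m n
  proof -
    have eq: "cdiff A (s m \<cdot> t m) (s n \<cdot> t n) = cdiff A (s m) (s n) \<cdot> t m \<oplus> s n \<cdot> cdiff A (t m) (t n)"
      by (rule vec_eqI) (auto simp: expand_simps)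
    have "cnorm A (cdiff A (s m) (s n) \<cdot> t m) <= cnorm A (cdiff A (s m) (s n)) * cnorm A (t m)" by (intro norm_times) auto
    also have "... <= cnorm A (cdiff A (s m) (s n)) * K2" by (intro mult_left_mono K2 norm_ge_zero) auto
    also have "... < r / (2 * K2) * K2" using N1 that K2 by (intro mult_strict_right_mono) auto
    finally have 1: "cnorm A (cdiff A (s m) (s n) \<cdot> t m) < r / 2" using K2 by simp
    have "cnorm A (s n \<cdot> cdiff A (t m) (t n)) <= cnorm A (s n) * cnorm A (cdiff A (t m) (t n))" by (intro norm_times) auto
    also have "... <= K1 * cnorm A (cdiff A (t m) (t n))" by (intro mult_right_mono K1 norm_ge_zero) auto
    also have "... < K1 * (r / (2 * K1))" using N2 that K1 by (intro mult_strict_left_mono) auto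
    finally have 2: "cnorm A (s n \<cdot> cdiff A (t m) (t n)) < r / 2" using K1 by simp
    show ?thesis unfolding eq
      using norm_plus[of "cdiff A (s m) (s n) \<cdot> t m" "s n \<cdot> cdiff A (t m) (t n)"] 1 2 by simp
  qed
  then show "\<exists>N. \<forall>m\<ge>N. \<forall>n\<ge>N. cnorm A (cdiff A (s m \<cdot> t m) (s n \<cdot> t n)) < r" by blast
qed (use s t in "auto intro: cauchy_seqs_mem")

abbreviation "cl \<equiv> cauchy_class A"
abbreviation "Q \<equiv> completion A"

definition null_seq :: "(nat => 'a) => (nat => 'a) => bool" where
  "null_seq s t \<longleftrightarrow> (%n. cnorm A (cdiff A (s n) (t n))) ----> 0"

lemma null_seqI:
  assumes "!!n. s n \<in> car A" "!!n. t n \<in> car A"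
    "!!n. cnorm A (cdiff A (s n) (t n)) <= f n" "f ----> 0"
  shows "null_seq s t"
  unfolding null_seq_def
  by (rule tendsto_sandwich[OF _ _ tendsto_const[of 0] assms(4)])
    (use assms norm_ge_zero in "auto intro!: always_eventually")

lemma equiv_cauchy_rel: "equiv (cauchy_seqs A) (cauchy_rel A)"
proof (rule equivI)
  show "cauchy_rel A \<subseteq> cauchy_seqs A \<times> cauchy_seqs A" by (auto simp: cauchy_rel_def)
  show "refl_on (cauchy_seqs A) (cauchy_rel A)"
    by (auto simp: refl_on_def cauchy_rel_def diff_self cauchy_seqs_mem norm_zero)
  show "sym (cauchy_rel A)"
  proof (rule symI)
    fix s t assume "(s, t) \<in> cauchy_rel A"
    then have st: "s \<in> cauchy_seqs A" "t \<in> cauchy_seqs A" "(%n. cnorm A (cdiff A (s n) (t n))) ----> 0"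
      by (auto simp: cauchy_rel_def)
    have "cnorm A (cdiff A (s n) (t n)) = cnorm A (cdiff A (t n) (s n))" for n
      using norm_diff_commute[OF cauchy_seqs_mem[OF st(1)] cauchy_seqs_mem[OF st(2)]] .
    then show "(t, s) \<in> cauchy_rel A" using st by (simp add: cauchy_rel_def)
  qed
  show "trans (cauchy_rel A)"
  proof (rule transI)
    fix s t u assume "(s, t) \<in> cauchy_rel A" "(t, u) \<in> cauchy_rel A"
    then have st: "s \<in> cauchy_seqs A" "t \<in> cauchy_seqs A" "u \<in> cauchy_seqs A"
      and n: "null_seq s t" "null_seq t u"
      by (auto simp: cauchy_rel_def null_seq_def)
    have "null_seq s u"
    proof (rule null_seqI)
      show "cnorm A (cdiff A (s n) (u n)) <= cnorm A (cdiff A (s n) (t n)) + cnorm A (cdiff A (t n) (u n))" for n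
        by (intro norm_diff_triangle cauchy_seqs_mem st)
      show "(%n. cnorm A (cdiff A (s n) (t n)) + cnorm A (cdiff A (t n) (u n))) ----> 0"
        using n tendsto_add[of "%n. cnorm A (cdiff A (s n) (t n))" 0] unfolding null_seq_def by fastforce
    qed (intro cauchy_seqs_mem st)+
    then show "(s, u) \<in> cauchy_rel A" using st by (simp add: cauchy_rel_def null_seq_def)
  qed
qed

lemma cl_eq_iff: "s \<in> cauchy_seqs A ==> t \<in> cauchy_seqs A ==> cl s = cl t \<longleftrightarrow> null_seq s t"
  unfolding cauchy_class_def
  using eq_equiv_class_iff[OF equiv_cauchy_rel, of s t] by (auto simp: cauchy_rel_def null_seq_def)

lemma cl_mem [intro]: "s \<in> cauchy_seqs A ==> cl s \<in> car Q"
  by (simp add: completion_def cauchy_class_def quotientI)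

lemma cl_cases:
  assumes "X \<in> car Q"
  obtains s where "s \<in> cauchy_seqs A" "X = cl s"
  using assms unfolding completion_def cauchy_class_def by (auto elim: quotientE)

text \<open>The operations of \<open>completion\<close> act on the chosen representative, so
  computing them on \<open>cl s\<close> begins with the fact that the chosen one differs from
  \<open>s\<close> by a null sequence.\<close>

lemma rep_cl:
  assumes "s \<in> cauchy_seqs A"
  shows "cauchy_rep (cl s) \<in> cauchy_seqs A" "null_seq (cauchy_rep (cl s)) s"
proof -
  have "s \<in> cl s" unfolding cauchy_class_def by (rule equiv_class_self[OF equiv_cauchy_rel assms])
  then have "cauchy_rep (cl s) \<in> cl s" unfolding cauchy_rep_def by (rule someI[of "%t. t \<in> cl s"])
  then have r: "(s, cauchy_rep (cl s)) \<in> cauchy_rel A" by (simp add: cauchy_class_def)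
  then have "(cauchy_rep (cl s), s) \<in> cauchy_rel A" using equiv_cauchy_rel by (meson equivE symE)
  then show "cauchy_rep (cl s) \<in> cauchy_seqs A" "null_seq (cauchy_rep (cl s)) s"
    by (auto simp: cauchy_rel_def null_seq_def)
qed

lemma rep_mem:
  assumes "X \<in> car Q" shows "cauchy_rep X \<in> cauchy_seqs A" "cl (cauchy_rep X) = X"
proof -
  from assms obtain s where s: "s \<in> cauchy_seqs A" and X: "X = cl s" by (rule cl_cases)
  show "cauchy_rep X \<in> cauchy_seqs A" unfolding X by (rule rep_cl(1)[OF s])
  show "cl (cauchy_rep X) = X" unfolding X using cl_eq_iff[OF rep_cl(1)[OF s] s] rep_cl(2)[OF s] by blast
qed

lemma completion_norm: assumes "s \<in> cauchy_seqs A" shows "(%n. cnorm A (s n)) ----> cnorm Q (cl s)"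
proof -
  note r = rep_cl[OF assms]
  have lim: "(%n. cnorm A (cauchy_rep (cl s) n)) ----> cnorm Q (cl s)"
    using cauchy_norm_convergent[OF r(1)] by (simp add: completion_def convergent_LIMSEQ_iff)
  have "norm (cnorm A (s n) - cnorm A (cauchy_rep (cl s) n)) <= cnorm A (cdiff A (cauchy_rep (cl s) n) (s n))" for n
    using abs_norm_diff[OF cauchy_seqs_mem[OF r(1)] cauchy_seqs_mem[OF assms], of n n]
    by (simp add: abs_minus_commute)
  then have ev: "\<forall>\<^sub>F n in sequentially. norm (cnorm A (s n) - cnorm A (cauchy_rep (cl s) n)) <= cnorm A (cdiff A (cauchy_rep (cl s) n) (s n))"
    by simp
  from tendsto_add[OF Lim_null_comparison[OF ev r(2)[unfolded null_seq_def]] lim] show ?thesis by simp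
qed

lemma completion_add: assumes s: "s \<in> cauchy_seqs A" and t: "t \<in> cauchy_seqs A"
  shows "cadd Q (cl s) (cl t) = cl (%n. s n \<oplus> t n)"
proof -
  note r = rep_cl[OF s] rep_cl[OF t]
  note [simp] = cauchy_seqs_mem[OF r(1)] cauchy_seqs_mem[OF r(3)] cauchy_seqs_mem[OF s] cauchy_seqs_mem[OF t]
  have "null_seq (%n. cauchy_rep (cl s) n \<oplus> cauchy_rep (cl t) n) (%n. s n \<oplus> t n)"
  proof (rule null_seqI)
    fix n
    have "cdiff A (cauchy_rep (cl s) n \<oplus> cauchy_rep (cl t) n) (s n \<oplus> t n)
      = cdiff A (cauchy_rep (cl s) n) (s n) \<oplus> cdiff A (cauchy_rep (cl t) n) (t n)"
      by (rule vec_eqI) auto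
    then show "cnorm A (cdiff A (cauchy_rep (cl s) n \<oplus> cauchy_rep (cl t) n) (s n \<oplus> t n))
      <= cnorm A (cdiff A (cauchy_rep (cl s) n) (s n)) + cnorm A (cdiff A (cauchy_rep (cl t) n) (t n))"
      using norm_plus by simp
  next
    show "(%n. cnorm A (cdiff A (cauchy_rep (cl s) n) (s n)) + cnorm A (cdiff A (cauchy_rep (cl t) n) (t n))) ----> 0"
      using tendsto_add[OF r(2)[unfolded null_seq_def] r(4)[unfolded null_seq_def]] by simp
  qed auto
  then show ?thesis
    using cauchy_seqs_add[OF r(1) r(3)] cauchy_seqs_add[OF s t] by (simp add: completion_def cl_eq_iff)
qed

lemma completion_times: assumes s: "s \<in> cauchy_seqs A" and t: "t \<in> cauchy_seqs A"
  shows "cmult Q (cl s) (cl t) = cl (%n. s n \<cdot> t n)"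
proof -
  note r = rep_cl[OF s] rep_cl[OF t]
  note [simp] = cauchy_seqs_mem[OF r(1)] cauchy_seqs_mem[OF r(3)] cauchy_seqs_mem[OF s] cauchy_seqs_mem[OF t]
  obtain K1 where K1: "0 < K1" "!!n. cnorm A (s n) <= K1" using cauchy_seqs_bounded[OF s] by auto
  obtain K2 where K2: "0 < K2" "!!n. cnorm A (cauchy_rep (cl t) n) <= K2" using cauchy_seqs_bounded[OF r(3)] by auto
  have "null_seq (%n. cauchy_rep (cl s) n \<cdot> cauchy_rep (cl t) n) (%n. s n \<cdot> t n)"
  proof (rule null_seqI)
    fix n
    let ?x = "cauchy_rep (cl s) n" and ?y = "cauchy_rep (cl t) n"
    have eq: "cdiff A (?x \<cdot> ?y) (s n \<cdot> t n) = cdiff A ?x (s n) \<cdot> ?y \<oplus> s n \<cdot> cdiff A ?y (t n)"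
      by (rule vec_eqI) (auto simp: expand_simps)
    have "cnorm A (cdiff A ?x (s n) \<cdot> ?y) <= cnorm A (cdiff A ?x (s n)) * cnorm A ?y" by (intro norm_times) auto
    also have "... <= cnorm A (cdiff A ?x (s n)) * K2" by (intro mult_left_mono K2 norm_ge_zero) auto
    finally have 1: "cnorm A (cdiff A ?x (s n) \<cdot> ?y) <= cnorm A (cdiff A ?x (s n)) * K2" .
    have "cnorm A (s n \<cdot> cdiff A ?y (t n)) <= cnorm A (s n) * cnorm A (cdiff A ?y (t n))" by (intro norm_times) auto
    also have "... <= K1 * cnorm A (cdiff A ?y (t n))" by (intro mult_right_mono K1 norm_ge_zero) auto
    finally show "cnorm A (cdiff A (?x \<cdot> ?y) (s n \<cdot> t n)) <= cnorm A (cdiff A ?x (s n)) * K2 + K1 * cnorm A (cdiff A ?y (t n))"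
      unfolding eq using 1 norm_plus[of "cdiff A ?x (s n) \<cdot> ?y" "s n \<cdot> cdiff A ?y (t n)"] by simp
  next
    have "(%n. cnorm A (cdiff A (cauchy_rep (cl s) n) (s n)) * K2 + K1 * cnorm A (cdiff A (cauchy_rep (cl t) n) (t n))) ----> 0 * K2 + K1 * 0"
      by (intro tendsto_intros r(2)[unfolded null_seq_def] r(4)[unfolded null_seq_def])
    then show "(%n. cnorm A (cdiff A (cauchy_rep (cl s) n) (s n)) * K2 + K1 * cnorm A (cdiff A (cauchy_rep (cl t) n) (t n))) ----> 0"
      by simp
  qed auto
  then show ?thesis
    using cauchy_seqs_times[OF r(1) r(3)] cauchy_seqs_times[OF s t] by (simp add: completion_def cl_eq_iff)
qed

lemma completion_smult: assumes s: "s \<in> cauchy_seqs A"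
  shows "csmult Q c (cl s) = cl (%n. c \<odot> s n)"
proof -
  note r = rep_cl[OF s]
  note [simp] = cauchy_seqs_mem[OF r(1)] cauchy_seqs_mem[OF s]
  have "null_seq (%n. c \<odot> cauchy_rep (cl s) n) (%n. c \<odot> s n)"
  proof (rule null_seqI)
    fix n
    have "cdiff A (c \<odot> cauchy_rep (cl s) n) (c \<odot> s n) = c \<odot> cdiff A (cauchy_rep (cl s) n) (s n)"
      by (rule vec_eqI) (auto simp: algebra_simps)
    then show "cnorm A (cdiff A (c \<odot> cauchy_rep (cl s) n) (c \<odot> s n)) <= cmod c * cnorm A (cdiff A (cauchy_rep (cl s) n) (s n))"
      by (simp add: norm_scale)
  next
    show "(%n. cmod c * cnorm A (cdiff A (cauchy_rep (cl s) n) (s n))) ----> 0"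
      by (intro tendsto_mult_right_zero r(2)[unfolded null_seq_def])
  qed auto
  then show ?thesis
    using cauchy_seqs_smult[OF r(1)] cauchy_seqs_smult[OF s] by (simp add: completion_def cl_eq_iff)
qed

lemma completion_adj: assumes s: "s \<in> cauchy_seqs A"
  shows "cstar Q (cl s) = cl (%n. cstar A (s n))"
proof -
  note r = rep_cl[OF s]
  note [simp] = cauchy_seqs_mem[OF r(1)] cauchy_seqs_mem[OF s]
  have "null_seq (%n. cstar A (cauchy_rep (cl s) n)) (%n. cstar A (s n))"
    using r(2) by (simp add: null_seq_def adj_diff[symmetric] norm_adj)
  then show ?thesis
    using cauchy_seqs_adj[OF r(1)] cauchy_seqs_adj[OF s] by (simp add: completion_def cl_eq_iff)
qed

lemma completion_zero: "czero Q = cl (%_. \<zero>)"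
  by (simp add: completion_def)

lemma completion_diff: assumes s: "s \<in> cauchy_seqs A" and t: "t \<in> cauchy_seqs A"
  shows "cdiff Q (cl s) (cl t) = cl (%n. cdiff A (s n) (t n))"
  unfolding cdiff_def by (simp add: completion_smult[OF t] completion_add[OF s cauchy_seqs_smult[OF t]])

lemma cauchy_seqs_diff: "s \<in> cauchy_seqs A ==> t \<in> cauchy_seqs A ==> (%n. cdiff A (s n) (t n)) \<in> cauchy_seqs A"
  unfolding cdiff_def by (intro cauchy_seqs_add cauchy_seqs_smult)

lemma norm_cl_const: "x \<in> car A ==> cnorm Q (cl (%_. x)) = cnorm A x"
  using completion_norm[OF cauchy_seqs_const, of x] by (simp add: LIMSEQ_const_iff)

lemma pre_cstar_completion: "pre_cstar_algebra Q"
proof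
  note cs = cauchy_seqs_add cauchy_seqs_smult cauchy_seqs_times cauchy_seqs_adj cauchy_seqs_const[OF zero_mem]
  note cc = completion_add completion_smult completion_times completion_adj completion_zero
  fix X Y Z c d
  show "czero Q \<in> car Q" unfolding completion_zero by (intro cl_mem cs)
  assume "X \<in> car Q"
  then obtain s where s: "s \<in> cauchy_seqs A" and X: "X = cl s" by (rule cl_cases)
  note sm = cauchy_seqs_mem[OF s]
  show "csmult Q c X \<in> car Q" "cstar Q X \<in> car Q" unfolding X using s by (auto simp: cc cs)
  show "cadd Q (czero Q) X = X" "cadd Q X (csmult Q (- 1) X) = czero Q"
    "csmult Q (c + d) X = cadd Q (csmult Q c X) (csmult Q d X)"
    "csmult Q c (csmult Q d X) = csmult Q (c * d) X" "csmult Q 1 X = X"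
    "cstar Q (cstar Q X) = X" "cstar Q (csmult Q c X) = csmult Q (cnj c) (cstar Q X)"
    unfolding X using s by (simp_all add: cc cs sm zero_plus plus_inverse plus_smult smult_assoc one_smult adj_adj adj_smult)
  note nX = completion_norm[OF s]
  show "0 <= cnorm Q X" unfolding X by (rule LIMSEQ_le_const[OF nX]) (auto simp: norm_ge_zero sm)
  show "cnorm Q (csmult Q c X) = cmod c * cnorm Q X"
  proof (rule LIMSEQ_unique)
    show "(%n. cnorm A (c \<odot> s n)) ----> cnorm Q (csmult Q c X)"
      unfolding X completion_smult[OF s] by (intro completion_norm cs s)
    show "(%n. cnorm A (c \<odot> s n)) ----> cmod c * cnorm Q X"
      unfolding X using tendsto_mult_left[OF nX, of "cmod c"] by (simp add: norm_scale sm)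
  qed
  show "cnorm Q (cmult Q (cstar Q X) X) = (cnorm Q X)\<^sup>2"
  proof (rule LIMSEQ_unique)
    show "(%n. cnorm A (cstar A (s n) \<cdot> s n)) ----> cnorm Q (cmult Q (cstar Q X) X)"
      unfolding X completion_adj[OF s] completion_times[OF cauchy_seqs_adj[OF s] s] by (intro completion_norm cs s)
    show "(%n. cnorm A (cstar A (s n) \<cdot> s n)) ----> (cnorm Q X)\<^sup>2"
      unfolding X using tendsto_power[OF nX, of 2] by (simp add: norm_adj_times sm)
  qed
  assume "Y \<in> car Q"
  then obtain t where t: "t \<in> cauchy_seqs A" and Y: "Y = cl t" by (rule cl_cases)
  note tm = cauchy_seqs_mem[OF t]
  note nY = completion_norm[OF t]
  show "cadd Q X Y \<in> car Q" "cmult Q X Y \<in> car Q" unfolding X Y using s t by (auto simp: cc cs)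
  show "cadd Q X Y = cadd Q Y X"
    unfolding X Y using s t by (simp add: cc cs) (simp add: plus_commute sm tm)
  show "csmult Q c (cadd Q X Y) = cadd Q (csmult Q c X) (csmult Q c Y)"
    "cmult Q (csmult Q c X) Y = csmult Q c (cmult Q X Y)" "cmult Q X (csmult Q c Y) = csmult Q c (cmult Q X Y)"
    "cstar Q (cadd Q X Y) = cadd Q (cstar Q X) (cstar Q Y)" "cstar Q (cmult Q X Y) = cmult Q (cstar Q Y) (cstar Q X)"
    unfolding X Y using s t by (simp_all add: cc cs sm tm smult_plus smult_times times_smult adj_plus adj_times)
  show "cnorm Q (cadd Q X Y) <= cnorm Q X + cnorm Q Y"
    unfolding X Y completion_add[OF s t]
    by (rule LIMSEQ_le[OF completion_norm[OF cauchy_seqs_add[OF s t]] tendsto_add[OF nX nY]]) (auto intro!: norm_plus sm tm)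
  show "cnorm Q (cmult Q X Y) <= cnorm Q X * cnorm Q Y"
    unfolding X Y completion_times[OF s t]
    by (rule LIMSEQ_le[OF completion_norm[OF cauchy_seqs_times[OF s t]] tendsto_mult[OF nX nY]]) (auto intro!: norm_times sm tm)
  assume "Z \<in> car Q"
  then obtain u where u: "u \<in> cauchy_seqs A" and Z: "Z = cl u" by (rule cl_cases)
  note um = cauchy_seqs_mem[OF u]
  show "cadd Q (cadd Q X Y) Z = cadd Q X (cadd Q Y Z)" "cmult Q (cmult Q X Y) Z = cmult Q X (cmult Q Y Z)"
    "cmult Q X (cadd Q Y Z) = cadd Q (cmult Q X Y) (cmult Q X Z)"
    "cmult Q (cadd Q X Y) Z = cadd Q (cmult Q X Z) (cmult Q Y Z)"
    unfolding X Y Z using s t u by (simp_all add: cc cs sm tm um plus_assoc times_assoc times_plus plus_times)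
qed

lemma cl_const_approx:
  assumes s: "s \<in> cauchy_seqs A" and r: "0 < r"
  obtains N where "\<forall>n\<ge>N. cnorm Q (cdiff Q (cl s) (cl (%_. s n))) <= r"
proof -
  obtain N where "\<forall>m\<ge>N. \<forall>n\<ge>N. cnorm A (cdiff A (s m) (s n)) < r" by (rule cauchy_seqsD[OF s r])
  note N = this[rule_format]
  have "cnorm Q (cdiff Q (cl s) (cl (%_. s n))) <= r" if n: "n \<ge> N" for n
  proof -
    have c: "(%_. s n) \<in> cauchy_seqs A" by (intro cauchy_seqs_const cauchy_seqs_mem[OF s])
    have "(%m. cnorm A (cdiff A (s m) (s n))) ----> cnorm Q (cdiff Q (cl s) (cl (%_. s n)))"
      unfolding completion_diff[OF s c] by (rule completion_norm[OF cauchy_seqs_diff[OF s c]])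
    moreover have "\<exists>N. \<forall>m\<ge>N. cnorm A (cdiff A (s m) (s n)) <= r" using N[OF _ n] less_imp_le by blast
    ultimately show ?thesis by (rule LIMSEQ_le_const2)
  qed
  then have "\<forall>n\<ge>N. cnorm Q (cdiff Q (cl s) (cl (%_. s n))) <= r" by simp
  then show ?thesis by (rule that)
qed

lemma cl_ctends:
  assumes s: "s \<in> cauchy_seqs A" shows "ctends Q (%n. cl (%_. s n)) (cl s)"
  unfolding ctends_def
proof (intro conjI allI metric_LIMSEQ_I)
  interpret Q: pre_cstar_algebra Q by (rule pre_cstar_completion)
  have mem: "cl (%_. s n) \<in> car Q" for n by (intro cl_mem cauchy_seqs_const cauchy_seqs_mem[OF s])
  fix r :: real assume "0 < r"
  then have "0 < r / 2" by simp
  then obtain N where N: "\<forall>n\<ge>N. cnorm Q (cdiff Q (cl s) (cl (%_. s n))) <= r / 2" by (rule cl_const_approx[OF s])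
  have "dist (cnorm Q (cdiff Q (cl (%_. s n)) (cl s))) 0 < r" if "n \<ge> N" for n
    using N that \<open>0 < r\<close> Q.norm_diff_commute[OF mem cl_mem[OF s], of n] Q.norm_ge_zero[OF Q.diff_mem[OF mem cl_mem[OF s]], of n]
    by (auto simp: dist_real_def)
  then show "\<exists>N. \<forall>n\<ge>N. dist (cnorm Q (cdiff Q (cl (%_. s n)) (cl s))) 0 < r" by blast
qed (auto intro!: cl_mem cauchy_seqs_const cauchy_seqs_mem[OF s] s)

text \<open>Each term of a Cauchy sequence in the completion is replaced by a constant sequence at
  distance at most \<open>1 / Suc k\<close>; the constants form a Cauchy sequence in
  \<open>A\<close>, and its class is the limit.\<close>

lemma cstar_algebra_completion: "cstar_algebra Q"
proof (rule cstar_algebraI[OF pre_cstar_completion])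
  interpret Q: pre_cstar_algebra Q by (rule pre_cstar_completion)
  fix X assume "X \<in> car Q" and n0: "cnorm Q X = 0"
  then obtain s where s: "s \<in> cauchy_seqs A" and X: "X = cl s" by (metis cl_cases)
  have "(%n. cnorm A (s n)) ----> 0" using completion_norm[OF s] n0 X by simp
  moreover have "cdiff A (s n) \<zero> = s n" for n by (rule vec_eqI) (auto simp: cauchy_seqs_mem[OF s])
  ultimately have "null_seq s (%_. \<zero>)" by (simp add: null_seq_def)
  then show "X = czero Q" unfolding X completion_zero using cl_eq_iff[OF s cauchy_seqs_const[OF zero_mem]] by simp
next
  interpret Q: pre_cstar_algebra Q by (rule pre_cstar_completion)
  fix S assume S: "S \<in> cauchy_seqs Q"
  have Smem: "S k \<in> car Q" for k by (rule cauchy_seqs_mem[OF S])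
  have "\<exists>u. u \<in> car A \<and> cnorm Q (cdiff Q (S k) (cl (%_. u))) <= 1 / real (Suc k)" for k
  proof -
    obtain s where s: "s \<in> cauchy_seqs A" "S k = cl s" using Smem[of k] by (metis cl_cases)
    have "0 < 1 / real (Suc k)" by simp
    then obtain N where "\<forall>n\<ge>N. cnorm Q (cdiff Q (cl s) (cl (%_. s n))) <= 1 / real (Suc k)"
      by (rule cl_const_approx[OF s(1)])
    then show ?thesis using s cauchy_seqs_mem[OF s(1), of N] by auto
  qed
  then obtain u where u: "!!k. u k \<in> car A" "!!k. cnorm Q (cdiff Q (S k) (cl (%_. u k))) <= 1 / real (Suc k)"
    by metis
  have umem: "cl (%_. u k) \<in> car Q" for k by (intro cl_mem cauchy_seqs_const u)
  have inv: "(%k. 1 / real (Suc k)) ----> 0" using LIMSEQ_inverse_real_of_nat by (simp add: inverse_eq_divide)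
  have ucauchy: "u \<in> cauchy_seqs A"
  proof (rule cauchy_seqsI')
    fix r :: real assume "0 < r"
    then have r: "0 < r / 3" by simp
    then obtain N where "\<forall>m\<ge>N. \<forall>n\<ge>N. cnorm Q (cdiff Q (S m) (S n)) < r / 3" by (rule cauchy_seqsD[OF S])
    note N = this[rule_format]
    obtain N' where N': "!!n. n \<ge> N' ==> 1 / real (Suc n) < r / 3"
      using order_tendstoD(2)[OF inv r] by (auto simp: eventually_sequentially)
    have "cnorm A (cdiff A (u m) (u n)) < r" if "m \<ge> max N N'" "n \<ge> max N N'" for m n
    proof -
      have "cnorm A (cdiff A (u m) (u n)) = cnorm Q (cdiff Q (cl (%_. u m)) (cl (%_. u n)))"
        using norm_cl_const[of "cdiff A (u m) (u n)"] u(1) completion_diff[OF cauchy_seqs_const cauchy_seqs_const, of "u m" "u n"] by simp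
      also have "... <= cnorm Q (cdiff Q (cl (%_. u m)) (S m)) + cnorm Q (cdiff Q (S m) (cl (%_. u n)))"
        by (intro Q.norm_diff_triangle umem Smem)
      also have "... <= cnorm Q (cdiff Q (S m) (cl (%_. u m))) + (cnorm Q (cdiff Q (S m) (S n)) + cnorm Q (cdiff Q (S n) (cl (%_. u n))))"
        using Q.norm_diff_commute[OF umem Smem, of m m] Q.norm_diff_triangle[OF Smem Smem umem, of m n n] by simp
      also have "... < r" using u(2)[of m] u(2)[of n] N[of m n] N'[of m] N'[of n] that by simp
      finally show ?thesis .
    qed
    then show "\<exists>N. \<forall>m\<ge>N. \<forall>n\<ge>N. cnorm A (cdiff A (u m) (u n)) < r" by blast
  qed (rule u(1))
  have "ctends Q S (cl u)"
  proof (rule Q.ctendsI)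
    show "cnorm Q (cdiff Q (S n) (cl u)) <= 1 / real (Suc n) + cnorm Q (cdiff Q (cl (%_. u n)) (cl u))" for n
      using Q.norm_diff_triangle[OF Smem umem cl_mem[OF ucauchy], of n n] u(2)[of n] by simp
    show "(%n. 1 / real (Suc n) + cnorm Q (cdiff Q (cl (%_. u n)) (cl u))) ----> 0"
      using tendsto_add[OF inv, of "%n. cnorm Q (cdiff Q (cl (%_. u n)) (cl u))" 0] cl_ctends[OF ucauchy]
      by (simp add: ctends_def)
  qed (intro Smem cl_mem ucauchy)+
  then show "\<exists>l. ctends Q S l" by blast
qed

text \<open>The homomorphism is extended along Cauchy sequences. Isometry makes the extension well
  defined and injective, and it turns approximations of a given \<open>y\<close> into Cauchy
  sequences, whence surjectivity.\<close>

lemma completion_iso: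
  assumes B: "cstar_algebra B" and f: "cstar_hom A B f"
    and iso: "!!x. x \<in> car A ==> cnorm B (f x) = cnorm A x"
    and dense: "!!y. y \<in> car B ==> \<exists>x. (\<forall>n. x n \<in> car A) \<and> ctends B (%n. f (x n)) y"
  shows "\<exists>F. cstar_iso Q B F \<and> (\<forall>x\<in>car A. F (cl (%_. x)) = f x)"
proof -
  interpret B: cstar_algebra B by fact
  have f': "!!x. x \<in> car A ==> f x \<in> car B"
    "!!x y. x \<in> car A ==> y \<in> car A ==> f (cadd A x y) = cadd B (f x) (f y)"
    "!!c x. x \<in> car A ==> f (csmult A c x) = csmult B c (f x)"
    "!!x y. x \<in> car A ==> y \<in> car A ==> f (cmult A x y) = cmult B (f x) (f y)"
    "!!x. x \<in> car A ==> f (cstar A x) = cstar B (f x)"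
    using f unfolding cstar_hom_def by auto
  have fd: "cnorm B (cdiff B (f x) (f y)) = cnorm A (cdiff A x y)" if "x \<in> car A" "y \<in> car A" for x y
    using iso[of "cdiff A x y"] that by (simp add: cdiff_def f')
  have fc: "(%n. f (s n)) \<in> cauchy_seqs B \<longleftrightarrow> s \<in> cauchy_seqs A" if "!!n. s n \<in> car A" for s
    using that by (auto simp: cauchy_seqs_def fd f')
  define F where "F X = (THE y. ctends B (%n. f (cauchy_rep X n)) y)" for X
  have lim: "ctends B (%n. f (cauchy_rep X n)) (F X)" if "X \<in> car Q" for X
  proof -
    have r: "cauchy_rep X \<in> cauchy_seqs A" using rep_mem(1)[OF that] .
    then have "(%n. f (cauchy_rep X n)) \<in> cauchy_seqs B" using fc cauchy_seqs_mem[OF r] by blast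
    then obtain y where y: "ctends B (%n. f (cauchy_rep X n)) y" by (rule B.cauchy_convergent)
    then have "F X = y" unfolding F_def using B.ctends_unique by (intro the_equality) blast+
    with y show ?thesis by simp
  qed
  have Fcl: "F (cl s) = y" if s: "s \<in> cauchy_seqs A" and y: "ctends B (%n. f (s n)) y" for s y
  proof (rule B.ctends_unique)
    note r = rep_cl[OF s]
    show "ctends B (%n. f (cauchy_rep (cl s) n)) (F (cl s))" by (rule lim[OF cl_mem[OF s]])
    show "ctends B (%n. f (cauchy_rep (cl s) n)) y"
    proof (rule B.ctendsI)
      fix n
      show "cnorm B (cdiff B (f (cauchy_rep (cl s) n)) y)
          <= cnorm A (cdiff A (cauchy_rep (cl s) n) (s n)) + cnorm B (cdiff B (f (s n)) y)"
        using B.norm_diff_triangle[of "f (cauchy_rep (cl s) n)" "f (s n)" y] ctends_mem[OF y]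
        by (simp add: f' fd cauchy_seqs_mem[OF r(1)] cauchy_seqs_mem[OF s])
    next
      show "(%n. cnorm A (cdiff A (cauchy_rep (cl s) n) (s n)) + cnorm B (cdiff B (f (s n)) y)) ----> 0"
        using tendsto_add[OF r(2)[unfolded null_seq_def], of "%n. cnorm B (cdiff B (f (s n)) y)" 0] y
        by (simp add: ctends_def)
    qed (use ctends_mem[OF y] f' cauchy_seqs_mem[OF r(1)] in auto)
  qed
  have limcl: "ctends B (%n. f (s n)) (F (cl s))" if s: "s \<in> cauchy_seqs A" for s
  proof -
    have "(%n. f (s n)) \<in> cauchy_seqs B" using fc cauchy_seqs_mem[OF s] s by blast
    then obtain y where "ctends B (%n. f (s n)) y" by (rule B.cauchy_convergent)
    with Fcl[OF s this] show ?thesis by simp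
  qed
  have hom: "cstar_hom Q B F"
    unfolding cstar_hom_def
  proof (intro conjI ballI allI)
    show "F \<in> car Q \<rightarrow> car B" by (rule Pi_I) (rule ctends_mem(2)[OF lim])
    fix X assume "X \<in> car Q"
    then obtain s where s: "s \<in> cauchy_seqs A" and X: "X = cl s" by (rule cl_cases)
    note sm = cauchy_seqs_mem[OF s]
    show "F (csmult Q c X) = csmult B c (F X)" for c
      unfolding X completion_smult[OF s]
      by (rule Fcl[OF cauchy_seqs_smult[OF s]]) (simp add: f' sm B.ctends_smult limcl s)
    show "F (cstar Q X) = cstar B (F X)"
      unfolding X completion_adj[OF s]
      by (rule Fcl[OF cauchy_seqs_adj[OF s]]) (simp add: f' sm B.ctends_adj limcl s)
    fix Y assume "Y \<in> car Q"
    then obtain t where t: "t \<in> cauchy_seqs A" and Y: "Y = cl t" by (rule cl_cases)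
    note tm = cauchy_seqs_mem[OF t]
    show "F (cadd Q X Y) = cadd B (F X) (F Y)"
      unfolding X Y completion_add[OF s t]
      by (rule Fcl[OF cauchy_seqs_add[OF s t]]) (simp add: f' sm tm B.ctends_add limcl s t)
    show "F (cmult Q X Y) = cmult B (F X) (F Y)"
      unfolding X Y completion_times[OF s t]
      by (rule Fcl[OF cauchy_seqs_times[OF s t]]) (simp add: f' sm tm B.ctends_times limcl s t)
  qed
  have "inj_on F (car Q)"
  proof (rule inj_onI)
    fix X Y assume "X \<in> car Q" "Y \<in> car Q" and FXY: "F X = F Y"
    obtain s where s: "s \<in> cauchy_seqs A" and X: "X = cl s" using \<open>X \<in> car Q\<close> by (rule cl_cases)
    obtain t where t: "t \<in> cauchy_seqs A" and Y: "Y = cl t" using \<open>Y \<in> car Q\<close> by (rule cl_cases)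
    note sm = cauchy_seqs_mem[OF s] and tm = cauchy_seqs_mem[OF t]
    have "ctends B (%n. cdiff B (f (s n)) (f (t n))) (cdiff B (F X) (F Y))"
      unfolding X Y by (intro B.ctends_diff limcl s t)
    then have "(%n. cnorm A (cdiff A (s n) (t n))) ----> cnorm B (cdiff B (F X) (F Y))"
      by (drule_tac B.ctends_norm) (simp add: fd sm tm)
    moreover have "cdiff B (F X) (F Y) = czero B"
      using FXY B.diff_self ctends_mem(2)[OF limcl[OF t]] Y by simp
    ultimately have "null_seq s t" by (simp add: null_seq_def B.norm_zero)
    then show "X = Y" unfolding X Y using cl_eq_iff[OF s t] by simp
  qed
  moreover have "F ` car Q = car B"
  proof
    show "F ` car Q \<subseteq> car B" by (rule image_subsetI) (rule ctends_mem(2)[OF lim])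
    show "car B \<subseteq> F ` car Q"
    proof
      fix y assume "y \<in> car B"
      then obtain x where x: "!!n. x n \<in> car A" "ctends B (%n. f (x n)) y" using dense[of y] by blast
      have xc: "x \<in> cauchy_seqs A" using fc[OF x(1)] B.ctends_cauchy[OF x(2)] by simp
      show "y \<in> F ` car Q"
        using Fcl[OF xc x(2)] cl_mem[OF xc] by (intro image_eqI[of _ _ "cl x"]) simp_all
    qed
  qed
  moreover have "F (cl (%_. x)) = f x" if "x \<in> car A" for x
    by (rule Fcl[OF cauchy_seqs_const[OF that]]) (rule B.ctends_const[OF f'(1)[OF that]])
  ultimately show ?thesis
    using hom B cstar_algebra_completion unfolding cstar_iso_def bij_betw_def by (intro exI[of _ F]) simp
qed

end

section \<open>Tensor products\<close>

interpretation pm: vector_space "pm_scale :: complex => ('x \<Rightarrow>\<^sub>0 complex) => ('x \<Rightarrow>\<^sub>0 complex)"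
  by (rule vector_space_pm_scale)

lemma pm_induct [case_names zero add]:
  fixes u :: "'x \<Rightarrow>\<^sub>0 complex"
  assumes "keys u \<subseteq> S" "Q 0"
    and "!!x c u. x \<in> S ==> keys u \<subseteq> S ==> Q u ==> Q (single x c + u)"
  shows "Q u"
proof -
  have "keys (\<Sum>x\<in>T. single x (g x)) \<subseteq> S \<and> Q (\<Sum>x\<in>T. single x (g x))"
    if "finite T" "T \<subseteq> S" for T g
    using that
  proof (induction T rule: finite_induct)
    case (insert x T)
    then have "x \<in> S" and IH: "keys (\<Sum>x\<in>T. single x (g x)) \<subseteq> S" "Q (\<Sum>x\<in>T. single x (g x))" by auto
    then have "keys (single x (g x) + (\<Sum>x\<in>T. single x (g x))) \<subseteq> S"
      using keys_add[of "single x (g x)" "\<Sum>x\<in>T. single x (g x)"] by (auto split: if_splits)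
    then show ?case using assms(3)[OF \<open>x \<in> S\<close> IH] insert by simp
  qed (use assms in auto)
  moreover have "u = (\<Sum>x\<in>keys u. single x (lookup u x))"
  proof (rule poly_mapping_eqI)
    fix k
    have "lookup (\<Sum>x\<in>keys u. single x (lookup u x)) k
        = (\<Sum>x\<in>keys u. if x = k then lookup u k else 0)"
      unfolding lookup_sum by (intro sum.cong) (auto simp: lookup_single when_def)
    also have "... = lookup u k" by (simp add: in_keys_iff)
    finally show "lookup u k = lookup (\<Sum>x\<in>keys u. single x (lookup u x)) k" ..
  qed
  ultimately show ?thesis using assms(1) by (metis finite_keys)
qed

text \<open>Cancellation may shrink the support of \<open>u + v\<close>, so all three sums are
  compared over the union of the supports of \<open>u\<close> and \<open>v\<close>.\<close>

lemma pm_sum_add: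
  fixes f :: "'x => complex => 'm::comm_monoid_add"
  assumes "!!x. f x 0 = 0" "!!x c d. f x (c + d) = f x c + f x d"
  shows "(\<Sum>x\<in>keys (u + v). f x (lookup (u + v) x))
    = (\<Sum>x\<in>keys u. f x (lookup u x)) + (\<Sum>x\<in>keys v. f x (lookup v x))"
proof -
  let ?S = "keys u \<union> keys v"
  have *: "(\<Sum>x\<in>keys w. f x (lookup w x)) = (\<Sum>x\<in>?S. f x (lookup w x))"
    if "keys w \<subseteq> ?S" for w
    using that assms(1) by (intro sum.mono_neutral_left) (auto simp: in_keys_iff)
  show ?thesis
    by (subst (1 2 3) *) (auto simp: lookup_add assms(2) sum.distrib dest: keys_add[THEN subsetD])
qed

text \<open>Linear extension of a map given on the points.\<close>

definition pext :: "('x => ('y \<Rightarrow>\<^sub>0 complex)) => ('x \<Rightarrow>\<^sub>0 complex) => ('y \<Rightarrow>\<^sub>0 complex)" where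
  "pext f u = (\<Sum>x\<in>keys u. pm_scale (lookup u x) (f x))"

lemma pext_zero [simp]: "pext f 0 = 0" by (simp add: pext_def)

lemma pext_add: "pext f (u + v) = pext f u + pext f v"
  unfolding pext_def by (rule pm_sum_add) (auto simp: pm.scale_left_distrib)

lemma pext_single [simp]: "pext f (single x c) = pm_scale c (f x)"
  by (cases "c = 0") (simp_all add: pext_def)

lemma pext_scale: "pext f (pm_scale c u) = pm_scale c (pext f u)"
proof (cases "c = 0")
  case False
  then have "keys (pm_scale c u) = keys u" by (auto simp: in_keys_iff)
  then show ?thesis by (simp add: pext_def pm.scale_sum_right)
qed simp

lemma pm_scale_zero_left [simp]: "pm_scale 0 u = 0" by (rule poly_mapping_eqI) simp

lemma free_tensor_mult_pext:
  "free_tensor_mult A B u v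
    = pext (%x. pext (%y. single (cmult A (fst x) (fst y), cmult B (snd x) (snd y)) 1) v) u"
  by (simp add: free_tensor_mult_def pext_def pm.scale_sum_right case_prod_unfold pm.scale_scale)

lemma pm_minus: "u - v = u + pm_scale (- 1) (v :: 'x \<Rightarrow>\<^sub>0 complex)"
  by (rule poly_mapping_eqI) (simp add: lookup_add lookup_minus)

text \<open>The map of the free spaces induced by \<open>g\<close> and \<open>h\<close>. It is
  linear whatever \<open>g\<close> and \<open>h\<close> are; their own linearity matters only modulo
  the bilinearity relations.\<close>

definition tmap :: "('a => 'c) => ('b => 'd) => ('a \<times> 'b \<Rightarrow>\<^sub>0 complex) => ('c \<times> 'd \<Rightarrow>\<^sub>0 complex)" where
  "tmap g h u = pext (%x. single (g (fst x), h (snd x)) 1) u"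

lemma tmap_zero [simp]: "tmap g h 0 = 0"
  and tmap_add: "tmap g h (u + v) = tmap g h u + tmap g h v"
  and tmap_scale: "tmap g h (pm_scale c u) = pm_scale c (tmap g h u)"
  and tmap_single: "tmap g h (single (a, b) c) = single (g a, h b) c"
  by (simp_all add: tmap_def pext_add pext_scale)

lemma tmap_diff: "tmap g h (u - v) = tmap g h u - tmap g h v"
  by (simp only: pm_minus tmap_add tmap_scale)

lemma ftm_zero_left [simp]: "free_tensor_mult A B 0 v = 0"
  and ftm_zero_right [simp]: "free_tensor_mult A B u 0 = 0"
  and ftm_add_left: "free_tensor_mult A B (u + u') v = free_tensor_mult A B u v + free_tensor_mult A B u' v"
  and ftm_scale_left: "free_tensor_mult A B (pm_scale c u) v = pm_scale c (free_tensor_mult A B u v)"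
  by (simp_all add: free_tensor_mult_pext pext_add pext_scale) (simp add: pext_def)

lemma pext_fun_add: "pext (%x. f x + g x) u = pext f u + pext g u"
  by (simp add: pext_def pm.scale_right_distrib sum.distrib)

lemma pext_fun_scale: "pext (%x. pm_scale c (f x)) u = pm_scale c (pext f u)"
  by (simp add: pext_def pm.scale_sum_right pm.scale_scale mult.commute)

lemma ftm_add_right: "free_tensor_mult A B u (v + v') = free_tensor_mult A B u v + free_tensor_mult A B u v'"
  and ftm_scale_right: "free_tensor_mult A B u (pm_scale c v) = pm_scale c (free_tensor_mult A B u v)"
  by (simp_all add: free_tensor_mult_pext pext_add pext_scale pext_fun_add pext_fun_scale)

lemma ftm_single: "free_tensor_mult A B (single (a, b) c) (single (a', b') d)
   = single (cmult A a a', cmult B b b') (c * d)"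
  by (simp add: free_tensor_mult_pext mult.commute)

lemma fts_zero [simp]: "free_tensor_star A B 0 = 0"
  by (simp add: free_tensor_star_def)

lemma fts_add: "free_tensor_star A B (u + v) = free_tensor_star A B u + free_tensor_star A B v"
  unfolding free_tensor_star_def case_prod_unfold prod.collapse
  by (rule pm_sum_add[where f="%x z. single (cstar A (fst x), cstar B (snd x)) (cnj z)"]) (auto simp: single_add)

lemma fts_single: "free_tensor_star A B (single (a, b) c) = single (cstar A a, cstar B b) (cnj c)"
  by (cases "c = 0") (simp_all add: free_tensor_star_def)

lemma fts_scale: "free_tensor_star A B (pm_scale c u) = pm_scale (cnj c) (free_tensor_star A B u)"
proof (cases "c = 0")
  case False
  then have "keys (pm_scale c u) = keys u" by (auto simp: in_keys_iff)
  then show ?thesis by (simp add: free_tensor_star_def pm.scale_sum_right case_prod_unfold)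
qed simp

lemma fts_diff: "free_tensor_star A B (u - v) = free_tensor_star A B u - free_tensor_star A B v"
  by (simp only: pm_minus fts_add fts_scale) simp

lemma ftm_diff_left: "free_tensor_mult A B (u - u') v = free_tensor_mult A B u v - free_tensor_mult A B u' v"
  and ftm_diff_right: "free_tensor_mult A B v (u - u') = free_tensor_mult A B v u - free_tensor_mult A B v u'"
  by (simp_all only: pm_minus ftm_add_left ftm_add_right ftm_scale_left ftm_scale_right)

lemmas ft_linear = tmap_add tmap_scale tmap_diff ftm_add_left ftm_add_right ftm_scale_left ftm_scale_right
  fts_add fts_scale ftm_diff_left ftm_diff_right fts_diff

locale tensor_pair = A: cstar_algebra A + B: cstar_algebra B
  for A :: "'a cstar_alg" and B :: "'b cstar_alg"
begin

abbreviation "FC \<equiv> free_tensor_carrier A B"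
abbreviation "FT \<equiv> free_tensor A B"
abbreviation "fm \<equiv> free_tensor_mult A B"
abbreviation "fs \<equiv> free_tensor_star A B"
abbreviation sng :: "'a => 'b => complex => ('a \<times> 'b \<Rightarrow>\<^sub>0 complex)" where "sng a b c \<equiv> single (a, b) c"

lemma FC_zero [simp, intro]: "0 \<in> FC" by (simp add: free_tensor_carrier_def)

lemma FC_single [simp, intro]: "a \<in> car A ==> b \<in> car B ==> sng a b c \<in> FC"
  by (simp add: free_tensor_carrier_def)

lemma FC_add [simp, intro]: "u \<in> FC ==> v \<in> FC ==> u + v \<in> FC"
  using keys_add[of u v] by (auto simp: free_tensor_carrier_def)

lemma FC_scale [simp, intro]: "u \<in> FC ==> pm_scale c u \<in> FC"
  using keys_pm_scale[of c u] by (auto simp: free_tensor_carrier_def)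

lemma FC_diff [simp, intro]: "u \<in> FC ==> v \<in> FC ==> u - v \<in> FC"
  using FC_add[of u "pm_scale (- 1) v"] FC_scale[of v "- 1"] by (simp only: pm_minus)

lemma FC_induct [consumes 1, case_names zero add]:
  assumes "u \<in> FC" "Q 0"
    and "!!a b c u. a \<in> car A ==> b \<in> car B ==> u \<in> FC ==> Q u ==> Q (sng a b c + u)"
  shows "Q u"
proof (rule pm_induct[of u "car A \<times> car B" Q])
  show "keys u \<subseteq> car A \<times> car B" using assms(1) by (simp add: free_tensor_carrier_def)
  show "Q 0" by fact
  fix x c u assume "x \<in> car A \<times> car B" "keys u \<subseteq> car A \<times> car B" "Q u"
  then show "Q (single x c + u)"
    using assms(3)[of "fst x" "snd x" u c] by (auto simp: free_tensor_carrier_def)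
qed

lemma FC_tmap [simp, intro]:
  assumes "u \<in> FC" "!!a. a \<in> car A ==> g a \<in> car A" "!!b. b \<in> car B ==> h b \<in> car B"
  shows "tmap g h u \<in> FC"
  using assms(1) by (induction rule: FC_induct) (auto simp: tmap_add tmap_single assms)

lemma FC_star [simp, intro]: "u \<in> FC ==> fs u \<in> FC"
  by (induction rule: FC_induct) (auto simp: fts_add fts_single)

lemma FC_mult [simp, intro]:
  assumes u: "u \<in> FC" and v: "v \<in> FC" shows "fm u v \<in> FC"
  using u
proof (induction rule: FC_induct)
  case (add a b c u)
  have "fm (sng a b c) v \<in> FC" using v
    by (induction rule: FC_induct) (use add in "auto simp: ftm_add_right ftm_single")
  then show ?case using add by (simp add: ftm_add_left)
qed simp

text \<open>Scalars are part of the generators \<open>sng a b c\<close>, so additivity of both sides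
  is enough.\<close>

lemma FC_eqI:
  assumes u: "u \<in> FC" and add: "!!v w. L (v + w) = L v + L w" "!!v w. K (v + w) = K v + K w"
    and zero: "L 0 = K 0"
    and sing: "!!a b c. a \<in> car A ==> b \<in> car B ==> L (sng a b c) = K (sng a b c)"
  shows "L u = K u"
  using u by (induction rule: FC_induct) (simp_all add: add zero sing)

lemma fm_assoc:
  assumes u: "u \<in> FC" and v: "v \<in> FC" and w: "w \<in> FC" shows "fm (fm u v) w = fm u (fm v w)"
proof (rule FC_eqI[OF u, where L="%u. fm (fm u v) w" and K="%u. fm u (fm v w)"])
  fix a b c assume ab: "a \<in> car A" "b \<in> car B"
  show "fm (fm (sng a b c) v) w = fm (sng a b c) (fm v w)"
  proof (rule FC_eqI[OF v, where L="%v. fm (fm (sng a b c) v) w" and K="%v. fm (sng a b c) (fm v w)"])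
    fix a' b' c' assume ab': "a' \<in> car A" "b' \<in> car B"
    show "fm (fm (sng a b c) (sng a' b' c')) w = fm (sng a b c) (fm (sng a' b' c') w)"
      by (rule FC_eqI[OF w, where L="%w. fm (fm (sng a b c) (sng a' b' c')) w" and K="%w. fm (sng a b c) (fm (sng a' b' c') w)"])
        (use ab ab' in "simp_all add: ft_linear ftm_single A.times_assoc B.times_assoc mult.assoc")
  qed (simp_all add: ft_linear)
qed (simp_all add: ft_linear)

lemma fs_mult:
  assumes u: "u \<in> FC" and v: "v \<in> FC" shows "fs (fm u v) = fm (fs v) (fs u)"
proof (rule FC_eqI[OF u, where L="%u. fs (fm u v)" and K="%u. fm (fs v) (fs u)"])
  fix a b c assume ab: "a \<in> car A" "b \<in> car B"
  show "fs (fm (sng a b c) v) = fm (fs v) (fs (sng a b c))"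
    by (rule FC_eqI[OF v, where L="%v. fs (fm (sng a b c) v)" and K="%v. fm (fs v) (fs (sng a b c))"])
      (use ab in "simp_all add: ft_linear ftm_single fts_single A.adj_times B.adj_times mult.commute")
qed (simp_all add: ft_linear)

lemma fs_fs: "u \<in> FC ==> fs (fs u) = u"
  by (rule FC_eqI[where L="%u. fs (fs u)" and K="%u. u"]) (simp_all add: ft_linear fts_single A.adj_adj B.adj_adj)

abbreviation "MA \<equiv> multiplier_algebra A"
abbreviation "MB \<equiv> multiplier_algebra B"

abbreviation "lact m n \<equiv> tmap (fst m) (fst n)"
abbreviation "ract m n \<equiv> tmap (snd m) (snd n)"

lemma ract_mult_lact:
  assumes m: "dcent A m" and n: "dcent B n" and u: "u \<in> FC" and v: "v \<in> FC"
  shows "fm (ract m n u) v = fm u (lact m n v)"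
proof (rule FC_eqI[OF u, where L="%u. fm (ract m n u) v" and K="%u. fm u (lact m n v)"])
  fix a b c assume ab: "a \<in> car A" "b \<in> car B"
  show "fm (ract m n (sng a b c)) v = fm (sng a b c) (lact m n v)"
    by (rule FC_eqI[OF v, where L="%v. fm (ract m n (sng a b c)) v" and K="%v. fm (sng a b c) (lact m n v)"])
      (use ab m n in "simp_all add: ft_linear ftm_single tmap_single A.snd_times_fst B.snd_times_fst")
qed (simp_all add: ft_linear)

lemma fs_ract:
  assumes m: "dcent A m" and n: "dcent B n" and u: "u \<in> FC"
  shows "fs (ract m n u) = lact (cstar MA m) (cstar MB n) (fs u)"
  by (rule FC_eqI[OF u, where L="%u. fs (ract m n u)" and K="%u. lact (cstar MA m) (cstar MB n) (fs u)"])
    (use m n in "simp_all add: ft_linear fts_single tmap_single A.adj_adj B.adj_adj")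

lemma fs_lact:
  assumes m: "dcent A m" and n: "dcent B n" and u: "u \<in> FC"
  shows "fs (lact m n u) = ract (cstar MA m) (cstar MB n) (fs u)"
  by (rule FC_eqI[OF u, where L="%u. fs (lact m n u)" and K="%u. ract (cstar MA m) (cstar MB n) (fs u)"])
    (use m n in "simp_all add: ft_linear fts_single tmap_single A.adj_adj B.adj_adj")

lemma lact_lact:
  assumes "dcent A m'" "dcent B n'" and u: "u \<in> FC"
  shows "lact m n (lact m' n' u) = lact (cmult MA m m') (cmult MB n n') u"
  by (rule FC_eqI[OF u, where L="%u. lact m n (lact m' n' u)" and K="%u. lact (cmult MA m m') (cmult MB n n') u"])
    (use assms in "simp_all add: ft_linear tmap_single")

text \<open>Moving the multipliers across the product shows that a seminorm computed from
  \<open>u\<^sup>* u\<close> sees them only through \<open>m\<^sup>* m\<close> and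
  \<open>n\<^sup>* n\<close>; this is the hypothesis \<open>isom\<close> of
  \<open>seminorm_le_norm\<close>.\<close>

lemma fs_lact_mult_lact:
  assumes m: "dcent A m" and n: "dcent B n" and u: "u \<in> FC" and v: "v \<in> FC"
  shows "fm (fs (lact m n u)) (lact m n v) = fm (fs u) (lact (cmult MA (cstar MA m) m) (cmult MB (cstar MB n) n) v)"
proof -
  have ms: "dcent A (cstar MA m)" "dcent B (cstar MB n)"
    using A.multiplier_adj_mem[OF m] B.multiplier_adj_mem[OF n] by auto
  have lv: "lact m n v \<in> FC" using v m n by auto
  show ?thesis
    unfolding fs_lact[OF m n u] ract_mult_lact[OF ms FC_star[OF u] lv] lact_lact[OF m n v] ..
qed

text \<open>The kernel of the projection onto the algebraic tensor product.\<close>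

definition tnull :: "('a \<times> 'b \<Rightarrow>\<^sub>0 complex) set" where
  "tnull = pm.span (bilinearity_relations A B)"

lemma relations_FC: "bilinearity_relations A B \<subseteq> FC"
proof -
  have "u - v - w \<in> FC" if "u \<in> FC" "v \<in> FC" "w \<in> FC" for u v w using that by auto
  then show ?thesis unfolding bilinearity_relations_def by (fastforce simp del: FC_diff)
qed

lemma tnull_FC: "u \<in> tnull ==> u \<in> FC"
proof -
  have "pm.subspace FC" unfolding pm.subspace_def by auto
  then show "u \<in> tnull ==> u \<in> FC" unfolding tnull_def using pm.span_minimal[OF relations_FC] by blast
qed

lemma tnull_zero: "0 \<in> tnull" and tnull_add: "u \<in> tnull ==> v \<in> tnull ==> u + v \<in> tnull"
  and tnull_scale: "u \<in> tnull ==> pm_scale c u \<in> tnull" and tnull_diff: "u \<in> tnull ==> v \<in> tnull ==> u - v \<in> tnull"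
  unfolding tnull_def by (auto intro: pm.span_zero pm.span_add pm.span_scale pm.span_diff)

lemma
  assumes [simp]: "a \<in> car A" "a' \<in> car A" "b \<in> car B" "b' \<in> car B"
  shows tnull_add_left: "sng (cadd A a a') b c - sng a b c - sng a' b c \<in> tnull"
    and tnull_add_right: "sng a (cadd B b b') c - sng a b c - sng a b' c \<in> tnull"
    and tnull_smult_left: "sng (csmult A d a) b c - sng a b (d * c) \<in> tnull"
    and tnull_smult_right: "sng a (csmult B d b) c - sng a b (d * c) \<in> tnull"
proof -
  have rel: "r \<in> bilinearity_relations A B ==> pm_scale c r \<in> tnull" for r
    unfolding tnull_def by (intro pm.span_scale pm.span_base)
  have eq: "pm_scale c (u - v - w) = pm_scale c u - pm_scale c v - pm_scale c w" "pm_scale c (u - v) = pm_scale c u - pm_scale c v"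
    for u v w :: "'a \<times> 'b \<Rightarrow>\<^sub>0 complex" by (simp_all add: pm.scale_right_diff_distrib)
  have "sng (cadd A a a') b 1 - sng a b 1 - sng a' b 1 \<in> bilinearity_relations A B"
    unfolding bilinearity_relations_def using assms by blast
  from rel[OF this] show "sng (cadd A a a') b c - sng a b c - sng a' b c \<in> tnull" by (simp add: eq)
  have "sng a (cadd B b b') 1 - sng a b 1 - sng a b' 1 \<in> bilinearity_relations A B"
    unfolding bilinearity_relations_def using assms by blast
  from rel[OF this] show "sng a (cadd B b b') c - sng a b c - sng a b' c \<in> tnull" by (simp add: eq)
  have "sng (csmult A d a) b 1 - sng a b d \<in> bilinearity_relations A B"
    unfolding bilinearity_relations_def using assms by blast
  from rel[OF this] show "sng (csmult A d a) b c - sng a b (d * c) \<in> tnull" by (simp add: eq mult.commute)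
  have "sng a (csmult B d b) 1 - sng a b d \<in> bilinearity_relations A B"
    unfolding bilinearity_relations_def using assms by blast
  from rel[OF this] show "sng a (csmult B d b) c - sng a b (d * c) \<in> tnull" by (simp add: eq mult.commute)
qed

lemma tnull_induct [consumes 1, case_names zero add scale add_left add_right smult_left smult_right]:
  assumes u: "u \<in> tnull" and "Q 0" "!!u v. u \<in> tnull ==> v \<in> tnull ==> Q u ==> Q v ==> Q (u + v)"
    "!!c u. u \<in> tnull ==> Q u ==> Q (pm_scale c u)"
    "!!a a' b. a \<in> car A ==> a' \<in> car A ==> b \<in> car B ==> Q (sng (cadd A a a') b 1 - sng a b 1 - sng a' b 1)"
    "!!a b b'. a \<in> car A ==> b \<in> car B ==> b' \<in> car B ==> Q (sng a (cadd B b b') 1 - sng a b 1 - sng a b' 1)"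
    "!!d a b. a \<in> car A ==> b \<in> car B ==> Q (sng (csmult A d a) b 1 - sng a b d)"
    "!!d a b. a \<in> car A ==> b \<in> car B ==> Q (sng a (csmult B d b) 1 - sng a b d)"
  shows "Q u"
proof -
  have "pm.span (bilinearity_relations A B) \<subseteq> {u. u \<in> tnull \<and> Q u}"
  proof (rule pm.span_minimal)
    show "pm.subspace {u. u \<in> tnull \<and> Q u}"
      unfolding pm.subspace_def using assms(2-4) by (auto simp: tnull_zero tnull_add tnull_scale)
    show "bilinearity_relations A B \<subseteq> {u. u \<in> tnull \<and> Q u}"
    proof
      fix x assume x: "x \<in> bilinearity_relations A B"
      then have "Q x" unfolding bilinearity_relations_def
        by (elim UnE CollectE exE conjE) (simp_all only: assms(5-8))
      with x show "x \<in> {u. u \<in> tnull \<and> Q u}" by (simp add: tnull_def pm.span_base)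
    qed
  qed
  then show ?thesis using u by (auto simp: tnull_def[symmetric])
qed

lemma tnull_mult_left:
  assumes u: "u \<in> tnull" and v: "v \<in> FC" shows "fm v u \<in> tnull"
proof -
  have *: "fm (sng x y c) u \<in> tnull" if xy [simp]: "x \<in> car A" "y \<in> car B" for x y c
    using u
  proof (induction rule: tnull_induct)
    case (add_left a a' b)
    then show ?case using tnull_add_left[of "cmult A x a" "cmult A x a'" "cmult B y b" "cmult B y b" c]
      by (simp add: ft_linear ftm_single A.times_plus)
  next
    case (add_right a b b')
    then show ?case using tnull_add_right[of "cmult A x a" "cmult A x a" "cmult B y b" "cmult B y b'" c]
      by (simp add: ft_linear ftm_single B.times_plus)
  next
    case (smult_left d a b)
    then show ?case using tnull_smult_left[of "cmult A x a" "cmult A x a" "cmult B y b" "cmult B y b" d c]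
      by (simp add: ft_linear ftm_single A.times_smult mult.commute)
  next
    case (smult_right d a b)
    then show ?case using tnull_smult_right[of "cmult A x a" "cmult A x a" "cmult B y b" "cmult B y b" d c]
      by (simp add: ft_linear ftm_single B.times_smult mult.commute)
  qed (simp_all add: tnull_zero ft_linear tnull_add tnull_scale)
  show ?thesis using v
    by (induction rule: FC_induct) (simp_all add: tnull_zero ft_linear tnull_add *)
qed

lemma tnull_mult_right:
  assumes u: "u \<in> tnull" and v: "v \<in> FC" shows "fm u v \<in> tnull"
proof -
  have *: "fm u (sng x y c) \<in> tnull" if xy [simp]: "x \<in> car A" "y \<in> car B" for x y c
    using u
  proof (induction rule: tnull_induct)
    case (add_left a a' b)
    then show ?case using tnull_add_left[of "cmult A a x" "cmult A a' x" "cmult B b y" "cmult B b y" c]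
      by (simp add: ft_linear ftm_single A.plus_times)
  next
    case (add_right a b b')
    then show ?case using tnull_add_right[of "cmult A a x" "cmult A a x" "cmult B b y" "cmult B b' y" c]
      by (simp add: ft_linear ftm_single B.plus_times)
  next
    case (smult_left d a b)
    then show ?case using tnull_smult_left[of "cmult A a x" "cmult A a x" "cmult B b y" "cmult B b y" d c]
      by (simp add: ft_linear ftm_single A.smult_times mult.commute)
  next
    case (smult_right d a b)
    then show ?case using tnull_smult_right[of "cmult A a x" "cmult A a x" "cmult B b y" "cmult B b y" d c]
      by (simp add: ft_linear ftm_single B.smult_times mult.commute)
  qed (simp_all add: tnull_zero ft_linear tnull_add tnull_scale)
  show ?thesis using v
    by (induction rule: FC_induct) (simp_all add: tnull_zero ft_linear tnull_add *)
qed

text \<open>In the free space a pair with first entry \<open>a + a'\<close> is a new generator, so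
  addition of multipliers is respected only up to \<open>tnull\<close>, on which every Hilbert
  seminorm vanishes.\<close>

lemma lact_add_tnull:
  assumes [simp]: "dcent A m" "dcent A m'" "dcent B n" and u: "u \<in> FC"
  shows "lact (cadd MA m m') n u - lact m n u - lact m' n u \<in> tnull"
  using u
proof (induction rule: FC_induct)
  case (add a b c u)
  have eq: "lact (cadd MA m m') n (sng a b c + u) - lact m n (sng a b c + u) - lact m' n (sng a b c + u)
    = (sng (cadd A (fst m a) (fst m' a)) (fst n b) c - sng (fst m a) (fst n b) c - sng (fst m' a) (fst n b) c)
      + (lact (cadd MA m m') n u - lact m n u - lact m' n u)"
    using add by (simp add: tmap_add tmap_single)
  show ?case unfolding eq
    by (rule tnull_add[OF tnull_add_left add.IH]) (use add in simp_all)
qed (simp add: tnull_zero)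

lemma lact_smult_tnull:
  assumes [simp]: "dcent A m" "dcent B n" and u: "u \<in> FC"
  shows "lact (csmult MA d m) n u - pm_scale d (lact m n u) \<in> tnull"
  using u
proof (induction rule: FC_induct)
  case (add a b c u)
  have eq: "lact (csmult MA d m) n (sng a b c + u) - pm_scale d (lact m n (sng a b c + u))
    = (sng (csmult A d (fst m a)) (fst n b) c - sng (fst m a) (fst n b) (d * c))
      + (lact (csmult MA d m) n u - pm_scale d (lact m n u))"
    using add by (simp add: tmap_add tmap_single pm.scale_right_distrib)
  show ?case unfolding eq
    by (rule tnull_add[OF tnull_smult_left add.IH]) (use add in simp_all)
qed (simp add: tnull_zero)

lemma lact_add_tnull':
  assumes [simp]: "dcent B m" "dcent B m'" "dcent A n" and u: "u \<in> FC"
  shows "lact n (cadd MB m m') u - lact n m u - lact n m' u \<in> tnull"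
  using u
proof (induction rule: FC_induct)
  case (add a b c u)
  have eq: "lact n (cadd MB m m') (sng a b c + u) - lact n m (sng a b c + u) - lact n m' (sng a b c + u)
    = (sng (fst n a) (cadd B (fst m b) (fst m' b)) c - sng (fst n a) (fst m b) c - sng (fst n a) (fst m' b) c)
      + (lact n (cadd MB m m') u - lact n m u - lact n m' u)"
    using add by (simp add: tmap_add tmap_single)
  show ?case unfolding eq
    by (rule tnull_add[OF tnull_add_right add.IH]) (use add in simp_all)
qed (simp add: tnull_zero)

lemma lact_smult_tnull':
  assumes [simp]: "dcent B m" "dcent A n" and u: "u \<in> FC"
  shows "lact n (csmult MB d m) u - pm_scale d (lact n m u) \<in> tnull"
  using u
proof (induction rule: FC_induct)
  case (add a b c u)
  have eq: "lact n (csmult MB d m) (sng a b c + u) - pm_scale d (lact n m (sng a b c + u))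
    = (sng (fst n a) (csmult B d (fst m b)) c - sng (fst n a) (fst m b) (d * c))
      + (lact n (csmult MB d m) u - pm_scale d (lact n m u))"
    using add by (simp add: tmap_add tmap_single pm.scale_right_distrib)
  show ?case unfolding eq
    by (rule tnull_add[OF tnull_smult_right add.IH]) (use add in simp_all)
qed (simp add: tnull_zero)

text \<open>Seminorms \<open>N\<close> with \<open>N x ^ 2 = G (x\<^sup>* x)\<close> obeying Cauchy-Schwarz: this covers both \<open>C\<^sup>*\<close>-seminorms
  (\<open>G = N\<close>) and the seminorms of Hilbert modules.\<close>

definition hilbert_seminorm ::
    "(('a \<times> 'b \<Rightarrow>\<^sub>0 complex) => real) => (('a \<times> 'b \<Rightarrow>\<^sub>0 complex) => real) => bool" where
  "hilbert_seminorm N G \<longleftrightarrow>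
     (\<forall>u\<in>FC. 0 <= N u) \<and> (\<forall>u\<in>FC. \<forall>v\<in>FC. N (u + v) <= N u + N v) \<and> (\<forall>c. \<forall>u\<in>FC. N (pm_scale c u) = cmod c * N u) \<and>
     (\<forall>u\<in>bilinearity_relations A B. N u = 0) \<and> (\<forall>u\<in>FC. (N u)\<^sup>2 = G (fm (fs u) u)) \<and>
     (\<forall>u\<in>FC. \<forall>v\<in>FC. G (fm (fs u) v) <= N u * N v)"

context
  fixes N G assumes N: "hilbert_seminorm N G"
begin

lemma hs_nonneg: "u \<in> FC ==> 0 <= N u" and hs_add: "u \<in> FC ==> v \<in> FC ==> N (u + v) <= N u + N v"
  and hs_scale: "u \<in> FC ==> N (pm_scale c u) = cmod c * N u"
  and hs_rel: "u \<in> bilinearity_relations A B ==> N u = 0"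
  and hs_sq: "u \<in> FC ==> (N u)\<^sup>2 = G (fm (fs u) u)"
  and hs_cs: "u \<in> FC ==> v \<in> FC ==> G (fm (fs u) v) <= N u * N v"
  using N unfolding hilbert_seminorm_def by blast+

lemma hs_zero: "N 0 = 0" using hs_scale[of 0 0] by simp

lemma hs_tnull: "u \<in> tnull ==> N u = 0"
proof -
  assume "u \<in> tnull"
  moreover have "tnull \<subseteq> {x. x \<in> FC \<and> N x = 0}"
    unfolding tnull_def
  proof (rule pm.span_minimal)
    show "pm.subspace {x. x \<in> FC \<and> N x = 0}"
      unfolding pm.subspace_def
    proof (intro conjI allI ballI)
      fix u v assume "u \<in> {x. x \<in> FC \<and> N x = 0}" "v \<in> {x. x \<in> FC \<and> N x = 0}"
      then show "u + v \<in> {x. x \<in> FC \<and> N x = 0}" using hs_add[of u v] hs_nonneg[of "u + v"] by auto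
    qed (auto simp: hs_zero hs_scale)
    show "bilinearity_relations A B \<subseteq> {x. x \<in> FC \<and> N x = 0}" using hs_rel relations_FC by auto
  qed
  ultimately show "N u = 0" by blast
qed

lemma hs_cong:
  assumes "u \<in> FC" "v \<in> FC" "u - v \<in> tnull" shows "N u = N v"
proof -
  have "N u <= N (u - v) + N v" using hs_add[of "u - v" v] assms by simp
  moreover have "N v <= N (pm_scale (-1) (u - v)) + N u" using hs_add[of "pm_scale (-1) (u - v)" u] assms by (simp add: pm.scale_minus_left)
  ultimately show ?thesis using hs_tnull[OF assms(3)] hs_scale[of "u - v" "-1"] assms by simp
qed

text \<open>\<open>seminorm_le_norm\<close> in the multiplier algebra of \<open>A\<close>, for
  \<open>m \<mapsto> N ((m \<otimes> 1) v)\<close>: by \<open>hs_sq\<close> this depends only on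
  \<open>m\<^sup>* m\<close>, and \<open>hs_cs\<close> is its Cauchy-Schwarz hypothesis.\<close>

lemma hs_lact_left:
  assumes m: "dcent A m" and v: "v \<in> FC"
  shows "N (lact m (multiplier_one B) v) <= cnorm MA m * N v"
proof -
  interpret M: unital_cstar_algebra MA "multiplier_one A" by (rule A.unital_cstar_algebra_multiplier)
  let ?o = "multiplier_one B"
  note o = B.dcent_one
  have oo: "cmult MB (cstar MB ?o) ?o = ?o"
    by (rule B.multiplier_eqI; (intro B.dcent_mult B.multiplier_adj_mem o)?; simp add: multiplier_one_def B.adj_adj)
  have FC: "lact k ?o v \<in> FC" if "dcent A k" for k using that o v by auto
  have sq: "(N (lact k ?o v))\<^sup>2 = G (fm (fs v) (lact (cmult MA (cstar MA k) k) ?o v))" if k: "dcent A k" for k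
    unfolding hs_sq[OF FC[OF k]] fs_lact_mult_lact[OF k o v v] oo ..
  have one: "lact (multiplier_one A) ?o v = v"
    by (rule FC_eqI[OF v, where L="lact (multiplier_one A) ?o" and K="%u. u"]) (simp_all add: ft_linear tmap_single multiplier_one_def)
  have "N (lact m ?o v) <= cnorm MA m * N (lact (multiplier_one A) ?o v)"
  proof (rule M.seminorm_le_norm[where f="%m. N (lact m ?o v)"])
    fix k l assume "k \<in> car MA" "l \<in> car MA"
    then have k: "dcent A k" and l: "dcent A l" by auto
    have "N (lact (cadd MA k l) ?o v) = N (lact k ?o v + lact l ?o v)"
      using lact_add_tnull[OF k l o v] FC[OF k] FC[OF l] FC[OF A.dcent_add[OF k l]]
      by (intro hs_cong) (auto simp: diff_diff_add)
    also have "... <= N (lact k ?o v) + N (lact l ?o v)" using FC k l by (intro hs_add)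
    finally show "N (lact (cadd MA k l) ?o v) <= N (lact k ?o v) + N (lact l ?o v)" .
    assume "cmult MA (cstar MA k) k = cmult MA (cstar MA l) l"
    then have "(N (lact k ?o v))\<^sup>2 = (N (lact l ?o v))\<^sup>2" unfolding sq[OF k] sq[OF l] by (rule arg_cong)
    then show "N (lact k ?o v) = N (lact l ?o v)" by (rule power2_eq_imp_eq) (use hs_nonneg FC k l in auto)
  next
    fix k c assume "k \<in> car MA"
    then have k: "dcent A k" by simp
    show "0 <= N (lact k ?o v)" using hs_nonneg FC k by blast
    have "N (lact (csmult MA c k) ?o v) = N (pm_scale c (lact k ?o v))"
      using lact_smult_tnull[OF k o v] FC[OF k] FC[OF A.dcent_smult[OF k]] by (intro hs_cong) auto
    then show "N (lact (csmult MA c k) ?o v) = cmod c * N (lact k ?o v)" using FC[OF k] hs_scale by simp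
    have mm: "dcent A (cmult MA (cstar MA k) k)"
      using k by (intro A.dcent_mult A.multiplier_adj_mem)
    show "(N (lact k ?o v))\<^sup>2 <= N (lact (multiplier_one A) ?o v) * N (lact (cmult MA (cstar MA k) k) ?o v)"
      unfolding sq[OF k] one using FC[OF mm] by (rule hs_cs[OF v])
  qed (use m in simp)
  then show ?thesis unfolding one .
qed

lemma hs_lact_right:
  assumes m: "dcent B m" and v: "v \<in> FC"
  shows "N (lact (multiplier_one A) m v) <= cnorm MB m * N v"
proof -
  interpret M: unital_cstar_algebra MB "multiplier_one B" by (rule B.unital_cstar_algebra_multiplier)
  let ?o = "multiplier_one A"
  note o = A.dcent_one
  have oo: "cmult MA (cstar MA ?o) ?o = ?o"
    by (rule A.multiplier_eqI; (intro A.dcent_mult A.multiplier_adj_mem o)?; simp add: multiplier_one_def A.adj_adj)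
  have FC: "lact ?o k v \<in> FC" if "dcent B k" for k using that o v by auto
  have sq: "(N (lact ?o k v))\<^sup>2 = G (fm (fs v) (lact ?o (cmult MB (cstar MB k) k) v))" if k: "dcent B k" for k
    unfolding hs_sq[OF FC[OF k]] fs_lact_mult_lact[OF o k v v] oo ..
  have one: "lact ?o (multiplier_one B) v = v"
    by (rule FC_eqI[OF v, where L="lact ?o (multiplier_one B)" and K="%u. u"]) (simp_all add: ft_linear tmap_single multiplier_one_def)
  have "N (lact ?o m v) <= cnorm MB m * N (lact ?o (multiplier_one B) v)"
  proof (rule M.seminorm_le_norm[where f="%m. N (lact ?o m v)"])
    fix k l assume "k \<in> car MB" "l \<in> car MB"
    then have k: "dcent B k" and l: "dcent B l" by auto
    have "N (lact ?o (cadd MB k l) v) = N (lact ?o k v + lact ?o l v)"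
      using lact_add_tnull'[OF k l o v] FC[OF k] FC[OF l] FC[OF B.dcent_add[OF k l]]
      by (intro hs_cong) (auto simp: diff_diff_add)
    also have "... <= N (lact ?o k v) + N (lact ?o l v)" using FC k l by (intro hs_add)
    finally show "N (lact ?o (cadd MB k l) v) <= N (lact ?o k v) + N (lact ?o l v)" .
    assume "cmult MB (cstar MB k) k = cmult MB (cstar MB l) l"
    then have "(N (lact ?o k v))\<^sup>2 = (N (lact ?o l v))\<^sup>2" unfolding sq[OF k] sq[OF l] by (rule arg_cong)
    then show "N (lact ?o k v) = N (lact ?o l v)" by (rule power2_eq_imp_eq) (use hs_nonneg FC k l in auto)
  next
    fix k c assume "k \<in> car MB"
    then have k: "dcent B k" by simp
    show "0 <= N (lact ?o k v)" using hs_nonneg FC k by blast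
    have "N (lact ?o (csmult MB c k) v) = N (pm_scale c (lact ?o k v))"
      using lact_smult_tnull'[OF k o v] FC[OF k] FC[OF B.dcent_smult[OF k]] by (intro hs_cong) auto
    then show "N (lact ?o (csmult MB c k) v) = cmod c * N (lact ?o k v)" using FC[OF k] hs_scale by simp
    have mm: "dcent B (cmult MB (cstar MB k) k)"
      using k by (intro B.dcent_mult B.multiplier_adj_mem)
    show "(N (lact ?o k v))\<^sup>2 <= N (lact ?o (multiplier_one B) v) * N (lact ?o (cmult MB (cstar MB k) k) v)"
      unfolding sq[OF k] one using FC[OF mm] by (rule hs_cs[OF v])
  qed (use m in simp)
  then show ?thesis unfolding one .
qed

lemma hs_lact:
  assumes m: "dcent A m" and n: "dcent B n" and v: "v \<in> FC"
  shows "N (lact m n v) <= cnorm MA m * cnorm MB n * N v"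
proof -
  have eq: "lact m n v = lact m (multiplier_one B) (lact (multiplier_one A) n v)"
    by (rule FC_eqI[OF v, where L="lact m n" and K="%v. lact m (multiplier_one B) (lact (multiplier_one A) n v)"])
      (use n in "simp_all add: ft_linear tmap_single multiplier_one_def")
  have "lact (multiplier_one A) n v \<in> FC" using v n A.dcent_one by auto
  then have "N (lact m n v) <= cnorm MA m * N (lact (multiplier_one A) n v)" unfolding eq by (rule hs_lact_left[OF m])
  also have "... <= cnorm MA m * (cnorm MB n * N v)"
    by (intro mult_left_mono hs_lact_right n v A.multiplier_norm_nonneg m)
  finally show ?thesis by (simp add: mult.assoc)
qed

end

section \<open>C*-seminorms on the tensor product and their supremum\<close>

context
  fixes p assumes p: "tensor_cstar_seminorm A B p"
begin

lemma ts_nonneg: "u \<in> FC ==> 0 <= p u" and ts_add: "u \<in> FC ==> v \<in> FC ==> p (u + v) <= p u + p v"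
  and ts_scale: "u \<in> FC ==> p (pm_scale c u) = cmod c * p u"
  and ts_mult: "u \<in> FC ==> v \<in> FC ==> p (fm u v) <= p u * p v"
  and ts_star: "u \<in> FC ==> p (fs u) = p u"
  and ts_cstar: "u \<in> FC ==> p (fm (fs u) u) = (p u)\<^sup>2"
  and ts_rel: "u \<in> bilinearity_relations A B ==> p u = 0"
  using p unfolding tensor_cstar_seminorm_def free_tensor_smult_eq by blast+

lemma ts_hilbert: "hilbert_seminorm p p"
proof -
  have "p (fm (fs u) v) <= p u * p v" if "u \<in> FC" "v \<in> FC" for u v
    using ts_mult[of "fs u" v] ts_star[of u] that by simp
  then show ?thesis
    unfolding hilbert_seminorm_def using ts_nonneg ts_add ts_scale ts_cstar ts_rel by simp
qed

text \<open>For \<open>x = a \<otimes> b\<close>, the square of \<open>p x\<close> is the seminorm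
  of \<open>x x\<^sup>*\<close>, that is, of \<open>x\<^sup>*\<close> moved by the multipliers of
  \<open>a\<close> and \<open>b\<close>, and \<open>hs_lact\<close> bounds it by the product of the
  norms times \<open>p x\<close>. The bound is common to all C*-seminorms, so their supremum is
  finite.\<close>

lemma ts_single_le:
  assumes a: "a \<in> car A" and b: "b \<in> car B"
  shows "p (sng a b c) <= cmod c * (cnorm A a * cnorm B b)"
proof -
  let ?x = "sng a b 1"
  have "(p ?x)\<^sup>2 = p (fm ?x (fs ?x))"
    using ts_cstar[of "fs ?x"] a b by (simp add: fs_fs ts_star)
  also have "fm ?x (fs ?x) = lact (multiplier_embed A a) (multiplier_embed B b) (fs ?x)"
    using a b by (simp add: fts_single ftm_single tmap_single)
  also have "p ... <= cnorm MA (multiplier_embed A a) * cnorm MB (multiplier_embed B b) * p (fs ?x)"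
    using a b by (intro hs_lact[OF ts_hilbert] A.dcent_embed B.dcent_embed) auto
  finally have sq: "p ?x * p ?x <= (cnorm A a * cnorm B b) * p ?x"
    using a b by (simp add: A.norm_embed B.norm_embed ts_star power2_eq_square)
  have 0: "0 <= p ?x" using a b ts_nonneg by auto
  have "p ?x <= cnorm A a * cnorm B b"
  proof (cases "p ?x = 0")
    case True
    then show ?thesis using A.norm_ge_zero[OF a] B.norm_ge_zero[OF b] by simp
  next
    case False
    then show ?thesis using sq 0 by (simp add: mult_le_cancel_right)
  qed
  moreover have "p (sng a b c) = cmod c * p ?x" using ts_scale[of ?x c] a b by simp
  ultimately show ?thesis by (simp add: mult_left_mono)
qed

end

lemma zero_tensor_seminorm: "tensor_cstar_seminorm A B (%_. 0)"
  by (simp add: tensor_cstar_seminorm_def)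

abbreviation "tn \<equiv> cnorm FT"

lemma free_tensor_simps [simp]:
  "car FT = FC" "czero FT = 0" "cadd FT = (+)" "csmult FT = pm_scale" "cmult FT = fm" "cstar FT = fs"
  by (simp_all add: free_tensor_def free_tensor_smult_eq)

lemma tn_def: "tn u = Sup {p u | p. tensor_cstar_seminorm A B p}"
  by (simp add: free_tensor_def)

lemma seminorms_bdd: "u \<in> FC ==> \<exists>K. \<forall>p. tensor_cstar_seminorm A B p --> p u <= K"
proof (induction rule: FC_induct)
  case zero
  show ?case
  proof (intro exI allI impI)
    fix p assume p: "tensor_cstar_seminorm A B p"
    show "p 0 <= 0" using hs_zero[OF ts_hilbert[OF p]] by simp
  qed
next
  case (add a b c u)
  then obtain K where K: "!!p. tensor_cstar_seminorm A B p ==> p u <= K" by blast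
  show ?case
  proof (intro exI allI impI)
    fix p assume p: "tensor_cstar_seminorm A B p"
    show "p (sng a b c + u) <= cmod c * (cnorm A a * cnorm B b) + K"
      using ts_add[OF p, of "sng a b c" u] ts_single_le[OF p add(1,2), of c] K[OF p] add by simp
  qed
qed

lemma tensor_seminorm_le:
  assumes "tensor_cstar_seminorm A B p" "u \<in> FC" shows "p u <= tn u"
proof -
  obtain K where "!!p. tensor_cstar_seminorm A B p ==> p u <= K" using seminorms_bdd[OF assms(2)] by blast
  then have "bdd_above {p u | p. tensor_cstar_seminorm A B p}" by (intro bdd_aboveI[of _ K]) auto
  then show ?thesis unfolding tn_def using assms(1) by (intro cSup_upper) auto
qed

lemma tn_le:
  assumes "!!p. tensor_cstar_seminorm A B p ==> p u <= K" shows "tn u <= K"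
  unfolding tn_def using zero_tensor_seminorm assms by (intro cSup_least) auto

text \<open>Each axiom passes to the supremum. In the C*-identity, every
  \<open>(p u)\<^sup>2 = p (u\<^sup>* u)\<close> is bounded by \<open>tn (u\<^sup>* u)\<close>; the
  reverse inequality is submultiplicativity.\<close>

lemma tn_seminorm: "tensor_cstar_seminorm A B tn"
proof -
  have nonneg: "0 <= tn u" if "u \<in> FC" for u
    using tensor_seminorm_le[OF zero_tensor_seminorm that] .
  have le_scale: "tn (pm_scale c u) <= cmod c * tn u" if u: "u \<in> FC" for c u
    by (rule tn_le) (simp add: ts_scale u mult_left_mono tensor_seminorm_le)
  have scale: "tn (pm_scale c u) = cmod c * tn u" if u: "u \<in> FC" for c u
  proof (cases "c = 0")
    case True
    then show ?thesis using le_scale[OF u, of c] nonneg[of "pm_scale c u"] u by simp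
  next
    case False
    have "tn (pm_scale (1 / c) (pm_scale c u)) <= cmod (1 / c) * tn (pm_scale c u)" using u by (intro le_scale) auto
    then have "cmod c * tn u <= tn (pm_scale c u)" using False by (simp add: pm.scale_scale norm_divide field_simps)
    then show ?thesis using le_scale[OF u, of c] by simp
  qed
  have add: "tn (u + v) <= tn u + tn v" if u: "u \<in> FC" and v: "v \<in> FC" for u v
  proof (rule tn_le)
    fix p assume p: "tensor_cstar_seminorm A B p"
    show "p (u + v) <= tn u + tn v" using ts_add[OF p u v] tensor_seminorm_le[OF p u] tensor_seminorm_le[OF p v] by simp
  qed
  have mult: "tn (fm u v) <= tn u * tn v" if u: "u \<in> FC" and v: "v \<in> FC" for u v
  proof (rule tn_le)
    fix p assume p: "tensor_cstar_seminorm A B p"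
    have "p (fm u v) <= p u * p v" by (rule ts_mult[OF p u v])
    also have "... <= tn u * tn v"
      by (intro mult_mono tensor_seminorm_le p u v nonneg ts_nonneg[OF p v])
    finally show "p (fm u v) <= tn u * tn v" .
  qed
  have star_le: "tn (fs u) <= tn u" if u: "u \<in> FC" for u
    by (rule tn_le) (simp add: ts_star u tensor_seminorm_le)
  have star: "tn (fs u) = tn u" if u: "u \<in> FC" for u
    using star_le[OF u] star_le[OF FC_star[OF u]] by (simp add: fs_fs u)
  have cst: "tn (fm (fs u) u) = (tn u)\<^sup>2" if u: "u \<in> FC" for u
  proof (rule antisym)
    show "tn (fm (fs u) u) <= (tn u)\<^sup>2" using mult[of "fs u" u] u by (simp add: star power2_eq_square)
    have "tn u <= sqrt (tn (fm (fs u) u))"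
    proof (rule tn_le)
      fix p assume p: "tensor_cstar_seminorm A B p"
      have "(p u)\<^sup>2 <= tn (fm (fs u) u)" using tensor_seminorm_le[OF p, of "fm (fs u) u"] u by (simp add: ts_cstar[OF p])
      then show "p u <= sqrt (tn (fm (fs u) u))" by (rule real_le_rsqrt)
    qed
    then have "(tn u)\<^sup>2 <= (sqrt (tn (fm (fs u) u)))\<^sup>2" using nonneg[OF u] by (rule power_mono)
    then show "(tn u)\<^sup>2 <= tn (fm (fs u) u)" using nonneg u by simp
  qed
  have rel: "tn u = 0" if u: "u \<in> bilinearity_relations A B" for u
  proof -
    have "tn u <= 0" by (rule tn_le) (simp add: ts_rel[OF _ u])
    then show ?thesis using nonneg relations_FC u by force
  qed
  show ?thesis
    unfolding tensor_cstar_seminorm_def free_tensor_smult_eq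
    by (intro conjI ballI allI nonneg add scale mult star cst rel)
qed

lemma pre_cstar_free_tensor: "pre_cstar_algebra FT"
proof (unfold_locales, unfold free_tensor_simps)
  fix u v w :: "'a \<times> 'b \<Rightarrow>\<^sub>0 complex" and c d :: complex
  show "0 \<in> FC" by simp
  show "u + v + w = u + (v + w)" "u + v = v + u" "0 + u = u" by (simp_all add: add_ac)
  show "u + pm_scale (- 1) u = 0" "pm_scale c (u + v) = pm_scale c u + pm_scale c v"
    "pm_scale (c + d) u = pm_scale c u + pm_scale d u" "pm_scale c (pm_scale d u) = pm_scale (c * d) u" "pm_scale 1 u = u"
    by (auto intro!: poly_mapping_eqI simp: lookup_add algebra_simps)
  show "fm u (v + w) = fm u v + fm u w" "fm (u + v) w = fm u w + fm v w" "fm (pm_scale c u) v = pm_scale c (fm u v)"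
    "fm u (pm_scale c v) = pm_scale c (fm u v)" "fs (u + v) = fs u + fs v" "fs (pm_scale c u) = pm_scale (cnj c) (fs u)"
    by (simp_all add: ft_linear)
  assume u: "u \<in> FC"
  show "pm_scale c u \<in> FC" "fs u \<in> FC" "fs (fs u) = u" using u by (simp_all add: fs_fs)
  show "0 <= tn u" "tn (pm_scale c u) = cmod c * tn u" "tn (fm (fs u) u) = (tn u)\<^sup>2"
    by (rule ts_nonneg[OF tn_seminorm u] ts_scale[OF tn_seminorm u] ts_cstar[OF tn_seminorm u])+
  assume v: "v \<in> FC"
  show "u + v \<in> FC" "fm u v \<in> FC" "fs (fm u v) = fm (fs v) (fs u)" using u v by (simp_all add: fs_mult)
  show "tn (u + v) <= tn u + tn v" "tn (fm u v) <= tn u * tn v"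
    by (rule ts_add[OF tn_seminorm u v] ts_mult[OF tn_seminorm u v])+
  assume w: "w \<in> FC"
  show "fm (fm u v) w = fm u (fm v w)" by (rule fm_assoc[OF u v w])
qed

end

sublocale tensor_pair \<subseteq> FT: pre_cstar_algebra "free_tensor A B" by (rule pre_cstar_free_tensor)

lemma (in cstar_algebra) fst_ctends:
  assumes m: "dcent A m" and s: "ctends A s l"
  shows "ctends A (%n. fst m (s n)) (fst m l)"
proof (rule ctendsI)
  note [simp] = ctends_mem[OF s] m
  show "cnorm A (cdiff A (fst m (s n)) (fst m l)) <= cnorm M m * cnorm A (cdiff A (s n) l)" for n
    unfolding fst_diff[OF m ctends_mem[OF s], symmetric] by (intro multiplier_norm_bound m) simp
  have "(%n. cnorm A (cdiff A (s n) l)) ----> 0" using s by (simp add: ctends_def)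
  then show "(%n. cnorm M m * cnorm A (cdiff A (s n) l)) ----> 0" by (rule tendsto_mult_right_zero)
qed (use m ctends_mem[OF s] in auto)

section \<open>The completed tensor product and its elementary tensors\<close>

context tensor_pair
begin

abbreviation "T \<equiv> tensor_product A B"
abbreviation "et \<equiv> elementary_tensor A B"

definition ci :: "('a \<times> 'b \<Rightarrow>\<^sub>0 complex) => ('a, 'b) tensor" where
  "ci u = cauchy_class FT (%_. u)"

lemma cstar_algebra_tensor: "cstar_algebra T"
  unfolding tensor_product_def by (rule FT.cstar_algebra_completion)

end

sublocale tensor_pair \<subseteq> T: cstar_algebra "tensor_product A B" by (rule cstar_algebra_tensor)

context tensor_pair
begin

lemma const_cauchy: "u \<in> FC ==> (%_. u) \<in> cauchy_seqs FT"
  using FT.cauchy_seqs_const by simp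

lemma cdiff_FT: "cdiff FT u v = u - v"
  unfolding cdiff_def by (simp only: pm_minus free_tensor_simps)

lemma ci_mem [simp, intro]: "u \<in> FC ==> ci u \<in> car T"
  unfolding ci_def tensor_product_def by (intro FT.cl_mem const_cauchy)

lemma
  assumes u: "u \<in> FC"
  shows ci_scale: "ci (pm_scale c u) = csmult T c (ci u)"
    and ci_star: "ci (fs u) = cstar T (ci u)"
    and norm_ci: "cnorm T (ci u) = tn u"
  using FT.completion_smult[OF const_cauchy[OF u], of c] FT.completion_adj[OF const_cauchy[OF u]] FT.norm_cl_const[of u] u
  by (simp_all add: ci_def tensor_product_def)

lemma
  assumes u: "u \<in> FC" and v: "v \<in> FC"
  shows ci_add: "ci (u + v) = cadd T (ci u) (ci v)"
    and ci_mult: "ci (fm u v) = cmult T (ci u) (ci v)"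
    and ci_diff: "ci (u - v) = cdiff T (ci u) (ci v)"
  using FT.completion_add[OF const_cauchy[OF u] const_cauchy[OF v]] FT.completion_times[OF const_cauchy[OF u] const_cauchy[OF v]]
    FT.completion_diff[OF const_cauchy[OF u] const_cauchy[OF v]]
  by (simp_all add: ci_def tensor_product_def cdiff_FT)

lemma ci_zero: "ci 0 = czero T"
  by (simp add: ci_def tensor_product_def FT.completion_zero)

lemma ci_eqI:
  assumes "u \<in> FC" "v \<in> FC" "u - v \<in> tnull" shows "ci u = ci v"
proof -
  have "tn (u - v) = 0" using hs_tnull[OF ts_hilbert[OF tn_seminorm] assms(3)] .
  then have "cnorm T (cdiff T (ci u) (ci v)) = 0" using assms by (simp add: norm_ci flip: ci_diff)
  then show ?thesis using assms T.norm_eq_zero T.diff_eq_zero_iff by (metis T.diff_mem ci_mem)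
qed

lemma et_ci: "et a b = ci (sng a b 1)"
  by (simp add: elementary_tensor_def ci_def)

lemma et_mem [simp, intro]: "a \<in> car A ==> b \<in> car B ==> et a b \<in> car T"
  by (simp add: et_ci)

lemma ci_single: "a \<in> car A ==> b \<in> car B ==> ci (sng a b c) = csmult T c (et a b)"
  using ci_scale[of "sng a b 1" c] by (simp add: et_ci)

lemma
  assumes a: "a \<in> car A" "a' \<in> car A" and b: "b \<in> car B" "b' \<in> car B"
  shows et_add_left: "et (cadd A a a') b = cadd T (et a b) (et a' b)"
    and et_add_right: "et a (cadd B b b') = cadd T (et a b) (et a b')"
    and et_smult_left: "et (csmult A c a) b = csmult T c (et a b)"
    and et_smult_right: "et a (csmult B c b) = csmult T c (et a b)"
    and et_times: "cmult T (et a b) (et a' b') = et (cmult A a a') (cmult B b b')"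
    and et_adj: "cstar T (et a b) = et (cstar A a) (cstar B b)"
proof -
  have "ci (sng (cadd A a a') b 1) = ci (sng a b 1 + sng a' b 1)"
    using tnull_add_left[of a a' b b' 1] a b by (intro ci_eqI) (auto simp: diff_diff_add)
  then show "et (cadd A a a') b = cadd T (et a b) (et a' b)" using a b by (simp add: et_ci ci_add)
  have "ci (sng a (cadd B b b') 1) = ci (sng a b 1 + sng a b' 1)"
    using tnull_add_right[of a a' b b' 1] a b by (intro ci_eqI) (auto simp: diff_diff_add)
  then show "et a (cadd B b b') = cadd T (et a b) (et a b')" using a b by (simp add: et_ci ci_add)
  have "ci (sng (csmult A c a) b 1) = ci (sng a b c)"
    using tnull_smult_left[of a a' b b' c 1] a b by (intro ci_eqI) auto
  then show "et (csmult A c a) b = csmult T c (et a b)" using a b ci_single[of a b c] by (simp add: et_ci)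
  have "ci (sng a (csmult B c b) 1) = ci (sng a b c)"
    using tnull_smult_right[of a a' b b' c 1] a b by (intro ci_eqI) auto
  then show "et a (csmult B c b) = csmult T c (et a b)" using a b ci_single[of a b c] by (simp add: et_ci)
  show "cmult T (et a b) (et a' b') = et (cmult A a a') (cmult B b b')"
    using a b by (simp add: et_ci ftm_single flip: ci_mult)
  show "cstar T (et a b) = et (cstar A a) (cstar B b)"
    using a b by (simp add: et_ci fts_single flip: ci_star)
qed

lemma norm_et_le: "a \<in> car A ==> b \<in> car B ==> cnorm T (et a b) <= cnorm A a * cnorm B b"
  using ts_single_le[OF tn_seminorm, of a b 1] by (simp add: et_ci norm_ci)

lemma tensor_approx:
  assumes "X \<in> car T"
  obtains u where "!!n. u n \<in> FC" "ctends T (%n. ci (u n)) X"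
proof -
  from assms have "X \<in> car (completion FT)" by (simp add: tensor_product_def)
  then obtain s where s: "s \<in> cauchy_seqs FT" and X: "X = cauchy_class FT s" by (rule FT.cl_cases)
  have "s n \<in> FC" for n using cauchy_seqs_mem[OF s] by simp
  moreover have "ctends T (%n. ci (s n)) X"
    using FT.cl_ctends[OF s] by (simp add: X ci_def tensor_product_def)
  ultimately show ?thesis by (rule that)
qed

lemma ci_induct [consumes 1, case_names et add smult]:
  assumes u: "u \<in> FC" and et: "!!a b. a \<in> car A ==> b \<in> car B ==> Q (et a b)"
    and add: "!!X Y. X \<in> car T ==> Y \<in> car T ==> Q X ==> Q Y ==> Q (cadd T X Y)"
    and smult: "!!c X. X \<in> car T ==> Q X ==> Q (csmult T c X)"
  shows "Q (ci u)"
  using u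
proof (induction rule: FC_induct)
  case zero
  have "ci 0 = csmult T 0 (et (czero A) (czero B))" by (simp add: ci_zero T.zero_smult)
  then show ?case using et smult by (metis A.zero_mem B.zero_mem et_mem)
next
  case (add a b c u)
  then have "ci (sng a b c + u) = cadd T (csmult T c (et a b)) (ci u)" by (simp add: ci_add ci_single)
  then show ?case using add et[OF add(1,2)] smult assms(3) by (metis T.smult_mem ci_mem et_mem)
qed

lemma tensor_induct [consumes 1, case_names et add smult limit]:
  assumes X: "X \<in> car T" and et: "!!a b. a \<in> car A ==> b \<in> car B ==> Q (et a b)"
    and add: "!!X Y. X \<in> car T ==> Y \<in> car T ==> Q X ==> Q Y ==> Q (cadd T X Y)"
    and smult: "!!c X. X \<in> car T ==> Q X ==> Q (csmult T c X)"
    and limit: "!!s X. (!!n. Q (s n)) ==> ctends T s X ==> Q X"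
  shows "Q X"
proof -
  obtain u where u: "!!n. u n \<in> FC" "ctends T (%n. ci (u n)) X" using tensor_approx[OF X] by blast
  have "Q (ci (u n))" for n
    using u(1)[of n] et add smult by (rule ci_induct)
  then show ?thesis using u(2) by (rule limit)
qed

section \<open>Tensor products of multipliers\<close>

abbreviation "MT \<equiv> multiplier_algebra T"

text \<open>Combinations of elementary tensors are dense and multipliers are bounded. This is the
  uniqueness behind the description in \<open>multiplier_tensor\<close>.\<close>

lemma tensor_multiplier_eqI:
  assumes x: "dcent T x" and y: "dcent T y"
    and eq: "!!a b. a \<in> car A ==> b \<in> car B ==> fst x (et a b) = fst y (et a b)"
  shows "x = y"
proof (rule T.multiplier_eqI[OF x y])
  fix X assume "X \<in> car T"
  then show "fst x X = fst y X"
  proof (induction rule: tensor_induct)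
    case (add X Y)
    then show ?case using T.fst_plus[OF x] T.fst_plus[OF y] by simp
  next
    case (smult c X)
    then show ?case using T.fst_smult[OF x] T.fst_smult[OF y] by simp
  next
    case (limit s X)
    show ?case
      using T.ctends_unique[OF T.fst_ctends[OF x limit(2)], of "fst y X"] T.fst_ctends[OF y limit(2)] limit(1) by simp
  qed (rule eq)
qed

lemma tn_lact:
  assumes "dcent A m" "dcent B n" "v \<in> FC"
  shows "tn (lact m n v) <= cnorm MA m * cnorm MB n * tn v"
  by (rule hs_lact[OF ts_hilbert[OF tn_seminorm] assms])

lemma tn_ract:
  assumes m: "dcent A m" and n: "dcent B n" and v: "v \<in> FC"
  shows "tn (ract m n v) <= cnorm MA (cstar MA m) * cnorm MB (cstar MB n) * tn v"
proof -
  have "ract m n v \<in> FC" using m n v by auto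
  then have "tn (ract m n v) = tn (lact (cstar MA m) (cstar MB n) (fs v))"
    using ts_star[OF tn_seminorm, of "ract m n v"] fs_ract[OF m n v] by simp
  also have "... <= cnorm MA (cstar MA m) * cnorm MB (cstar MB n) * tn (fs v)"
    by (intro tn_lact A.multiplier_adj_mem B.multiplier_adj_mem m n FC_star v)
  finally show ?thesis using ts_star[OF tn_seminorm v] by simp
qed

text \<open>The maps act term by term on representing sequences; \<open>tn_lact\<close> and
  \<open>tn_ract\<close> keep these Cauchy, and the identity between left and right action passes to
  the classes.\<close>

lemma multiplier_tensor_exists:
  assumes m: "dcent A m" and n: "dcent B n"
  shows "\<exists>x. dcent T x \<and> (\<forall>a\<in>car A. \<forall>b\<in>car B.
     fst x (et a b) = et (fst m a) (fst n b) \<and> snd x (et a b) = et (snd m a) (snd n b))"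
proof -
  let ?Q = "completion FT"
  let ?K = "cnorm MA m * cnorm MB n" and ?K' = "cnorm MA (cstar MA m) * cnorm MB (cstar MB n)"
  have K: "0 <= ?K" "0 <= ?K'"
    using A.multiplier_norm_nonneg B.multiplier_norm_nonneg m n A.multiplier_adj_mem[OF m] B.multiplier_adj_mem[OF n] by auto
  have lFC: "lact m n v \<in> FC" and rFC: "ract m n v \<in> FC" if "v \<in> FC" for v using m n that by auto
  have lc: "(%k. lact m n (s k)) \<in> cauchy_seqs FT" if s: "s \<in> cauchy_seqs FT" for s
  proof (rule FT.cauchy_seqs_dominated[OF _ s K(1)])
    have sm: "s k \<in> FC" for k using cauchy_seqs_mem[OF s] by simp
    show "lact m n (s k) \<in> car FT" for k using lFC[OF sm] by simp
    show "tn (cdiff FT (lact m n (s i)) (lact m n (s j))) <= ?K * tn (cdiff FT (s i) (s j))" for i j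
      unfolding cdiff_FT tmap_diff[symmetric] by (intro tn_lact m n FC_diff sm)
  qed
  have rc: "(%k. ract m n (s k)) \<in> cauchy_seqs FT" if s: "s \<in> cauchy_seqs FT" for s
  proof (rule FT.cauchy_seqs_dominated[OF _ s K(2)])
    have sm: "s k \<in> FC" for k using cauchy_seqs_mem[OF s] by simp
    show "ract m n (s k) \<in> car FT" for k using rFC[OF sm] by simp
    show "tn (cdiff FT (ract m n (s i)) (ract m n (s j))) <= ?K' * tn (cdiff FT (s i) (s j))" for i j
      unfolding cdiff_FT tmap_diff[symmetric] by (intro tn_ract m n FC_diff sm)
  qed
  define f where "f X = cauchy_class FT (%k. lact m n (cauchy_rep X k))" for X
  define g where "g X = cauchy_class FT (%k. ract m n (cauchy_rep X k))" for X
  have T: "T = ?Q" by (rule tensor_product_def)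
  let ?x = "(\<lambda>X\<in>car T. f X, \<lambda>X\<in>car T. g X)"
  have dc: "dcent T ?x"
  proof (rule T.double_centralizerI)
    fix X assume X: "X \<in> car T"
    note r = FT.rep_mem[OF X[unfolded T]]
    have rm: "cauchy_rep X k \<in> FC" for k using cauchy_seqs_mem[OF r(1)] by simp
    show "f X \<in> car T" "g X \<in> car T"
      unfolding f_def g_def T by (intro FT.cl_mem lc rc r(1))+
    show "cnorm T (f X) <= ?K * cnorm T X"
    proof (rule LIMSEQ_le)
      show "(%k. tn (lact m n (cauchy_rep X k))) ----> cnorm T (f X)"
        unfolding f_def T by (rule FT.completion_norm[OF lc[OF r(1)]])
      show "(%k. ?K * tn (cauchy_rep X k)) ----> ?K * cnorm T X"
        using FT.completion_norm[OF r(1)] unfolding r(2) T by (rule tendsto_mult_left)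
      show "\<exists>N. \<forall>k\<ge>N. tn (lact m n (cauchy_rep X k)) <= ?K * tn (cauchy_rep X k)"
        using tn_lact[OF m n rm] by blast
    qed
    fix Y assume Y: "Y \<in> car T"
    note q = FT.rep_mem[OF Y[unfolded T]]
    have qm: "cauchy_rep Y k \<in> FC" for k using cauchy_seqs_mem[OF q(1)] by simp
    have "cmult T (g X) Y = cauchy_class FT (%k. fm (ract m n (cauchy_rep X k)) (cauchy_rep Y k))"
      using FT.completion_times[OF rc[OF r(1)] q(1)] unfolding g_def T q(2) by simp
    also have "... = cauchy_class FT (%k. fm (cauchy_rep X k) (lact m n (cauchy_rep Y k)))"
      using ract_mult_lact[OF m n rm qm] by simp
    also have "... = cmult T X (f Y)"
      using FT.completion_times[OF r(1) lc[OF q(1)]] unfolding f_def T r(2) by simp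
    finally show "cmult T (g X) Y = cmult T X (f Y)" .
  qed
  moreover have "f (et a b) = et (fst m a) (fst n b)" "g (et a b) = et (snd m a) (snd n b)"
    if ab: "a \<in> car A" "b \<in> car B" for a b
  proof -
    have s: "(%_. sng a b 1) \<in> cauchy_seqs FT" using ab by (intro const_cauchy) auto
    note r = FT.rep_cl[OF s]
    have rm: "cauchy_rep (et a b) k \<in> FC" for k using cauchy_seqs_mem[OF r(1)] by (simp add: elementary_tensor_def)
    have lim: "(%k. tn (cauchy_rep (et a b) k - sng a b 1)) ----> 0"
      using r(2) by (simp add: FT.null_seq_def cdiff_FT elementary_tensor_def)
    have r1: "cauchy_rep (et a b) \<in> cauchy_seqs FT" using r(1) by (simp add: elementary_tensor_def)
    \<comment> \<open>The representative chosen for an elementary tensor need not be the constant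
      sequence, so boundedness is used to compare the two.\<close>
    have "FT.null_seq (%k. lact m n (cauchy_rep (et a b) k)) (%_. lact m n (sng a b 1))"
    proof (rule FT.null_seqI)
      show "tn (cdiff FT (lact m n (cauchy_rep (et a b) k)) (lact m n (sng a b 1))) <= ?K * tn (cauchy_rep (et a b) k - sng a b 1)" for k
        unfolding cdiff_FT tmap_diff[symmetric] using ab by (intro tn_lact m n FC_diff rm) auto
      show "(%k. ?K * tn (cauchy_rep (et a b) k - sng a b 1)) ----> 0" by (rule tendsto_mult_right_zero[OF lim])
    qed (use lFC rm ab in auto)
    then have "f (et a b) = cauchy_class FT (%_. lact m n (sng a b 1))"
      unfolding f_def using FT.cl_eq_iff[OF lc[OF r1] lc[OF s]] by simp
    then show "f (et a b) = et (fst m a) (fst n b)" by (simp add: tmap_single elementary_tensor_def)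
    have "FT.null_seq (%k. ract m n (cauchy_rep (et a b) k)) (%_. ract m n (sng a b 1))"
    proof (rule FT.null_seqI)
      show "tn (cdiff FT (ract m n (cauchy_rep (et a b) k)) (ract m n (sng a b 1))) <= ?K' * tn (cauchy_rep (et a b) k - sng a b 1)" for k
        unfolding cdiff_FT tmap_diff[symmetric] using ab by (intro tn_ract m n FC_diff rm) auto
      show "(%k. ?K' * tn (cauchy_rep (et a b) k - sng a b 1)) ----> 0" by (rule tendsto_mult_right_zero[OF lim])
    qed (use rFC rm ab in auto)
    then have "g (et a b) = cauchy_class FT (%_. ract m n (sng a b 1))"
      unfolding g_def using FT.cl_eq_iff[OF rc[OF r1] rc[OF s]] by simp
    then show "g (et a b) = et (snd m a) (snd n b)" by (simp add: tmap_single elementary_tensor_def)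
  qed
  ultimately show ?thesis by (intro exI[of _ ?x]) auto
qed

abbreviation "mt \<equiv> multiplier_tensor A B"

lemma
  assumes m: "dcent A m" and n: "dcent B n"
  shows mt_mem: "dcent T (mt m n)"
    and fst_mt: "a \<in> car A ==> b \<in> car B ==> fst (mt m n) (et a b) = et (fst m a) (fst n b)"
    and snd_mt: "a \<in> car A ==> b \<in> car B ==> snd (mt m n) (et a b) = et (snd m a) (snd n b)"
proof -
  let ?Pr = "%x. x \<in> car MT \<and> (\<forall>a\<in>car A. \<forall>b\<in>car B.
     fst x (et a b) = et (fst m a) (fst n b) \<and> snd x (et a b) = et (snd m a) (snd n b))"
  have "\<exists>!x. ?Pr x"
  proof (rule ex_ex1I)
    show "\<exists>x. ?Pr x" using multiplier_tensor_exists[OF m n] by simp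
    fix x y assume "?Pr x" "?Pr y"
    then show "x = y" by (intro tensor_multiplier_eqI) auto
  qed
  then have "?Pr (mt m n)" unfolding multiplier_tensor_def by (rule theI')
  then show "dcent T (mt m n)"
    "a \<in> car A ==> b \<in> car B ==> fst (mt m n) (et a b) = et (fst m a) (fst n b)"
    "a \<in> car A ==> b \<in> car B ==> snd (mt m n) (et a b) = et (snd m a) (snd n b)"
    by auto
qed

lemma mt_adj:
  assumes m: "dcent A m" and n: "dcent B n"
  shows "cstar MT (mt m n) = mt (cstar MA m) (cstar MB n)"
proof (rule tensor_multiplier_eqI)
  note mn = A.multiplier_adj_mem[OF m] B.multiplier_adj_mem[OF n]
  show "dcent T (cstar MT (mt m n))" by (intro T.multiplier_adj_mem mt_mem m n)
  show "dcent T (mt (cstar MA m) (cstar MB n))" by (intro mt_mem mn)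
  fix a b assume ab: "a \<in> car A" "b \<in> car B"
  have "fst (cstar MT (mt m n)) (et a b) = cstar T (snd (mt m n) (cstar T (et a b)))" using ab by simp
  also have "... = et (cstar A (snd m (cstar A a))) (cstar B (snd n (cstar B b)))"
    using ab m n by (simp add: et_adj[of _ a _ b] snd_mt et_adj[of "snd m (cstar A a)" a "snd n (cstar B b)" b])
  also have "... = fst (mt (cstar MA m) (cstar MB n)) (et a b)"
    using fst_mt[OF mn ab] ab by simp
  finally show "fst (cstar MT (mt m n)) (et a b) = fst (mt (cstar MA m) (cstar MB n)) (et a b)" .
qed

end

section \<open>Tensor products with the compact operators\<close>

text \<open>The counterpart of \<open>pext\<close> for values in a vector space on a carrier
  set.\<close>

definition lext :: "'a cstar_alg => ('x => 'a) => ('x \<Rightarrow>\<^sub>0 complex) => 'a" where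
  "lext D g u = csum D (%x. csmult D (lookup u x) (g x)) (keys u)"

context carrier_vector_space
begin

lemma
  assumes g: "!!x. x \<in> S ==> g x \<in> car A" and u: "keys u \<subseteq> S"
  shows lext_mem: "lext A g u \<in> car A"
    and coord_lext: "coord A (lext A g u) i = (\<Sum>x\<in>keys u. lookup u x * coord A (g x) i)"
proof -
  have [simp]: "g x \<in> car A" if "x \<in> keys u" for x using that g u by auto
  show "lext A g u \<in> car A" unfolding lext_def by (intro csum_mem) auto
  show "coord A (lext A g u) i = (\<Sum>x\<in>keys u. lookup u x * coord A (g x) i)"
    unfolding lext_def by (subst coord_csum) auto
qed

lemma lext_add:
  assumes g: "!!x. x \<in> S ==> g x \<in> car A" and u: "keys u \<subseteq> S" and v: "keys v \<subseteq> S"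
  shows "lext A g (u + v) = lext A g u \<oplus> lext A g v"
proof (rule vec_eqI)
  have uv: "keys (u + v) \<subseteq> S" using keys_add[of u v] u v by auto
  have m: "lext A g w \<in> car A" if "keys w \<subseteq> S" for w
    by (rule lext_mem[where S=S]) (use g that in auto)
  have c: "coord A (lext A g w) i = (\<Sum>x\<in>keys w. lookup w x * coord A (g x) i)"
    if "keys w \<subseteq> S" for w i
    by (rule coord_lext[where S=S]) (use g that in auto)
  show "lext A g (u + v) \<in> car A" "lext A g u \<oplus> lext A g v \<in> car A" using m u v uv by auto
  fix i
  have "coord A (lext A g (u + v)) i = coord A (lext A g u) i + coord A (lext A g v) i"
    unfolding c[OF uv] c[OF u] c[OF v]
    by (rule pm_sum_add[where f="%x c. c * coord A (g x) i"]) (simp_all add: algebra_simps)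
  then show "coord A (lext A g (u + v)) i = coord A (lext A g u \<oplus> lext A g v) i" using m u v by simp
qed

lemma lext_zero [simp]: "lext A g 0 = \<zero>"
  by (simp add: lext_def)

lemma lext_single: "g x \<in> car A ==> lext A g (single x c) = c \<odot> g x"
  by (cases "c = 0") (simp_all add: lext_def zero_smult csum_singleton)

lemma csum_smult_const: "z \<in> car A ==> csum A (%m. s m \<odot> z) S = (\<Sum>m\<in>S. s m) \<odot> z"
  by (rule vec_eqI) (simp_all add: sum_distrib_right)

end

lemma (in pre_cstar_algebra) ctends_scalar:
  assumes "s ----> c" and [simp]: "z \<in> car A"
  shows "ctends A (%n. s n \<odot> z) (c \<odot> z)"
proof (rule ctendsI)
  fix n
  have "cdiff A (s n \<odot> z) (c \<odot> z) = (s n - c) \<odot> z" by (rule vec_eqI) (auto simp: algebra_simps)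
  then show "cnorm A (cdiff A (s n \<odot> z) (c \<odot> z)) <= cmod (s n - c) * cnorm A z" by (simp add: norm_scale)
next
  have "(%n. s n - c) ----> 0" using assms(1) by (simp add: LIM_zero_iff)
  then show "(%n. cmod (s n - c) * cnorm A z) ----> 0"
    by (intro tendsto_mult_left_zero tendsto_norm_zero)
qed auto

text \<open>A unit vector \<open>\<omega>\<close> is fixed separately, because any given basis
  vector \<open>e n\<close> may be zero.\<close>

locale tensor_K = hilbert_basis e + A: cstar_algebra A
  for e :: "nat => 'h::complex_hilbert_space" and A :: "'a cstar_alg" +
  fixes \<omega> :: 'h
  assumes norm_omega: "norm \<omega> = 1"

abbreviation (in tensor_K) KK :: "('h op) cstar_alg" where "KK \<equiv> compact_operators"

sublocale tensor_K \<subseteq> tensor_pair A "compact_operators :: ('h op) cstar_alg"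
  by (intro tensor_pair.intro A.cstar_algebra_axioms cstar_algebra_compact_operators)

context tensor_K
begin

abbreviation "om \<equiv> rone \<omega> \<omega>"

lemma om_omega: "ap om \<omega> = \<omega>"
  using norm_omega by (simp add: cinner_self scaleC_one)

lemma om_mem [simp]: "Kop om" by (rule Kop_rone)

lemma hadj_om: "hadj om = om" by (rule hadj_rone)

lemma om_om: "om o\<^sub>L om = om"
  by (simp add: op_rone clin_rone om_omega del: rone_apply)

lemma FC_iff: "u \<in> FC \<longleftrightarrow> keys u \<subseteq> car A \<times> car KK"
  by (simp add: free_tensor_carrier_def)

text \<open>The slice map \<open>id \<otimes> f\<close> on the free space.\<close>

definition slice :: "('h op => complex) => ('a \<times> ('h op) \<Rightarrow>\<^sub>0 complex) => 'a" where
  "slice f u = lext A (%x. csmult A (f (snd x)) (fst x)) u"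

lemma
  assumes u: "u \<in> FC"
  shows slice_mem [simp]: "slice f u \<in> car A"
  unfolding slice_def by (rule A.lext_mem[where S="car A \<times> car KK"]) (use u in "auto simp: FC_iff")

lemma slice_add: "u \<in> FC ==> v \<in> FC ==> slice f (u + v) = cadd A (slice f u) (slice f v)"
  unfolding slice_def by (rule A.lext_add[where S="car A \<times> car KK"]) (auto simp: FC_iff)

lemma slice_zero [simp]: "slice f 0 = czero A" by (simp add: slice_def)

lemma slice_single: "a \<in> car A ==> slice f (sng a k c) = csmult A (c * f k) a"
  by (simp add: slice_def A.lext_single A.smult_assoc)

lemma slice_scale:
  assumes u: "u \<in> FC" shows "slice f (pm_scale c u) = csmult A c (slice f u)"
  using u
proof (induction rule: FC_induct)
  case (add a b d u)
  then show ?case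
    by (simp add: pm.scale_right_distrib slice_add slice_single A.smult_plus A.smult_assoc mult.assoc)
qed (simp add: A.smult_zero)

lemma slice_diff: "u \<in> FC ==> v \<in> FC ==> slice f (u - v) = cdiff A (slice f u) (slice f v)"
  unfolding cdiff_def by (simp only: pm_minus slice_add FC_scale slice_scale)

text \<open>The slice along the vector state of \<open>\<omega>\<close>.\<close>

definition \<phi> :: "('a \<times> ('h op) \<Rightarrow>\<^sub>0 complex) => 'a" where
  "\<phi> = slice (%k. cinner (ap k \<omega>) \<omega>)"

lemma phi_mem [simp]: "u \<in> FC ==> \<phi> u \<in> car A"
  and phi_add: "u \<in> FC ==> v \<in> FC ==> \<phi> (u + v) = cadd A (\<phi> u) (\<phi> v)"
  and phi_diff: "u \<in> FC ==> v \<in> FC ==> \<phi> (u - v) = cdiff A (\<phi> u) (\<phi> v)"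
  and phi_scale: "u \<in> FC ==> \<phi> (pm_scale c u) = csmult A c (\<phi> u)"
  and phi_zero [simp]: "\<phi> 0 = czero A"
  and phi_single: "a \<in> car A ==> \<phi> (sng a k c) = csmult A (c * cinner (ap k \<omega>) \<omega>) a"
  by (simp_all add: \<phi>_def slice_add slice_scale slice_single slice_diff)

text \<open>The right action of \<open>A\<close> on the Hilbert module is realised inside the tensor
  product as multiplication by \<open>c \<otimes> om\<close>; this works because \<open>om\<close>
  fixes \<open>\<omega>\<close>.\<close>

lemma phi_mult_right:
  assumes u: "u \<in> FC" and c: "c \<in> car A"
  shows "\<phi> (fm u (sng c om 1)) = cmult A (\<phi> u) c"
  using u
proof (induction rule: FC_induct)
  case (add a k d u)
  have "fm u (sng c om 1) \<in> FC" using add c by (intro FC_mult FC_single) (auto simp: Kop_iff)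
  moreover have "sng (cmult A a c) (k o\<^sub>L om) d \<in> FC"
    using add c B.times_mem[of k om] by (intro FC_single) (auto simp: Kop_iff)
  ultimately show ?case using add c
    by (simp add: ftm_add_left ftm_single phi_add phi_single om_omega A.plus_times A.smult_times del: rone_apply)
qed (use c in "simp add: A.zero_times")

lemma cinner_hadj_omega: "Kop k ==> cinner (ap (hadj k) x) y = cinner x (ap k y)"
  by (metis Kop_clin cinner_commute hadj(1))

lemma phi_star:
  assumes u: "u \<in> FC" shows "\<phi> (fs u) = cstar A (\<phi> u)"
  using u
proof (induction rule: FC_induct)
  case (add a k d u)
  have "cinner (ap (hadj k) \<omega>) \<omega> = cnj (cinner (ap k \<omega>) \<omega>)"
    using add cinner_hadj_omega[of k \<omega> \<omega>] cinner_commute[of \<omega> "ap k \<omega>"] by (simp add: Kop_iff)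
  moreover have "sng (cstar A a) (hadj k) (cnj d) \<in> FC" using add B.adj_mem[of k] by (intro FC_single) auto
  ultimately show ?case using add
    by (simp add: fts_add fts_single phi_add phi_single A.adj_plus A.adj_smult)
qed (simp add: A.adj_zero)

lemma phi_mult_left:
  assumes u: "u \<in> FC" and c: "c \<in> car A"
  shows "\<phi> (fm (sng (cstar A c) om 1) u) = cmult A (cstar A c) (\<phi> u)"
proof -
  have cm: "sng c om 1 \<in> FC" using c by (intro FC_single) (auto simp: Kop_iff)
  have "fm (sng (cstar A c) om 1) u = fs (fm (fs u) (sng c om 1))"
    using fs_mult[OF FC_star[OF u] cm] u by (simp add: fs_fs fts_single hadj_om)
  then show ?thesis
    using u c cm by (simp add: phi_star phi_mult_right A.adj_times A.adj_adj)
qed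

lemma phi_tnull: "u \<in> tnull ==> \<phi> u = czero A"
proof (induction rule: tnull_induct)
  case (add u v)
  then show ?case using tnull_FC[OF add(1)] tnull_FC[OF add(2)] by (simp add: phi_add A.zero_plus)
next
  case (scale c u)
  then show ?case using tnull_FC[OF scale(1)] by (simp add: phi_scale A.smult_zero)
next
  case (add_left a a' b)
  then show ?case
    by (intro A.vec_eqI) (simp_all add: phi_diff phi_add phi_single algebra_simps del: diff_diff_eq diff_diff_add)
next
  case (add_right a b b')
  moreover have "b + b' \<in> car KK" using add_right B.add_mem[of b b'] by simp
  ultimately show ?case
    by (intro A.vec_eqI) (simp_all add: phi_diff phi_add phi_single algebra_simps blinfun.add_left cinner_add_left)
next
  case (smult_left d a b)
  then show ?case
    by (intro A.vec_eqI) (simp_all add: phi_diff phi_single algebra_simps)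
next
  case (smult_right d a b)
  moreover have "cscale_op d b \<in> car KK" using smult_right B.smult_mem[of b d] by simp
  ultimately show ?case
    by (intro A.vec_eqI) (simp_all add: phi_diff phi_single algebra_simps cinner_scaleC_left)
qed simp

text \<open>Expanding along the basis exhibits \<open>\<phi> (u\<^sup>* v)\<close> as a limit of sums of \<open>\<psi> m u\<^sup>* \<psi> m v\<close>.\<close>

definition \<psi> :: "nat => ('a \<times> ('h op) \<Rightarrow>\<^sub>0 complex) => 'a" where
  "\<psi> m = slice (%k. cinner (ap k \<omega>) (e m))"

definition gr :: "nat => ('a \<times> ('h op) \<Rightarrow>\<^sub>0 complex) => ('a \<times> ('h op) \<Rightarrow>\<^sub>0 complex) => 'a" where
  "gr n u v = csum A (%m. cmult A (cstar A (\<psi> m u)) (\<psi> m v)) {..<n}"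

lemma psi_mem [simp]: "u \<in> FC ==> \<psi> m u \<in> car A" by (simp add: \<psi>_def)

lemma gr_add_left: "u \<in> FC ==> u' \<in> FC ==> v \<in> FC ==> gr n (u + u') v = cadd A (gr n u v) (gr n u' v)"
  and gr_add_right: "u \<in> FC ==> v' \<in> FC ==> v \<in> FC ==> gr n u (v + v') = cadd A (gr n u v) (gr n u v')"
  unfolding gr_def by (subst A.csum_add[symmetric]; simp add: \<psi>_def slice_add A.adj_plus A.plus_times A.times_plus)+

lemma gr_single:
  assumes a: "a \<in> car A" "a' \<in> car A"
  shows "gr n (sng a k c) (sng a' k' c')
    = csmult A (cnj c * c' * cinner (hproj e n (ap k' \<omega>)) (ap k \<omega>)) (cmult A (cstar A a) a')"
proof -
  have "gr n (sng a k c) (sng a' k' c')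
    = csum A (%m. csmult A (cnj (c * cinner (ap k \<omega>) (e m)) * (c' * cinner (ap k' \<omega>) (e m))) (cmult A (cstar A a) a')) {..<n}"
    unfolding gr_def using a
    by (intro A.csum_cong) (simp_all add: \<psi>_def slice_single A.adj_smult A.smult_times A.times_smult A.smult_assoc mult.commute)
  also have "... = csmult A (\<Sum>m<n. cnj (c * cinner (ap k \<omega>) (e m)) * (c' * cinner (ap k' \<omega>) (e m))) (cmult A (cstar A a) a')"
    using a by (intro A.csum_smult_const) auto
  also have "(\<Sum>m<n. cnj (c * cinner (ap k \<omega>) (e m)) * (c' * cinner (ap k' \<omega>) (e m)))
    = cnj c * c' * cinner (hproj e n (ap k' \<omega>)) (ap k \<omega>)"
    unfolding hproj_def cinner_sum_left cinner_scaleC_left sum_distrib_left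
  proof (intro sum.cong refl)
    fix m
    have "cinner (e m) (ap k \<omega>) = cnj (cinner (ap k \<omega>) (e m))" by (rule cinner_commute)
    then show "cnj (c * cinner (ap k \<omega>) (e m)) * (c' * cinner (ap k' \<omega>) (e m))
      = cnj c * c' * (cinner (ap k' \<omega>) (e m) * cinner (e m) (ap k \<omega>))"
      by (simp add: mult_ac)
  qed
  finally show ?thesis .
qed

lemma gr_tends:
  assumes u: "u \<in> FC" and v: "v \<in> FC"
  shows "ctends A (%n. gr n u v) (\<phi> (fm (fs u) v))"
  using u
proof (induction rule: FC_induct)
  case zero
  have "gr n 0 v = czero A" for n
    unfolding gr_def using v by (intro A.vec_eqI) (simp_all add: \<psi>_def A.adj_zero A.zero_times)
  then show ?case by (simp add: A.ctends_const)
next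
  case (add a k c u)
  have "ctends A (%n. gr n (sng a k c) v) (\<phi> (fm (fs (sng a k c)) v))"
    using v
  proof (induction rule: FC_induct)
    case zero
    have "gr n (sng a k c) 0 = czero A" for n
      unfolding gr_def using add by (intro A.vec_eqI) (simp_all add: \<psi>_def A.times_zero)
    then show ?case by (simp add: A.ctends_const)
  next
    case (add a' k' c' v)
    note ak = \<open>a \<in> car A\<close> \<open>k \<in> car KK\<close>
    have lim: "(%n. cinner (hproj e n (ap k' \<omega>)) (ap k \<omega>)) ----> cinner (ap k' \<omega>) (ap k \<omega>)"
      by (rule bounded_linear.tendsto[OF bounded_linear_cinner_left hproj_tendsto])
    have "ctends A (%n. gr n (sng a k c) (sng a' k' c'))
       (csmult A (cnj c * c' * cinner (ap k' \<omega>) (ap k \<omega>)) (cmult A (cstar A a) a'))"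
      unfolding gr_single[OF ak(1) add(1)] using ak add
      by (intro A.ctends_scalar tendsto_mult tendsto_const lim) auto
    also have "csmult A (cnj c * c' * cinner (ap k' \<omega>) (ap k \<omega>)) (cmult A (cstar A a) a')
       = \<phi> (fm (fs (sng a k c)) (sng a' k' c'))"
      using ak add cinner_hadj_omega[of k "ap k' \<omega>" \<omega>]
      by (simp add: fts_single ftm_single phi_single Kop_iff)
    finally have 1: "ctends A (%n. gr n (sng a k c) (sng a' k' c')) (\<phi> (fm (fs (sng a k c)) (sng a' k' c')))" .
    have FCs: "sng a k c \<in> FC" "sng a' k' c' \<in> FC" using ak add by auto
    show ?case
      using A.ctends_add[OF 1 add.IH] FCs add
      by (simp add: gr_add_right ftm_add_right phi_add)
  qed
  from A.ctends_add[OF this add.IH] show ?case using add v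
    by (simp add: gr_add_left fts_add ftm_add_left phi_add)
qed

section \<open>Positivity of the inner product and the Cauchy-Schwarz inequality\<close>

abbreviation "em \<equiv> multiplier_embed A"

text \<open>\<open>gr n u u\<close> is a sum of elements \<open>\<psi>\<^sup>* \<psi>\<close>,
  positive by the theorem of Kelley and Vaught, and positivity survives the limit. All this takes
  place in the multiplier algebra, which has the unit that \<open>pos\<close> refers to.\<close>

lemma phi_pos:
  assumes u: "u \<in> FC"
  shows "unital_cstar_algebra.pos MA (multiplier_one A) (em (\<phi> (fm (fs u) u)))"
proof -
  interpret M: unital_cstar_algebra MA "multiplier_one A" by (rule A.unital_cstar_algebra_multiplier)
  have mem: "gr n u u \<in> car A" for n unfolding gr_def using u by auto
  have "M.pos (em (gr n u u))" for n
  proof (induction n)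
    case 0
    have "em (gr 0 u u) = czero MA"
      by (rule A.multiplier_eqI[OF A.dcent_embed[OF mem] A.dcent_zero])
        (simp add: gr_def A.zero_times)
    then show ?case using M.pos_zero by simp
  next
    case (Suc n)
    have g: "gr (Suc n) u u = cadd A (gr n u u) (cmult A (cstar A (\<psi> n u)) (\<psi> n u))"
      unfolding gr_def using u by (intro A.csum_lessThan_Suc) auto
    have "em (\<psi> n u) \<in> car MA" using A.dcent_embed[of "\<psi> n u"] u by simp
    from M.pos_plus[OF Suc M.pos_adj_times[OF this]]
    show ?case unfolding g
      using u mem by (simp add: A.embed_add A.embed_times A.embed_adj[of _ "\<psi> n u"] del: M_simps)
  qed
  moreover have "ctends MA (%n. em (gr n u u)) (em (\<phi> (fm (fs u) u)))"
    using gr_tends[OF u u] mem u A.dcent_embed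
    by (simp add: ctends_def A.norm_embed flip: A.embed_diff del: M_simps(2-))
  ultimately show ?thesis by (rule M.pos_limit)
qed

text \<open>Put \<open>x = t u\<close>, \<open>X = \<phi> (x\<^sup>* x)\<close> of norm at most 1,
  \<open>d = \<phi> (x\<^sup>* v)\<close> and \<open>w = v - x d\<close>. Then
  \<open>\<phi> (w\<^sup>* w)\<close> and \<open>d\<^sup>* (1 - X) d\<close> are positive and add up
  to \<open>\<phi> (v\<^sup>* v) - d\<^sup>* d\<close>, so the norms compare. The parameter
  \<open>t\<close> avoids dividing by a norm that may vanish.\<close>

lemma phi_cauchy_schwarz_aux:
  assumes u: "u \<in> FC" and v: "v \<in> FC" and t: "0 < t" "t\<^sup>2 * cnorm A (\<phi> (fm (fs u) u)) <= 1"
  shows "t\<^sup>2 * (cnorm A (\<phi> (fm (fs u) v)))\<^sup>2 <= cnorm A (\<phi> (fm (fs v) v))"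
proof -
  interpret M: unital_cstar_algebra MA "multiplier_one A" by (rule A.unital_cstar_algebra_multiplier)
  define x where "x = pm_scale (rc t) u"
  define d where "d = \<phi> (fm (fs x) v)"
  define X where "X = \<phi> (fm (fs x) x)"
  define Y where "Y = \<phi> (fm (fs v) v)"
  let ?D = "sng d om 1" and ?D' = "sng (cstar A d) om 1"
  have x: "x \<in> FC" using u by (simp add: x_def)
  have d [simp]: "d \<in> car A" and X [simp]: "X \<in> car A" and Y [simp]: "Y \<in> car A"
    using x v by (auto simp: d_def X_def Y_def)
  have omK: "om \<in> car KK" by (simp add: Kop_iff)
  have D: "?D \<in> FC" "?D' \<in> FC" using omK by auto
  have fsD: "fs ?D = ?D'" by (simp add: fts_single hadj_om)
  have FCs: "fs x \<in> FC" "fs v \<in> FC" "fm x ?D \<in> FC" using x v D by auto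
  \<comment> \<open>The subtracted vector is \<open>x d\<close>, with \<open>d\<close> acting from
    the right as \<open>d \<otimes> om\<close>.\<close>
  define w where "w = v - fm x ?D"
  have w: "w \<in> FC" using v FCs by (simp add: w_def)
  have fsw: "fs w = fs v - fm ?D' (fs x)"
    by (simp add: w_def fts_diff fs_mult[OF x D(1)] fsD)
  have t1: "\<phi> (fm (fs v) (fm x ?D)) = cmult A (cstar A d) d"
  proof -
    have "fm (fs v) (fm x ?D) = fm (fm (fs v) x) ?D" using fm_assoc[OF FCs(2) x D(1)] by simp
    moreover have "\<phi> (fm (fs v) x) = cstar A d"
      using phi_star[of "fm (fs x) v"] fs_mult[OF FCs(1) v] fs_fs[OF x] x v by (simp add: d_def)
    ultimately show ?thesis using phi_mult_right[of "fm (fs v) x" d] x v by simp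
  qed
  have t2: "\<phi> (fm (fm ?D' (fs x)) v) = cmult A (cstar A d) d"
    using fm_assoc[OF D(2) FCs(1) v] phi_mult_left[of "fm (fs x) v" d] x v by (simp add: d_def)
  have t3: "\<phi> (fm (fm ?D' (fs x)) (fm x ?D)) = cmult A (cstar A d) (cmult A X d)"
  proof -
    have "fm (fm ?D' (fs x)) (fm x ?D) = fm ?D' (fm (fm (fs x) x) ?D)"
      using fm_assoc[OF D(2) FCs(1) FCs(3)] fm_assoc[OF FCs(1) x D(1)] by simp
    moreover have "fm (fm (fs x) x) ?D \<in> FC" using x D by auto
    ultimately show ?thesis
      using phi_mult_left[of "fm (fm (fs x) x) ?D" d] phi_mult_right[of "fm (fs x) x" d] x by (simp add: X_def)
  qed
  have ww: "\<phi> (fm (fs w) w) = cdiff A (cdiff A Y (cmult A (cstar A d) d)) (cdiff A (cmult A (cstar A d) d) (cmult A (cstar A d) (cmult A X d)))"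
  proof -
    have "fm (fs w) w = (fm (fs v) v - fm (fs v) (fm x ?D)) - (fm (fm ?D' (fs x)) v - fm (fm ?D' (fs x)) (fm x ?D))"
      unfolding fsw unfolding w_def by (simp add: ftm_diff_left ftm_diff_right)
    moreover have "fm (fm ?D' (fs x)) v \<in> FC" "fm (fm ?D' (fs x)) (fm x ?D) \<in> FC" "fm (fs v) v \<in> FC" "fm (fs v) (fm x ?D) \<in> FC"
      using FCs D v by (auto intro!: FC_mult)
    ultimately show ?thesis by (simp add: phi_diff t1 t2 t3 Y_def)
  qed
  have emM [simp]: "em a \<in> car MA" if "a \<in> car A" for a using A.dcent_embed[OF that] by simp
  have Xle: "cnorm MA (em X) <= 1"
  proof -
    have "fm (fs x) x = pm_scale (rc (t\<^sup>2)) (fm (fs u) u)"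
      by (simp add: x_def fts_scale ftm_scale_left ftm_scale_right pm.scale_scale power2_eq_square)
    then have "X = csmult A (rc (t\<^sup>2)) (\<phi> (fm (fs u) u))" using u by (simp add: X_def phi_scale)
    then show ?thesis using t u by (simp add: A.norm_embed A.norm_scale norm_power)
  qed
  have Xadj: "cstar A X = X" using phi_star[of "fm (fs x) x"] fs_mult[OF FCs(1) x] fs_fs[OF x] x by (simp add: X_def)
  have "M.pos (cdiff MA (multiplier_one A) (em X))"
    unfolding M.pos_def
  proof (intro conjI exI[of _ 1])
    have "cdiff MA (csmult MA (rc 1) (multiplier_one A)) (cdiff MA (multiplier_one A) (em X)) = em X"
      by (rule M.vec_eqI) (simp_all del: M_simps)
    then show "cnorm MA (cdiff MA (csmult MA (rc 1) (multiplier_one A)) (cdiff MA (multiplier_one A) (em X))) <= 1"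
      using Xle by simp
    show "cstar MA (cdiff MA (multiplier_one A) (em X)) = cdiff MA (multiplier_one A) (em X)"
      using A.embed_adj[OF X X] Xadj by (simp add: M.adj_diff M.adj_unit del: M_simps)
  qed (simp_all del: M_simps)
  from M.pos_plus[OF phi_pos[OF w] M.pos_conj[OF this emM[OF d]]]
  have p: "M.pos (cadd MA (em (\<phi> (fm (fs w) w))) (cmult MA (cstar MA (em d)) (cmult MA (cdiff MA (multiplier_one A) (em X)) (em d))))" .
  have "cadd MA (em (\<phi> (fm (fs w) w))) (cmult MA (cstar MA (em d)) (cmult MA (cdiff MA (multiplier_one A) (em X)) (em d)))
      = cdiff MA (em Y) (em (cmult A (cstar A d) d))"
    unfolding ww
    by (rule M.vec_eqI)
      (simp_all add: A.embed_diff A.embed_times A.embed_adj[OF d d] M.unital_simps del: M_simps)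
  with p have "M.pos (cdiff MA (em Y) (em (cmult A (cstar A d) d)))" by simp
  moreover have "M.pos (em (cmult A (cstar A d) d))"
    using M.pos_adj_times[OF emM[OF d]] by (simp add: A.embed_times A.embed_adj[OF d d] del: M_simps)
  ultimately have "cnorm MA (em (cmult A (cstar A d) d)) <= cnorm MA (em Y)"
    using emM[OF Y] by (intro M.norm_mono)
  then have 1: "(cnorm A d)\<^sup>2 <= cnorm A Y" by (simp add: A.norm_embed A.norm_adj_times)
  have "fm (fs x) v = pm_scale (rc t) (fm (fs u) v)" by (simp add: x_def fts_scale ftm_scale_left)
  then have "cnorm A d = t * cnorm A (\<phi> (fm (fs u) v))" using t u v by (simp add: d_def phi_scale A.norm_scale)
  then show ?thesis using 1 by (simp add: Y_def power_mult_distrib)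
qed

lemma phi_cauchy_schwarz:
  assumes u: "u \<in> FC" and v: "v \<in> FC"
  shows "(cnorm A (\<phi> (fm (fs u) v)))\<^sup>2 <= cnorm A (\<phi> (fm (fs u) u)) * cnorm A (\<phi> (fm (fs v) v))"
proof -
  let ?X = "cnorm A (\<phi> (fm (fs u) u))" and ?Y = "cnorm A (\<phi> (fm (fs v) v))" and ?c = "cnorm A (\<phi> (fm (fs u) v))"
  have nn: "0 <= ?X" "0 <= ?Y" "0 <= ?c" using u v by (auto intro!: A.norm_ge_zero)
  show ?thesis
  proof (cases "?X = 0")
    case True
    have "?c\<^sup>2 = 0"
    proof (rule ccontr)
      assume "?c\<^sup>2 ~= 0"
      then have c: "0 < ?c\<^sup>2" by simp
      \<comment> \<open>For \<open>u\<close> of length zero every \<open>t\<close> is admissible;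
        this one would make the left-hand side exceed the right-hand side by 1.\<close>
      define t where "t = sqrt ((?Y + 1) / ?c\<^sup>2)"
      have t: "0 < t" using nn c by (simp add: t_def)
      have "t\<^sup>2 = (?Y + 1) / ?c\<^sup>2" using nn c by (simp add: t_def)
      then have "t\<^sup>2 * ?c\<^sup>2 = ?Y + 1" using c by simp
      moreover have "t\<^sup>2 * ?c\<^sup>2 <= ?Y" using phi_cauchy_schwarz_aux[OF u v t] True by simp
      ultimately show False by simp
    qed
    then show ?thesis using True by simp
  next
    case False
    then have X: "0 < ?X" using nn by simp
    define t where "t = 1 / sqrt ?X"
    have t: "0 < t" "t\<^sup>2 = 1 / ?X" using X by (auto simp: t_def power_divide)
    have "t\<^sup>2 * ?c\<^sup>2 <= ?Y" using phi_cauchy_schwarz_aux[OF u v t(1)] t(2) X by simp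
    then show ?thesis using X by (simp add: t(2) field_simps)
  qed
qed

section \<open>The representation of the tensor product on the Hilbert module\<close>

definition gns :: "('a \<times> ('h op) \<Rightarrow>\<^sub>0 complex) => real" where
  "gns u = sqrt (cnorm A (\<phi> (fm (fs u) u)))"

lemma gns_sq: "u \<in> FC ==> (gns u)\<^sup>2 = cnorm A (\<phi> (fm (fs u) u))"
  by (simp add: gns_def A.norm_ge_zero)

lemma gns_cs: "u \<in> FC ==> v \<in> FC ==> cnorm A (\<phi> (fm (fs u) v)) <= gns u * gns v"
  unfolding gns_def real_sqrt_mult[symmetric] by (rule real_le_rsqrt) (rule phi_cauchy_schwarz)

lemma gns_hilbert: "hilbert_seminorm gns (%z. cnorm A (\<phi> z))"
  unfolding hilbert_seminorm_def
proof (intro conjI ballI allI)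
  fix u assume u: "u \<in> FC"
  show nn: "0 <= gns u" using u by (simp add: gns_def A.norm_ge_zero)
  show "(gns u)\<^sup>2 = cnorm A (\<phi> (fm (fs u) u))" by (rule gns_sq[OF u])
  show "gns (pm_scale c u) = cmod c * gns u" for c
  proof -
    have "fm (fs (pm_scale c u)) (pm_scale c u) = pm_scale (rc ((cmod c)\<^sup>2)) (fm (fs u) u)"
      unfolding complex_norm_square by (simp add: fts_scale ftm_scale_left ftm_scale_right pm.scale_scale)
    then show ?thesis using u by (simp add: gns_def phi_scale A.norm_scale norm_power real_sqrt_mult)
  qed
  fix v assume v: "v \<in> FC"
  show "cnorm A (\<phi> (fm (fs u) v)) <= gns u * gns v" by (rule gns_cs[OF u v])
  show "gns (u + v) <= gns u + gns v"
  proof (rule power2_le_imp_le)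
    have "\<phi> (fm (fs (u + v)) (u + v)) = cadd A (cadd A (\<phi> (fm (fs u) u)) (\<phi> (fm (fs u) v))) (cadd A (\<phi> (fm (fs v) u)) (\<phi> (fm (fs v) v)))"
      using u v by (intro A.vec_eqI) (simp_all add: fts_add ftm_add_left ftm_add_right phi_add)
    then have "(gns (u + v))\<^sup>2 = cnorm A (cadd A (cadd A (\<phi> (fm (fs u) u)) (\<phi> (fm (fs u) v))) (cadd A (\<phi> (fm (fs v) u)) (\<phi> (fm (fs v) v))))"
      using u v by (simp add: gns_sq)
    also have "... <= (cnorm A (\<phi> (fm (fs u) u)) + cnorm A (\<phi> (fm (fs u) v))) + (cnorm A (\<phi> (fm (fs v) u)) + cnorm A (\<phi> (fm (fs v) v)))"
      using u v by (intro order_trans[OF A.norm_plus] add_mono A.norm_plus) auto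
    also have "... <= ((gns u)\<^sup>2 + gns u * gns v) + (gns v * gns u + (gns v)\<^sup>2)"
      by (intro add_mono gns_cs u v) (simp_all add: gns_sq u v)
    also have "... = (gns u + gns v)\<^sup>2" by (simp add: power2_eq_square algebra_simps)
    finally show "(gns (u + v))\<^sup>2 <= (gns u + gns v)\<^sup>2" .
    show "0 <= gns u + gns v" using u v by (simp add: gns_def A.norm_ge_zero)
  qed
next
  fix u assume "u \<in> bilinearity_relations A KK"
  then have u: "u \<in> tnull" "u \<in> FC" unfolding tnull_def using relations_FC by (auto intro: pm.span_base)
  have "\<phi> (fm (fs u) u) = czero A" using tnull_mult_left[OF u(1), of "fs u"] u(2) by (intro phi_tnull) auto
  then show "gns u = 0" by (simp add: gns_def A.norm_zero)
qed

lemmas gns_nonneg = hs_nonneg[OF gns_hilbert] and gns_add = hs_add[OF gns_hilbert]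
  and gns_scale = hs_scale[OF gns_hilbert] and gns_tnull = hs_tnull[OF gns_hilbert]

lemma single_mult_lact:
  assumes ab: "a \<in> car A" "k \<in> car KK" and u: "u \<in> FC"
  shows "fm (sng a k c) u = pm_scale c (lact (multiplier_embed A a) (multiplier_embed KK k) u)"
  by (rule FC_eqI[OF u, where L="fm (sng a k c)" and K="%u. pm_scale c (lact (multiplier_embed A a) (multiplier_embed KK k) u)"])
    (use ab in "simp_all add: ft_linear pm.scale_right_distrib ftm_single tmap_single B.fst_embed del: compact_operators_simps")

text \<open>A generator \<open>a \<otimes> k\<close> acts as the pair of multipliers of
  \<open>a\<close> and \<open>k\<close>, so \<open>hs_lact\<close> bounds it. Boundedness makes the
  supremum in \<open>opn\<close> meaningful.\<close>

lemma gns_action_bound: "t \<in> FC ==> \<exists>C\<ge>0. \<forall>x\<in>FC. gns (fm t x) <= C * gns x"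
proof (induction rule: FC_induct)
  case zero
  have "gns 0 = 0" by (rule hs_zero[OF gns_hilbert])
  then show ?case by (intro exI[of _ 0]) simp
next
  case (add a k c t)
  then obtain C where C: "0 <= C" "!!x. x \<in> FC ==> gns (fm t x) <= C * gns x" by blast
  let ?C = "cmod c * (cnorm MA (multiplier_embed A a) * cnorm MB (multiplier_embed KK k))"
  note dc = A.dcent_embed[OF add(1)] B.dcent_embed[OF add(2)]
  have "gns (fm (sng a k c + t) x) <= (?C + C) * gns x" if x: "x \<in> FC" for x
  proof -
    have l: "lact (multiplier_embed A a) (multiplier_embed KK k) x \<in> FC" using dc x by auto
    have "gns (fm (sng a k c) x) <= ?C * gns x"
      unfolding single_mult_lact[OF add(1,2) x] gns_scale[OF l]
      using mult_left_mono[OF hs_lact[OF gns_hilbert dc x], of "cmod c"] by (simp add: mult.assoc)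
    moreover have "gns (fm (sng a k c + t) x) <= gns (fm (sng a k c) x) + gns (fm t x)"
      unfolding ftm_add_left using add x by (intro gns_add) auto
    ultimately show ?thesis using C(2)[OF x] by (simp add: semiring_class.distrib_right)
  qed
  moreover have "0 <= ?C" using A.multiplier_norm_nonneg[OF dc(1)] B.multiplier_norm_nonneg[OF dc(2)] by simp
  ultimately show ?case using C(1) by (intro exI[of _ "?C + C"]) auto
qed

text \<open>The operator seminorm of left multiplication by \<open>t\<close> on the Hilbert module.
  Being a C*-seminorm, it is a lower bound for \<open>tn\<close>.\<close>

definition opn :: "('a \<times> ('h op) \<Rightarrow>\<^sub>0 complex) => real" where
  "opn t = Sup {gns (fm t x) | x. x \<in> FC \<and> gns x <= 1}"

lemma
  assumes t: "t \<in> FC"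
  shows opn_bound: "x \<in> FC ==> gns (fm t x) <= opn t * gns x"
    and opn_nonneg: "0 <= opn t"
    and opn_le: "0 <= K ==> (!!x. x \<in> FC ==> gns (fm t x) <= K * gns x) ==> opn t <= K"
proof -
  let ?S = "{gns (fm t x) |x. x \<in> FC \<and> gns x <= 1}"
  obtain C where C: "0 <= C" "!!x. x \<in> FC ==> gns (fm t x) <= C * gns x" using gns_action_bound[OF t] by blast
  have bdd: "bdd_above ?S"
  proof (rule bdd_aboveI[of _ C], elim CollectE exE conjE)
    fix y x assume x: "y = gns (fm t x)" "x \<in> FC" "gns x <= 1"
    show "y <= C" using C(2)[OF x(2)] mult_left_mono[OF x(3) C(1)] x(1) by simp
  qed
  have g0: "gns 0 = 0" by (rule hs_zero[OF gns_hilbert])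
  have in0: "0 \<in> ?S" by (intro CollectI exI[of _ 0]) (simp add: g0)
  show nn: "0 <= opn t" unfolding opn_def by (rule cSup_upper[OF in0 bdd])
  show "gns (fm t x) <= opn t * gns x" if x: "x \<in> FC" for x
  proof (cases "gns x = 0")
    case True
    then show ?thesis using C(2)[OF x] by simp
  next
    case False
    then have p: "0 < gns x" using gns_nonneg[OF x] by simp
    let ?y = "pm_scale (rc (1 / gns x)) x"
    have "?y \<in> FC \<and> gns ?y <= 1" using x p by (simp add: gns_scale norm_divide)
    then have "gns (fm t ?y) \<in> ?S" by (intro CollectI exI conjI refl) auto
    from cSup_upper[OF this bdd] have "gns (fm t ?y) <= opn t" by (simp add: opn_def)
    then show ?thesis using x p t by (simp add: ftm_scale_right gns_scale norm_divide field_simps)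
  qed
  show "opn t <= K" if K: "0 <= K" "!!x. x \<in> FC ==> gns (fm t x) <= K * gns x" for K
    unfolding opn_def
  proof (rule cSup_least, use in0 in fast, elim CollectE exE conjE)
    fix y x assume x: "y = gns (fm t x)" "x \<in> FC" "gns x <= 1"
    then show "y <= K" using K(2)[OF x(2)] mult_left_mono[OF x(3) K(1)] by simp
  qed
qed

lemma opn_seminorm: "tensor_cstar_seminorm A KK opn"
proof -
  have sq: "(opn t)\<^sup>2 <= opn (fm (fs t) t)" if t: "t \<in> FC" for t
  proof -
    have tt: "fm (fs t) t \<in> FC" using t by auto
    have "opn t <= sqrt (opn (fm (fs t) t))"
    proof (rule opn_le[OF t])
      fix x assume x: "x \<in> FC"
      have "fm (fs (fm t x)) (fm t x) = fm (fs x) (fm (fm (fs t) t) x)"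
        using fs_mult[OF t x] fm_assoc[OF FC_star[OF x] FC_star[OF t] FC_mult[OF t x]] fm_assoc[OF FC_star[OF t] t x] by simp
      then have "(gns (fm t x))\<^sup>2 = cnorm A (\<phi> (fm (fs x) (fm (fm (fs t) t) x)))" using gns_sq[of "fm t x"] t x by simp
      also have "... <= gns x * gns (fm (fm (fs t) t) x)" using x tt by (intro gns_cs) auto
      also have "... <= gns x * (opn (fm (fs t) t) * gns x)" by (intro mult_left_mono opn_bound tt x gns_nonneg)
      also have "... = (sqrt (opn (fm (fs t) t)) * gns x)\<^sup>2"
        using opn_nonneg[OF tt] by (simp add: power_mult_distrib power2_eq_square)
      finally show "gns (fm t x) <= sqrt (opn (fm (fs t) t)) * gns x"
        by (rule power2_le_imp_le) (use opn_nonneg[OF tt] gns_nonneg[OF x] in simp)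
    qed (use opn_nonneg[OF tt] in simp)
    then have "(opn t)\<^sup>2 <= (sqrt (opn (fm (fs t) t)))\<^sup>2" by (rule power_mono) (rule opn_nonneg[OF t])
    then show ?thesis using opn_nonneg[OF tt] by simp
  qed
  have mult: "opn (fm s t) <= opn s * opn t" if s: "s \<in> FC" and t: "t \<in> FC" for s t
  proof (rule opn_le)
    fix x assume x: "x \<in> FC"
    have "gns (fm (fm s t) x) = gns (fm s (fm t x))" by (simp add: fm_assoc[OF s t x])
    also have "... <= opn s * gns (fm t x)" by (intro opn_bound s FC_mult t x)
    also have "... <= opn s * (opn t * gns x)" by (intro mult_left_mono opn_bound t x opn_nonneg s)
    finally show "gns (fm (fm s t) x) <= opn s * opn t * gns x" by (simp add: mult.assoc)
  qed (use s t opn_nonneg in auto)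
  have star_ge: "opn t <= opn (fs t)" if t: "t \<in> FC" for t
  proof (cases "opn t = 0")
    case False
    have "opn t * opn t <= opn (fs t) * opn t"
      using sq[OF t] mult[OF FC_star[OF t] t] by (simp add: power2_eq_square)
    then show ?thesis using False opn_nonneg[OF t] by (simp add: mult_le_cancel_right)
  qed (use opn_nonneg[OF FC_star[OF t]] in simp)
  have star: "opn (fs t) = opn t" if t: "t \<in> FC" for t
    using star_ge[OF t] star_ge[OF FC_star[OF t]] fs_fs[OF t] by simp
  have cst: "opn (fm (fs t) t) = (opn t)\<^sup>2" if t: "t \<in> FC" for t
    using sq[OF t] mult[OF FC_star[OF t] t] star[OF t] by (simp add: power2_eq_square)
  have add: "opn (s + t) <= opn s + opn t" if s: "s \<in> FC" and t: "t \<in> FC" for s t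
  proof (rule opn_le)
    fix x assume x: "x \<in> FC"
    have "gns (fm (s + t) x) <= gns (fm s x) + gns (fm t x)" unfolding ftm_add_left by (intro gns_add FC_mult s t x)
    then show "gns (fm (s + t) x) <= (opn s + opn t) * gns x"
      using opn_bound[OF s x] opn_bound[OF t x] by (simp add: semiring_class.distrib_right)
  qed (use s t opn_nonneg in auto)
  have sle: "opn (pm_scale c t) <= cmod c * opn t" if t: "t \<in> FC" for c t
  proof (rule opn_le)
    fix x assume x: "x \<in> FC"
    show "gns (fm (pm_scale c t) x) <= cmod c * opn t * gns x"
      using opn_bound[OF t x] t x by (simp add: ftm_scale_left gns_scale mult_left_mono mult.assoc)
  qed (use t opn_nonneg in auto)
  have scale: "opn (pm_scale c t) = cmod c * opn t" if t: "t \<in> FC" for c t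
  proof (cases "c = 0")
    case True
    then show ?thesis using sle[OF t, of c] opn_nonneg[OF FC_scale[OF t], of c] by simp
  next
    case False
    have "opn (pm_scale (1 / c) (pm_scale c t)) <= cmod (1 / c) * opn (pm_scale c t)" by (rule sle[OF FC_scale[OF t]])
    then have "cmod c * opn t <= opn (pm_scale c t)" using False by (simp add: pm.scale_scale norm_divide field_simps)
    then show ?thesis using sle[OF t, of c] by simp
  qed
  have rel: "opn t = 0" if "t \<in> bilinearity_relations A KK" for t
  proof -
    have t: "t \<in> tnull" "t \<in> FC" using that relations_FC by (auto simp: tnull_def pm.span_base)
    have "opn t <= 0" by (rule opn_le[OF t(2)]) (simp_all add: gns_tnull tnull_mult_right t(1))
    then show ?thesis using opn_nonneg[OF t(2)] by simp
  qed
  show ?thesis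
    unfolding tensor_cstar_seminorm_def free_tensor_smult_eq
    by (intro conjI ballI allI opn_nonneg add scale mult star cst rel)
qed

lemma om_KK: "om \<in> car KK" by (simp add: Kop_iff)

lemma norm_om_le: "norm om <= 1"
  using norm_rone_le[of \<omega> \<omega>] norm_omega by simp

text \<open>A priori the supremum defining the tensor norm could be too small; the Hilbert module
  prevents this. The test vector \<open>b\<^sup>* \<otimes> om\<close>, divided by the norm of
  \<open>b\<close>, has length 1, and \<open>b \<otimes> om\<close> maps it to a vector of length
  \<open>cnorm A b\<close>.\<close>

lemma norm_et_om:
  assumes b: "b \<in> car A" shows "cnorm T (et b om) = cnorm A b"
proof (rule antisym)
  have "cnorm T (et b om) <= cnorm A b * norm om" using norm_et_le[OF b om_KK] by simp
  also have "... <= cnorm A b * 1" by (intro mult_left_mono norm_om_le A.norm_ge_zero b)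
  finally show "cnorm T (et b om) <= cnorm A b" by simp
  show "cnorm A b <= cnorm T (et b om)"
  proof (cases "cnorm A b = 0")
    case False
    then have pb: "0 < cnorm A b" using A.norm_ge_zero[OF b] by simp
    let ?t = "sng b om 1" and ?x = "sng (cstar A b) om (rc (1 / cnorm A b))"
    have t: "?t \<in> FC" and x: "?x \<in> FC" using b om_KK by auto
    have ph: "\<phi> (sng a om c) = csmult A c a" if "a \<in> car A" for a c
      using that norm_omega by (simp add: phi_single om_omega cinner_self del: rone_apply)
    have "(gns ?x)\<^sup>2 = 1"
      unfolding gns_sq[OF x] using b pb
      by (simp add: fts_single ftm_single hadj_om om_om ph A.adj_adj A.norm_scale A.norm_times_adj norm_mult norm_divide power2_eq_square)
    then have gx: "gns ?x = 1" using gns_nonneg[OF x] by (simp add: power2_eq_1_iff)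
    have "(gns (fm ?t ?x))\<^sup>2 = (cnorm A b)\<^sup>2"
    proof -
      let ?z = "cmult A b (cstar A b)"
      have z: "?z \<in> car A" "cstar A ?z = ?z" using b by (auto simp: A.adj_times A.adj_adj)
      have "fm ?t ?x = sng ?z om (rc (1 / cnorm A b))" by (simp add: ftm_single om_om)
      moreover have "sng ?z om (rc (1 / cnorm A b)) \<in> FC" using z om_KK by auto
      moreover have "cnorm A (cmult A ?z ?z) = ((cnorm A b)\<^sup>2)\<^sup>2"
        using A.norm_adj_times[OF z(1)] z(2) A.norm_times_adj[OF b] by simp
      moreover have "(gns (sng ?z om c))\<^sup>2 = cmod (cnj c * c) * cnorm A (cmult A ?z ?z)" if "sng ?z om c \<in> FC" for c
        unfolding gns_sq[OF that] using z by (simp add: fts_single ftm_single hadj_om om_om ph A.norm_scale)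
      ultimately show ?thesis
        using pb by (simp add: norm_mult norm_divide power2_eq_square)
    qed
    then have "gns (fm ?t ?x) = cnorm A b"
      by (rule power2_eq_imp_eq) (use gns_nonneg[OF FC_mult[OF t x]] pb in auto)
    then have "cnorm A b <= opn ?t" using opn_bound[OF t x] gx by simp
    also have "... <= tn ?t" by (rule tensor_seminorm_le[OF opn_seminorm t])
    finally show ?thesis using t by (simp add: et_ci norm_ci)
  qed (use T.norm_ge_zero[OF et_mem[OF b om_KK]] in simp)
qed

end

declare M_simps(2-6) [simp del]

section \<open>The relative commutant of the compact operators\<close>

context cstar_algebra
begin

lemma snd_bound:
  assumes m: "dcent A m" and x: "x \<in> car A"
  shows "cnorm A (snd m x) <= cnorm M m * cnorm A x"
proof -
  interpret M: unital_cstar_algebra M "multiplier_one A" by (rule unital_cstar_algebra_multiplier)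
  have "cstar A (snd m x) = fst (cstar M m) (cstar A x)"
    using m x by (simp add: M_simps(6) adj_adj)
  then have "cnorm A (snd m x) = cnorm A (fst (cstar M m) (cstar A x))"
    using m x norm_adj[of "snd m x"] by simp
  also have "... <= cnorm M (cstar M m) * cnorm A (cstar A x)"
    using x by (intro multiplier_norm_bound multiplier_adj_mem m) auto
  finally show ?thesis using M.norm_adj[of m] m norm_adj[OF x] by simp
qed

lemma snd_ctends:
  assumes m: "dcent A m" and s: "ctends A s l"
  shows "ctends A (%n. snd m (s n)) (snd m l)"
proof (rule ctendsI)
  note [simp] = ctends_mem[OF s] m
  show "cnorm A (cdiff A (snd m (s n)) (snd m l)) <= cnorm M m * cnorm A (cdiff A (s n) l)" for n
    unfolding snd_diff[OF m ctends_mem[OF s], symmetric] by (intro snd_bound m) simp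
  have "(%n. cnorm A (cdiff A (s n) l)) ----> 0" using s by (simp add: ctends_def)
  then show "(%n. cnorm M m * cnorm A (cdiff A (s n) l)) ----> 0" by (rule tendsto_mult_right_zero)
qed (use m ctends_mem[OF s] in auto)

lemma embed_zero: "multiplier_embed A \<zero> = czero M"
  by (rule multiplier_eqI[OF dcent_embed dcent_zero])
    (auto simp: zero_times M_simps(2))

text \<open>The embedding is isometric and \<open>A\<close> is complete, so \<open>A\<close> is
  closed in its multiplier algebra.\<close>

lemma ctends_embed:
  assumes x: "!!n. x n \<in> car A" and lim: "ctends M (%n. multiplier_embed A (x n)) m"
  obtains l where "ctends A x l" "m = multiplier_embed A l"
proof -
  interpret M: unital_cstar_algebra M "multiplier_one A" by (rule unital_cstar_algebra_multiplier)
  have nd: "cnorm M (cdiff M (multiplier_embed A a) (multiplier_embed A b)) = cnorm A (cdiff A a b)"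
    if "a \<in> car A" "b \<in> car A" for a b
    using that by (simp add: norm_embed flip: embed_diff)
  have "x \<in> cauchy_seqs A"
    by (rule cauchy_seqs_dominated[where K=1, OF x M.ctends_cauchy[OF lim]]) (simp_all add: nd x)
  then obtain l where l: "ctends A x l" by (rule cauchy_convergent)
  have "ctends M (%n. multiplier_embed A (x n)) (multiplier_embed A l)"
    using l x ctends_mem(2)[OF l] dcent_embed by (simp add: ctends_def nd)
  then have "m = multiplier_embed A l" using lim M.ctends_unique by blast
  with l show ?thesis by (rule that)
qed

end

lemma cspan_superset: "S \<subseteq> cspan A S"
  by (auto simp: cspan_def)

lemma (in carrier_vector_space) cspan_carrier: "S \<subseteq> car A ==> cspan A S \<subseteq> car A"
  unfolding cspan_def by (rule Inter_lower) (auto simp: csubspace_def)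

text \<open>Nondegeneracy is left to a later locale: these facts are applied to
  \<open>1 \<otimes> id\<close> on the tensor product in order to prove its nondegeneracy.\<close>

locale K_hom = hilbert_basis e + A: cstar_algebra A
  for e :: "nat => 'h::complex_hilbert_space" and A :: "'a cstar_alg" +
  fixes \<iota> :: "('h op) => 'a multiplier"
  assumes hom: "cstar_hom compact_operators (multiplier_algebra A) \<iota>"
begin

abbreviation "MA \<equiv> multiplier_algebra A"
abbreviation "em \<equiv> multiplier_embed A"
abbreviation "C \<equiv> K_commutant A \<iota>"

lemma unital_MA: "unital_cstar_algebra MA (multiplier_one A)"
  by (rule A.unital_cstar_algebra_multiplier)

end

sublocale K_hom \<subseteq> M: unital_cstar_algebra "multiplier_algebra A" "multiplier_one A" by (rule unital_MA)

context K_hom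
begin

lemma
  shows iota_mem [simp, intro]: "Kop k ==> dcent A (\<iota> k)"
    and iota_add: "Kop k ==> Kop l ==> \<iota> (k + l) = cadd MA (\<iota> k) (\<iota> l)"
    and iota_scale: "Kop k ==> \<iota> (cscale_op c k) = csmult MA c (\<iota> k)"
    and iota_mult: "Kop k ==> Kop l ==> \<iota> (k o\<^sub>L l) = cmult MA (\<iota> k) (\<iota> l)"
    and iota_adj: "Kop k ==> \<iota> (hadj k) = cstar MA (\<iota> k)"
  using hom unfolding cstar_hom_def by (simp_all add: Kop_iff Pi_iff)

lemma norm_iota_le: "Kop k ==> cnorm MA (\<iota> k) <= norm k"
  using cstar_hom_norm_le[OF cstar_algebra_compact_operators M.cstar_algebra_axioms hom, of k]
  by (simp add: Kop_iff)

lemma iota_diff: "Kop k ==> Kop l ==> \<iota> (k - l) = cdiff MA (\<iota> k) (\<iota> l)"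
proof -
  assume k: "Kop k" and l: "Kop l"
  have eq: "k - l = k + cscale_op (- 1) l"
    by (rule blinfun_eqI) (simp add: blinfun.diff_left blinfun.add_left scaleC_minus_one)
  show ?thesis unfolding eq using k l by (simp add: iota_add iota_scale Kop_cscale cdiff_def)
qed

lemma iota_tends:
  assumes "!!n. Kop (s n)" "Kop k" "s ----> k"
  shows "ctends MA (%n. \<iota> (s n)) (\<iota> k)"
proof (rule M.ctendsI)
  interpret K: cstar_algebra "compact_operators :: ('h op) cstar_alg" by (rule cstar_algebra_compact_operators)
  have Kd: "Kop (s n - k)" for n
    using K.diff_mem[of "s n" k] assms by (simp add: Kop_iff)
  show "cnorm MA (cdiff MA (\<iota> (s n)) (\<iota> k)) <= norm (s n - k)" for n
    using norm_iota_le[OF Kd, of n] assms by (simp add: iota_diff)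
  show "(%n. norm (s n - k)) ----> 0" using assms(3) by (simp add: LIM_zero_iff tendsto_norm_zero)
qed (use assms in auto)

lemma iota_P_contr: "Y \<in> car A ==> cnorm A (fst (\<iota> (P n)) Y) <= cnorm A Y"
  using A.multiplier_norm_bound[OF iota_mem[OF Kop_P], of Y n] norm_iota_le[OF Kop_P, of n] norm_P[of n]
    mult_right_mono[of "cnorm MA (\<iota> (P n))" 1 "cnorm A Y"] A.norm_ge_zero[of Y] by simp

text \<open>The operators \<open>\<iota> (P n)\<close> are contractions, so the elements they
  approximate form a closed set. It then suffices to look at generators, both in the tensor product
  and in a general K-algebra.\<close>

lemma iota_P_limit:
  assumes lim: "ctends A s X" and s: "!!j. ctends A (%n. fst (\<iota> (P n)) (s j)) (s j)"
  shows "ctends A (%n. fst (\<iota> (P n)) X) X"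
  unfolding ctends_def
proof (intro conjI allI metric_LIMSEQ_I)
  note sm = ctends_mem[OF lim]
  note dc = iota_mem[OF Kop_P]
  show "fst (\<iota> (P n)) X \<in> car A" for n by (rule A.fst_mem[OF dc sm(2)])
  show "X \<in> car A" by (rule sm(2))
  fix r :: real assume r: "0 < r"
  then have r3: "0 < r / 3" by simp
  obtain j where j: "cnorm A (cdiff A (s j) X) < r / 3" using A.ctends_approx[OF lim r3] by blast
  have "(%n. cnorm A (cdiff A (fst (\<iota> (P n)) (s j)) (s j))) ----> 0" using s[of j] by (simp add: ctends_def)
  from order_tendstoD(2)[OF this r3] obtain N
    where N: "!!n. n \<ge> N ==> cnorm A (cdiff A (fst (\<iota> (P n)) (s j)) (s j)) < r / 3"
    unfolding eventually_sequentially by blast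
  have "cnorm A (cdiff A (fst (\<iota> (P n)) X) X) < r" if n: "n \<ge> N" for n
  proof -
    have f: "fst (\<iota> (P n)) X \<in> car A" "fst (\<iota> (P n)) (s j) \<in> car A" using A.fst_mem[OF dc] sm by auto
    have "cnorm A (cdiff A (fst (\<iota> (P n)) X) (fst (\<iota> (P n)) (s j))) <= cnorm A (cdiff A X (s j))"
      using iota_P_contr[of "cdiff A X (s j)" n] A.fst_diff[OF dc sm(2) sm(1), of n j] sm by simp
    then show ?thesis
      using A.norm_diff_triangle[OF f(1,2) sm(2)] A.norm_diff_triangle[OF f(2) sm(1) sm(2), of j] N[OF n] j
        A.norm_diff_commute[OF sm(2) sm(1), of j] by simp
  qed
  then show "\<exists>N. \<forall>n\<ge>N. dist (cnorm A (cdiff A (fst (\<iota> (P n)) X) X)) 0 < r"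
    using A.norm_ge_zero[OF A.diff_mem[OF A.fst_mem[OF dc sm(2)] sm(2)]] by (intro exI[of _ N]) (simp add: dist_real_def)
qed

section \<open>The commutant as a C*-subalgebra\<close>

lemma commutant_mem: "a \<in> C ==> dcent A a"
  and commutant_commute: "a \<in> C ==> Kop k ==> cmult MA (\<iota> k) a = cmult MA a (\<iota> k)"
  and commutant_embed: "a \<in> C ==> Kop k ==> \<exists>x\<in>car A. cmult MA a (\<iota> k) = em x"
  by (auto simp: K_commutant_def Kop_iff)

lemma commutantI:
  assumes "dcent A a" "!!k. Kop k ==> cmult MA (\<iota> k) a = cmult MA a (\<iota> k)"
    "!!k. Kop k ==> \<exists>x\<in>car A. cmult MA a (\<iota> k) = em x"
  shows "a \<in> C"
  using assms by (auto simp: K_commutant_def Kop_iff image_iff)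

lemma commutant_subalgebra: "cstar_subalgebra C MA"
  unfolding cstar_subalgebra_def csubspace_def
proof (intro conjI ballI allI)
  show "C \<subseteq> car MA" using commutant_mem by auto
  show "czero MA \<in> C"
  proof (rule commutantI)
    fix k assume k: "Kop k"
    show "cmult MA (\<iota> k) (czero MA) = cmult MA (czero MA) (\<iota> k)" using k by (simp add: M.zero_times M.times_zero)
    show "\<exists>x\<in>car A. cmult MA (czero MA) (\<iota> k) = em x"
      using k by (intro bexI[of _ "czero A"]) (simp_all add: M.zero_times A.embed_zero)
  qed (rule A.dcent_zero)
  fix a assume a: "a \<in> C"
  note ad = commutant_mem[OF a]
  show "csmult MA c a \<in> C" for c
  proof (rule commutantI)
    fix k assume k: "Kop k"
    show "cmult MA (\<iota> k) (csmult MA c a) = cmult MA (csmult MA c a) (\<iota> k)"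
      using k ad commutant_commute[OF a k] by (simp add: M.smult_times M.times_smult)
    obtain x where x: "x \<in> car A" "cmult MA a (\<iota> k) = em x" using commutant_embed[OF a k] by blast
    then show "\<exists>x\<in>car A. cmult MA (csmult MA c a) (\<iota> k) = em x"
      using k ad by (intro bexI[of _ "csmult A c x"]) (simp_all add: M.smult_times A.embed_smult[OF x(1) x(1)])
  qed (rule A.dcent_smult[OF ad])
  show "cstar MA a \<in> C"
  proof (rule commutantI)
    fix k assume k: "Kop k"
    \<comment> \<open>The conditions for the adjoint of \<open>a\<close> at \<open>k\<close> are the
      adjoints of those for \<open>a\<close> at \<open>hadj k\<close>.\<close>
    have sk: "Kop (hadj k)" by (rule Kop_hadj[OF k])
    have kk: "\<iota> k = cstar MA (\<iota> (hadj k))" using iota_adj[OF sk] hadj_hadj[OF Kop_clin[OF k]] by simp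
    have e1: "cmult MA (\<iota> k) (cstar MA a) = cstar MA (cmult MA a (\<iota> (hadj k)))"
      and e2: "cmult MA (cstar MA a) (\<iota> k) = cstar MA (cmult MA (\<iota> (hadj k)) a)"
      unfolding kk using sk ad by (simp_all add: M.adj_times)
    show "cmult MA (\<iota> k) (cstar MA a) = cmult MA (cstar MA a) (\<iota> k)"
      unfolding e1 e2 commutant_commute[OF a sk] ..
    obtain x where x: "x \<in> car A" "cmult MA a (\<iota> (hadj k)) = em x" using commutant_embed[OF a sk] by blast
    show "\<exists>x\<in>car A. cmult MA (cstar MA a) (\<iota> k) = em x"
      unfolding e2 commutant_commute[OF a sk] x(2) using x(1)
      by (intro bexI[of _ "cstar A x"]) (simp_all add: A.embed_adj[OF x(1) x(1)])
  qed (rule A.multiplier_adj_mem[OF ad])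
  fix b assume b: "b \<in> C"
  note bd = commutant_mem[OF b]
  show "cadd MA a b \<in> C"
  proof (rule commutantI)
    fix k assume k: "Kop k"
    show "cmult MA (\<iota> k) (cadd MA a b) = cmult MA (cadd MA a b) (\<iota> k)"
      using k ad bd commutant_commute[OF a k] commutant_commute[OF b k] by (simp add: M.plus_times M.times_plus)
    obtain x y where x: "x \<in> car A" "cmult MA a (\<iota> k) = em x" and y: "y \<in> car A" "cmult MA b (\<iota> k) = em y"
      using commutant_embed[OF a k] commutant_embed[OF b k] by blast
    then show "\<exists>x\<in>car A. cmult MA (cadd MA a b) (\<iota> k) = em x"
      using k ad bd by (intro bexI[of _ "cadd A x y"]) (simp_all add: M.plus_times A.embed_add)
  qed (rule A.dcent_add[OF ad bd])
  show "cmult MA a b \<in> C"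
  proof (rule commutantI)
    fix k assume k: "Kop k"
    have "cmult MA (\<iota> k) (cmult MA a b) = cmult MA (cmult MA (\<iota> k) a) b"
      using k ad bd M.times_assoc[of "\<iota> k" a b] by simp
    also have "... = cmult MA a (cmult MA (\<iota> k) b)"
      unfolding commutant_commute[OF a k] using k ad bd M.times_assoc[of a "\<iota> k" b] by simp
    also have "... = cmult MA (cmult MA a b) (\<iota> k)"
      unfolding commutant_commute[OF b k] using k ad bd M.times_assoc[of a b "\<iota> k"] by simp
    finally show "cmult MA (\<iota> k) (cmult MA a b) = cmult MA (cmult MA a b) (\<iota> k)" .
    obtain x where x: "x \<in> car A" "cmult MA b (\<iota> k) = em x" using commutant_embed[OF b k] by blast
    have "cmult MA (cmult MA a b) (\<iota> k) = em (fst a x)"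
      using k ad bd M.times_assoc[of a b "\<iota> k"] x A.mult_embed[OF ad x(1)] by simp
    then show "\<exists>x\<in>car A. cmult MA (cmult MA a b) (\<iota> k) = em x" using A.fst_mem[OF ad x(1)] by blast
  qed (rule A.dcent_mult[OF ad bd])
next
  show "closedin (ctopology MA) C"
    unfolding M.closedin_iff
  proof (intro conjI allI impI)
    show "C \<subseteq> car MA" using commutant_mem by auto
    fix s l assume sC: "\<forall>n. s n \<in> C" and lim: "ctends MA s l"
    have ld: "dcent A l" using ctends_mem(2)[OF lim] by simp
    show "l \<in> C"
    proof (rule commutantI[OF ld])
      fix k assume k: "Kop k"
      have ck: "ctends MA (%_. \<iota> k) (\<iota> k)" using k by (intro M.ctends_const) simp
      have l1: "ctends MA (%n. cmult MA (s n) (\<iota> k)) (cmult MA l (\<iota> k))" by (rule M.ctends_times[OF lim ck])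
      have "ctends MA (%n. cmult MA (\<iota> k) (s n)) (cmult MA (\<iota> k) l)" by (rule M.ctends_times[OF ck lim])
      then have "ctends MA (%n. cmult MA (s n) (\<iota> k)) (cmult MA (\<iota> k) l)"
        using commutant_commute[OF sC[rule_format] k] by simp
      then show "cmult MA (\<iota> k) l = cmult MA l (\<iota> k)" using l1 M.ctends_unique by blast
      \<comment> \<open>The products of \<open>s n\<close> with \<open>\<iota> k\<close> lie in the
        copy of \<open>A\<close>, which is norm closed, and so does their limit.\<close>
      have "\<forall>n. \<exists>x. x \<in> car A \<and> cmult MA (s n) (\<iota> k) = em x" using commutant_embed[OF _ k] sC by blast
      from choice[OF this] obtain x where x: "!!n. x n \<in> car A" "!!n. cmult MA (s n) (\<iota> k) = em (x n)" by blast
      from l1 have l2: "ctends MA (%n. em (x n)) (cmult MA l (\<iota> k))" unfolding x(2) .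
      obtain y where y: "ctends A x y" "cmult MA l (\<iota> k) = em y" by (rule A.ctends_embed[OF x(1) l2])
      then show "\<exists>x\<in>car A. cmult MA l (\<iota> k) = em x" using ctends_mem(2)[OF y(1)] by blast
    qed
  qed
qed

lemma cstar_algebra_commutant: "cstar_algebra (K_commutant_algebra A \<iota>)"
  unfolding K_commutant_algebra_def by (rule M.cstar_subalgebra_algebra[OF commutant_subalgebra])

end

section \<open>The \<open>\<K>\<close>-algebra \<open>B \<otimes> \<K>\<close>\<close>

context tensor_K
begin

abbreviation "\<kappa> \<equiv> one_tensor_id A :: ('h op) => _"
abbreviation "\<tau> \<equiv> tensor_one A :: 'a => ('a, 'h op) tensor multiplier"

lemma embed_KK: "Kop k ==> dcent KK (multiplier_embed KK k)"
  using B.dcent_embed[of k] by (simp add: Kop_iff)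

lemma Kop_mult [simp]: "Kop k ==> Kop l ==> Kop (k o\<^sub>L l)"
  by (intro Kop_compose Kop_clin)

lemma kappa_mem [simp, intro]: "Kop k ==> dcent T (\<kappa> k)"
  unfolding one_tensor_id_def by (intro mt_mem A.dcent_one embed_KK)

lemma tau_mem [simp, intro]: "b \<in> car A ==> dcent T (\<tau> b)"
  unfolding tensor_one_def by (intro mt_mem A.dcent_embed B.dcent_one)

lemma
  assumes "Kop k" "a \<in> car A" "Kop l"
  shows fst_kappa: "fst (\<kappa> k) (et a l) = et a (k o\<^sub>L l)" and snd_kappa: "snd (\<kappa> k) (et a l) = et a (l o\<^sub>L k)"
  unfolding one_tensor_id_def using assms fst_mt[OF A.dcent_one embed_KK] snd_mt[OF A.dcent_one embed_KK]
  by (simp_all add: multiplier_one_def Kop_iff multiplier_embed_def)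

lemma fst_tau: "b \<in> car A ==> a \<in> car A ==> Kop l ==> fst (\<tau> b) (et a l) = et (cmult A b a) l"
  unfolding tensor_one_def using fst_mt[OF A.dcent_embed B.dcent_one, of b a l]
  by (simp add: multiplier_one_def Kop_iff)

lemma etK_mem [simp, intro]: "a \<in> car A ==> Kop k ==> et a k \<in> car T"
  using et_mem[of a k] by (simp add: Kop_iff)

lemma
  assumes a: "a \<in> car A" "a' \<in> car A" and k: "Kop k" "Kop k'"
  shows etK_add_right: "et a (k + k') = cadd T (et a k) (et a k')"
    and etK_smult_right: "et a (cscale_op c k) = csmult T c (et a k)"
    and etK_times: "cmult T (et a k) (et a' k') = et (cmult A a a') (k o\<^sub>L k')"
    and etK_adj: "cstar T (et a k) = et (cstar A a) (hadj k)"
    and etK_add_left: "et (cadd A a a') k = cadd T (et a k) (et a' k)"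
    and etK_smult_left: "et (csmult A c a) k = csmult T c (et a k)"
  using et_add_right[of a a' k k'] et_smult_right[of a a' k k'] et_times[of a a' k k'] et_adj[of a a' k k']
    et_add_left[of a a' k k'] et_smult_left[of a a' k k' c] et_smult_right[of a a' k k' c] a k
  by (simp_all add: Kop_iff)

lemma etK_diff_left: "a \<in> car A ==> a' \<in> car A ==> Kop k ==> et (cdiff A a a') k = cdiff T (et a k) (et a' k)"
  using etK_add_left[of a "csmult A (- 1) a'" k k] etK_smult_left[of a' a' k k "- 1"] by (simp add: cdiff_def)

lemma etK_diff_right: "a \<in> car A ==> Kop k ==> Kop k' ==> et a (k - k') = cdiff T (et a k) (et a k')"
proof -
  assume a: "a \<in> car A" and k: "Kop k" "Kop k'"
  have eq: "k - k' = k + cscale_op (- 1) k'"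
    by (rule blinfun_eqI) (simp add: blinfun.diff_left blinfun.add_left scaleC_minus_one)
  show ?thesis unfolding eq using a k etK_add_right[of a a k "cscale_op (- 1) k'"] etK_smult_right[of a a k' k' "- 1"]
    by (simp add: cdiff_def Kop_cscale)
qed

lemma etK_tends:
  assumes a: "a \<in> car A" and s: "!!n. Kop (s n)" "Kop k" "s ----> k"
  shows "ctends T (%n. et a (s n)) (et a k)"
proof (rule T.ctendsI)
  have Kd: "Kop (s n - k)" for n using B.diff_mem[of "s n" k] s by (simp add: Kop_iff)
  show "cnorm T (cdiff T (et a (s n)) (et a k)) <= cnorm A a * norm (s n - k)" for n
    using norm_et_le[of a "s n - k"] a s Kd by (simp add: Kop_iff flip: etK_diff_right)
  have "(%n. norm (s n - k)) ----> 0" using s(3) by (simp add: LIM_zero_iff tendsto_norm_zero)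
  then show "(%n. cnorm A a * norm (s n - k)) ----> 0" by (rule tendsto_mult_right_zero)
qed (use a s in auto)

lemma kappa_hom: "cstar_hom KK MT \<kappa>"
  unfolding cstar_hom_def
proof (intro conjI ballI allI, unfold Kop_iff compact_operators_simps)
  show "\<kappa> \<in> car KK \<rightarrow> car MT" by (auto simp: Kop_iff)
  fix k :: "'h op" assume k: "Kop k"
  note evs = fst_kappa M_simps(3-6) Kop_iff
  show "\<kappa> (cscale_op c k) = csmult MT c (\<kappa> k)" for c
  proof (rule tensor_multiplier_eqI)
    fix a l assume a: "a \<in> car A" and "l \<in> car KK"
    then have l: "Kop l" by (simp add: Kop_iff)
    have "cscale_op c k o\<^sub>L l = cscale_op c (k o\<^sub>L l)" by (rule blinfun_eqI) simp
    then show "fst (\<kappa> (cscale_op c k)) (et a l) = fst (csmult MT c (\<kappa> k)) (et a l)"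
      using a k l by (simp add: evs Kop_cscale etK_smult_right[OF a a])
  qed (use k in "auto intro: T.dcent_smult Kop_cscale")
  show "\<kappa> (hadj k) = cstar MT (\<kappa> k)"
  proof -
    have "cstar MA (multiplier_one A) = multiplier_one A"
      by (rule A.multiplier_eqI[OF A.multiplier_adj_mem A.dcent_one])
        (auto simp: multiplier_one_def M_simps(6) A.adj_adj A.dcent_one[unfolded multiplier_one_def])
    then show ?thesis
      using mt_adj[OF A.dcent_one embed_KK[OF k]] B.embed_adj[of k k] k
      unfolding one_tensor_id_def by (simp add: Kop_iff)
  qed
  fix k' :: "'h op" assume k': "Kop k'"
  show "\<kappa> (k + k') = cadd MT (\<kappa> k) (\<kappa> k')"
  proof (rule tensor_multiplier_eqI)
    fix a l assume a: "a \<in> car A" and "l \<in> car KK"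
    then have l: "Kop l" by (simp add: Kop_iff)
    have "(k + k') o\<^sub>L l = (k o\<^sub>L l) + (k' o\<^sub>L l)" by (rule blinfun_eqI) (simp add: blinfun.add_left)
    then show "fst (\<kappa> (k + k')) (et a l) = fst (cadd MT (\<kappa> k) (\<kappa> k')) (et a l)"
      using a k k' l by (simp add: evs Kop_add etK_add_right[OF a a])
  qed (use k k' in "auto intro: T.dcent_add Kop_add")
  show "\<kappa> (k o\<^sub>L k') = cmult MT (\<kappa> k) (\<kappa> k')"
  proof (rule tensor_multiplier_eqI)
    fix a l assume a: "a \<in> car A" and "l \<in> car KK"
    then have l: "Kop l" by (simp add: Kop_iff)
    have "(k o\<^sub>L k') o\<^sub>L l = k o\<^sub>L (k' o\<^sub>L l)" by (rule blinfun_eqI) simp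
    then show "fst (\<kappa> (k o\<^sub>L k')) (et a l) = fst (cmult MT (\<kappa> k) (\<kappa> k')) (et a l)"
      using a k k' l by (simp add: evs)
  qed (use k k' in "auto intro: T.dcent_mult")
qed

end

sublocale tensor_K \<subseteq> TK: K_hom e "tensor_product A compact_operators" "one_tensor_id A"
  by (intro K_hom.intro hilbert_basis_axioms T.cstar_algebra_axioms K_hom_axioms.intro kappa_hom)

context tensor_K
begin

lemma kappa_P_tends:
  assumes X: "X \<in> car T" shows "ctends T (%n. fst (\<kappa> (P n)) X) X"
  using X
proof (induction rule: tensor_induct)
  case (et a k)
  then have k: "Kop k" by (simp add: Kop_iff)
  have "ctends T (%n. et a (P n o\<^sub>L k)) (et a k)"
    using k et(1) by (intro etK_tends Kop_mult Kop_P) (auto simp: Kop_def)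
  then show ?case using et(1) k by (simp add: fst_kappa Kop_P)
next
  case (add X Y)
  then show ?case using T.ctends_add[OF add(3,4)] by (simp add: T.fst_plus[OF kappa_mem[OF Kop_P]])
next
  case (smult c X)
  then show ?case using T.ctends_smult[OF smult(2), of c] by (simp add: T.fst_smult[OF kappa_mem[OF Kop_P]])
next
  case (limit s X)
  show ?case by (rule TK.iota_P_limit[OF limit(2) limit(1)])
qed

lemma kappa_nondegenerate: "nondegenerate T (\<kappa> ` car KK)"
  unfolding nondegenerate_def
proof
  let ?S = "{fst d a |d a. d \<in> \<kappa> ` car KK \<and> a \<in> car T}"
  have S: "?S \<subseteq> car T"
    by (rule subsetI, elim CollectE exE conjE imageE) (simp add: Kop_iff T.fst_mem kappa_mem)
  have V: "cspan T ?S \<subseteq> car T" by (rule T.cspan_carrier[OF S])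
  show "ctopology T closure_of cspan T ?S \<subseteq> car T"
  proof
    fix X assume "X \<in> ctopology T closure_of cspan T ?S"
    then obtain s where "ctends T s X" unfolding T.closure_of_iff[OF V] by (elim exE conjE)
    then show "X \<in> car T" by (rule ctends_mem(2))
  qed
  show "car T \<subseteq> ctopology T closure_of cspan T ?S"
  proof
    fix X assume X: "X \<in> car T"
    have kP: "\<kappa> (P n) \<in> \<kappa> ` car KK" for n
      by (intro imageI) (simp only: Kop_iff Kop_P)
    have "fst (\<kappa> (P n)) X \<in> ?S" for n
      by (intro CollectI exI[of _ "\<kappa> (P n)"] exI[of _ X] conjI refl kP X)
    then have "\<forall>n. fst (\<kappa> (P n)) X \<in> cspan T ?S" by (intro allI subsetD[OF cspan_superset])
    then show "X \<in> ctopology T closure_of cspan T ?S"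
      unfolding T.closure_of_iff[OF V] using kappa_P_tends[OF X] by (intro exI conjI)
  qed
qed

lemma K_algebra_tensor: "K_algebra T \<kappa>"
  unfolding K_algebra_def using T.cstar_algebra_axioms kappa_hom kappa_nondegenerate by blast

section \<open>The map \<open>b \<mapsto> b \<otimes> 1\<close> onto the commutant\<close>

abbreviation "emT \<equiv> multiplier_embed T"

lemma fst_emT_et: "b \<in> car A ==> Kop k ==> a \<in> car A ==> Kop l ==> fst (emT (et b k)) (et a l) = et (cmult A b a) (k o\<^sub>L l)"
  by (simp add: etK_times)

lemma
  assumes b: "b \<in> car A" and k: "Kop k"
  shows tau_kappa: "cmult MT (\<tau> b) (\<kappa> k) = emT (et b k)" and kappa_tau: "cmult MT (\<kappa> k) (\<tau> b) = emT (et b k)"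
proof -
  note dc = T.dcent_mult[OF tau_mem[OF b] kappa_mem[OF k]] T.dcent_mult[OF kappa_mem[OF k] tau_mem[OF b]]
    T.dcent_embed[OF etK_mem[OF b k]]
  show "cmult MT (\<tau> b) (\<kappa> k) = emT (et b k)"
    by (rule tensor_multiplier_eqI[OF dc(1,3)])
      (use b k in "simp add: Kop_iff M_simps(5) fst_kappa fst_tau fst_emT_et del: T.fst_embed")
  show "cmult MT (\<kappa> k) (\<tau> b) = emT (et b k)"
    by (rule tensor_multiplier_eqI[OF dc(2,3)])
      (use b k in "simp add: Kop_iff M_simps(5) fst_kappa fst_tau fst_emT_et del: T.fst_embed")
qed

lemma tau_commutant: "b \<in> car A ==> \<tau> b \<in> K_commutant T \<kappa>"
proof (rule TK.commutantI)
  assume b: "b \<in> car A"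
  show "dcent T (\<tau> b)" by (rule tau_mem[OF b])
  fix k :: "'h op" assume k: "Kop k"
  show "cmult MT (\<kappa> k) (\<tau> b) = cmult MT (\<tau> b) (\<kappa> k)" by (simp only: tau_kappa[OF b k] kappa_tau[OF b k])
  show "\<exists>x\<in>car T. cmult MT (\<tau> b) (\<kappa> k) = emT x"
    by (intro bexI[of _ "et b k"] tau_kappa[OF b k] etK_mem[OF b k])
qed

lemma tau_hom: "cstar_hom A (K_commutant_algebra T \<kappa>) \<tau>"
  unfolding cstar_hom_def K_commutant_algebra_def
proof (intro conjI ballI allI, simp_all)
  show "\<tau> \<in> car A \<rightarrow> K_commutant T \<kappa>" using tau_commutant by blast
  fix b assume b: "b \<in> car A"
  note evs = fst_tau M_simps(3-6) Kop_iff
  show "\<tau> (csmult A c b) = csmult MT c (\<tau> b)" for c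
    by (rule tensor_multiplier_eqI[OF tau_mem T.dcent_smult[OF tau_mem]])
      (use b in "simp_all add: evs A.smult_times etK_smult_left")
  show "\<tau> (cstar A b) = cstar MT (\<tau> b)"
  proof -
    have "cstar MB (multiplier_one KK) = multiplier_one KK"
      by (rule B.multiplier_eqI[OF B.multiplier_adj_mem B.dcent_one])
        (auto simp: multiplier_one_def M_simps(6) B.adj_adj B.dcent_one[unfolded multiplier_one_def] simp del: compact_operators_simps)
    then show ?thesis
      using mt_adj[OF A.dcent_embed[OF b] B.dcent_one] A.embed_adj[OF b b]
      unfolding tensor_one_def by simp
  qed
  fix b' assume b': "b' \<in> car A"
  show "\<tau> (cadd A b b') = cadd MT (\<tau> b) (\<tau> b')"
    by (rule tensor_multiplier_eqI[OF tau_mem T.dcent_add[OF tau_mem tau_mem]])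
      (use b b' in "simp_all add: evs A.plus_times etK_add_left")
  show "\<tau> (cmult A b b') = cmult MT (\<tau> b) (\<tau> b')"
    by (rule tensor_multiplier_eqI[OF tau_mem T.dcent_mult[OF tau_mem tau_mem]])
      (use b b' in "simp_all add: evs A.times_assoc")
qed

text \<open>Multiplication by \<open>\<kappa> om\<close> turns \<open>\<tau> b\<close> into
  \<open>b \<otimes> om\<close>, which has the norm of \<open>b\<close>.\<close>

lemma tau_inj: "inj_on \<tau> (car A)"
proof (rule inj_onI)
  fix b b' assume b: "b \<in> car A" "b' \<in> car A" and eq: "\<tau> b = \<tau> b'"
  have "emT (et b om) = emT (et b' om)"
    using tau_kappa[OF b(1) om_mem] tau_kappa[OF b(2) om_mem] eq by simp
  then have "et b om = et b' om" using b by (intro T.embed_inj) auto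
  then have "cnorm T (et (cdiff A b b') om) = 0"
    using b by (simp add: etK_diff_left T.diff_self T.norm_zero)
  then have "cnorm A (cdiff A b b') = 0" using norm_et_om[of "cdiff A b b'"] b by simp
  then show "b = b'" using b A.norm_eq_zero A.diff_eq_zero_iff by simp
qed

text \<open>\<open>om k om\<close> is the number \<open>cinner (ap k \<omega>) \<omega>\<close>
  times \<open>om\<close>, so compression by \<open>1 \<otimes> om\<close> leads into
  \<open>A \<otimes> om\<close>, with \<open>\<phi>\<close> as coefficient.\<close>

lemma compress_om:
  assumes "u \<in> FC" shows "fst (\<kappa> om) (snd (\<kappa> om) (ci u)) = et (\<phi> u) om"
  using assms
proof (induction rule: FC_induct)
  case zero
  have "et (czero A) om = czero T" using etK_smult_left[of "czero A" "czero A" om om 0] by (simp add: A.zero_smult T.zero_smult)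
  moreover have "snd (\<kappa> om) (czero T) = czero T" "fst (\<kappa> om) (czero T) = czero T"
    using T.snd_smult[OF kappa_mem[OF om_mem], of "czero T" 0] T.fst_smult[OF kappa_mem[OF om_mem], of "czero T" 0]
    by (simp_all add: T.zero_smult)
  ultimately show ?case by (simp add: ci_zero)
next
  case (add a k c u)
  then have k: "Kop k" by (simp add: Kop_iff)
  note dc = kappa_mem[OF om_mem]
  have "om o\<^sub>L (k o\<^sub>L om) = cscale_op (cinner (ap k \<omega>) \<omega>) om"
    using Kop_clin[OF k] by (intro blinfun_eqI) (simp add: clin_def scaleC_scaleC cinner_scaleC_left mult.commute)
  then have 1: "fst (\<kappa> om) (snd (\<kappa> om) (et a k)) = csmult T (cinner (ap k \<omega>) \<omega>) (et a om)"
    using add(1) k by (simp add: snd_kappa fst_kappa etK_smult_right[OF add(1) add(1)])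
  have "ci (sng a k c + u) = cadd T (csmult T c (et a k)) (ci u)" using add by (simp add: ci_add ci_single)
  then have "fst (\<kappa> om) (snd (\<kappa> om) (ci (sng a k c + u)))
     = cadd T (csmult T c (csmult T (cinner (ap k \<omega>) \<omega>) (et a om))) (et (\<phi> u) om)"
    using add k 1 by (simp add: T.snd_plus[OF dc] T.snd_smult[OF dc] T.fst_plus[OF dc] T.fst_smult[OF dc] T.snd_mem[OF dc])
  also have "... = et (\<phi> (sng a k c + u)) om"
    using add k by (simp add: phi_add phi_single etK_add_left etK_smult_left T.smult_assoc)
  finally show ?case .
qed

text \<open>The product of \<open>m\<close> with \<open>1 \<otimes> om\<close> is an element
  \<open>t\<close> of the tensor product fixed by compression, hence a limit of tensors
  \<open>\<phi> (u n) \<otimes> om\<close>. By \<open>norm_et_om\<close> the coefficients converge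
  to some \<open>b\<close>. As \<open>m\<close> commutes with \<open>1 \<otimes> K\<close>, its
  values on all \<open>a \<otimes> rone x y\<close> follow from this one product.\<close>

lemma tau_surj:
  assumes m: "m \<in> K_commutant T \<kappa>" shows "\<exists>b\<in>car A. m = \<tau> b"
proof -
  note md = TK.commutant_mem[OF m]
  note kd = kappa_mem[OF om_mem]
  obtain t where t: "t \<in> car T" "cmult MT m (\<kappa> om) = emT t" using TK.commutant_embed[OF m om_mem] by blast
  have kk: "cmult MT (\<kappa> om) (\<kappa> om) = \<kappa> om" using TK.iota_mult[OF om_mem om_mem] om_om by simp
  \<comment> \<open>\<open>\<kappa> om\<close> is idempotent and commutes with \<open>m\<close>, so
    it can be placed on both sides.\<close>
  have mk: "cmult MT m (\<kappa> om) = cmult MT (\<kappa> om) (cmult MT (cmult MT m (\<kappa> om)) (\<kappa> om))"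
  proof -
    have "cmult MT (\<kappa> om) (cmult MT (cmult MT m (\<kappa> om)) (\<kappa> om)) = cmult MT (\<kappa> om) (cmult MT m (\<kappa> om))"
      using md kd TK.M.times_assoc[of m "\<kappa> om" "\<kappa> om"] kk by simp
    also have "... = cmult MT (cmult MT m (\<kappa> om)) (\<kappa> om)"
      using md kd TK.M.times_assoc[of "\<kappa> om" m "\<kappa> om"] TK.commutant_commute[OF m om_mem] by simp
    also have "... = cmult MT m (\<kappa> om)" using md kd TK.M.times_assoc[of m "\<kappa> om" "\<kappa> om"] kk by simp
    finally show ?thesis ..
  qed
  have "emT t = emT (fst (\<kappa> om) (snd (\<kappa> om) t))"
    using mk unfolding t(2) T.embed_mult[OF kd t(1)] T.mult_embed[OF kd T.snd_mem[OF kd t(1)]] .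
  then have tt: "t = fst (\<kappa> om) (snd (\<kappa> om) t)" using t kd by (intro T.embed_inj) auto
  obtain u where u: "!!n. u n \<in> FC" "ctends T (%n. ci (u n)) t" using tensor_approx[OF t(1)] by blast
  have lim: "ctends T (%n. et (\<phi> (u n)) om) t"
    using T.fst_ctends[OF kd T.snd_ctends[OF kd u(2)]] tt u(1) by (simp add: compress_om)
  have pm: "\<phi> (u n) \<in> car A" for n using u(1) by simp
  have nd: "cnorm T (cdiff T (et a om) (et b om)) = cnorm A (cdiff A a b)" if "a \<in> car A" "b \<in> car A" for a b
    using norm_et_om[of "cdiff A a b"] that by (simp add: etK_diff_left)
  have "(%n. \<phi> (u n)) \<in> cauchy_seqs A"
    by (rule A.cauchy_seqs_dominated[where K=1, OF pm T.ctends_cauchy[OF lim]]) (simp_all add: nd pm)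
  then obtain b where b: "ctends A (%n. \<phi> (u n)) b" by (rule A.cauchy_convergent)
  have bA: "b \<in> car A" using ctends_mem(2)[OF b] .
  have "ctends T (%n. et (\<phi> (u n)) om) (et b om)" using b pm bA by (simp add: ctends_def nd)
  then have tb: "t = et b om" using lim T.ctends_unique by blast
  have r1: "fst m (et a (rone x y)) = et (cmult A b a) (rone x y)" if a: "a \<in> car A" for a x y
  proof -
    \<comment> \<open>Every rank-one operator factors through \<open>om\<close>; this leads from
      \<open>om\<close> to arbitrary \<open>x\<close> and \<open>y\<close>.\<close>
    have s1: "rone x \<omega> o\<^sub>L (om o\<^sub>L rone \<omega> y) = rone x y" and s2: "rone x \<omega> o\<^sub>L (om o\<^sub>L (om o\<^sub>L rone \<omega> y)) = rone x y"
      using norm_omega by (simp_all add: op_rone clin_rone cinner_self scaleC_one)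
    let ?Z = "et a (om o\<^sub>L rone \<omega> y)"
    have Z: "?Z \<in> car T" using a by (simp add: Kop_rone)
    have Z': "?Z = fst (\<kappa> om) (et a (rone \<omega> y))" using a by (simp add: fst_kappa Kop_rone)
    have "fst m (et a (rone x y)) = fst m (fst (\<kappa> (rone x \<omega>)) ?Z)"
      using a s1 by (simp add: fst_kappa Kop_rone)
    also have "... = fst (cmult MT m (\<kappa> (rone x \<omega>))) ?Z" using Z by (simp add: M_simps(5))
    also have "... = fst (\<kappa> (rone x \<omega>)) (fst m ?Z)"
      unfolding TK.commutant_commute[OF m Kop_rone, symmetric] using Z by (simp add: M_simps(5))
    also have "fst m ?Z = fst (cmult MT m (\<kappa> om)) (et a (rone \<omega> y))"
      unfolding Z' using a by (simp add: M_simps(5) Kop_rone)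
    also have "... = et (cmult A b a) (om o\<^sub>L rone \<omega> y)"
      unfolding t(2) tb using a bA by (simp add: etK_times[OF bA a] Kop_rone)
    also have "fst (\<kappa> (rone x \<omega>)) ... = et (cmult A b a) (rone x y)"
      using a bA s1 by (simp add: fst_kappa Kop_rone)
    finally show ?thesis .
  qed
  have r2: "fst m (et a (\<Sum>i\<in>I. rone (f i) (g i))) = et (cmult A b a) (\<Sum>i\<in>I. rone (f i) (g i))"
    if a: "a \<in> car A" and I: "finite I" for a f g and I :: "nat set"
    using I
  proof (induction I rule: finite_induct)
    case empty
    have "rone 0 0 = (0 :: 'h op)" by (rule blinfun_eqI) (simp add: blinfun.zero_left)
    then show ?case using r1[OF a, of 0 0] by simp
  next
    case (insert i I)
    have K: "Kop (\<Sum>i\<in>I. rone (f i) (g i))" by (intro Kop_sum Kop_rone)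
    have ba: "cmult A b a \<in> car A" using a bA by simp
    show ?case
      using insert K Kop_rone a md r1[OF a] by (simp add: etK_add_right[OF a a] etK_add_right[OF ba ba] T.fst_plus)
  qed
  have "m = \<tau> b"
  proof (rule tensor_multiplier_eqI[OF md tau_mem[OF bA]])
    fix a k assume a: "a \<in> car A" and "k \<in> car KK"
    then have k: "Kop k" by (simp add: Kop_iff)
    \<comment> \<open>The finite-rank operators \<open>P n o\<^sub>L k\<close> are covered by
      \<open>r2\<close>, and they tend to \<open>k\<close>.\<close>
    have Pk: "P n o\<^sub>L k = (\<Sum>i<n. rone (e i) (ap (hadj k) (e i)))" for n
      by (rule blinfun_eqI) (simp add: P_apply hproj_def blinfun.sum_left hadj(1)[OF Kop_clin[OF k]])
    have lim: "ctends T (%n. et a' (P n o\<^sub>L k)) (et a' k)" if "a' \<in> car A" for a'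
      using k that by (intro etK_tends Kop_mult Kop_P) (auto simp: Kop_def)
    have "fst m (et a (P n o\<^sub>L k)) = et (cmult A b a) (P n o\<^sub>L k)" for n
      unfolding Pk by (rule r2[OF a]) simp
    then have "ctends T (%n. et (cmult A b a) (P n o\<^sub>L k)) (fst m (et a k))"
      using T.fst_ctends[OF md lim[OF a]] by simp
    then have "fst m (et a k) = et (cmult A b a) k" using lim[of "cmult A b a"] a bA T.ctends_unique by blast
    then show "fst m (et a k) = fst (\<tau> b) (et a k)" using a bA k by (simp add: fst_tau)
  qed
  then show ?thesis using bA by blast
qed

lemma tau_iso: "cstar_iso A (K_commutant_algebra T \<kappa>) \<tau>"
proof -
  have "\<tau> ` car A = K_commutant T \<kappa>" using tau_commutant tau_surj by blast
  then have "bij_betw \<tau> (car A) (car (K_commutant_algebra T \<kappa>))"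
    using tau_inj by (simp add: bij_betw_def K_commutant_algebra_def)
  then show ?thesis
    unfolding cstar_iso_def using A.cstar_algebra_axioms TK.cstar_algebra_commutant tau_hom by blast
qed

end

section \<open>Elements of the commutant\<close>

lemma (in cstar_algebra) multiplier_ctends:
  assumes s: "ctends M s m" and x: "x \<in> car A"
  shows "ctends A (%n. fst (s n) x) (fst m x)"
proof (rule ctendsI)
  have d: "dcent A (s n)" "dcent A m" for n using ctends_mem[OF s] by simp_all
  have dd: "dcent A (cdiff M (s n) m)" for n
    unfolding cdiff_def by (intro dcent_add dcent_smult d)
  show "fst (s n) x \<in> car A" "fst m x \<in> car A" for n using d x by auto
  have "cdiff A (fst (s n) x) (fst m x) = fst (cdiff M (s n) m) x" for n
    using x by (simp add: cdiff_def M_simps(3,4))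
  then show "cnorm A (cdiff A (fst (s n) x) (fst m x)) <= cnorm M (cdiff M (s n) m) * cnorm A x" for n
    using multiplier_norm_bound[OF dd x] by simp
  have "(%n. cnorm M (cdiff M (s n) m)) ----> 0" using s by (simp add: ctends_def)
  then show "(%n. cnorm M (cdiff M (s n) m) * cnorm A x) ----> 0" by (rule tendsto_mult_left_zero)
qed

locale K_alg = K_hom +
  assumes nondeg: "nondegenerate A (\<iota> ` car compact_operators)"
begin

text \<open>The elements approximated by \<open>\<iota> (P n)\<close> form a subspace, and it
  contains the products of \<open>\<iota> k\<close> with elements of \<open>A\<close> because
  \<open>P n o\<^sub>L k\<close> tends to \<open>k\<close> in norm. By \<open>iota_P_limit\<close>
  it is closed, so nondegeneracy makes it everything.\<close>

lemma iota_P_tends: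
  assumes a: "a \<in> car A" shows "ctends A (%n. fst (\<iota> (P n)) a) a"
proof -
  let ?S = "{fst d a |d a. d \<in> \<iota> ` car compact_operators \<and> a \<in> car A}"
  let ?V = "{a \<in> car A. ctends A (%n. fst (\<iota> (P n)) a) a}"
  note dc = iota_mem[OF Kop_P]
  have z: "fst (\<iota> (P n)) (czero A) = czero A" for n
    using A.fst_smult[OF dc[of n], of "czero A" 0] A.fst_mem[OF dc[of n], of "czero A"] by (simp add: A.zero_smult)
  have V: "csubspace A ?V"
    unfolding csubspace_def
  proof (intro conjI ballI allI)
    show "czero A \<in> ?V" by (simp add: z A.ctends_const)
    fix x assume x: "x \<in> ?V"
    show "csmult A c x \<in> ?V" for c
      using x A.ctends_smult[of "%n. fst (\<iota> (P n)) x" x c] by (simp add: A.fst_smult[OF dc])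
    fix y assume y: "y \<in> ?V"
    show "cadd A x y \<in> ?V"
      using x y A.ctends_add[of "%n. fst (\<iota> (P n)) x" x "%n. fst (\<iota> (P n)) y" y] by (simp add: A.fst_plus[OF dc])
  qed blast
  have SV: "?S \<subseteq> ?V"
  proof (rule subsetI, elim CollectE exE conjE imageE)
    fix x d b k assume x: "x = fst d b" "d = \<iota> k" and b: "b \<in> car A" and "k \<in> car compact_operators"
    then have k: "Kop k" by (simp add: Kop_iff)
    have Pk: "Kop (P n o\<^sub>L k)" for n by (intro Kop_compose Kop_P Kop_clin k)
    have "ctends MA (%n. \<iota> (P n o\<^sub>L k)) (\<iota> k)" using k Pk by (intro iota_tends) (auto simp: Kop_def)
    from A.multiplier_ctends[OF this b] have "ctends A (%n. fst (\<iota> (P n)) (fst (\<iota> k) b)) (fst (\<iota> k) b)"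
      using b k by (simp add: iota_mult Kop_P M_simps(5))
    then show "x \<in> ?V" using x b k by simp
  qed
  have cV: "cspan A ?S \<subseteq> ?V" unfolding cspan_def by (rule Inter_lower) (use V SV in simp)
  then have cA: "cspan A ?S \<subseteq> car A" by blast
  have "a \<in> ctopology A closure_of cspan A ?S" using nondeg a unfolding nondegenerate_def by simp
  then obtain s where s: "!!n. s n \<in> cspan A ?S" "ctends A s a" unfolding A.closure_of_iff[OF cA] by (elim exE conjE) blast
  show ?thesis by (rule iota_P_limit[OF s(2)]) (use s(1) cV in blast)
qed

lemma iota_P_tends':
  assumes a: "a \<in> car A" shows "ctends A (%n. snd (\<iota> (P n)) a) a"
proof -
  have sa: "cstar A a \<in> car A" by (rule A.adj_mem[OF a])
  have "cstar A (fst (\<iota> (P n)) (cstar A a)) = snd (\<iota> (P n)) a" for n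
    using A.adj_fst[OF iota_mem[OF Kop_P] sa] iota_adj[OF Kop_P, of n] a by (simp add: hadj_P A.adj_adj)
  then show ?thesis using A.ctends_adj[OF iota_P_tends[OF sa]] a by (simp add: A.adj_adj)
qed

lemma compress_tends:
  assumes a: "a \<in> car A" shows "ctends A (%n. fst (\<iota> (P n)) (snd (\<iota> (P n)) a)) a"
proof (rule A.ctendsI)
  note dc = iota_mem[OF Kop_P]
  have m: "snd (\<iota> (P n)) a \<in> car A" "fst (\<iota> (P n)) a \<in> car A"
    "fst (\<iota> (P n)) (snd (\<iota> (P n)) a) \<in> car A" for n
    using A.snd_mem[OF dc a] A.fst_mem[OF dc] a by auto
  show "fst (\<iota> (P n)) (snd (\<iota> (P n)) a) \<in> car A" "a \<in> car A" for n by (fact m a)+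
  show "cnorm A (cdiff A (fst (\<iota> (P n)) (snd (\<iota> (P n)) a)) a)
    <= cnorm A (cdiff A (snd (\<iota> (P n)) a) a) + cnorm A (cdiff A (fst (\<iota> (P n)) a) a)" for n
    using A.norm_diff_triangle[OF m(3) m(2) a, of n n] iota_P_contr[of "cdiff A (snd (\<iota> (P n)) a) a" n]
      A.fst_diff[OF dc m(1) a, of n n] m a by simp
  show "(%n. cnorm A (cdiff A (snd (\<iota> (P n)) a) a) + cnorm A (cdiff A (fst (\<iota> (P n)) a) a)) ----> 0"
    using iota_P_tends[OF a] iota_P_tends'[OF a] by (intro tendsto_add_zero) (simp_all add: ctends_def)
qed

end

locale stable_K = K_alg +
  fixes \<omega> :: 'a
  assumes norm_omega: "norm \<omega> = 1"
begin

section \<open>Matrix units in the multiplier algebra\<close>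

abbreviation mm (infixl "oo" 70) where "x oo y \<equiv> cmult MA x y"
abbreviation "D \<equiv> dcent A"
abbreviation "i x y \<equiv> \<iota> (rone x y)"
abbreviation "p \<equiv> i \<omega> \<omega>"
abbreviation "EA \<equiv> em ` car A"

lemmas D_closed [simp, intro] = A.dcent_mult A.dcent_add A.dcent_smult
  A.multiplier_adj_mem A.dcent_zero A.dcent_embed

lemma D_csum [simp, intro]: "(!!k. k \<in> I ==> D (f k)) ==> D (csum MA f I)"
  using M.csum_mem[of I f] by simp

lemma i_D [simp, intro]: "D (i x y)" by (intro iota_mem Kop_rone)

lemma P_D [simp, intro]: "D (\<iota> (P n))" by (intro iota_mem Kop_P)

lemma i_i: "i x y oo i z w = csmult MA (cinner z y) (i x w)"
proof -
  have "rone x y o\<^sub>L rone z w = cscale_op (cinner z y) (rone x w)"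
    by (rule blinfun_eqI) (simp add: cinner_scaleC_left scaleC_scaleC mult.commute)
  then show ?thesis by (simp add: Kop_rone iota_scale flip: iota_mult)
qed

lemma i_i_omega: "i x \<omega> oo i \<omega> y = i x y"
  by (simp add: i_i cinner_self norm_omega M.one_smult)

lemma i_i_assoc: "D m ==> i x y oo (i z w oo m) = csmult MA (cinner z y) (i x w oo m)"
  using M.times_assoc[of "i x y" "i z w" m] by (simp add: i_i M.smult_times)

lemma i_adj: "cstar MA (i x y) = i y x"
  by (simp add: Kop_rone hadj_rone flip: iota_adj)

lemma iota_sum: "finite I ==> (!!k. Kop (f k)) ==> \<iota> (sum f I) = csum MA (%k. \<iota> (f k)) I"
proof (induction I rule: finite_induct)
  case empty
  have "cscale_op 0 0 = (0 :: 'a op)" by (rule blinfun_eqI) simp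
  then show ?case using iota_scale[OF Kop_zero, of 0] Kop_zero by (simp add: M.zero_smult)
next
  case (insert k I)
  then show ?case by (simp add: iota_add Kop_sum M.plus_commute)
qed

lemma iota_P: "\<iota> (P n) = csum MA (%k. i (e k) (e k)) {..<n}"
  unfolding P_def by (rule iota_sum) (simp_all add: Kop_rone)

lemma
  shows i_P: "i x y oo \<iota> (P n) = i x (hproj e n y)" and P_i: "\<iota> (P n) oo i x y = i (hproj e n x) y"
  by (simp_all add: Kop_rone Kop_P rone_op[OF clin_P] op_rone[OF clin_P] hadj_P P_apply flip: iota_mult)

lemma hproj_basis: "k < n ==> hproj e n (e k) = e k"
proof -
  assume k: "k < n"
  have "hproj e n (e k) = (\<Sum>j<n. if j = k then e k else 0)"
    unfolding hproj_def using orth scaleC_cinner_basis by (intro sum.cong refl) auto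
  then show ?thesis using k by simp
qed

lemma
  shows i_hproj_left: "i (hproj e n x) y = csum MA (%k. csmult MA (cinner x (e k)) (i (e k) y)) {..<n}"
    and i_hproj_right: "i y (hproj e n x) = csum MA (%k. csmult MA (cnj (cinner x (e k))) (i y (e k))) {..<n}"
proof -
  have "rone (hproj e n x) y = (\<Sum>k<n. cscale_op (cinner x (e k)) (rone (e k) y))"
    by (rule blinfun_eqI) (simp add: blinfun.sum_left hproj_def scaleC_sum_right scaleC_scaleC mult.commute)
  then show "i (hproj e n x) y = csum MA (%k. csmult MA (cinner x (e k)) (i (e k) y)) {..<n}"
    by (simp add: iota_sum Kop_cscale Kop_rone iota_scale)
  have "ap (rone y (hproj e n x)) z = ap (\<Sum>k<n. cscale_op (cnj (cinner x (e k))) (rone y (e k))) z" for z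
    by (simp add: blinfun.sum_left hproj_def cinner_sum_right cinner_scaleC_right scaleC_scaleC
        linear_sum[OF bounded_linear.linear[OF bounded_linear_scaleC_left]])
  then have "rone y (hproj e n x) = (\<Sum>k<n. cscale_op (cnj (cinner x (e k))) (rone y (e k)))" by (rule blinfun_eqI)
  then show "i y (hproj e n x) = csum MA (%k. csmult MA (cnj (cinner x (e k))) (i y (e k))) {..<n}"
    by (simp add: iota_sum Kop_cscale Kop_rone iota_scale)
qed

lemma
  shows i_hproj_left_tends: "ctends MA (%n. i (hproj e n x) y) (i x y)"
    and i_hproj_right_tends: "ctends MA (%n. i x (hproj e n y)) (i x y)"
proof -
  have "ctends MA (%n. \<iota> (P n o\<^sub>L rone x y)) (i x y)"
    using Kop_rone[of x y] by (intro iota_tends Kop_compose Kop_P Kop_clin) (simp_all add: Kop_def)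
  then show "ctends MA (%n. i (hproj e n x) y) (i x y)" by (simp add: op_rone[OF clin_P] P_apply)
  have "ctends MA (%n. \<iota> (rone x y o\<^sub>L P n)) (i x y)"
    by (intro iota_tends Kop_compose Kop_rone clin_P Kop_P_right)
  then show "ctends MA (%n. i x (hproj e n y)) (i x y)" by (simp add: rone_op[OF clin_P] hadj_P P_apply)
qed

subsection \<open>Corners\<close>

lemma EA_D: "m \<in> EA ==> D m" by auto

lemma EA_left: "D m ==> x \<in> EA ==> m oo x \<in> EA"
  by (elim imageE) (simp add: A.mult_embed A.fst_mem imageI)

lemma EA_right: "D m ==> x \<in> EA ==> x oo m \<in> EA"
  by (elim imageE) (simp add: A.embed_mult A.snd_mem imageI)

lemma EA_subspace: "csubspace MA EA"
  unfolding csubspace_def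
  by (auto simp: image_iff simp flip: A.embed_add A.embed_smult[where b="czero A"] A.embed_zero)

lemma EA_add: "x \<in> EA ==> y \<in> EA ==> cadd MA x y \<in> EA" and EA_smult: "x \<in> EA ==> csmult MA c x \<in> EA" and EA_zero: "czero MA \<in> EA"
  using EA_subspace unfolding csubspace_def by blast+

lemma EA_csum: "(!!k. k \<in> I ==> f k \<in> EA) ==> csum MA f I \<in> EA"
proof (induction I rule: infinite_finite_induct)
  case (infinite I)
  then show ?case using EA_zero by (simp add: csum_def)
next
  case (insert k I)
  have "csum MA f (insert k I) = cadd MA (csum MA f I) (f k)"
    using insert EA_D by (intro M.csum_insert') auto
  then show ?case using EA_add insert by simp
qed (simp add: EA_zero)

lemma EA_adj: "x \<in> EA ==> cstar MA x \<in> EA"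
  by (auto simp flip: A.embed_adj[where b="czero A"])

lemma EA_limit: "(!!n. s n \<in> EA) ==> ctends MA s m ==> m \<in> EA"
proof -
  assume s: "!!n. s n \<in> EA" and lim: "ctends MA s m"
  have "\<forall>n. \<exists>x. x \<in> car A \<and> s n = em x" using s by blast
  from choice[OF this] obtain x where x: "!!n. x n \<in> car A" "!!n. s n = em (x n)" by blast
  have "s = (%n. em (x n))" using x(2) by (rule ext)
  then have *: "ctends MA (%n. em (x n)) m" using lim by simp
  obtain l where l: "ctends A x l" "m = em l" by (rule A.ctends_embed[OF x(1) *])
  show ?thesis unfolding l(2) by (intro imageI ctends_mem(2)[OF l(1)])
qed

text \<open>The corner is cut out of the copy \<open>EA\<close> of \<open>A\<close>, not of the
  whole multiplier algebra; this is why the multipliers built from it carry \<open>\<iota> k\<close>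
  into \<open>A\<close>.\<close>

definition corner :: "'b multiplier => 'b multiplier set" where
  "corner q = {m \<in> EA. q oo m = m \<and> m oo q = m}"

lemma cornerD: "m \<in> corner q ==> D m" "m \<in> corner q ==> m \<in> EA"
  "m \<in> corner q ==> q oo m = m" "m \<in> corner q ==> m oo q = m"
  by (auto simp: corner_def)

lemma corner_subalgebra:
  assumes q: "D q" "cstar MA q = q" shows "cstar_subalgebra (corner q) MA"
  unfolding cstar_subalgebra_def csubspace_def
proof (intro conjI ballI allI)
  show "corner q \<subseteq> car MA" by (rule subsetI) (simp add: cornerD(1))
  show "czero MA \<in> corner q" using q EA_zero by (simp add: corner_def M.zero_times M.times_zero)
  fix x assume x: "x \<in> corner q"
  note x' = cornerD[OF x]
  show "csmult MA c x \<in> corner q" for c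
    using x' q EA_smult by (simp add: corner_def M.smult_times M.times_smult)
  have "q oo cstar MA x = cstar MA (x oo q)" "cstar MA x oo q = cstar MA (q oo x)"
    using q x'(1) by (simp_all add: M.adj_times)
  then show "cstar MA x \<in> corner q" using x' EA_adj by (simp add: corner_def)
  fix y assume y: "y \<in> corner q"
  note y' = cornerD[OF y]
  show "cadd MA x y \<in> corner q" using x' y' q EA_add by (simp add: corner_def M.plus_times M.times_plus)
  have "q oo (x oo y) = x oo y" using M.times_assoc[of q x y] x' y' q by simp
  moreover have "x oo y oo q = x oo y" using M.times_assoc[of x y q] x' y' q by simp
  ultimately show "x oo y \<in> corner q" using EA_left[OF x'(1) y'(2)] by (simp add: corner_def)
next
  show "closedin (ctopology MA) (corner q)"
    unfolding M.closedin_iff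
  proof (intro conjI allI impI)
    show "corner q \<subseteq> car MA" by (rule subsetI) (simp add: cornerD(1))
    fix s l assume s: "\<forall>n. s n \<in> corner q" and lim: "ctends MA s l"
    have qc: "ctends MA (%_. q) q" using q by (intro M.ctends_const) simp
    have "ctends MA (%n. q oo s n) (q oo l)" "ctends MA (%n. s n oo q) (l oo q)"
      by (rule M.ctends_times[OF qc lim], rule M.ctends_times[OF lim qc])
    then have "ctends MA s (q oo l)" "ctends MA s (l oo q)" using s cornerD(3,4) by simp_all
    then have "q oo l = l" "l oo q = l" by (metis lim M.ctends_unique)+
    moreover have "l \<in> EA" by (rule EA_limit[OF _ lim]) (use s cornerD(2) in blast)
    ultimately show "l \<in> corner q" by (simp add: corner_def)
  qed
qed

lemma corner_algebra: "D q ==> cstar MA q = q ==> cstar_algebra (MA\<lparr>ccarrier := corner q\<rparr>)"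
  by (rule M.cstar_subalgebra_algebra[OF corner_subalgebra])

subsection \<open>Diagonal copies of a corner element\<close>

definition dg :: "nat => 'b multiplier => 'b multiplier" where
  "dg n m = csum MA (%k. i (e k) \<omega> oo (m oo i \<omega> (e k))) {..<n}"

lemma dg_D [simp, intro]: "D m ==> D (dg n m)"
  unfolding dg_def by (intro D_csum) simp

lemma
  assumes m: "D m"
  shows i_dg: "i x y oo dg n m = i x \<omega> oo (m oo i \<omega> (hproj e n y))"
    and dg_i: "dg n m oo i x y = i (hproj e n x) \<omega> oo (m oo i \<omega> y)"
proof -
  have "i x y oo dg n m = csum MA (%k. i x y oo (i (e k) \<omega> oo (m oo i \<omega> (e k)))) {..<n}"
    unfolding dg_def using m by (intro M.times_csum) simp_all
  also have "... = csum MA (%k. i x \<omega> oo (m oo csmult MA (cnj (cinner y (e k))) (i \<omega> (e k)))) {..<n}"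
    using m cinner_commute[of _ y] by (intro M.csum_cong) (simp_all add: i_i_assoc M.times_smult)
  also have "... = i x \<omega> oo (m oo i \<omega> (hproj e n y))"
    unfolding i_hproj_right using m by (simp add: M.times_csum)
  finally show "i x y oo dg n m = i x \<omega> oo (m oo i \<omega> (hproj e n y))" .
  have "dg n m oo i x y = csum MA (%k. i (e k) \<omega> oo (m oo i \<omega> (e k)) oo i x y) {..<n}"
    unfolding dg_def using m by (intro M.csum_times) simp_all
  also have "... = csum MA (%k. csmult MA (cinner x (e k)) (i (e k) \<omega>) oo (m oo i \<omega> y)) {..<n}"
    using m by (intro M.csum_cong) (simp_all add: M.times_assoc i_i M.times_smult M.smult_times)
  also have "... = i (hproj e n x) \<omega> oo (m oo i \<omega> y)"
    unfolding i_hproj_left using m by (simp add: M.csum_times)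
  finally show "dg n m oo i x y = i (hproj e n x) \<omega> oo (m oo i \<omega> y)" .
qed

text \<open>This compatibility makes the partial sums strictly Cauchy: on the range of
  \<open>\<iota> (P j)\<close> they are constant from \<open>j\<close> on.\<close>

lemma
  assumes m: "D m" and j: "j <= n"
  shows P_dg: "\<iota> (P j) oo dg n m = dg j m" and dg_P: "dg n m oo \<iota> (P j) = dg j m"
proof -
  have "\<iota> (P j) oo dg n m = csum MA (%k. i (e k) (e k) oo dg n m) {..<j}"
    unfolding iota_P using m by (intro M.csum_times) simp_all
  also have "... = dg j m"
    unfolding dg_def[of j] using m j by (intro M.csum_cong) (simp_all add: i_dg hproj_basis)
  finally show "\<iota> (P j) oo dg n m = dg j m" .
  have "dg n m oo \<iota> (P j) = csum MA (%k. dg n m oo i (e k) (e k)) {..<j}"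
    unfolding iota_P using m by (intro M.times_csum) simp_all
  also have "... = dg j m"
    unfolding dg_def[of j] using m j by (intro M.csum_cong) (simp_all add: dg_i hproj_basis)
  finally show "dg n m oo \<iota> (P j) = dg j m" .
qed

text \<open>Orthogonality of the \<open>e k\<close> removes the cross terms of a product, and the
  \<open>p\<close> in the middle is absorbed by the corner element. Contractivity then bounds the
  partial sums uniformly in \<open>n\<close>, which no triangle inequality would give.\<close>

lemma dg_hom: "cstar_hom (MA\<lparr>ccarrier := corner p\<rparr>) MA (dg n)"
  unfolding cstar_hom_def
proof (intro conjI ballI allI, simp_all)
  show "dg n \<in> corner p \<rightarrow> car MA" by (rule Pi_I) (simp add: cornerD(1))
  fix m assume "m \<in> corner p"
  note m = cornerD[OF this]
  show "dg n (csmult MA c m) = csmult MA c (dg n m)" for c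
    unfolding dg_def using m by (simp add: M.smult_times M.times_smult M.csum_smult)
  have "cstar MA (i (e k) \<omega> oo (m oo i \<omega> (e k))) = i (e k) \<omega> oo (cstar MA m oo i \<omega> (e k))" for k
    using m by (simp add: M.adj_times i_adj M.times_assoc)
  then show "dg n (cstar MA m) = cstar MA (dg n m)"
    unfolding dg_def using m by (simp add: M.adj_csum)
  fix m' assume "m' \<in> corner p"
  note m' = cornerD[OF this]
  show "dg n (cadd MA m m') = cadd MA (dg n m) (dg n m')"
    unfolding dg_def using m m' by (simp add: M.plus_times M.times_plus M.csum_add)
  have "dg n m oo dg n m' = csum MA (%k. i (e k) \<omega> oo (m oo i \<omega> (e k)) oo dg n m') {..<n}"
    unfolding dg_def[of n m] using m m' by (intro M.csum_times) simp_all
  also have "... = csum MA (%k. i (e k) \<omega> oo (m oo m' oo i \<omega> (e k))) {..<n}"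
  proof (intro M.csum_cong refl)
    fix k assume k: "k \<in> {..<n}"
    have "i (e k) \<omega> oo (m oo i \<omega> (e k)) oo dg n m' = i (e k) \<omega> oo (m oo (p oo (m' oo i \<omega> (e k))))"
      using m m' k by (simp add: M.times_assoc i_dg hproj_basis)
    also have "m oo (p oo (m' oo i \<omega> (e k))) = m oo p oo (m' oo i \<omega> (e k))"
      using m(1) m'(1) by (intro M.times_assoc[symmetric]) simp_all
    finally show "i (e k) \<omega> oo (m oo i \<omega> (e k)) oo dg n m' = i (e k) \<omega> oo (m oo m' oo i \<omega> (e k))"
      using m m' by (simp add: M.times_assoc)
  qed (use m m' in simp)
  finally show "dg n (m oo m') = dg n m oo dg n m'" by (simp add: dg_def)
qed

lemma dg_contr: "m \<in> corner p ==> cnorm MA (dg n m) <= cnorm MA m"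
  using cstar_hom_norm_le[OF corner_algebra M.cstar_algebra_axioms dg_hom, of m n] i_adj by simp

text \<open>For \<open>j \<le> n\<close> the step from \<open>dg j m\<close> to
  \<open>dg n m\<close> at \<open>x\<close> is \<open>dg n m\<close> applied to
  \<open>x - \<iota> (P j) x\<close>, hence at most \<open>cnorm MA m\<close> times a null sequence
  in \<open>j\<close>; \<open>strict_limit\<close> does the rest.\<close>

lemma dg_limit_exists:
  assumes m: "m \<in> corner p"
  obtains c where "D c" "!!j. c oo \<iota> (P j) = dg j m" "!!j. \<iota> (P j) oo c = dg j m"
proof -
  note md = cornerD(1)[OF m]
  have K: "0 <= cnorm MA m" using A.multiplier_norm_nonneg[OF md] .
  have f: "fst (dg n m) (fst (\<iota> (P j)) x) = fst (dg j m) x" if "j <= n" "x \<in> car A" for j n x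
    using that md by (simp add: M_simps(5) flip: dg_P[OF md that(1)])
  have s: "snd (dg n m) (snd (\<iota> (P j)) x) = snd (dg j m) x" if "j <= n" "x \<in> car A" for j n x
    using that md by (simp add: M_simps(5) flip: P_dg[OF md that(1)])
  have bd: "cnorm A (fst (dg n m) x) <= cnorm MA m * cnorm A x" "cnorm A (snd (dg n m) x) <= cnorm MA m * cnorm A x"
    if x: "x \<in> car A" for n x
    using A.multiplier_norm_bound[OF dg_D[OF md] x, of n] A.snd_bound[OF dg_D[OF md] x, of n]
      mult_right_mono[OF dg_contr[OF m] A.norm_ge_zero[OF x], of n] by simp_all
  have L: "(%n. fst (dg n m) x) \<in> cauchy_seqs A" if x: "x \<in> car A" for x
  proof (rule A.cauchy_seqsI)
    have "(%j. cnorm A (cdiff A (fst (\<iota> (P j)) x) x)) ----> 0" using iota_P_tends[OF x] by (simp add: ctends_def)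
    then show "(%j. cnorm MA m * cnorm A (cdiff A (fst (\<iota> (P j)) x) x)) ----> 0" by (rule tendsto_mult_right_zero)
    fix j n :: nat assume j: "j <= n"
    have "cdiff A (fst (dg n m) x) (fst (dg j m) x) = fst (dg n m) (cdiff A x (fst (\<iota> (P j)) x))"
      using A.fst_diff[OF dg_D[OF md], of x "fst (\<iota> (P j)) x" n] f[OF j x] x by simp
    then show "cnorm A (cdiff A (fst (dg n m) x) (fst (dg j m) x)) <= cnorm MA m * cnorm A (cdiff A (fst (\<iota> (P j)) x) x)"
      using bd(1)[of "cdiff A x (fst (\<iota> (P j)) x)" n] A.norm_diff_commute[of x "fst (\<iota> (P j)) x"] x by simp
  qed (use x md in simp)
  have R: "(%n. snd (dg n m) x) \<in> cauchy_seqs A" if x: "x \<in> car A" for x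
  proof (rule A.cauchy_seqsI)
    have "(%j. cnorm A (cdiff A (snd (\<iota> (P j)) x) x)) ----> 0" using iota_P_tends'[OF x] by (simp add: ctends_def)
    then show "(%j. cnorm MA m * cnorm A (cdiff A (snd (\<iota> (P j)) x) x)) ----> 0" by (rule tendsto_mult_right_zero)
    fix j n :: nat assume j: "j <= n"
    have "cdiff A (snd (dg n m) x) (snd (dg j m) x) = snd (dg n m) (cdiff A x (snd (\<iota> (P j)) x))"
      using A.snd_diff[OF dg_D[OF md], of x "snd (\<iota> (P j)) x" n] s[OF j x] x by simp
    then show "cnorm A (cdiff A (snd (dg n m) x) (snd (dg j m) x)) <= cnorm MA m * cnorm A (cdiff A (snd (\<iota> (P j)) x) x)"
      using bd(2)[of "cdiff A x (snd (\<iota> (P j)) x)" n] A.norm_diff_commute[of x "snd (\<iota> (P j)) x"] x by simp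
  qed (use x md in simp)
  obtain c where c: "D c" "!!x. x \<in> car A ==> ctends A (%n. fst (dg n m) x) (fst c x)"
    using A.strict_limit[where m="%n. dg n m", OF dg_D[OF md] dg_contr[OF m] L R] by blast
  \<comment> \<open>On the range of a fixed projection the sequence is eventually constant, and this
    identifies the values of the strict limit there.\<close>
  have ev: "ctends A t l" if "!!n. t n \<in> car A" "!!n. j <= n ==> t n = l" "l \<in> car A" for t l and j :: nat
    unfolding ctends_def
  proof (intro conjI allI that(1,3))
    show "(%n. cnorm A (cdiff A (t n) l)) ----> 0"
      by (rule tendsto_eventually, rule eventually_sequentiallyI[of j]) (simp add: that A.diff_self A.norm_zero)
  qed
  have "c oo \<iota> (P j) = dg j m" for j
  proof (rule A.multiplier_eqI)
    fix x assume x: "x \<in> car A"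
    have "ctends A (%n. fst (dg n m) (fst (\<iota> (P j)) x)) (fst (dg j m) x)"
      by (rule ev[of _ j]) (use x md f in simp_all)
    moreover have "ctends A (%n. fst (dg n m) (fst (\<iota> (P j)) x)) (fst c (fst (\<iota> (P j)) x))"
      by (rule c(2)) (use x in simp)
    ultimately show "fst (c oo \<iota> (P j)) x = fst (dg j m) x"
      using x A.ctends_unique by (simp add: M_simps(5))
  qed (use c(1) md in simp_all)
  moreover have "\<iota> (P j) oo c = dg j m" for j
  proof (rule A.multiplier_eqI)
    fix x assume x: "x \<in> car A"
    have "fst (\<iota> (P j)) (fst (dg n m) x) = fst (dg j m) x" if "j <= n" for n
      using x md by (simp add: M_simps(5) flip: P_dg[OF md that])
    then have "ctends A (%n. fst (\<iota> (P j)) (fst (dg n m) x)) (fst (dg j m) x)"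
      by (intro ev[of _ j]) (use x md in simp_all)
    moreover have "ctends A (%n. fst (\<iota> (P j)) (fst (dg n m) x)) (fst (\<iota> (P j)) (fst c x))"
      by (rule A.fst_ctends[OF P_D c(2)[OF x]])
    ultimately show "fst (\<iota> (P j) oo c) x = fst (dg j m) x"
      using x A.ctends_unique by (simp add: M_simps(5))
  qed (use c(1) md in simp_all)
  ultimately show ?thesis using c(1) that by blast
qed

text \<open>On rank-one operators \<open>c oo i x y\<close> and \<open>i x y oo c\<close> are the
  same element \<open>i x \<omega> oo (m oo i \<omega> y)\<close>, and combinations of these
  operators are dense in K. Moreover \<open>c oo \<iota> (P n o\<^sub>L k)\<close> is
  \<open>dg n m oo \<iota> k\<close>, a finite sum in the closed set \<open>EA\<close>, so the limit
  lies in \<open>A\<close> as well.\<close>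

lemma commutant_exists:
  assumes m: "m \<in> corner p"
  obtains c where "c \<in> C" "c oo p = m"
proof -
  note md = cornerD[OF m]
  obtain c where c: "D c" "!!j. c oo \<iota> (P j) = dg j m" "!!j. \<iota> (P j) oo c = dg j m"
    using dg_limit_exists[OF m] by blast
  have cc: "ctends MA (%_. c) c" using c(1) by (intro M.ctends_const) simp
  have const: "ctends MA (%_. i x y) (i x y)" "ctends MA (%_. m) m" for x y using md by (auto intro: M.ctends_const)
  have ci: "c oo i x y = i x \<omega> oo (m oo i \<omega> y)" for x y
  proof (rule M.ctends_unique)
    show "ctends MA (%n. c oo i (hproj e n x) y) (c oo i x y)"
      by (intro M.ctends_times cc i_hproj_left_tends)
    have "c oo i (hproj e n x) y = i (hproj e n x) \<omega> oo (m oo i \<omega> y)" for n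
      using M.times_assoc[of c "\<iota> (P n)" "i x y"] c(1) by (simp add: c(2) dg_i[OF md(1)] P_i)
    then show "ctends MA (%n. c oo i (hproj e n x) y) (i x \<omega> oo (m oo i \<omega> y))"
      by (simp only:) (intro M.ctends_times i_hproj_left_tends const)
  qed
  have ic: "i x y oo c = i x \<omega> oo (m oo i \<omega> y)" for x y
  proof (rule M.ctends_unique)
    show "ctends MA (%n. i x (hproj e n y) oo c) (i x y oo c)"
      by (intro M.ctends_times cc i_hproj_right_tends)
    have "i x (hproj e n y) oo c = i x \<omega> oo (m oo i \<omega> (hproj e n y))" for n
      using M.times_assoc[of "i x y" "\<iota> (P n)" c] c(1) by (simp add: c(3) i_dg[OF md(1)] i_P)
    then show "ctends MA (%n. i x (hproj e n y) oo c) (i x \<omega> oo (m oo i \<omega> y))"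
      by (simp only:) (intro M.ctends_times i_hproj_right_tends const)
  qed
  have "c \<in> C"
  proof (rule commutantI[OF c(1)])
    fix k assume k: "Kop k"
    have Pk: "P n o\<^sub>L k = (\<Sum>j<n. rone (e j) (ap (hadj k) (e j)))" for n
      by (rule blinfun_eqI) (simp add: P_apply hproj_def blinfun.sum_left hadj(1)[OF Kop_clin[OF k]])
    have K: "Kop (P n o\<^sub>L k)" for n by (intro Kop_compose Kop_P Kop_clin k)
    have lim: "ctends MA (%n. \<iota> (P n o\<^sub>L k)) (\<iota> k)" using k K by (intro iota_tends) (auto simp: Kop_def)
    have "\<iota> (P n o\<^sub>L k) oo c = c oo \<iota> (P n o\<^sub>L k)" for n
      unfolding Pk using c(1) by (simp add: iota_sum Kop_rone M.times_csum M.csum_times ci ic)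
    then have "ctends MA (%n. c oo \<iota> (P n o\<^sub>L k)) (\<iota> k oo c)"
      using M.ctends_times[OF lim cc] by simp
    moreover have l: "ctends MA (%n. c oo \<iota> (P n o\<^sub>L k)) (c oo \<iota> k)" by (rule M.ctends_times[OF cc lim])
    ultimately show "\<iota> k oo c = c oo \<iota> k" by (rule M.ctends_unique)
    have "c oo \<iota> (P n o\<^sub>L k) = dg n m oo \<iota> k" for n
      using M.times_assoc[of c "\<iota> (P n)" "\<iota> k"] c(1) k by (simp add: iota_mult Kop_P c(2))
    moreover have "dg n m oo \<iota> k \<in> EA" for n
      unfolding dg_def using k md by (intro EA_right EA_csum EA_left) auto
    ultimately have "c oo \<iota> (P n o\<^sub>L k) \<in> EA" for n by simp
    from EA_limit[OF this l] show "\<exists>x\<in>car A. c oo \<iota> k = em x" by blast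
  qed
  moreover have "c oo p = m" unfolding ci using md by (simp add: M.times_assoc)
  ultimately show ?thesis by (rule that)
qed

text \<open>Commuting with rank-one operators, \<open>c\<close> is determined on all of them by
  \<open>c oo p\<close>; since the \<open>\<iota> (P n)\<close> are sums of these and tend strictly
  to 1, this entails uniqueness.\<close>

lemma commutant_i:
  assumes c: "c \<in> C" shows "c oo i x y = i x \<omega> oo (c oo p oo i \<omega> y)"
proof -
  note d = commutant_mem[OF c]
  have "i x \<omega> oo (c oo p oo i \<omega> y) = i x \<omega> oo c oo (p oo i \<omega> y)" using d by (simp add: M.times_assoc)
  also have "... = c oo (i x \<omega> oo i \<omega> y)"
    unfolding commutant_commute[OF c Kop_rone] using d by (simp add: M.times_assoc i_i_omega)
  finally show ?thesis by (simp add: i_i_omega)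
qed

lemma commutant_eqI:
  assumes c: "c \<in> C" "c' \<in> C" and eq: "c oo p = c' oo p" shows "c = c'"
proof (rule A.multiplier_eqI)
  note d = commutant_mem[OF c(1)] commutant_mem[OF c(2)]
  show "D c" "D c'" by (fact d)+
  have "c oo i x y = c' oo i x y" for x y
    by (rule trans[OF commutant_i[OF c(1)]], subst eq, rule commutant_i[OF c(2), symmetric])
  then have P: "c oo \<iota> (P n) = c' oo \<iota> (P n)" for n unfolding iota_P using d by (simp add: M.times_csum)
  fix x assume x: "x \<in> car A"
  have "fst c (fst (\<iota> (P n)) x) = fst c' (fst (\<iota> (P n)) x)" for n
    using arg_cong[OF P, of "%m. fst m x" n] x by (simp add: M_simps(5))
  then have "ctends A (%n. fst c (fst (\<iota> (P n)) x)) (fst c' x)"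
    using A.fst_ctends[OF d(2) iota_P_tends[OF x]] by simp
  then show "fst c x = fst c' x" using A.fst_ctends[OF d(1) iota_P_tends[OF x]] A.ctends_unique by blast
qed

text \<open>The inverse of the bijection \<open>c \<mapsto> c oo p\<close> from the commutant to the
  corner of \<open>p\<close>.\<close>

definition \<Gamma> :: "'b multiplier => 'b multiplier" where
  "\<Gamma> m = (SOME c. c \<in> C \<and> c oo p = m)"

lemma Gamma: "m \<in> corner p ==> \<Gamma> m \<in> C" "m \<in> corner p ==> \<Gamma> m oo p = m"
proof -
  assume m: "m \<in> corner p"
  obtain c where "c \<in> C \<and> c oo p = m" using commutant_exists[OF m] by blast
  from someI[of "%c. c \<in> C \<and> c oo p = m", OF this] show "\<Gamma> m \<in> C" "\<Gamma> m oo p = m" unfolding \<Gamma>_def by blast+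
qed

lemma Gamma_eqI: "c \<in> C ==> c oo p = m ==> \<Gamma> m = c"
  unfolding \<Gamma>_def by (rule some_equality) (auto intro: commutant_eqI)

lemma
  shows C_add: "c \<in> C ==> c' \<in> C ==> cadd MA c c' \<in> C" and C_smult: "c \<in> C ==> csmult MA z c \<in> C"
    and C_times: "c \<in> C ==> c' \<in> C ==> c oo c' \<in> C" and C_adj: "c \<in> C ==> cstar MA c \<in> C" and C_zero: "czero MA \<in> C"
  using commutant_subalgebra unfolding cstar_subalgebra_def csubspace_def by blast+

lemma
  assumes m: "m \<in> corner p" "m' \<in> corner p"
  shows Gamma_add: "\<Gamma> (cadd MA m m') = cadd MA (\<Gamma> m) (\<Gamma> m')"
    and Gamma_smult: "\<Gamma> (csmult MA z m) = csmult MA z (\<Gamma> m)"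
    and Gamma_adj: "\<Gamma> (cstar MA m) = cstar MA (\<Gamma> m)"
proof -
  note g = Gamma[OF m(1)] Gamma[OF m(2)]
  note d = commutant_mem[OF g(1)] commutant_mem[OF g(3)]
  show "\<Gamma> (cadd MA m m') = cadd MA (\<Gamma> m) (\<Gamma> m')"
    by (rule Gamma_eqI[OF C_add[OF g(1,3)]]) (use g d in "simp add: M.plus_times")
  show "\<Gamma> (csmult MA z m) = csmult MA z (\<Gamma> m)"
    by (rule Gamma_eqI[OF C_smult[OF g(1)]]) (use g d in "simp add: M.smult_times")
  have "cstar MA (\<Gamma> m) oo p = cstar MA (p oo \<Gamma> m)" using d by (simp add: M.adj_times i_adj)
  also have "... = cstar MA m" unfolding commutant_commute[OF g(1) Kop_rone] g(2) ..
  finally show "\<Gamma> (cstar MA m) = cstar MA (\<Gamma> m)" by (rule Gamma_eqI[OF C_adj[OF g(1)]])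
qed

end

section \<open>The isomorphism \<open>C(A, \<iota>) \<otimes> \<K> \<simeq> A\<close>\<close>

lemma (in carrier_vector_space) csum_swap:
  assumes "!!j k. f j k \<in> car A"
  shows "csum A (%j. csum A (f j) I) J = csum A (%k. csum A (%j. f j k) J) I"
  by (rule vec_eqI) (simp_all add: assms sum.swap[of _ I J])

sublocale stable_K \<subseteq> S: tensor_K e "K_commutant_algebra A \<iota>" \<omega>
  by (intro tensor_K.intro hilbert_basis_axioms cstar_algebra_commutant tensor_K_axioms.intro norm_omega)

context stable_K
begin

abbreviation "CA \<equiv> K_commutant_algebra A \<iota>"

lemma CA_simps [simp]:
  "car CA = C" "czero CA = czero MA" "cadd CA = cadd MA" "csmult CA = csmult MA" "cmult CA = cmult MA"
  "cstar CA = cstar MA" "cnorm CA = cnorm MA"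
  by (simp_all add: K_commutant_algebra_def)

lemmas C_closed [simp, intro] = C_add C_smult C_times C_adj C_zero commutant_mem

lemma C_csum: "(!!k. k \<in> I ==> f k \<in> C) ==> csum MA f I \<in> C"
proof (induction I rule: infinite_finite_induct)
  case (infinite I)
  then show ?case by (simp add: csum_def)
next
  case (insert k I)
  have "csum MA f (insert k I) = cadd MA (csum MA f I) (f k)"
    using insert by (intro M.csum_insert') simp_all
  then show ?case using insert by simp
qed simp

subsection \<open>The homomorphism on the algebraic tensor product\<close>

definition ev :: "'b multiplier \<times> ('a op) => 'b multiplier" where
  "ev x = fst x oo \<iota> (snd x)"

text \<open>The candidate for the isomorphism on the free space, kept in the multiplier algebra; its
  values turn out to lie in \<open>EA\<close>.\<close>

definition ext :: "('b multiplier \<times> ('a op) \<Rightarrow>\<^sub>0 complex) => 'b multiplier" where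
  "ext u = lext MA ev u"

lemma ev_mem: "x \<in> C \<times> car S.KK ==> ev x \<in> car MA"
  unfolding ev_def mem_Times_iff Kop_iff by simp

lemma keys_FC: "u \<in> S.FC ==> keys u \<subseteq> C \<times> car S.KK"
  by (simp add: S.FC_iff)

lemma ext_D [simp, intro]: "u \<in> S.FC ==> D (ext u)"
proof -
  assume u: "u \<in> S.FC"
  have "lext MA ev u \<in> car MA"
  proof (rule M.lext_mem)
    show "ev x \<in> car MA" if "x \<in> C \<times> car S.KK" for x using that by (rule ev_mem)
  qed (rule keys_FC[OF u])
  then show ?thesis by (simp add: ext_def)
qed

lemma ext_add:
  assumes u: "u \<in> S.FC" and v: "v \<in> S.FC" shows "ext (u + v) = cadd MA (ext u) (ext v)"
  unfolding ext_def
proof (rule M.lext_add)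
  show "ev x \<in> car MA" if "x \<in> C \<times> car S.KK" for x using that by (rule ev_mem)
qed (rule keys_FC[OF u] keys_FC[OF v])+

lemma ext_zero [simp]: "ext 0 = czero MA" by (simp add: ext_def)

lemma ext_single: "c \<in> C ==> Kop k ==> ext (S.sng c k z) = csmult MA z (c oo \<iota> k)"
  unfolding ext_def using ev_mem[of "(c, k)"]
  by (subst M.lext_single) (simp_all add: ev_def Kop_iff)

lemma sng_FC: "c \<in> C ==> Kop k ==> S.sng c k z \<in> S.FC"
  using S.FC_single[of c k z] by (simp add: Kop_iff)

lemma ext_induct [consumes 1, case_names zero add]:
  assumes "u \<in> S.FC" "Q 0"
    and "!!c k z u. c \<in> C ==> Kop k ==> u \<in> S.FC ==> Q u ==> Q (S.sng c k z + u)"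
  shows "Q u"
  using assms(1)
proof (induction rule: S.FC_induct)
  case zero
  show ?case by (rule assms(2))
next
  case (add c k z u)
  show ?case by (rule assms(3)) (use add in "simp_all add: Kop_iff")
qed

lemma ext_scale: "u \<in> S.FC ==> ext (pm_scale z u) = csmult MA z (ext u)"
proof (induction rule: ext_induct)
  case (add c k d u)
  then show ?case using sng_FC[OF add(1,2)]
    by (simp add: pm.scale_right_distrib ext_add ext_single M.smult_plus M.smult_assoc)
qed (simp add: M.smult_zero)

lemma ext_diff: "u \<in> S.FC ==> v \<in> S.FC ==> ext (u - v) = cdiff MA (ext u) (ext v)"
  unfolding cdiff_def by (simp only: pm_minus ext_add S.FC_scale ext_scale)

text \<open>The factor \<open>\<iota> k\<close> moves past \<open>c'\<close>; the multiplicativity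
  of \<open>ext\<close> rests on this.\<close>

lemma commutant_times:
  assumes c: "c \<in> C" "c' \<in> C" and k: "Kop k" "Kop k'"
  shows "c oo \<iota> k oo (c' oo \<iota> k') = c oo c' oo \<iota> (k o\<^sub>L k')"
proof -
  have "c oo \<iota> k oo (c' oo \<iota> k') = c oo (\<iota> k oo c' oo \<iota> k')" using c k by (simp add: M.times_assoc)
  also have "... = c oo c' oo \<iota> (k o\<^sub>L k')"
    unfolding commutant_commute[OF c(2) k(1)] using c k by (simp add: M.times_assoc iota_mult)
  finally show ?thesis .
qed

lemma ext_single_mult:
  assumes v: "v \<in> S.FC" and c: "c \<in> C" and k: "Kop k"
  shows "ext (S.fm (S.sng c k z) v) = csmult MA z (c oo \<iota> k) oo ext v"
  using v
proof (induction rule: ext_induct)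
  case zero
  then show ?case using c k by (simp add: M.times_zero)
next
  case (add c' k' z' v)
  have kk: "Kop (k o\<^sub>L k')" using k add by (intro Kop_compose Kop_clin)
  have "S.fm (S.sng c k z) v \<in> S.FC" using sng_FC[OF c k] add by (intro S.FC_mult)
  moreover have "ext (S.fm (S.sng c k z) (S.sng c' k' z')) = csmult MA z (c oo \<iota> k) oo csmult MA z' (c' oo \<iota> k')"
    using c k add kk by (simp add: ftm_single ext_single M.smult_times M.times_smult M.smult_assoc commutant_times mult.commute)
  moreover have "S.fm (S.sng c k z) (S.sng c' k' z') \<in> S.FC" using c k add by (intro S.FC_mult sng_FC)
  ultimately show ?case using add c k sng_FC[OF add(1,2)]
    by (simp add: ftm_add_right ext_add ext_single M.times_plus)
qed

lemma ext_mult: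
  assumes u: "u \<in> S.FC" and v: "v \<in> S.FC" shows "ext (S.fm u v) = ext u oo ext v"
  using u
proof (induction rule: ext_induct)
  case zero
  then show ?case using v by (simp add: M.zero_times)
next
  case (add c k z u)
  have "S.fm (S.sng c k z) v \<in> S.FC" "S.fm u v \<in> S.FC" using sng_FC[OF add(1,2)] add v by (auto intro: S.FC_mult)
  then show ?case using add v sng_FC[OF add(1,2)]
    by (simp add: ftm_add_left ext_add ext_single ext_single_mult M.plus_times)
qed

lemma ext_star: "u \<in> S.FC ==> ext (S.fs u) = cstar MA (ext u)"
proof (induction rule: ext_induct)
  case zero
  then show ?case by (simp add: M.adj_zero)
next
  case (add c k z u)
  note hk = Kop_hadj[OF add(2)]
  have "cstar MA (c oo \<iota> k) = \<iota> (hadj k) oo cstar MA c" using add hk by (simp add: M.adj_times iota_adj)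
  also have "... = cstar MA c oo \<iota> (hadj k)" using add hk by (intro commutant_commute) auto
  finally have eq: "cstar MA (c oo \<iota> k) = cstar MA c oo \<iota> (hadj k)" .
  show ?case using add hk sng_FC[OF add(1,2)] sng_FC[OF C_adj[OF add(1)] hk]
    by (simp add: fts_add fts_single ext_add ext_single M.adj_plus M.adj_smult eq)
qed

lemma ext_EA: "u \<in> S.FC ==> ext u \<in> EA"
proof (induction rule: ext_induct)
  case zero
  then show ?case by (simp add: EA_zero)
next
  case (add c k z u)
  have "c oo \<iota> k \<in> EA" using commutant_embed[OF add(1,2)] by blast
  then show ?case using add sng_FC[OF add(1,2)] by (simp add: ext_add ext_single EA_add EA_smult)
qed

lemma D_diff [simp]: "D x ==> D y ==> D (cdiff MA x y)"
  unfolding cdiff_def by (intro D_closed)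

text \<open>Pulled back along \<open>ext\<close>, the norm becomes one of the C*-seminorms whose
  supremum is the tensor norm, hence is bounded by it.\<close>

lemma ext_seminorm: "tensor_cstar_seminorm CA S.KK (%u. cnorm MA (ext u))"
  unfolding tensor_cstar_seminorm_def free_tensor_smult_eq
proof (intro conjI ballI allI)
  fix u assume u: "u \<in> S.FC"
  show "0 <= cnorm MA (ext u)" using M.norm_ge_zero u by simp
  show "cnorm MA (ext (pm_scale c u)) = cmod c * cnorm MA (ext u)" for c using u by (simp add: ext_scale M.norm_scale)
  show "cnorm MA (ext (S.fs u)) = cnorm MA (ext u)" using u by (simp add: ext_star M.norm_adj)
  show "cnorm MA (ext (S.fm (S.fs u) u)) = (cnorm MA (ext u))\<^sup>2"
    using u by (simp add: ext_star ext_mult M.norm_adj_times)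
  fix v assume v: "v \<in> S.FC"
  show "cnorm MA (ext (u + v)) <= cnorm MA (ext u) + cnorm MA (ext v)" using u v by (simp add: ext_add M.norm_plus)
  show "cnorm MA (ext (S.fm u v)) <= cnorm MA (ext u) * cnorm MA (ext v)" using u v by (simp add: ext_mult M.norm_times)
next
  fix u assume "u \<in> bilinearity_relations CA S.KK"
  then have "ext u = czero MA"
    unfolding bilinearity_relations_def CA_simps compact_operators_simps Kop_iff
  proof (elim UnE CollectE exE conjE)
    fix c c' k assume u: "u = S.sng (cadd MA c c') k 1 - S.sng c k 1 - S.sng c' k 1" and c: "c \<in> C" "c' \<in> C" and k: "Kop k"
    show ?thesis unfolding u using c k
      by (intro M.vec_eqI) (simp_all add: sng_FC S.FC_diff ext_diff ext_single M.plus_times)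
  next
    fix c k k' assume u: "u = S.sng c (k + k') 1 - S.sng c k 1 - S.sng c k' 1" and c: "c \<in> C" and k: "Kop k" "Kop k'"
    show ?thesis unfolding u using c k
      by (intro M.vec_eqI) (simp_all add: sng_FC S.FC_diff ext_diff ext_single M.times_plus Kop_add iota_add)
  next
    fix z c k assume u: "u = S.sng (csmult MA z c) k 1 - S.sng c k z" and c: "c \<in> C" and k: "Kop k"
    show ?thesis unfolding u using c k
      by (intro M.vec_eqI) (simp_all add: sng_FC S.FC_diff ext_diff ext_single M.smult_times)
  next
    fix z c k assume u: "u = S.sng c (cscale_op z k) 1 - S.sng c k z" and c: "c \<in> C" and k: "Kop k"
    show ?thesis unfolding u using c k
      by (intro M.vec_eqI) (simp_all add: sng_FC S.FC_diff ext_diff ext_single M.times_smult Kop_cscale iota_scale)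
  qed
  then show "cnorm MA (ext u) = 0" by (simp add: M.norm_zero)
qed

subsection \<open>Matrix coefficients\<close>

text \<open>The matrix coefficient of \<open>x\<close> at \<open>j\<close> and \<open>k\<close>,
  carried from the corner of \<open>p\<close> to the commutant; formally \<open>x\<close> is the sum
  of the products of \<open>G j k x\<close> with \<open>i (e j) (e k)\<close>.\<close>

definition G :: "nat => nat => 'b multiplier => 'b multiplier" where
  "G j k x = \<Gamma> (i \<omega> (e j) oo (x oo i (e k) \<omega>))"

lemma coeff_corner: "x \<in> EA ==> i \<omega> (e j) oo (x oo i (e k) \<omega>) \<in> corner p"
proof -
  assume x: "x \<in> EA"
  note d = EA_D[OF x]
  have "i \<omega> (e j) oo (x oo i (e k) \<omega>) \<in> EA" using x by (intro EA_left EA_right) simp_all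
  moreover have "p oo (i \<omega> (e j) oo (x oo i (e k) \<omega>)) = i \<omega> (e j) oo (x oo i (e k) \<omega>)"
    using d by (simp add: i_i_assoc cinner_self norm_omega M.one_smult)
  moreover have "i \<omega> (e j) oo (x oo i (e k) \<omega>) oo p = i \<omega> (e j) oo (x oo i (e k) \<omega>)"
    using d by (simp add: M.times_assoc i_i_omega)
  ultimately show ?thesis by (simp add: corner_def)
qed

lemma G_C [simp, intro]: "x \<in> EA ==> G j k x \<in> C"
  unfolding G_def by (intro Gamma(1) coeff_corner)

lemma G_p: "x \<in> EA ==> G j k x oo p = i \<omega> (e j) oo (x oo i (e k) \<omega>)"
  unfolding G_def by (intro Gamma(2) coeff_corner)

lemma G_add: "x \<in> EA ==> y \<in> EA ==> G j k (cadd MA x y) = cadd MA (G j k x) (G j k y)"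
  unfolding G_def using EA_D[of x] EA_D[of y]
  by (simp add: M.plus_times M.times_plus Gamma_add coeff_corner)

lemma G_smult: "x \<in> EA ==> G j k (csmult MA z x) = csmult MA z (G j k x)"
  unfolding G_def using EA_D[of x] by (simp add: M.smult_times M.times_smult Gamma_smult[OF coeff_corner coeff_corner])

lemma G_adj: "x \<in> EA ==> G j k (cstar MA x) = cstar MA (G k j x)"
proof -
  assume x: "x \<in> EA"
  have "cstar MA (i \<omega> (e k) oo (x oo i (e j) \<omega>)) = i \<omega> (e j) oo (cstar MA x oo i (e k) \<omega>)"
    using EA_D[OF x] by (simp add: M.adj_times i_adj M.times_assoc)
  then show ?thesis unfolding G_def using Gamma_adj[OF coeff_corner[OF x] coeff_corner[OF x], of k j] by simp
qed

lemma i_basis: "csmult MA (cinner (e j) (e j)) (i x (e j)) = i x (e j)"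
proof -
  have "cscale_op (cinner (e j) (e j)) (rone x (e j)) = rone x (e j)"
    by (intro blinfun_eqI)
      (simp add: scaleC_scaleC mult.commute[of "cinner (e j) (e j)"] cinner_self_unit[of e j, OF unit[of j]])
  then show ?thesis using iota_scale[OF Kop_rone, of "cinner (e j) (e j)" x "e j"] by simp
qed

text \<open>\<open>cinner (e j) (e j)\<close> is 0 or 1, and for vanishing \<open>e j\<close> the
  coefficient vanishes too. The product of two matrix units through the index \<open>j\<close>
  carries this factor.\<close>

lemma G_basis: "x \<in> EA ==> csmult MA (cinner (e j) (e j)) (G j k x) = G j k x"
  unfolding G_def using EA_D[of x] Gamma_smult[OF coeff_corner coeff_corner, of x x "cinner (e j) (e j)" j k]
  by (simp add: i_basis flip: M.smult_times)

text \<open>Matrix multiplication: as \<open>\<iota> (P n)\<close> acts on \<open>y\<close> as the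
  identity, the sum of the \<open>i (e k) (e k)\<close> over \<open>k < n\<close> may be inserted
  between \<open>x\<close> and \<open>y\<close>.\<close>

lemma G_mult:
  assumes x: "x \<in> corner (\<iota> (P n))" and y: "y \<in> corner (\<iota> (P n))"
  shows "G j l (x oo y) = csum MA (%k. G j k x oo G k l y) {..<n}"
  unfolding G_def[of j l]
proof (rule Gamma_eqI)
  note x' = cornerD[OF x] and y' = cornerD[OF y]
  show "csum MA (%k. G j k x oo G k l y) {..<n} \<in> C" using x' y' by (intro C_csum) auto
  have t: "G j k x oo G k l y oo p = i \<omega> (e j) oo (x oo (i (e k) (e k) oo (y oo i (e l) \<omega>)))" for k
  proof -
    note cx = coeff_corner[OF x'(2), of j k] and cy = coeff_corner[OF y'(2), of k l]
    have "G j k x oo G k l y oo p = G j k x oo (p oo (i \<omega> (e k) oo (y oo i (e l) \<omega>)))"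
      using x' y' by (simp add: M.times_assoc G_p cornerD(3)[OF cy])
    also have "... = G j k x oo p oo (i \<omega> (e k) oo (y oo i (e l) \<omega>))"
      using x' y' by (intro M.times_assoc[symmetric]) simp_all
    also have "... = i \<omega> (e j) oo (x oo (i (e k) \<omega> oo (i \<omega> (e k) oo (y oo i (e l) \<omega>))))"
      using x' y' by (simp add: M.times_assoc G_p)
    also have "i (e k) \<omega> oo (i \<omega> (e k) oo (y oo i (e l) \<omega>)) = i (e k) (e k) oo (y oo i (e l) \<omega>)"
      using y' by (simp add: i_i_assoc cinner_self norm_omega M.one_smult)
    finally show ?thesis .
  qed
  have "csum MA (%k. G j k x oo G k l y) {..<n} oo p = csum MA (%k. G j k x oo G k l y oo p) {..<n}"
    using x' y' by (intro M.csum_times) auto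
  also have "... = i \<omega> (e j) oo (x oo (\<iota> (P n) oo (y oo i (e l) \<omega>)))"
    unfolding t iota_P using x' y' by (simp add: M.times_csum M.csum_times)
  also have "\<iota> (P n) oo (y oo i (e l) \<omega>) = \<iota> (P n) oo y oo i (e l) \<omega>"
    using y'(1) by (intro M.times_assoc[symmetric]) simp_all
  also have "... = y oo i (e l) \<omega>" by (simp add: y'(3))
  finally show "csum MA (%k. G j k x oo G k l y) {..<n} oo p = i \<omega> (e j) oo (x oo y oo i (e l) \<omega>)"
    using x' y' by (simp add: M.times_assoc)
qed

lemma G_unit: "x \<in> EA ==> G j k x oo i (e j) (e k) = i (e j) (e j) oo (x oo i (e k) (e k))"
proof -
  assume x: "x \<in> EA"
  have "G j k x oo i (e j) (e k) = i (e j) \<omega> oo (i \<omega> (e j) oo (x oo i (e k) \<omega>) oo i \<omega> (e k))"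
    unfolding commutant_i[OF G_C[OF x], of j k "e j" "e k"] G_p[OF x] ..
  also have "... = i (e j) (e j) oo (x oo i (e k) (e k))"
    using EA_D[OF x] by (simp add: M.times_assoc i_i_assoc i_i_omega cinner_self norm_omega M.one_smult)
  finally show ?thesis .
qed

lemma G_elementary:
  assumes c: "c \<in> C" and k: "Kop k"
  shows "G j l (c oo \<iota> k) = csmult MA (cinner (ap k (e l)) (e j)) c"
  unfolding G_def
proof (rule Gamma_eqI)
  let ?z = "cinner (ap k (e l)) (e j)"
  show "csmult MA ?z c \<in> C" using c by simp
  have "rone \<omega> (e j) o\<^sub>L (k o\<^sub>L rone (e l) \<omega>) = cscale_op ?z (rone \<omega> \<omega>)"
    using Kop_clin[OF k] by (intro blinfun_eqI) (simp add: clin_def scaleC_scaleC cinner_scaleC_left mult.commute)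
  then have "i \<omega> (e j) oo (\<iota> k oo i (e l) \<omega>) = csmult MA ?z p"
    using k Kop_compose[OF k clin_rone, of "e l" \<omega>] by (simp add: Kop_rone iota_scale flip: iota_mult)
  then have "c oo (i \<omega> (e j) oo (\<iota> k oo i (e l) \<omega>)) = csmult MA ?z c oo p" using c by (simp add: M.times_smult M.smult_times)
  also have "c oo (i \<omega> (e j) oo (\<iota> k oo i (e l) \<omega>)) = c oo i \<omega> (e j) oo (\<iota> k oo i (e l) \<omega>)"
    using c k by (intro M.times_assoc[symmetric]) simp_all
  also have "... = i \<omega> (e j) oo (c oo \<iota> k oo i (e l) \<omega>)"
    unfolding commutant_commute[OF c Kop_rone, symmetric] using c k by (simp add: M.times_assoc)
  finally show "csmult MA ?z c oo p = i \<omega> (e j) oo (c oo \<iota> k oo i (e l) \<omega>)" ..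
qed

lemma et_mem': "c \<in> C ==> Kop k ==> S.et c k \<in> car S.T"
  using S.etK_mem[of c k] by simp

lemma
  assumes c: "c \<in> C" and k: "Kop k"
  shows et_add: "c' \<in> C ==> S.et (cadd MA c c') k = cadd S.T (S.et c k) (S.et c' k)"
    and et_smult: "S.et (csmult MA z c) k = csmult S.T z (S.et c k)"
    and et_scale: "S.et c (cscale_op z k) = csmult S.T z (S.et c k)"
    and et_plus: "Kop k' ==> S.et c (k + k') = cadd S.T (S.et c k) (S.et c k')"
    and et_mult: "c' \<in> C ==> Kop k' ==> cmult S.T (S.et c k) (S.et c' k') = S.et (c oo c') (k o\<^sub>L k')"
    and et_star: "cstar S.T (S.et c k) = S.et (cstar MA c) (hadj k)"
  using S.etK_add_left[of c c' k k] S.etK_smult_left[of c c k k z] S.etK_smult_right[of c c k k z]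
    S.etK_add_right[of c c k k'] S.etK_times[of c c' k k'] S.etK_adj[of c c k k] c k by simp_all

lemma et_zero: "c \<in> C ==> S.et c 0 = czero S.T" "Kop k ==> S.et (czero MA) k = czero S.T"
proof -
  assume c: "c \<in> C"
  have "cscale_op 0 0 = (0 :: 'a op)" by (rule blinfun_eqI) simp
  then show "S.et c 0 = czero S.T" using et_scale[OF c Kop_zero, of 0] et_mem'[OF c Kop_zero] by (simp add: S.T.zero_smult)
next
  assume k: "Kop k"
  show "S.et (czero MA) k = czero S.T"
    using et_smult[OF C_zero k, of 0] et_mem'[OF C_zero k] by (simp add: S.T.zero_smult M.zero_smult)
qed

lemma et_csum: "finite I ==> (!!j. f j \<in> C) ==> Kop k ==> S.et (csum MA f I) k = csum S.T (%j. S.et (f j) k) I"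
  by (induction I rule: finite_induct) (simp_all add: et_zero et_add C_csum et_mem')

lemma et_sum: "finite I ==> c \<in> C ==> (!!j. Kop (f j)) ==> S.et c (sum f I) = csum S.T (%j. S.et c (f j)) I"
  by (induction I rule: finite_induct) (simp_all add: et_zero et_plus Kop_sum et_mem' S.T.plus_commute)

text \<open>The leading \<open>n\<close> by \<open>n\<close> block of the coefficient matrix, as an
  element of the tensor product.\<close>

definition \<Psi> :: "nat => 'b multiplier => ('b multiplier, 'a op) tensor" where
  "\<Psi> n x = csum S.T (%j. csum S.T (%k. S.et (G j k x) (rone (e j) (e k))) {..<n}) {..<n}"

lemma etG_mem [simp]: "x \<in> EA ==> S.et (G j k x) (rone y z) \<in> car S.T"
  by (intro et_mem' G_C Kop_rone)

lemma etGG_mem [simp]: "x \<in> EA ==> y \<in> EA ==> S.et (G j k x oo G l m y) (rone v w) \<in> car S.T"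
  by (intro et_mem' C_times G_C Kop_rone)

lemma Psi_mem [simp, intro]: "x \<in> EA ==> \<Psi> n x \<in> car S.T"
  unfolding \<Psi>_def by (intro S.T.csum_mem) simp

lemma Psi_add: "x \<in> EA ==> y \<in> EA ==> \<Psi> n (cadd MA x y) = cadd S.T (\<Psi> n x) (\<Psi> n y)"
  unfolding \<Psi>_def by (simp add: G_add et_add[OF G_C Kop_rone] S.T.csum_add)

lemma Psi_smult: "x \<in> EA ==> \<Psi> n (csmult MA z x) = csmult S.T z (\<Psi> n x)"
  unfolding \<Psi>_def by (simp add: G_smult et_smult[OF G_C Kop_rone] S.T.csum_smult)

lemma Psi_adj: "x \<in> EA ==> \<Psi> n (cstar MA x) = cstar S.T (\<Psi> n x)"
proof -
  assume x: "x \<in> EA"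
  have "cstar S.T (\<Psi> n x) = csum S.T (%j. csum S.T (%k. S.et (cstar MA (G j k x)) (rone (e k) (e j))) {..<n}) {..<n}"
    unfolding \<Psi>_def using x by (simp add: S.T.adj_csum et_star[OF G_C Kop_rone] hadj_rone)
  also have "... = csum S.T (%k. csum S.T (%j. S.et (cstar MA (G j k x)) (rone (e k) (e j))) {..<n}) {..<n}"
    using x by (intro S.T.csum_swap et_mem' C_adj G_C Kop_rone)
  finally show ?thesis unfolding \<Psi>_def using x by (simp add: G_adj)
qed

text \<open>Orthogonality leaves only row \<open>j\<close> of the matrix, and the remaining scalar
  \<open>cinner (e j) (e j)\<close> is absorbed by \<open>G_basis\<close>.\<close>

lemma et_Psi:
  assumes x: "x \<in> EA" and c: "c \<in> C" and j: "j < n"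
  shows "cmult S.T (S.et c (rone y (e j))) (\<Psi> n x) = csum S.T (%l. S.et (c oo G j l x) (rone y (e l))) {..<n}"
proof -
  let ?W = "%k. csum S.T (%l. S.et (c oo G k l x) (rone y (e j) o\<^sub>L rone (e k) (e l))) {..<n}"
  have K: "Kop (rone y (e j) o\<^sub>L rone (e k) (e l))" for k l by (intro Kop_compose Kop_rone clin_rone)
  have W: "?W k \<in> car S.T" for k using x c K by (intro S.T.csum_mem et_mem' C_times G_C)
  have r: "rone y (e j) o\<^sub>L rone (e k) (e l) = cscale_op (cinner (e k) (e j)) (rone y (e l))" for k l
    by (rule blinfun_eqI) (simp add: cinner_scaleC_left scaleC_scaleC mult.commute)
  have "cmult S.T (S.et c (rone y (e j))) (\<Psi> n x) = csum S.T ?W {..<n}"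
    unfolding \<Psi>_def using x c et_mem'[OF c Kop_rone]
    by (simp add: S.T.times_csum et_mult[OF c Kop_rone G_C Kop_rone])
  also have "... = csum S.T ?W {j}"
  proof (rule S.T.csum_mono_neutral)
    fix k assume "k \<in> {..<n} - {j}"
    then have z: "cinner (e k) (e j) = 0" using orth by simp
    have "S.et (c oo G k l x) (rone y (e j) o\<^sub>L rone (e k) (e l)) = csmult S.T 0 (S.et (c oo G k l x) (rone y (e l)))" for l
      unfolding r z by (rule et_scale[OF C_times[OF c G_C[OF x]] Kop_rone])
    then have "?W k = csum S.T (%l. csmult S.T 0 (S.et (c oo G k l x) (rone y (e l)))) {..<n}" by simp
    also have "... = czero S.T"
      using x c et_mem'[OF C_times[OF c G_C[OF x]] Kop_rone] by (intro S.T.vec_eqI) simp_all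
    finally show "?W k = czero S.T" .
  qed (use j W in simp_all)
  also have "... = ?W j" by (rule S.T.csum_singleton) (rule W)
  also have "... = csum S.T (%l. S.et (c oo G j l x) (rone y (e l))) {..<n}"
  proof (intro S.T.csum_cong refl)
    fix l
    note cG = C_times[OF c G_C[OF x, of j l]]
    have "S.et (c oo G j l x) (rone y (e j) o\<^sub>L rone (e j) (e l)) = S.et (csmult MA (cinner (e j) (e j)) (c oo G j l x)) (rone y (e l))"
      unfolding r et_scale[OF cG Kop_rone] et_smult[OF cG Kop_rone] ..
    also have "csmult MA (cinner (e j) (e j)) (c oo G j l x) = c oo csmult MA (cinner (e j) (e j)) (G j l x)"
      using x c by (simp add: M.times_smult)
    finally show "S.et (c oo G j l x) (rone y (e j) o\<^sub>L rone (e j) (e l)) = S.et (c oo G j l x) (rone y (e l))"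
      unfolding G_basis[OF x] .
    show "S.et (c oo G j l x) (rone y (e l)) \<in> car S.T" by (rule et_mem'[OF cG Kop_rone])
  qed
  finally show ?thesis .
qed

lemma Psi_mult:
  assumes x: "x \<in> corner (\<iota> (P n))" and y: "y \<in> corner (\<iota> (P n))"
  shows "\<Psi> n (x oo y) = cmult S.T (\<Psi> n x) (\<Psi> n y)"
proof -
  note xE = cornerD(2)[OF x] and yE = cornerD(2)[OF y]
  have GG: "G j k x oo G k l y \<in> C" for j k l using xE yE by auto
  have "cmult S.T (\<Psi> n x) (\<Psi> n y)
    = csum S.T (%j. csum S.T (%k. cmult S.T (S.et (G j k x) (rone (e j) (e k))) (\<Psi> n y)) {..<n}) {..<n}"
    unfolding \<Psi>_def[of n x] using xE yE by (simp add: S.T.csum_times)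
  also have "... = csum S.T (%j. csum S.T (%k. csum S.T (%l. S.et (G j k x oo G k l y) (rone (e j) (e l))) {..<n}) {..<n}) {..<n}"
    using xE yE by (intro S.T.csum_cong refl et_Psi) simp_all
  also have "... = csum S.T (%j. csum S.T (%l. csum S.T (%k. S.et (G j k x oo G k l y) (rone (e j) (e l))) {..<n}) {..<n}) {..<n}"
    using xE yE by (intro S.T.csum_cong refl S.T.csum_swap) simp_all
  also have "... = \<Psi> n (x oo y)"
    unfolding \<Psi>_def G_mult[OF x y] using GG by (simp add: et_csum Kop_rone)
  finally show ?thesis ..
qed

lemma P_self_adj: "cstar MA (\<iota> (P n)) = \<iota> (P n)"
  using iota_adj[OF Kop_P, of n] by (simp add: hadj_P)

lemma Psi_hom: "cstar_hom (MA\<lparr>ccarrier := corner (\<iota> (P n))\<rparr>) S.T (\<Psi> n)"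
  unfolding cstar_hom_def
proof (intro conjI ballI allI, simp_all)
  show "\<Psi> n \<in> corner (\<iota> (P n)) \<rightarrow> car S.T" by (rule Pi_I) (rule Psi_mem[OF cornerD(2)])
qed (simp_all add: cornerD(2) Psi_add Psi_smult Psi_adj Psi_mult)

text \<open>\<open>\<Psi> n\<close> is multiplicative on the compression of \<open>A\<close> by
  \<open>\<iota> (P n)\<close>, where contractivity is automatic. A general \<open>x\<close> has the
  same coefficients below \<open>n\<close> as its compression, whose norm is no larger.\<close>

lemma Psi_le:
  assumes x: "x \<in> EA" shows "cnorm S.T (\<Psi> n x) <= cnorm MA x"
proof -
  note d = EA_D[OF x]
  let ?y = "\<iota> (P n) oo (x oo \<iota> (P n))"
  have PP: "\<iota> (P n) oo \<iota> (P n) = \<iota> (P n)"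
  proof -
    have "\<iota> (P n) oo csum MA (%k. i (e k) (e k)) {..<n} = csum MA (%k. \<iota> (P n) oo i (e k) (e k)) {..<n}"
      by (intro M.times_csum) simp_all
    also have "... = csum MA (%k. i (e k) (e k)) {..<n}"
      by (intro M.csum_cong) (simp_all add: P_i hproj_basis)
    finally show ?thesis unfolding iota_P[symmetric] .
  qed
  have y: "?y \<in> corner (\<iota> (P n))"
  proof -
    have "?y \<in> EA" using x by (intro EA_left EA_right) simp_all
    moreover have "\<iota> (P n) oo ?y = ?y" using d M.times_assoc[of "\<iota> (P n)" "\<iota> (P n)" "x oo \<iota> (P n)"] by (simp add: PP)
    moreover have "?y oo \<iota> (P n) = ?y" using d by (simp add: M.times_assoc PP)
    ultimately show ?thesis by (simp add: corner_def)
  qed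
  have "G j k ?y = G j k x" if "j < n" "k < n" for j k
  proof -
    have "i \<omega> (e j) oo (?y oo i (e k) \<omega>) = i \<omega> (e j) oo \<iota> (P n) oo (x oo (\<iota> (P n) oo i (e k) \<omega>))"
      using d by (simp add: M.times_assoc)
    then show ?thesis unfolding G_def i_P P_i using that by (simp add: hproj_basis)
  qed
  then have "\<Psi> n x = \<Psi> n ?y" unfolding \<Psi>_def using x cornerD(2)[OF y] by (intro S.T.csum_cong refl S.T.csum_mem) simp_all
  also have "cnorm S.T (\<Psi> n ?y) <= cnorm MA ?y"
    using cstar_hom_norm_le[OF corner_algebra[OF P_D P_self_adj] S.T.cstar_algebra_axioms Psi_hom, of ?y n] y by simp
  also have "... <= cnorm MA x"
  proof -
    have P1: "cnorm MA (\<iota> (P n)) <= 1" using norm_iota_le[OF Kop_P, of n] norm_P[of n] by simp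
    have "cnorm MA ?y <= cnorm MA (\<iota> (P n)) * (cnorm MA x * cnorm MA (\<iota> (P n)))"
      using d by (intro order_trans[OF M.norm_times] mult_left_mono M.norm_times M.norm_ge_zero) simp_all
    also have "... <= 1 * (cnorm MA x * 1)"
      using d P1 by (intro mult_mono mult_nonneg_nonneg M.norm_ge_zero order_refl) simp_all
    finally show ?thesis by simp
  qed
  finally show ?thesis .
qed

text \<open>\<open>G_elementary\<close> reads off the matrix entries of \<open>k\<close> in the
  basis, and these reassemble to \<open>P n o\<^sub>L (k o\<^sub>L P n)\<close>. Thus
  \<open>\<Psi> n\<close> inverts \<open>ext\<close> up to a compression that tends to the
  identity.\<close>

lemma Psi_ext:
  assumes u: "u \<in> S.FC" shows "\<Psi> n (ext u) = fst (S.\<kappa> (P n)) (snd (S.\<kappa> (P n)) (S.ci u))"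
  using u
proof (induction rule: ext_induct)
  note dc = S.kappa_mem[OF Kop_P]
  case zero
  have "\<Psi> n (czero MA) = csmult S.T 0 (\<Psi> n (czero MA))"
    using Psi_smult[OF EA_zero, of n 0] by (simp add: M.zero_smult)
  then have "\<Psi> n (czero MA) = czero S.T" using EA_zero by (simp add: S.T.zero_smult)
  moreover have "snd (S.\<kappa> (P n)) (czero S.T) = czero S.T"
    using S.T.snd_smult[OF dc[of n], of "czero S.T" 0] S.T.snd_mem[OF dc[of n], of "czero S.T"] by (simp add: S.T.zero_smult)
  moreover have "fst (S.\<kappa> (P n)) (czero S.T) = czero S.T"
    using S.T.fst_smult[OF dc[of n], of "czero S.T" 0] S.T.fst_mem[OF dc[of n], of "czero S.T"] by (simp add: S.T.zero_smult)
  ultimately show ?case by (simp add: S.ci_zero)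
next
  note dc = S.kappa_mem[OF Kop_P]
  case (add c k z u)
  note c = add(1) and k = add(2)
  have ck: "c oo \<iota> k \<in> EA" using commutant_embed[OF c k] by blast
  have K: "Kop (P n o\<^sub>L (k o\<^sub>L P n))" "Kop (k o\<^sub>L P n)" using k by (auto intro: Kop_compose Kop_P Kop_clin clin_compose)
  have "ap (P n o\<^sub>L (k o\<^sub>L P n)) x
    = ap (\<Sum>j<n. \<Sum>l<n. cscale_op (cinner (ap k (e l)) (e j)) (rone (e j) (e l))) x" for x
    using Kop_clin[OF k]
    by (simp add: P_apply hproj_def blinfun.sum_left blinfun.sum_right clin_def cinner_sum_left cinner_scaleC_left scaleC_scaleC
        linear_sum[OF bounded_linear.linear[OF bounded_linear_scaleC_left]] mult.commute) (rule sum.swap)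
  then have PkP: "P n o\<^sub>L (k o\<^sub>L P n) = (\<Sum>j<n. \<Sum>l<n. cscale_op (cinner (ap k (e l)) (e j)) (rone (e j) (e l)))"
    by (rule blinfun_eqI)
  have K2: "Kop (\<Sum>l<n. cscale_op (cinner (ap k (e l)) (e j)) (rone (e j) (e l)))" for j
    by (intro Kop_sum Kop_cscale Kop_rone)
  have "\<Psi> n (c oo \<iota> k) = S.et c (P n o\<^sub>L (k o\<^sub>L P n))"
    unfolding \<Psi>_def PkP G_elementary[OF c k]
    by (simp add: et_sum[OF _ c K2] et_sum[OF _ c Kop_cscale[OF Kop_rone]] et_smult[OF c Kop_rone] et_scale[OF c Kop_rone])
  also have "... = fst (S.\<kappa> (P n)) (snd (S.\<kappa> (P n)) (S.et c k))"
    using c k K by (simp add: S.snd_kappa S.fst_kappa Kop_P)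
  finally have 1: "\<Psi> n (c oo \<iota> k) = fst (S.\<kappa> (P n)) (snd (S.\<kappa> (P n)) (S.et c k))" .
  note m = et_mem'[OF c k]
  have "S.ci (S.sng c k z + u) = cadd S.T (csmult S.T z (S.et c k)) (S.ci u)"
    using add sng_FC[OF c k] S.ci_single[of c k z] by (simp add: S.ci_add Kop_iff)
  moreover have "ext (S.sng c k z + u) = cadd MA (csmult MA z (c oo \<iota> k)) (ext u)"
    using add sng_FC[OF c k] by (simp add: ext_add ext_single)
  ultimately show ?case
    using add ck m ext_EA[OF add(3)] S.ci_mem[OF add(3)]
    by (simp add: Psi_add Psi_smult EA_smult 1 S.T.snd_plus[OF dc] S.T.snd_smult[OF dc] S.T.fst_plus[OF dc] S.T.fst_smult[OF dc] S.T.snd_mem[OF dc])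
qed

text \<open>One inequality holds because the tensor norm is the greatest C*-seminorm. For the other,
  \<open>\<Psi> n (ext u)\<close> has norm at most that of \<open>ext u\<close> and tends to the
  class of \<open>u\<close>. So the greatest seminorm is the one realised in \<open>A\<close>, which
  is the part that nuclearity would play.\<close>

lemma norm_ext:
  assumes u: "u \<in> S.FC" shows "cnorm MA (ext u) = S.tn u"
proof (rule antisym)
  show "cnorm MA (ext u) <= S.tn u" by (rule S.tensor_seminorm_le[OF ext_seminorm u])
  \<comment> \<open>By nondegeneracy of \<open>1 \<otimes> id\<close>, compression by the
    \<open>P n\<close> tends to the identity on the tensor product as well.\<close>
  interpret KT: K_alg e S.T S.\<kappa>
    by (intro K_alg.intro S.TK.K_hom_axioms K_alg_axioms.intro S.kappa_nondegenerate)
  have "(%n. cnorm S.T (\<Psi> n (ext u))) ----> S.tn u"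
    using S.T.ctends_norm[OF KT.compress_tends[OF S.ci_mem[OF u]]] u by (simp add: Psi_ext S.norm_ci)
  then show "S.tn u <= cnorm MA (ext u)"
    by (rule LIMSEQ_le_const2) (use Psi_le[OF ext_EA[OF u]] in blast)
qed

subsection \<open>Surjectivity\<close>

text \<open>\<open>ext\<close> with values in \<open>A\<close> itself, by undoing the
  embedding.\<close>

definition h :: "('b multiplier \<times> ('a op) \<Rightarrow>\<^sub>0 complex) => 'b" where
  "h u = inv_into (car A) em (ext u)"

lemma h_mem: "u \<in> S.FC ==> h u \<in> car A" and em_h: "u \<in> S.FC ==> em (h u) = ext u"
  unfolding h_def by (simp_all only: inv_into_into[OF ext_EA] f_inv_into_f[OF ext_EA])

lemma h_eqI: "u \<in> S.FC ==> x \<in> car A ==> ext u = em x ==> h u = x"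
  by (rule A.embed_inj) (simp_all add: h_mem em_h)

lemma h_hom: "cstar_hom S.FT A h"
  unfolding cstar_hom_def S.free_tensor_simps
proof (intro conjI ballI allI)
  show "h \<in> S.FC \<rightarrow> car A" by (rule Pi_I) (rule h_mem)
  fix u assume u: "u \<in> S.FC"
  note hu = h_mem[OF u]
  show "h (pm_scale z u) = csmult A z (h u)" for z
    using u hu by (intro h_eqI) (simp_all add: ext_scale A.embed_smult[OF hu hu] em_h)
  show "h (S.fs u) = cstar A (h u)"
    using u hu by (intro h_eqI) (simp_all add: ext_star A.embed_adj[OF hu hu] em_h)
  fix v assume v: "v \<in> S.FC"
  note hv = h_mem[OF v]
  show "h (u + v) = cadd A (h u) (h v)"
    using u v hu hv by (intro h_eqI) (simp_all add: ext_add A.embed_add[OF hu hv] em_h)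
  show "h (S.fm u v) = cmult A (h u) (h v)"
    using u v hu hv by (intro h_eqI) (simp_all add: ext_mult A.embed_times[OF hu hv] em_h)
qed

lemma ext_sum:
  assumes "finite I" "!!j. w j \<in> S.FC"
  shows FC_sum: "sum w I \<in> S.FC" and "ext (sum w I) = csum MA (%j. ext (w j)) I"
  using assms(1) by (induction I rule: finite_induct) (simp_all add: assms(2) ext_add M.plus_commute)

text \<open>The formal \<open>n\<close> by \<open>n\<close> coefficient matrix of \<open>y\<close>
  is sent to the compression of \<open>y\<close> by \<open>\<iota> (P n)\<close>, which tends to
  \<open>y\<close>.\<close>

lemma h_dense:
  assumes y: "y \<in> car A"
  shows "\<exists>u. (\<forall>n. u n \<in> S.FC) \<and> ctends A (%n. h (u n)) y"
proof -
  let ?y = "em y"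
  have yE: "?y \<in> EA" using y by (rule imageI)
  let ?u = "%n. \<Sum>j<n. \<Sum>k<n. S.sng (G j k ?y) (rone (e j) (e k)) 1"
  have s: "S.sng (G j k ?y) (rone (e j) (e k)) 1 \<in> S.FC" for j k by (intro sng_FC G_C yE Kop_rone)
  have s': "(\<Sum>k<n. S.sng (G j k ?y) (rone (e j) (e k)) 1) \<in> S.FC" for n j by (rule FC_sum) (simp_all add: s)
  have uF: "?u n \<in> S.FC" for n by (rule FC_sum) (simp_all add: s')
  have "ext (?u n) = csum MA (%j. csum MA (%k. i (e j) (e j) oo (?y oo i (e k) (e k))) {..<n}) {..<n}" for n
    using EA_D[OF yE] by (simp add: ext_sum[OF _ s'] ext_sum[OF _ s] ext_single[OF G_C[OF yE] Kop_rone] M.one_smult G_unit[OF yE])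
  also have "csum MA (%j. csum MA (%k. i (e j) (e j) oo (?y oo i (e k) (e k))) {..<n}) {..<n} = \<iota> (P n) oo (?y oo \<iota> (P n))" for n
    unfolding iota_P using EA_D[OF yE]
    by (simp add: M.times_csum M.csum_times) (rule M.csum_swap, simp)
  finally have "ext (?u n) = em (fst (\<iota> (P n)) (snd (\<iota> (P n)) y))" for n
    using y by (simp add: A.embed_mult A.mult_embed)
  then have "h (?u n) = fst (\<iota> (P n)) (snd (\<iota> (P n)) y)" for n
    using y by (intro h_eqI uF) simp_all
  then show ?thesis using compress_tends[OF y] uF by (intro exI[of _ ?u]) simp
qed

text \<open>The elements \<open>c oo \<iota> k\<close> of \<open>A\<close> span a dense subspace, so
  it suffices to put them into the closure of \<open>C A\<close>. An approximate right factor
  \<open>g n\<close> of \<open>c\<close> inside \<open>C\<close> does it: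
  \<open>c oo g n oo \<iota> k\<close> is \<open>c\<close> applied to the element
  \<open>g n oo \<iota> k\<close> of \<open>A\<close>.\<close>

lemma nondegenerate_commutant: "nondegenerate A C"
  unfolding nondegenerate_def
proof
  let ?S = "{fst d a |d a. d \<in> C \<and> a \<in> car A}"
  let ?V = "cspan A ?S"
  let ?W = "ctopology A closure_of ?V"
  have S: "?S \<subseteq> car A"
    by (rule subsetI, elim CollectE exE conjE) (simp add: A.fst_mem commutant_mem)
  have V: "?V \<subseteq> car A" by (rule A.cspan_carrier[OF S])
  have Vs: "czero A \<in> ?V" "x \<in> ?V ==> csmult A z x \<in> ?V" "x \<in> ?V ==> y \<in> ?V ==> cadd A x y \<in> ?V" for x y z
    unfolding cspan_def by (auto simp: csubspace_def)
  have W_iff: "x \<in> ?W \<longleftrightarrow> (\<exists>s. (\<forall>n. s n \<in> ?V) \<and> ctends A s x)" for x by (rule A.closure_of_iff[OF V])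
  show W: "?W \<subseteq> car A"
  proof
    fix x assume "x \<in> ?W"
    then obtain s where "ctends A s x" unfolding W_iff by (elim exE conjE)
    then show "x \<in> car A" by (rule ctends_mem(2))
  qed
  have hW: "h u \<in> ?W" if "u \<in> S.FC" for u
    using that
  proof (induction rule: ext_induct)
    case zero
    have "h 0 = czero A" by (rule h_eqI) (simp_all add: A.embed_zero)
    moreover have "czero A \<in> ?W" unfolding W_iff by (intro exI[of _ "%_. czero A"] conjI allI Vs A.ctends_const) simp
    ultimately show ?case by simp
  next
    case (add c k z u)
    obtain x where x: "x \<in> car A" "c oo \<iota> k = em x" using commutant_embed[OF add(1,2)] by blast
    have Csub: "csubspace MA C" using commutant_subalgebra by (simp add: cstar_subalgebra_def)
    obtain g where g: "!!n. g n \<in> C" "ctends MA (%n. c oo g n) c"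
      using M.right_factor_approx[OF Csub C_times C_adj add(1)] by blast
    have "\<forall>n. \<exists>a. a \<in> car A \<and> g n oo \<iota> k = em a" using commutant_embed[OF g(1) add(2)] by blast
    from choice[OF this] obtain a where a: "!!n. a n \<in> car A" "!!n. g n oo \<iota> k = em (a n)" by blast
    have kc: "ctends MA (%_. \<iota> k) (\<iota> k)" using add(2) by (intro M.ctends_const) simp
    have "c oo g n oo \<iota> k = em (fst c (a n))" for n
      using M.times_assoc[of c "g n" "\<iota> k"] g(1)[of n] add(1,2) a by (simp add: A.mult_embed)
    then have lim: "ctends MA (%n. em (fst c (a n))) (em x)"
      using M.ctends_times[OF g(2) kc] x(2) by simp
    have fa: "fst c (a n) \<in> car A" for n using a add(1) by simp
    obtain l where l: "ctends A (%n. fst c (a n)) l" "em x = em l" by (rule A.ctends_embed[OF fa lim])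
    have xl: "x = l" by (rule A.embed_inj[OF x(1) ctends_mem(2)[OF l(1)] l(2)])
    have fV: "fst c (a n) \<in> ?V" for n
      by (rule subsetD[OF cspan_superset]) (intro CollectI exI[of _ c] exI[of _ "a n"] conjI refl add(1) a(1))
    obtain t where t: "!!n. t n \<in> ?V" "ctends A t (h u)" using add(4) unfolding W_iff by (elim exE conjE) blast
    have "h (S.sng c k z + u) = cadd A (csmult A z x) (h u)"
    proof (rule h_eqI)
      note hu = h_mem[OF add(3)]
      show "S.sng c k z + u \<in> S.FC" using sng_FC[OF add(1,2)] add(3) by simp
      show "cadd A (csmult A z x) (h u) \<in> car A" using x hu by simp
      show "ext (S.sng c k z + u) = em (cadd A (csmult A z x) (h u))"
        using add sng_FC[OF add(1,2)] x hu
        by (simp add: ext_add ext_single A.embed_add[OF A.smult_mem[OF x(1)] hu] A.embed_smult[OF x(1) x(1)] em_h)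
    qed
    moreover have "ctends A (%n. cadd A (csmult A z (fst c (a n))) (t n)) (cadd A (csmult A z x) (h u))"
      unfolding xl by (intro A.ctends_add A.ctends_smult l(1) t(2))
    moreover have "\<forall>n. cadd A (csmult A z (fst c (a n))) (t n) \<in> ?V" by (intro allI Vs fV t(1))
    ultimately show ?case unfolding W_iff by (intro exI[of _ "%n. cadd A (csmult A z (fst c (a n))) (t n)"] conjI) simp_all
  qed
  show "car A \<subseteq> ?W"
  proof
    fix y assume "y \<in> car A"
    then obtain u where u: "\<forall>n. u n \<in> S.FC" "ctends A (%n. h (u n)) y" using h_dense by blast
    have "\<forall>n. h (u n) \<in> ?W" using u(1) hW by simp
    then have "y \<in> ctopology A closure_of ?W" unfolding A.closure_of_iff[OF W] using u(2) by (intro exI conjI)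
    then show "y \<in> ?W" by (simp only: closure_of_closure_of)
  qed
qed

text \<open>The completion of an isometric map with dense range. The formula on elementary tensors
  is stated in the multiplier algebra, where the product \<open>c oo \<iota> k\<close> is
  formed.\<close>

lemma theta_exists:
  "\<exists>\<theta>. cstar_iso S.T A \<theta> \<and> (\<forall>c\<in>C. \<forall>k\<in>car S.KK. em (\<theta> (S.et c k)) = c oo \<iota> k)"
proof -
  have "\<exists>F. cstar_iso (completion S.FT) A F \<and> (\<forall>x\<in>car S.FT. F (cauchy_class S.FT (%_. x)) = h x)"
  proof (rule S.FT.completion_iso[OF A.cstar_algebra_axioms h_hom])
    show "cnorm A (h x) = cnorm S.FT x" if "x \<in> car S.FT" for x
      using that norm_ext[of x] A.norm_embed[OF h_mem[of x]] em_h[of x] by simp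
    show "\<exists>x. (\<forall>n. x n \<in> car S.FT) \<and> ctends A (%n. h (x n)) y" if "y \<in> car A" for y
      using h_dense[OF that] by simp
  qed
  then obtain F where F: "cstar_iso S.T A F" "!!x. x \<in> S.FC ==> F (S.ci x) = h x"
    unfolding tensor_product_def S.ci_def by (auto simp: S.free_tensor_simps)
  have "em (F (S.et c k)) = c oo \<iota> k" if c: "c \<in> C" and k: "k \<in> car S.KK" for c k
  proof -
    have k': "Kop k" using k by (simp add: Kop_iff)
    show ?thesis unfolding S.et_ci F(2)[OF sng_FC[OF c k']] em_h[OF sng_FC[OF c k']]
      using c k' by (simp add: ext_single M.one_smult)
  qed
  with F(1) show ?thesis by blast
qed

end

text \<open>Infinite dimension excludes in particular the span of the empty set, so a nonzero vector
  exists.\<close>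

lemma unit_vector_exists:
  assumes "separable_infinite_dim TYPE('h::complex_hilbert_space)"
  shows "\<exists>\<omega>::'h. norm \<omega> = 1"
proof -
  have "module (scaleC :: complex => 'h => 'h)"
    by unfold_locales (simp_all add: scaleC_add_right scaleC_add_left scaleC_scaleC scaleC_one)
  from module.span_empty[OF this] have "module.span scaleC {} = {0 :: 'h}" .
  moreover have "module.span scaleC {} ~= (UNIV :: 'h set)"
    using assms unfolding separable_infinite_dim_def by blast
  ultimately obtain x :: 'h where "x ~= 0" by auto
  then have "norm (sgn x) = 1" by (simp add: norm_sgn)
  then show ?thesis by blast
qed

theorem proposition3p4:
  fixes A :: "'a cstar_alg"
    and \<iota> :: "('h::complex_hilbert_space \<Rightarrow>\<^sub>L 'h) \<Rightarrow> 'a multiplier"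
    and B :: "'b cstar_alg"
  assumes "separable_infinite_dim TYPE('h)"
  shows
    "(K_algebra A \<iota> \<longrightarrow>
        cstar_subalgebra (K_commutant A \<iota>) (multiplier_algebra A) \<and>
        nondegenerate A (K_commutant A \<iota>) \<and>
        (\<exists>\<theta>. cstar_iso (K_commutant_algebra A \<iota> \<otimes>\<^sub>C compact_operators) A \<theta> \<and>
             (\<forall>a\<in>K_commutant A \<iota>. \<forall>k\<in>ccarrier compact_operators.
                multiplier_embed A
                  (\<theta> (elementary_tensor (K_commutant_algebra A \<iota>) compact_operators a k)) =
                a \<cdot>\<^bsub>multiplier_algebra A\<^esub> \<iota> k))) \<and>
     (cstar_algebra B \<longrightarrow>
        K_algebra (B \<otimes>\<^sub>C compact_operators)
          (one_tensor_id B :: ('h \<Rightarrow>\<^sub>L 'h) \<Rightarrow> ('b, 'h \<Rightarrow>\<^sub>L 'h) tensor multiplier) \<and>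
        cstar_iso B
          (K_commutant_algebra (B \<otimes>\<^sub>C compact_operators)
            (one_tensor_id B :: ('h \<Rightarrow>\<^sub>L 'h) \<Rightarrow> ('b, 'h \<Rightarrow>\<^sub>L 'h) tensor multiplier))
          (tensor_one B))"
proof -
  obtain e :: "nat => 'h" where e: "hilbert_basis e" using hilbert_basis_exists[OF assms] by blast
  obtain \<omega> :: 'h where w: "norm \<omega> = 1" using unit_vector_exists[OF assms] by blast
  show ?thesis
  proof (intro conjI impI)
    assume "K_algebra A \<iota>"
    then have K: "cstar_algebra A" "cstar_hom compact_operators (multiplier_algebra A) \<iota>"
      "nondegenerate A (\<iota> ` car compact_operators)"
      by (simp_all add: K_algebra_def)
    interpret stable_K e A \<iota> \<omega>
      by (intro stable_K.intro K_alg.intro K_hom.intro e K(1) K_hom_axioms.intro K(2) K_alg_axioms.intro K(3)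
          stable_K_axioms.intro w)
    show "cstar_subalgebra (K_commutant A \<iota>) (multiplier_algebra A)" by (rule commutant_subalgebra)
    show "nondegenerate A (K_commutant A \<iota>)" by (rule nondegenerate_commutant)
    show "\<exists>\<theta>. cstar_iso (K_commutant_algebra A \<iota> \<otimes>\<^sub>C compact_operators) A \<theta> \<and>
      (\<forall>a\<in>K_commutant A \<iota>. \<forall>k\<in>car compact_operators. multiplier_embed A
        (\<theta> (elementary_tensor (K_commutant_algebra A \<iota>) compact_operators a k)) = a \<cdot>\<^bsub>multiplier_algebra A\<^esub> \<iota> k)"
      by (rule theta_exists)
  next
    assume B: "cstar_algebra B"
    interpret tensor_K e B \<omega> by (intro tensor_K.intro e B tensor_K_axioms.intro w)
    show "K_algebra (B \<otimes>\<^sub>C compact_operators) (one_tensor_id B :: ('h op) => _)" by (rule K_algebra_tensor)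
    show "cstar_iso B (K_commutant_algebra (B \<otimes>\<^sub>C compact_operators) (one_tensor_id B :: ('h op) => _)) (tensor_one B)"
      by (rule tau_iso)
  qed
qed

end
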